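(* Let $\mathcal{M}$ be a monoidal bicategory. For every object $A$, every right skew monoidale $M$, every oplax right action $a:AM\to A$, and every opmonoidal monad $B:M\to M$ (with multiplication $\mu$ and unit $\eta$), the category of right $B$-comodules $\mathsf{rComod}_B((A,a),(A,a))$ has a monoidal structure such that the forgetful functor $$\mathsf{rComod}_B((A,a),(A,a))\to\mathcal{M}(A,A),\qquad(Y,y)\mapsto Y,$$ is strong monoidal (where $\mathcal{M}(A,A)$ is monoidal under composition). The tensor product of $B$-comodules $(Y,y)$ and $(Z,z)$ has underlying arrow $Z\circ Y$ and coaction the composite $$Z\circ Y\circ a\xRightarrow{\;Zy\;}Z\circ a\circ(YB)\xRightarrow{\;z\,(YB)\;}a\circ(ZB)\circ(YB)\cong a\circ\big((Z\circ Y)(B\circ B)\big)\xRightarrow{\;\mu\;}a\circ\big((Z\circ Y)B\big),$$ and the unit is $1_A$ with coaction $a\Rightarrow a\circ(1B)$ given by $1\eta$.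
   Context: Conventions. $\mathcal{M}$ is a monoidal bicategory with unit object $I$; its 0-, 1-, 2-cells are called objects, arrows, cells. Tensor product is written by juxtaposition, composition by $\circ$, and $1$ denotes an identity arrow; $ff'$ for arrows $f:X\to Y$, $f':X'\to Y'$ means $(f1)\circ(1f')$. By coherence everything is written as if $\mathcal{M}$ were a Gray monoid; interchange isomorphisms are suppressed in equations. Equations between cells are in element notation: variables stand for identity arrows on tensor factors of the source, arrows are written as operations on them, and composites of named cells denote pastings of the corresponding whiskered cells. Right skew monoidale $(M,m,u,\alpha,\lambda,\rho)$: arrows $m:MM\to M$ (written $xy$), $u:I\to M$ and not necessarily invertible cells $\alpha:x(yz)\to(xy)z$, $\lambda:x\to ux$, $\rho:xu\to x$ with $\alpha_{wx,y,z}\,\alpha_{w,x,yz}=(\alpha_{w,x,y}z)\,\alpha_{w,xy,z}\,(w\alpha_{x,y,z})$; $(\rho_xy)\,\alpha_{x,u,y}\,(x\lambda_y)=1$; $\alpha_{u,x,y}\lambda_{xy}=\lambda_xy$; $\rho_{xy}\,\alpha_{x,y,u}=x\rho_y$; $\rho_u\lambda_u=1$. Opmonoidal arrow $C:M\to N$ between right skew monoidales: an arrow with cells $C^2:C(xy)\to Cx\,Cy$ and $C^0:Cu\to u$ such that $\alpha\,(Cx\,C^2_{y,z})\,C^2_{x,yz}=(C^2_{x,y}\,Cz)\,C^2_{xy,z}\,C\alpha$; $\rho_{Cx}\,(Cx\,C^0)\,C^2_{x,u}=C\rho_x$; $(C^0\,Cx)\,C^2_{u,x}\,C\lambda_x=\lambda_{Cx}$.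 Opmonoidal cell $\xi:C\Rightarrow C'$: a cell with $C'^2\,\xi_{xy}=(\xi_x\xi_y)\,C^2$ and $C'^0\,\xi_u=C^0$. An opmonoidal monad is a monad in the bicategory of right skew monoidales, opmonoidal arrows and opmonoidal cells: a monad $(B,\mu,\eta)$ on $M$ with $B$ opmonoidal and $\mu:B\circ B\Rightarrow B$, $\eta:1\Rightarrow B$ opmonoidal cells. Oplax right $M$-action on an object $A$: an arrow $a:AM\to A$ (written $x\cdot p$) with cells $a^2:x\cdot(pq)\to(x\cdot p)\cdot q$ and $a^0:x\cdot u\to x$ such that $a^2_{x\cdot p,q,r}\,a^2_{x,p,qr}=(a^2_{x,p,q}\cdot r)\,a^2_{x,pq,r}\,(x\cdot\alpha)$; $a^0_{x\cdot p}\,a^2_{x,p,u}=x\cdot\rho_p$; $(a^0_x\cdot p)\,a^2_{x,u,p}\,(x\cdot\lambda_p)=1$. For oplax right actions $a:AM\to A$, $b:A'N\to A'$ and an opmonoidal arrow $C:M\to N$, a right $C$-comodule from $a$ to $b$ is an arrow $Y:A\to A'$ with a cell $y:Y\circ a\Rightarrow b\circ(YC)$, $y:Y(x\cdot p)\to Yx\cdot Cp$, such that $(y_{x,p}\cdot Cq)\,y_{x\cdot p,q}\,Ya^2=b^2\,(Yx\cdot C^2)\,y_{x,pq}$ and $Ya^0=b^0\,(Yx\cdot C^0)\,y_{x,u}$. A morphism is a cell $\gamma:Y\Rightarrow Y'$ with $y'\,\gamma_{x\cdot p}=(\gamma_x\cdot Cp)\,y$. These form the category $\mathsf{rComod}_C((A,a),(A',b))$.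 *)

theory Defs
  imports Main
begin

section \<open>Categories and monoidal categories\<close>

record ('o,'m) category_data =
  cObj :: "'o set"
  cArr :: "'m set"
  cDom :: "'m \<Rightarrow> 'o"
  cCod :: "'m \<Rightarrow> 'o"
  cId :: "'o \<Rightarrow> 'm"
  cComp :: "'m \<Rightarrow> 'm \<Rightarrow> 'm"  (infixr "\<bullet>\<index>" 55)

definition cHom :: "('o,'m,'z) category_data_scheme \<Rightarrow> 'm \<Rightarrow> 'o \<Rightarrow> 'o \<Rightarrow> bool"
  where "cHom C f X Y \<longleftrightarrow> f \<in> cArr C \<and> cDom C f = X \<and> cCod C f = Y"

locale category =
  fixes C :: "('o,'m,'z) category_data_scheme" (structure)
  assumes dom_obj: "f \<in> cArr C \<Longrightarrow> cDom C f \<in> cObj C"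
    and cod_obj: "f \<in> cArr C \<Longrightarrow> cCod C f \<in> cObj C"
    and id_hom: "X \<in> cObj C \<Longrightarrow> cHom C (cId C X) X X"
    and comp_hom: "\<lbrakk>cHom C f X Y; cHom C g Y Z\<rbrakk> \<Longrightarrow> cHom C (g \<bullet> f) X Z"
    and comp_id_left: "cHom C f X Y \<Longrightarrow> cId C Y \<bullet> f = f"
    and comp_id_right: "cHom C f X Y \<Longrightarrow> f \<bullet> cId C X = f"
    and comp_assoc: "\<lbrakk>cHom C f W X; cHom C g X Y; cHom C h Y Z\<rbrakk>
                       \<Longrightarrow> (h \<bullet> g) \<bullet> f = h \<bullet> (g \<bullet> f)"

definition cIso :: "('o,'m,'z) category_data_scheme \<Rightarrow> 'm \<Rightarrow> 'o \<Rightarrow> 'o \<Rightarrow> bool"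
  where "cIso C f X Y \<longleftrightarrow> cHom C f X Y \<and>
           (\<exists>g. cHom C g Y X \<and> g \<bullet>\<^bsub>C\<^esub> f = cId C X \<and> f \<bullet>\<^bsub>C\<^esub> g = cId C Y)"

locale category_functor = C: category C + D: category D
  for C :: "('o,'m,'z) category_data_scheme" and D :: "('p,'n,'y) category_data_scheme" +
  fixes Fo :: "'o \<Rightarrow> 'p" and Fa :: "'m \<Rightarrow> 'n"
  assumes map_hom: "cHom C f X Y \<Longrightarrow> cHom D (Fa f) (Fo X) (Fo Y)"
    and map_obj: "X \<in> cObj C \<Longrightarrow> Fo X \<in> cObj D"
    and map_id: "X \<in> cObj C \<Longrightarrow> Fa (cId C X) = cId D (Fo X)"
    and map_comp: "\<lbrakk>cHom C f X Y; cHom C g Y Z\<rbrakk> \<Longrightarrow> Fa (g \<bullet>\<^bsub>C\<^esub> f) = Fa g \<bullet>\<^bsub>D\<^esub> Fa f"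

record ('o,'m) monoidal_structure =
  mTenO :: "'o \<Rightarrow> 'o \<Rightarrow> 'o"
  mTenA :: "'m \<Rightarrow> 'm \<Rightarrow> 'm"
  mUnit :: "'o"
  mAssoc :: "'o \<Rightarrow> 'o \<Rightarrow> 'o \<Rightarrow> 'm"
  mLun :: "'o \<Rightarrow> 'm"
  mRun :: "'o \<Rightarrow> 'm"

text \<open>The constraints point \<open>(X \<otimes> Y) \<otimes> Z \<rightarrow> X \<otimes> (Y \<otimes> Z)\<close>, \<open>I \<otimes> X \<rightarrow> X\<close>, \<open>X \<otimes> I \<rightarrow> X\<close>.\<close>

locale monoidal_category = category C
  for C :: "('o,'m,'z) category_data_scheme" (structure) +
  fixes T :: "('o,'m) monoidal_structure"
  assumes unit_obj: "mUnit T \<in> cObj C"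
    and ten_obj: "\<lbrakk>X \<in> cObj C; Y \<in> cObj C\<rbrakk> \<Longrightarrow> mTenO T X Y \<in> cObj C"
    and ten_hom: "\<lbrakk>cHom C f X X'; cHom C g Y Y'\<rbrakk>
        \<Longrightarrow> cHom C (mTenA T f g) (mTenO T X Y) (mTenO T X' Y')"
    and ten_id: "\<lbrakk>X \<in> cObj C; Y \<in> cObj C\<rbrakk>
        \<Longrightarrow> mTenA T (cId C X) (cId C Y) = cId C (mTenO T X Y)"
    and ten_comp: "\<lbrakk>cHom C f X X'; cHom C f' X' X''; cHom C g Y Y'; cHom C g' Y' Y''\<rbrakk>
        \<Longrightarrow> mTenA T (f' \<bullet> f) (g' \<bullet> g) = mTenA T f' g' \<bullet> mTenA T f g"
    and massoc_iso: "\<lbrakk>X \<in> cObj C; Y \<in> cObj C; Z \<in> cObj C\<rbrakk>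
        \<Longrightarrow> cIso C (mAssoc T X Y Z) (mTenO T (mTenO T X Y) Z) (mTenO T X (mTenO T Y Z))"
    and massoc_nat: "\<lbrakk>cHom C f X X'; cHom C g Y Y'; cHom C h Z Z'\<rbrakk>
        \<Longrightarrow> mAssoc T X' Y' Z' \<bullet> mTenA T (mTenA T f g) h
            = mTenA T f (mTenA T g h) \<bullet> mAssoc T X Y Z"
    and mlun_iso: "X \<in> cObj C \<Longrightarrow> cIso C (mLun T X) (mTenO T (mUnit T) X) X"
    and mlun_nat: "cHom C f X X' \<Longrightarrow> mLun T X' \<bullet> mTenA T (cId C (mUnit T)) f = f \<bullet> mLun T X"
    and mrun_iso: "X \<in> cObj C \<Longrightarrow> cIso C (mRun T X) (mTenO T X (mUnit T)) X"
    and mrun_nat: "cHom C f X X' \<Longrightarrow> mRun T X' \<bullet> mTenA T f (cId C (mUnit T)) = f \<bullet> mRun T X"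
    and pentagon: "\<lbrakk>W \<in> cObj C; X \<in> cObj C; Y \<in> cObj C; Z \<in> cObj C\<rbrakk>
        \<Longrightarrow> mAssoc T W X (mTenO T Y Z) \<bullet> mAssoc T (mTenO T W X) Y Z
            = mTenA T (cId C W) (mAssoc T X Y Z) \<bullet> mAssoc T W (mTenO T X Y) Z
              \<bullet> mTenA T (mAssoc T W X Y) (cId C Z)"
    and triangle: "\<lbrakk>X \<in> cObj C; Y \<in> cObj C\<rbrakk>
        \<Longrightarrow> mTenA T (cId C X) (mLun T Y) \<bullet> mAssoc T X (mUnit T) Y
            = mTenA T (mRun T X) (cId C Y)"

locale strong_monoidal_functor =
  C: monoidal_category C T + D: monoidal_category D S + category_functor C D Fo Fa
  for C :: "('o,'m,'z) category_data_scheme" and T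
    and D :: "('p,'n,'y) category_data_scheme" and S
    and Fo Fa +
  fixes \<phi> :: "'o \<Rightarrow> 'o \<Rightarrow> 'n" and \<phi>0 :: 'n
  assumes mult_iso: "\<lbrakk>X \<in> cObj C; Y \<in> cObj C\<rbrakk>
        \<Longrightarrow> cIso D (\<phi> X Y) (mTenO S (Fo X) (Fo Y)) (Fo (mTenO T X Y))"
    and unit_iso: "cIso D \<phi>0 (mUnit S) (Fo (mUnit T))"
    and mult_nat: "\<lbrakk>cHom C f X X'; cHom C g Y Y'\<rbrakk>
        \<Longrightarrow> \<phi> X' Y' \<bullet>\<^bsub>D\<^esub> mTenA S (Fa f) (Fa g) = Fa (mTenA T f g) \<bullet>\<^bsub>D\<^esub> \<phi> X Y"
    and mult_assoc: "\<lbrakk>X \<in> cObj C; Y \<in> cObj C; Z \<in> cObj C\<rbrakk>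
        \<Longrightarrow> Fa (mAssoc T X Y Z) \<bullet>\<^bsub>D\<^esub> \<phi> (mTenO T X Y) Z \<bullet>\<^bsub>D\<^esub> mTenA S (\<phi> X Y) (cId D (Fo Z))
            = \<phi> X (mTenO T Y Z) \<bullet>\<^bsub>D\<^esub> mTenA S (cId D (Fo X)) (\<phi> Y Z)
              \<bullet>\<^bsub>D\<^esub> mAssoc S (Fo X) (Fo Y) (Fo Z)"
    and mult_lun: "X \<in> cObj C
        \<Longrightarrow> Fa (mLun T X) \<bullet>\<^bsub>D\<^esub> \<phi> (mUnit T) X \<bullet>\<^bsub>D\<^esub> mTenA S \<phi>0 (cId D (Fo X)) = mLun S (Fo X)"
    and mult_run: "X \<in> cObj C
        \<Longrightarrow> Fa (mRun T X) \<bullet>\<^bsub>D\<^esub> \<phi> X (mUnit T) \<bullet>\<^bsub>D\<^esub> mTenA S (cId D (Fo X)) \<phi>0 = mRun S (Fo X)"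


section \<open>Bicategories\<close>

text \<open>
  Arrows compose by \<open>\<odot>\<close>; cells compose vertically by \<open>\<cdot>\<close> and horizontally by \<open>\<star>\<close>, all three in
  the order of application of functions.  \<open>\<aa> h g f : (h \<odot> g) \<odot> f \<Rightarrow> h \<odot> (g \<odot> f)\<close>,
  \<open>\<ll> f : 1 \<odot> f \<Rightarrow> f\<close> and \<open>\<rr> f : f \<odot> 1 \<Rightarrow> f\<close> are the constraint cells.
\<close>

record ('o,'a,'c) bicategory_data =
  Obj :: "'o set"
  Arr :: "'a set"
  Src :: "'a \<Rightarrow> 'o"
  Trg :: "'a \<Rightarrow> 'o"
  Cell :: "'c set"
  Dom :: "'c \<Rightarrow> 'a"
  Cod :: "'c \<Rightarrow> 'a"
  IdArr :: "'o \<Rightarrow> 'a"  ("\<one>\<index>")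
  Comp :: "'a \<Rightarrow> 'a \<Rightarrow> 'a"  (infixr "\<odot>\<index>" 70)
  IdCell :: "'a \<Rightarrow> 'c"  ("\<ii>\<index>")
  VComp :: "'c \<Rightarrow> 'c \<Rightarrow> 'c"  (infixr "\<cdot>\<index>" 55)
  HComp :: "'c \<Rightarrow> 'c \<Rightarrow> 'c"  (infixr "\<star>\<index>" 70)
  AssocC :: "'a \<Rightarrow> 'a \<Rightarrow> 'a \<Rightarrow> 'c"  ("\<aa>\<index>")
  LunC :: "'a \<Rightarrow> 'c"  ("\<ll>\<index>")
  RunC :: "'a \<Rightarrow> 'c"  ("\<rr>\<index>")

definition is_arrow :: "('o,'a,'c,'z) bicategory_data_scheme \<Rightarrow> 'a \<Rightarrow> 'o \<Rightarrow> 'o \<Rightarrow> bool"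
    ("(\<guillemotleft>_ : _ \<rightarrow>\<index> _\<guillemotright>)")
  where "is_arrow \<M> f A B \<longleftrightarrow> f \<in> Arr \<M> \<and> Src \<M> f = A \<and> Trg \<M> f = B"

definition is_cell :: "('o,'a,'c,'z) bicategory_data_scheme \<Rightarrow> 'c \<Rightarrow> 'a \<Rightarrow> 'a \<Rightarrow> bool"
    ("(\<guillemotleft>_ : _ \<Rightarrow>\<index> _\<guillemotright>)")
  where "is_cell \<M> \<theta> f g \<longleftrightarrow> \<theta> \<in> Cell \<M> \<and> Dom \<M> \<theta> = f \<and> Cod \<M> \<theta> = g"

definition inverse_cells :: "('o,'a,'c,'z) bicategory_data_scheme \<Rightarrow> 'c \<Rightarrow> 'c \<Rightarrow> bool"
  where "inverse_cells \<M> \<theta> \<phi> \<longleftrightarrow>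
           \<theta> \<in> Cell \<M> \<and> is_cell \<M> \<phi> (Cod \<M> \<theta>) (Dom \<M> \<theta>) \<and>
           \<phi> \<cdot>\<^bsub>\<M>\<^esub> \<theta> = \<ii>\<^bsub>\<M>\<^esub> (Dom \<M> \<theta>) \<and> \<theta> \<cdot>\<^bsub>\<M>\<^esub> \<phi> = \<ii>\<^bsub>\<M>\<^esub> (Cod \<M> \<theta>)"

definition is_iso_cell :: "('o,'a,'c,'z) bicategory_data_scheme \<Rightarrow> 'c \<Rightarrow> 'a \<Rightarrow> 'a \<Rightarrow> bool"
    ("(\<guillemotleft>_ : _ \<cong>\<index> _\<guillemotright>)")
  where "is_iso_cell \<M> \<theta> f g \<longleftrightarrow> is_cell \<M> \<theta> f g \<and> (\<exists>\<phi>. inverse_cells \<M> \<theta> \<phi>)"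

definition cell_inv :: "('o,'a,'c,'z) bicategory_data_scheme \<Rightarrow> 'c \<Rightarrow> 'c"  ("\<ominus>\<index> _" [90] 90)
  where "cell_inv \<M> \<theta> = (THE \<phi>. inverse_cells \<M> \<theta> \<phi>)"

definition is_equivalence :: "('o,'a,'c,'z) bicategory_data_scheme \<Rightarrow> 'a \<Rightarrow> 'o \<Rightarrow> 'o \<Rightarrow> bool"
  where "is_equivalence \<M> f A B \<longleftrightarrow> is_arrow \<M> f A B \<and>
           (\<exists>g \<epsilon> \<eta>. is_arrow \<M> g B A \<and> is_iso_cell \<M> \<eta> (\<one>\<^bsub>\<M>\<^esub> A) (g \<odot>\<^bsub>\<M>\<^esub> f)
                  \<and> is_iso_cell \<M> \<epsilon> (f \<odot>\<^bsub>\<M>\<^esub> g) (\<one>\<^bsub>\<M>\<^esub> B))"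

locale bicategory =
  fixes \<M> :: "('o,'a,'c,'z) bicategory_data_scheme" (structure)
  assumes src_obj: "f \<in> Arr \<M> \<Longrightarrow> Src \<M> f \<in> Obj \<M>"
    and trg_obj: "f \<in> Arr \<M> \<Longrightarrow> Trg \<M> f \<in> Obj \<M>"
    and dom_arr: "\<theta> \<in> Cell \<M> \<Longrightarrow> Dom \<M> \<theta> \<in> Arr \<M>"
    and cod_arr: "\<theta> \<in> Cell \<M> \<Longrightarrow> Cod \<M> \<theta> \<in> Arr \<M>"
    and src_dom_cod: "\<theta> \<in> Cell \<M> \<Longrightarrow> Src \<M> (Dom \<M> \<theta>) = Src \<M> (Cod \<M> \<theta>)"
    and trg_dom_cod: "\<theta> \<in> Cell \<M> \<Longrightarrow> Trg \<M> (Dom \<M> \<theta>) = Trg \<M> (Cod \<M> \<theta>)"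
    and one_arrow: "A \<in> Obj \<M> \<Longrightarrow> \<guillemotleft>\<one> A : A \<rightarrow> A\<guillemotright>"
    and comp_arrow: "\<lbrakk>\<guillemotleft>f : A \<rightarrow> B\<guillemotright>; \<guillemotleft>g : B \<rightarrow> C\<guillemotright>\<rbrakk> \<Longrightarrow> \<guillemotleft>g \<odot> f : A \<rightarrow> C\<guillemotright>"
    and id_cell: "f \<in> Arr \<M> \<Longrightarrow> \<guillemotleft>\<ii> f : f \<Rightarrow> f\<guillemotright>"
    and vcomp_cell: "\<lbrakk>\<guillemotleft>\<theta> : f \<Rightarrow> g\<guillemotright>; \<guillemotleft>\<phi> : g \<Rightarrow> h\<guillemotright>\<rbrakk> \<Longrightarrow> \<guillemotleft>\<phi> \<cdot> \<theta> : f \<Rightarrow> h\<guillemotright>"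
    and vcomp_id_left: "\<guillemotleft>\<theta> : f \<Rightarrow> g\<guillemotright> \<Longrightarrow> \<ii> g \<cdot> \<theta> = \<theta>"
    and vcomp_id_right: "\<guillemotleft>\<theta> : f \<Rightarrow> g\<guillemotright> \<Longrightarrow> \<theta> \<cdot> \<ii> f = \<theta>"
    and vcomp_assoc: "\<lbrakk>\<guillemotleft>\<theta> : f \<Rightarrow> g\<guillemotright>; \<guillemotleft>\<phi> : g \<Rightarrow> h\<guillemotright>; \<guillemotleft>\<psi> : h \<Rightarrow> k\<guillemotright>\<rbrakk>
        \<Longrightarrow> (\<psi> \<cdot> \<phi>) \<cdot> \<theta> = \<psi> \<cdot> (\<phi> \<cdot> \<theta>)"
    and hcomp_cell: "\<lbrakk>\<guillemotleft>\<theta> : f \<Rightarrow> f'\<guillemotright>; \<guillemotleft>\<phi> : g \<Rightarrow> g'\<guillemotright>; Trg \<M> f = Src \<M> g\<rbrakk>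
        \<Longrightarrow> \<guillemotleft>\<phi> \<star> \<theta> : g \<odot> f \<Rightarrow> g' \<odot> f'\<guillemotright>"
    and hcomp_id: "\<lbrakk>\<guillemotleft>f : A \<rightarrow> B\<guillemotright>; \<guillemotleft>g : B \<rightarrow> C\<guillemotright>\<rbrakk> \<Longrightarrow> \<ii> g \<star> \<ii> f = \<ii> (g \<odot> f)"
    and interchange: "\<lbrakk>\<guillemotleft>\<theta> : f \<Rightarrow> f'\<guillemotright>; \<guillemotleft>\<theta>' : f' \<Rightarrow> f''\<guillemotright>; \<guillemotleft>\<phi> : g \<Rightarrow> g'\<guillemotright>; \<guillemotleft>\<phi>' : g' \<Rightarrow> g''\<guillemotright>;
          Trg \<M> f = Src \<M> g\<rbrakk>
        \<Longrightarrow> (\<phi>' \<cdot> \<phi>) \<star> (\<theta>' \<cdot> \<theta>) = (\<phi>' \<star> \<theta>') \<cdot> (\<phi> \<star> \<theta>)"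
    and assoc_iso: "\<lbrakk>\<guillemotleft>f : A \<rightarrow> B\<guillemotright>; \<guillemotleft>g : B \<rightarrow> C\<guillemotright>; \<guillemotleft>h : C \<rightarrow> D\<guillemotright>\<rbrakk>
        \<Longrightarrow> \<guillemotleft>\<aa> h g f : (h \<odot> g) \<odot> f \<cong> h \<odot> (g \<odot> f)\<guillemotright>"
    and assoc_nat: "\<lbrakk>\<guillemotleft>\<theta> : f \<Rightarrow> f'\<guillemotright>; \<guillemotleft>\<phi> : g \<Rightarrow> g'\<guillemotright>; \<guillemotleft>\<psi> : h \<Rightarrow> h'\<guillemotright>;
          Trg \<M> f = Src \<M> g; Trg \<M> g = Src \<M> h\<rbrakk>
        \<Longrightarrow> \<aa> h' g' f' \<cdot> ((\<psi> \<star> \<phi>) \<star> \<theta>) = (\<psi> \<star> (\<phi> \<star> \<theta>)) \<cdot> \<aa> h g f"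
    and lun_iso: "\<guillemotleft>f : A \<rightarrow> B\<guillemotright> \<Longrightarrow> \<guillemotleft>\<ll> f : \<one> B \<odot> f \<cong> f\<guillemotright>"
    and lun_nat: "\<guillemotleft>\<theta> : f \<Rightarrow> f'\<guillemotright> \<Longrightarrow> \<ll> f' \<cdot> (\<ii> (\<one> (Trg \<M> f)) \<star> \<theta>) = \<theta> \<cdot> \<ll> f"
    and run_iso: "\<guillemotleft>f : A \<rightarrow> B\<guillemotright> \<Longrightarrow> \<guillemotleft>\<rr> f : f \<odot> \<one> A \<cong> f\<guillemotright>"
    and run_nat: "\<guillemotleft>\<theta> : f \<Rightarrow> f'\<guillemotright> \<Longrightarrow> \<rr> f' \<cdot> (\<theta> \<star> \<ii> (\<one> (Src \<M> f))) = \<theta> \<cdot> \<rr> f"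
    and pentagon: "\<lbrakk>\<guillemotleft>f : A \<rightarrow> B\<guillemotright>; \<guillemotleft>g : B \<rightarrow> C\<guillemotright>; \<guillemotleft>h : C \<rightarrow> D\<guillemotright>; \<guillemotleft>k : D \<rightarrow> E\<guillemotright>\<rbrakk>
        \<Longrightarrow> \<aa> k h (g \<odot> f) \<cdot> \<aa> (k \<odot> h) g f
            = (\<ii> k \<star> \<aa> h g f) \<cdot> \<aa> k (h \<odot> g) f \<cdot> (\<aa> k h g \<star> \<ii> f)"
    and triangle: "\<lbrakk>\<guillemotleft>f : A \<rightarrow> B\<guillemotright>; \<guillemotleft>g : B \<rightarrow> C\<guillemotright>\<rbrakk>
        \<Longrightarrow> (\<ii> g \<star> \<ll> f) \<cdot> \<aa> g (\<one> B) f = \<rr> g \<star> \<ii> f"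


subsection \<open>The endohom \<open>\<M>(A,A)\<close>, monoidal under composition\<close>

definition hom_category ::
    "('o,'a,'c,'z) bicategory_data_scheme \<Rightarrow> 'o \<Rightarrow> 'o \<Rightarrow> ('a,'c) category_data"
  where "hom_category \<M> A B =
    \<lparr> cObj = {f. is_arrow \<M> f A B},
      cArr = {\<theta> \<in> Cell \<M>. is_arrow \<M> (Dom \<M> \<theta>) A B},
      cDom = Dom \<M>, cCod = Cod \<M>, cId = IdCell \<M>, cComp = VComp \<M> \<rparr>"

text \<open>
  The tensor product of \<open>Y\<close> and \<open>Z\<close>, in this order, is \<open>Z \<odot> Y\<close>.  So the associator is the inverse
  of the one of \<open>\<M>\<close>, and the two unitors trade places.
\<close>

definition composition_monoidal ::
    "('o,'a,'c,'z) bicategory_data_scheme \<Rightarrow> 'o \<Rightarrow> ('a,'c) monoidal_structure"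
  where "composition_monoidal \<M> A =
    \<lparr> mTenO = (\<lambda>Y Z. Z \<odot>\<^bsub>\<M>\<^esub> Y), mTenA = (\<lambda>\<gamma> \<delta>. \<delta> \<star>\<^bsub>\<M>\<^esub> \<gamma>), mUnit = \<one>\<^bsub>\<M>\<^esub> A,
      mAssoc = (\<lambda>X Y Z. cell_inv \<M> (\<aa>\<^bsub>\<M>\<^esub> Z Y X)),
      mLun = \<rr>\<^bsub>\<M>\<^esub>, mRun = \<ll>\<^bsub>\<M>\<^esub> \<rparr>"


subsection \<open>Pasting\<close>

text \<open>
  A path \<open>[f\<^sub>1, \<dots>, f\<^sub>n]\<close> stands for the arrow \<open>f\<^sub>1 \<odot> (f\<^sub>2 \<odot> \<dots> \<odot> f\<^sub>n)\<close>: \<open>f\<^sub>n\<close> is applied first.  A path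
  cell \<open>(p, \<theta>, q)\<close> is a cell \<open>\<theta>\<close> from the composite of the path \<open>p\<close> to that of \<open>q\<close>.  Whiskering a
  path cell by further arrows on both sides inserts the associators that are needed, so pasting
  diagrams in \<open>\<M>\<close> can be written without brackets, as in a strict 2-category.  All paths that occur
  as source or target of a path cell are nonempty.
\<close>

type_synonym ('a,'c) pcell = "'a list \<times> 'c \<times> 'a list"

fun mid :: "('a,'c) pcell \<Rightarrow> 'c"
  where "mid (p, \<theta>, q) = \<theta>"

context bicategory
begin

fun path :: "'a list \<Rightarrow> 'a"
  where "path [f] = f"
  | "path (f # g # p) = f \<odot> path (g # p)"

definition is_pcell :: "('a,'c) pcell \<Rightarrow> bool"
  where "is_pcell P \<longleftrightarrow> (case P of (p, \<theta>, q) \<Rightarrow> \<guillemotleft>\<theta> : path p \<Rightarrow> path q\<guillemotright>)"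

definition is_iso_pcell :: "('a,'c) pcell \<Rightarrow> bool"
  where "is_iso_pcell P \<longleftrightarrow> (case P of (p, \<theta>, q) \<Rightarrow> \<guillemotleft>\<theta> : path p \<cong> path q\<guillemotright>)"

text \<open>\<open>join p r : path p \<odot> path r \<Rightarrow> path (p @ r)\<close> for nonempty \<open>p\<close> and \<open>r\<close>.\<close>

fun join :: "'a list \<Rightarrow> 'a list \<Rightarrow> 'c"
  where "join [f] r = \<ii> (f \<odot> path r)"
  | "join (f # g # p) r = (\<ii> f \<star> join (g # p) r) \<cdot> \<aa> f (path (g # p)) (path r)"

fun whisker_right :: "('a,'c) pcell \<Rightarrow> 'a list \<Rightarrow> 'c"
  where "whisker_right (p, \<theta>, q) [] = \<theta>"
  | "whisker_right (p, \<theta>, q) (f # r) = join q (f # r) \<cdot> (\<theta> \<star> \<ii> (path (f # r))) \<cdot> \<ominus> (join p (f # r))"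

fun whisker :: "'a list \<Rightarrow> ('a,'c) pcell \<Rightarrow> 'a list \<Rightarrow> ('a,'c) pcell"
    ("(_ \<lhd> _ \<rhd> _)" [61,61,61] 60)
  where "l \<lhd> (p, \<theta>, q) \<rhd> r =
           (l @ p @ r, foldr (\<lambda>f \<phi>. \<ii> f \<star> \<phi>) l (whisker_right (p, \<theta>, q) r), l @ q @ r)"

text \<open>Vertical composition of path cells is written in diagrammatic order.\<close>

fun pthen :: "('a,'c) pcell \<Rightarrow> ('a,'c) pcell \<Rightarrow> ('a,'c) pcell"  (infixl "\<Zsemi>" 55)
  where "(p, \<theta>, q) \<Zsemi> (q', \<phi>, r) = (p, \<phi> \<cdot> \<theta>, r)"

fun pinv :: "('a,'c) pcell \<Rightarrow> ('a,'c) pcell"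
  where "pinv (p, \<theta>, q) = (q, \<ominus> \<theta>, p)"

definition single :: "'c \<Rightarrow> ('a,'c) pcell"
  where "single \<theta> = ([Dom \<M> \<theta>], \<theta>, [Cod \<M> \<theta>])"

definition split :: "'a \<Rightarrow> 'a \<Rightarrow> ('a,'c) pcell"
  where "split g f = ([g \<odot> f], \<ii> (g \<odot> f), [g, f])"

text \<open>The canonical cells \<open>f \<odot> 1 \<Rightarrow> 1 \<odot> f\<close>, and \<open>1 \<odot> \<dots> \<odot> 1 \<Rightarrow> 1 \<odot> \<dots> \<odot> 1\<close> with
  \<open>n\<close> and \<open>k\<close> factors.\<close>

definition swap :: "'a \<Rightarrow> ('a,'c) pcell"
  where "swap f = ([f, \<one> (Src \<M> f)], \<ominus> (\<ll> f) \<cdot> \<rr> f, [\<one> (Trg \<M> f), f])"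

fun collapse :: "'o \<Rightarrow> nat \<Rightarrow> 'c"
  where "collapse A 0 = \<ii> (\<one> A)"
  | "collapse A (Suc 0) = \<ii> (\<one> A)"
  | "collapse A (Suc (Suc n)) = \<ll> (\<one> A) \<cdot> (\<ii> (\<one> A) \<star> collapse A (Suc n))"

definition ones :: "'o \<Rightarrow> nat \<Rightarrow> nat \<Rightarrow> ('a,'c) pcell"
  where "ones A n k =
           (replicate n (\<one> A), \<ominus> (collapse A k) \<cdot> collapse A n, replicate k (\<one> A))"

end


section \<open>Monoidal bicategories\<close>

text \<open>
  A monoidal bicategory is a tricategory, in the sense of Gordon, Power and Street, with one object.
  Besides the tensor product on objects, arrows and cells, the data are
    \<^item> \<open>TComp g g' f f' : (g \<otimes> g') \<odot> (f \<otimes> f') \<Rightarrow> (g \<odot> f) \<otimes> (g' \<odot> f')\<close> and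
      \<open>TUnit A B : 1 \<Rightarrow> 1 \<otimes> 1\<close>, the constraints of the pseudofunctor \<open>\<otimes>\<close>;
    \<^item> \<open>as A B C : (A \<otimes> B) \<otimes> C \<rightarrow> A \<otimes> (B \<otimes> C)\<close>, \<open>lu A : I \<otimes> A \<rightarrow> A\<close>, \<open>ru A : A \<otimes> I \<rightarrow> A\<close>, with the
      pseudonaturality cells \<open>AsN\<close>, \<open>LuN\<close>, \<open>RuN\<close>;
    \<^item> \<open>PiC\<close>, \<open>MuC\<close>, \<open>LaC\<close>, \<open>RhC\<close>, the components of the modifications between composites of these, for
      the pentagon and for the three triangles with the unit object in the middle, on the left
      and on the right.
  The sources and targets of the cells are displayed below, where they are made into path cells.
\<close>

record ('o,'a,'c) monoidal_bicategory_data = "('o,'a,'c) bicategory_data" +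
  TObj :: "'o \<Rightarrow> 'o \<Rightarrow> 'o"  (infixr "\<otimes>\<^sub>0\<index>" 75)
  TArr :: "'a \<Rightarrow> 'a \<Rightarrow> 'a"  (infixr "\<otimes>\<^sub>1\<index>" 75)
  TCell :: "'c \<Rightarrow> 'c \<Rightarrow> 'c"  (infixr "\<otimes>\<^sub>2\<index>" 75)
  TComp :: "'a \<Rightarrow> 'a \<Rightarrow> 'a \<Rightarrow> 'a \<Rightarrow> 'c"
  TUnit :: "'o \<Rightarrow> 'o \<Rightarrow> 'c"
  UnitObj :: "'o"  ("\<I>\<index>")
  As :: "'o \<Rightarrow> 'o \<Rightarrow> 'o \<Rightarrow> 'a"  ("as\<index>")
  AsN :: "'a \<Rightarrow> 'a \<Rightarrow> 'a \<Rightarrow> 'c"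
  Lu :: "'o \<Rightarrow> 'a"  ("lu\<index>")
  LuN :: "'a \<Rightarrow> 'c"
  Ru :: "'o \<Rightarrow> 'a"  ("ru\<index>")
  RuN :: "'a \<Rightarrow> 'c"
  PiC :: "'o \<Rightarrow> 'o \<Rightarrow> 'o \<Rightarrow> 'o \<Rightarrow> 'c"
  MuC :: "'o \<Rightarrow> 'o \<Rightarrow> 'c"
  LaC :: "'o \<Rightarrow> 'o \<Rightarrow> 'c"
  RhC :: "'o \<Rightarrow> 'o \<Rightarrow> 'c"

locale tensor_bicategory = bicategory \<M>
  for \<M> :: "('o,'a,'c,'z) monoidal_bicategory_data_scheme" (structure) +
  assumes tensor_obj: "\<lbrakk>A \<in> Obj \<M>; B \<in> Obj \<M>\<rbrakk> \<Longrightarrow> A \<otimes>\<^sub>0 B \<in> Obj \<M>"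
    and tensor_arrow: "\<lbrakk>\<guillemotleft>f : A \<rightarrow> B\<guillemotright>; \<guillemotleft>f' : A' \<rightarrow> B'\<guillemotright>\<rbrakk>
        \<Longrightarrow> \<guillemotleft>f \<otimes>\<^sub>1 f' : A \<otimes>\<^sub>0 A' \<rightarrow> B \<otimes>\<^sub>0 B'\<guillemotright>"
    and tensor_cell: "\<lbrakk>\<guillemotleft>\<theta> : f \<Rightarrow> g\<guillemotright>; \<guillemotleft>\<theta>' : f' \<Rightarrow> g'\<guillemotright>\<rbrakk>
        \<Longrightarrow> \<guillemotleft>\<theta> \<otimes>\<^sub>2 \<theta>' : f \<otimes>\<^sub>1 f' \<Rightarrow> g \<otimes>\<^sub>1 g'\<guillemotright>"
    and tensor_id_cell: "\<lbrakk>f \<in> Arr \<M>; f' \<in> Arr \<M>\<rbrakk> \<Longrightarrow> \<ii> f \<otimes>\<^sub>2 \<ii> f' = \<ii> (f \<otimes>\<^sub>1 f')"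
    and tensor_vcomp: "\<lbrakk>\<guillemotleft>\<theta> : f \<Rightarrow> g\<guillemotright>; \<guillemotleft>\<phi> : g \<Rightarrow> h\<guillemotright>; \<guillemotleft>\<theta>' : f' \<Rightarrow> g'\<guillemotright>; \<guillemotleft>\<phi>' : g' \<Rightarrow> h'\<guillemotright>\<rbrakk>
        \<Longrightarrow> (\<phi> \<cdot> \<theta>) \<otimes>\<^sub>2 (\<phi>' \<cdot> \<theta>') = (\<phi> \<otimes>\<^sub>2 \<phi>') \<cdot> (\<theta> \<otimes>\<^sub>2 \<theta>')"
    and tcomp_iso: "\<lbrakk>\<guillemotleft>f : A \<rightarrow> B\<guillemotright>; \<guillemotleft>g : B \<rightarrow> C\<guillemotright>; \<guillemotleft>f' : A' \<rightarrow> B'\<guillemotright>; \<guillemotleft>g' : B' \<rightarrow> C'\<guillemotright>\<rbrakk>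
        \<Longrightarrow> \<guillemotleft>TComp \<M> g g' f f' : (g \<otimes>\<^sub>1 g') \<odot> (f \<otimes>\<^sub>1 f') \<cong> (g \<odot> f) \<otimes>\<^sub>1 (g' \<odot> f')\<guillemotright>"
    and tcomp_nat: "\<lbrakk>\<guillemotleft>\<theta> : f \<Rightarrow> k\<guillemotright>; \<guillemotleft>\<phi> : g \<Rightarrow> h\<guillemotright>; \<guillemotleft>\<theta>' : f' \<Rightarrow> k'\<guillemotright>; \<guillemotleft>\<phi>' : g' \<Rightarrow> h'\<guillemotright>;
          Trg \<M> f = Src \<M> g; Trg \<M> f' = Src \<M> g'\<rbrakk>
        \<Longrightarrow> TComp \<M> h h' k k' \<cdot> ((\<phi> \<otimes>\<^sub>2 \<phi>') \<star> (\<theta> \<otimes>\<^sub>2 \<theta>'))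
            = ((\<phi> \<star> \<theta>) \<otimes>\<^sub>2 (\<phi>' \<star> \<theta>')) \<cdot> TComp \<M> g g' f f'"
    and tunit_iso: "\<lbrakk>A \<in> Obj \<M>; B \<in> Obj \<M>\<rbrakk>
        \<Longrightarrow> \<guillemotleft>TUnit \<M> A B : \<one> (A \<otimes>\<^sub>0 B) \<cong> \<one> A \<otimes>\<^sub>1 \<one> B\<guillemotright>"
    and tcomp_assoc: "\<lbrakk>\<guillemotleft>f : A \<rightarrow> B\<guillemotright>; \<guillemotleft>g : B \<rightarrow> C\<guillemotright>; \<guillemotleft>h : C \<rightarrow> D\<guillemotright>;
          \<guillemotleft>f' : A' \<rightarrow> B'\<guillemotright>; \<guillemotleft>g' : B' \<rightarrow> C'\<guillemotright>; \<guillemotleft>h' : C' \<rightarrow> D'\<guillemotright>\<rbrakk>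
        \<Longrightarrow> (\<aa> h g f \<otimes>\<^sub>2 \<aa> h' g' f') \<cdot> TComp \<M> (h \<odot> g) (h' \<odot> g') f f'
              \<cdot> (TComp \<M> h h' g g' \<star> \<ii> (f \<otimes>\<^sub>1 f'))
            = TComp \<M> h h' (g \<odot> f) (g' \<odot> f') \<cdot> (\<ii> (h \<otimes>\<^sub>1 h') \<star> TComp \<M> g g' f f')
              \<cdot> \<aa> (h \<otimes>\<^sub>1 h') (g \<otimes>\<^sub>1 g') (f \<otimes>\<^sub>1 f')"
    and tcomp_lun: "\<lbrakk>\<guillemotleft>f : A \<rightarrow> B\<guillemotright>; \<guillemotleft>f' : A' \<rightarrow> B'\<guillemotright>\<rbrakk>
        \<Longrightarrow> (\<ll> f \<otimes>\<^sub>2 \<ll> f') \<cdot> TComp \<M> (\<one> B) (\<one> B') f f' \<cdot> (TUnit \<M> B B' \<star> \<ii> (f \<otimes>\<^sub>1 f'))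
            = \<ll> (f \<otimes>\<^sub>1 f')"
    and tcomp_run: "\<lbrakk>\<guillemotleft>f : A \<rightarrow> B\<guillemotright>; \<guillemotleft>f' : A' \<rightarrow> B'\<guillemotright>\<rbrakk>
        \<Longrightarrow> (\<rr> f \<otimes>\<^sub>2 \<rr> f') \<cdot> TComp \<M> f f' (\<one> A) (\<one> A') \<cdot> (\<ii> (f \<otimes>\<^sub>1 f') \<star> TUnit \<M> A A')
            = \<rr> (f \<otimes>\<^sub>1 f')"
begin

definition Phi :: "'a \<Rightarrow> 'a \<Rightarrow> 'a \<Rightarrow> 'a \<Rightarrow> ('a,'c) pcell"
  where "Phi g g' f f' =
           ([g \<otimes>\<^sub>1 g', f \<otimes>\<^sub>1 f'], TComp \<M> g g' f f', [(g \<odot> f) \<otimes>\<^sub>1 (g' \<odot> f')])"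

text \<open>
  \<open>tjoin p p' : path [f\<^sub>1 \<otimes> f'\<^sub>1, \<dots>, f\<^sub>n \<otimes> f'\<^sub>n] \<Rightarrow> path p \<otimes> path p'\<close> for paths \<open>p\<close>, \<open>p'\<close> of the same length.
  With it, path cells can be tensored whenever their sources have equal length and so
  do their targets.
\<close>

fun tjoin :: "'a list \<Rightarrow> 'a list \<Rightarrow> 'c"
  where "tjoin [f] [f'] = \<ii> (f \<otimes>\<^sub>1 f')"
  | "tjoin (f # g # p) (f' # g' # p') =
       TComp \<M> f f' (path (g # p)) (path (g' # p')) \<cdot> (\<ii> (f \<otimes>\<^sub>1 f') \<star> tjoin (g # p) (g' # p'))"

fun ptensor :: "('a,'c) pcell \<Rightarrow> ('a,'c) pcell \<Rightarrow> ('a,'c) pcell"  (infixr "\<boxtimes>" 75)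
  where "(p, \<theta>, q) \<boxtimes> (p', \<theta>', q') =
           (map2 (\<otimes>\<^sub>1) p p', \<ominus> (tjoin q q') \<cdot> (\<theta> \<otimes>\<^sub>2 \<theta>') \<cdot> tjoin p p', map2 (\<otimes>\<^sub>1) q q')"

text \<open>\<open>1\<^sub>A \<otimes> P\<close> and \<open>P \<otimes> 1\<^sub>A\<close> for a path cell \<open>P\<close>.\<close>

fun ltensor :: "'o \<Rightarrow> ('a,'c) pcell \<Rightarrow> ('a,'c) pcell"
  where "ltensor A (p, \<theta>, q) = ones A (length p) (length q) \<boxtimes> (p, \<theta>, q)"

fun rtensor :: "('a,'c) pcell \<Rightarrow> 'o \<Rightarrow> ('a,'c) pcell"
  where "rtensor (p, \<theta>, q) A = (p, \<theta>, q) \<boxtimes> ones A (length p) (length q)"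

text \<open>The interchange cell \<open>(f 1) (1 g) \<Rightarrow> (1 g) (f 1)\<close>.\<close>

definition Inter :: "'a \<Rightarrow> 'a \<Rightarrow> ('a,'c) pcell"
  where "Inter f g = swap f \<boxtimes> pinv (swap g)"

definition As\<^sub>n :: "'a \<Rightarrow> 'a \<Rightarrow> 'a \<Rightarrow> ('a,'c) pcell"
  where "As\<^sub>n f g h =
           ([as (Trg \<M> f) (Trg \<M> g) (Trg \<M> h), (f \<otimes>\<^sub>1 g) \<otimes>\<^sub>1 h], AsN \<M> f g h,
            [f \<otimes>\<^sub>1 (g \<otimes>\<^sub>1 h), as (Src \<M> f) (Src \<M> g) (Src \<M> h)])"

text \<open>Instances in which \<open>1\<^sub>A \<otimes> 1\<^sub>B\<close> is replaced by the identity arrow of \<open>A \<otimes> B\<close>.\<close>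

definition As\<^sub>l :: "'a \<Rightarrow> 'o \<Rightarrow> 'o \<Rightarrow> ('a,'c) pcell"
  where "As\<^sub>l f B C =
           As\<^sub>n f (\<one> B) (\<one> C)
           \<Zsemi> [] \<lhd> single (\<ii> f \<otimes>\<^sub>2 \<ominus> (TUnit \<M> B C)) \<rhd> [as (Src \<M> f) B C]"

definition As\<^sub>r :: "'o \<Rightarrow> 'o \<Rightarrow> 'a \<Rightarrow> ('a,'c) pcell"
  where "As\<^sub>r A B f =
           [as A B (Trg \<M> f)] \<lhd> single (TUnit \<M> A B \<otimes>\<^sub>2 \<ii> f) \<rhd> []
           \<Zsemi> As\<^sub>n (\<one> A) (\<one> B) f"

definition Lu\<^sub>n :: "'a \<Rightarrow> ('a,'c) pcell"
  where "Lu\<^sub>n f = ([lu (Trg \<M> f), \<one> \<I> \<otimes>\<^sub>1 f], LuN \<M> f, [f, lu (Src \<M> f)])"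

definition Ru\<^sub>n :: "'a \<Rightarrow> ('a,'c) pcell"
  where "Ru\<^sub>n f = ([ru (Trg \<M> f), f \<otimes>\<^sub>1 \<one> \<I>], RuN \<M> f, [f, ru (Src \<M> f)])"

definition Pi :: "'o \<Rightarrow> 'o \<Rightarrow> 'o \<Rightarrow> 'o \<Rightarrow> ('a,'c) pcell"
  where "Pi A B C D =
           ([as A B (C \<otimes>\<^sub>0 D), as (A \<otimes>\<^sub>0 B) C D], PiC \<M> A B C D,
            [\<one> A \<otimes>\<^sub>1 as B C D, as A (B \<otimes>\<^sub>0 C) D, as A B C \<otimes>\<^sub>1 \<one> D])"

definition Mu :: "'o \<Rightarrow> 'o \<Rightarrow> ('a,'c) pcell"
  where "Mu A B = ([\<one> A \<otimes>\<^sub>1 lu B, as A \<I> B], MuC \<M> A B, [ru A \<otimes>\<^sub>1 \<one> B])"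

definition La :: "'o \<Rightarrow> 'o \<Rightarrow> ('a,'c) pcell"
  where "La A B = ([lu A \<otimes>\<^sub>1 \<one> B], LaC \<M> A B, [lu (A \<otimes>\<^sub>0 B), as \<I> A B])"

definition Rh :: "'o \<Rightarrow> 'o \<Rightarrow> ('a,'c) pcell"
  where "Rh A B = ([\<one> A \<otimes>\<^sub>1 ru B, as A B \<I>], RhC \<M> A B, [ru (A \<otimes>\<^sub>0 B)])"

end

locale monoidal_bicategory = tensor_bicategory \<M>
  for \<M> :: "('o,'a,'c,'z) monoidal_bicategory_data_scheme" (structure) +
  assumes unit_obj: "\<I> \<in> Obj \<M>"
  \<comment> \<open>\<open>as\<close>, \<open>lu\<close>, \<open>ru\<close> are pseudonatural equivalences\<close>
    and as_equiv: "\<lbrakk>A \<in> Obj \<M>; B \<in> Obj \<M>; C \<in> Obj \<M>\<rbrakk>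
        \<Longrightarrow> is_equivalence \<M> (as A B C) ((A \<otimes>\<^sub>0 B) \<otimes>\<^sub>0 C) (A \<otimes>\<^sub>0 (B \<otimes>\<^sub>0 C))"
    and asn_iso: "\<lbrakk>f \<in> Arr \<M>; g \<in> Arr \<M>; h \<in> Arr \<M>\<rbrakk> \<Longrightarrow> is_iso_pcell (As\<^sub>n f g h)"
    and asn_nat: "\<lbrakk>\<guillemotleft>\<theta> : f \<Rightarrow> f'\<guillemotright>; \<guillemotleft>\<phi> : g \<Rightarrow> g'\<guillemotright>; \<guillemotleft>\<psi> : h \<Rightarrow> h'\<guillemotright>\<rbrakk>
        \<Longrightarrow> [as (Trg \<M> f) (Trg \<M> g) (Trg \<M> h)] \<lhd> single ((\<theta> \<otimes>\<^sub>2 \<phi>) \<otimes>\<^sub>2 \<psi>) \<rhd> [] \<Zsemi> As\<^sub>n f' g' h'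
            = As\<^sub>n f g h \<Zsemi> [] \<lhd> single (\<theta> \<otimes>\<^sub>2 (\<phi> \<otimes>\<^sub>2 \<psi>)) \<rhd> [as (Src \<M> f) (Src \<M> g) (Src \<M> h)]"
    and asn_comp: "\<lbrakk>\<guillemotleft>f : A \<rightarrow> B\<guillemotright>; \<guillemotleft>f' : B \<rightarrow> C\<guillemotright>; \<guillemotleft>g : A' \<rightarrow> B'\<guillemotright>; \<guillemotleft>g' : B' \<rightarrow> C'\<guillemotright>;
          \<guillemotleft>h : A'' \<rightarrow> B''\<guillemotright>; \<guillemotleft>h' : B'' \<rightarrow> C''\<guillemotright>\<rbrakk>
        \<Longrightarrow> [as C C' C''] \<lhd> Phi (f' \<otimes>\<^sub>1 g') h' (f \<otimes>\<^sub>1 g) h \<rhd> []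
              \<Zsemi> [as C C' C''] \<lhd> single (TComp \<M> f' g' f g \<otimes>\<^sub>2 \<ii> (h' \<odot> h)) \<rhd> []
              \<Zsemi> As\<^sub>n (f' \<odot> f) (g' \<odot> g) (h' \<odot> h)
            = [] \<lhd> As\<^sub>n f' g' h' \<rhd> [(f \<otimes>\<^sub>1 g) \<otimes>\<^sub>1 h]
              \<Zsemi> [f' \<otimes>\<^sub>1 (g' \<otimes>\<^sub>1 h')] \<lhd> As\<^sub>n f g h \<rhd> []
              \<Zsemi> [] \<lhd> Phi f' (g' \<otimes>\<^sub>1 h') f (g \<otimes>\<^sub>1 h) \<rhd> [as A A' A'']
              \<Zsemi> [] \<lhd> single (\<ii> (f' \<odot> f) \<otimes>\<^sub>2 TComp \<M> g' h' g h) \<rhd> [as A A' A'']"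
    and asn_unit: "\<lbrakk>A \<in> Obj \<M>; B \<in> Obj \<M>; C \<in> Obj \<M>\<rbrakk>
        \<Longrightarrow> [as A B C] \<lhd> single (TUnit \<M> (A \<otimes>\<^sub>0 B) C) \<rhd> []
              \<Zsemi> [as A B C] \<lhd> single (TUnit \<M> A B \<otimes>\<^sub>2 \<ii> (\<one> C)) \<rhd> []
              \<Zsemi> As\<^sub>n (\<one> A) (\<one> B) (\<one> C)
            = swap (as A B C)
              \<Zsemi> [] \<lhd> single (TUnit \<M> A (B \<otimes>\<^sub>0 C)) \<rhd> [as A B C]
              \<Zsemi> [] \<lhd> single (\<ii> (\<one> A) \<otimes>\<^sub>2 TUnit \<M> B C) \<rhd> [as A B C]"
    and lu_equiv: "A \<in> Obj \<M> \<Longrightarrow> is_equivalence \<M> (lu A) (\<I> \<otimes>\<^sub>0 A) A"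
    and lun_iso': "f \<in> Arr \<M> \<Longrightarrow> is_iso_pcell (Lu\<^sub>n f)"
    and lun_nat': "\<guillemotleft>\<theta> : f \<Rightarrow> f'\<guillemotright>
        \<Longrightarrow> [lu (Trg \<M> f)] \<lhd> single (\<ii> (\<one> \<I>) \<otimes>\<^sub>2 \<theta>) \<rhd> [] \<Zsemi> Lu\<^sub>n f'
            = Lu\<^sub>n f \<Zsemi> [] \<lhd> single \<theta> \<rhd> [lu (Src \<M> f)]"
    and lun_comp: "\<lbrakk>\<guillemotleft>f : A \<rightarrow> B\<guillemotright>; \<guillemotleft>f' : B \<rightarrow> C\<guillemotright>\<rbrakk>
        \<Longrightarrow> [lu C] \<lhd> Phi (\<one> \<I>) f' (\<one> \<I>) f \<rhd> []
              \<Zsemi> [lu C] \<lhd> single (\<ll> (\<one> \<I>) \<otimes>\<^sub>2 \<ii> (f' \<odot> f)) \<rhd> []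
              \<Zsemi> Lu\<^sub>n (f' \<odot> f)
            = [] \<lhd> Lu\<^sub>n f' \<rhd> [\<one> \<I> \<otimes>\<^sub>1 f]
              \<Zsemi> [f'] \<lhd> Lu\<^sub>n f \<rhd> []
              \<Zsemi> [] \<lhd> pinv (split f' f) \<rhd> [lu A]"
    and lun_unit: "A \<in> Obj \<M>
        \<Longrightarrow> [lu A] \<lhd> single (TUnit \<M> \<I> A) \<rhd> [] \<Zsemi> Lu\<^sub>n (\<one> A) = swap (lu A)"
    and ru_equiv: "A \<in> Obj \<M> \<Longrightarrow> is_equivalence \<M> (ru A) (A \<otimes>\<^sub>0 \<I>) A"
    and run_iso': "f \<in> Arr \<M> \<Longrightarrow> is_iso_pcell (Ru\<^sub>n f)"
    and run_nat': "\<guillemotleft>\<theta> : f \<Rightarrow> f'\<guillemotright>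
        \<Longrightarrow> [ru (Trg \<M> f)] \<lhd> single (\<theta> \<otimes>\<^sub>2 \<ii> (\<one> \<I>)) \<rhd> [] \<Zsemi> Ru\<^sub>n f'
            = Ru\<^sub>n f \<Zsemi> [] \<lhd> single \<theta> \<rhd> [ru (Src \<M> f)]"
    and run_comp: "\<lbrakk>\<guillemotleft>f : A \<rightarrow> B\<guillemotright>; \<guillemotleft>f' : B \<rightarrow> C\<guillemotright>\<rbrakk>
        \<Longrightarrow> [ru C] \<lhd> Phi f' (\<one> \<I>) f (\<one> \<I>) \<rhd> []
              \<Zsemi> [ru C] \<lhd> single (\<ii> (f' \<odot> f) \<otimes>\<^sub>2 \<ll> (\<one> \<I>)) \<rhd> []
              \<Zsemi> Ru\<^sub>n (f' \<odot> f)
            = [] \<lhd> Ru\<^sub>n f' \<rhd> [f \<otimes>\<^sub>1 \<one> \<I>]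
              \<Zsemi> [f'] \<lhd> Ru\<^sub>n f \<rhd> []
              \<Zsemi> [] \<lhd> pinv (split f' f) \<rhd> [ru A]"
    and run_unit: "A \<in> Obj \<M>
        \<Longrightarrow> [ru A] \<lhd> single (TUnit \<M> A \<I>) \<rhd> [] \<Zsemi> Ru\<^sub>n (\<one> A) = swap (ru A)"
  \<comment> \<open>\<open>Pi\<close>, \<open>Mu\<close>, \<open>La\<close>, \<open>Rh\<close> are invertible modifications\<close>
    and pi_iso: "\<lbrakk>A \<in> Obj \<M>; B \<in> Obj \<M>; C \<in> Obj \<M>; D \<in> Obj \<M>\<rbrakk> \<Longrightarrow> is_iso_pcell (Pi A B C D)"
    and pi_mod: "\<lbrakk>\<guillemotleft>f : A \<rightarrow> A'\<guillemotright>; \<guillemotleft>g : B \<rightarrow> B'\<guillemotright>; \<guillemotleft>h : C \<rightarrow> C'\<guillemotright>; \<guillemotleft>k : D \<rightarrow> D'\<guillemotright>\<rbrakk>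
        \<Longrightarrow> [as A' B' (C' \<otimes>\<^sub>0 D')] \<lhd> As\<^sub>n (f \<otimes>\<^sub>1 g) h k \<rhd> []
              \<Zsemi> [] \<lhd> As\<^sub>n f g (h \<otimes>\<^sub>1 k) \<rhd> [as (A \<otimes>\<^sub>0 B) C D]
              \<Zsemi> [f \<otimes>\<^sub>1 (g \<otimes>\<^sub>1 (h \<otimes>\<^sub>1 k))] \<lhd> Pi A B C D \<rhd> []
            = [] \<lhd> Pi A' B' C' D' \<rhd> [((f \<otimes>\<^sub>1 g) \<otimes>\<^sub>1 h) \<otimes>\<^sub>1 k]
              \<Zsemi> [\<one> A' \<otimes>\<^sub>1 as B' C' D', as A' (B' \<otimes>\<^sub>0 C') D'] \<lhd> As\<^sub>n f g h \<boxtimes> pinv (swap k) \<rhd> []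
              \<Zsemi> [\<one> A' \<otimes>\<^sub>1 as B' C' D'] \<lhd> As\<^sub>n f (g \<otimes>\<^sub>1 h) k \<rhd> [as A B C \<otimes>\<^sub>1 \<one> D]
              \<Zsemi> [] \<lhd> pinv (swap f) \<boxtimes> As\<^sub>n g h k \<rhd> [as A (B \<otimes>\<^sub>0 C) D, as A B C \<otimes>\<^sub>1 \<one> D]"
    and mu_iso: "\<lbrakk>A \<in> Obj \<M>; B \<in> Obj \<M>\<rbrakk> \<Longrightarrow> is_iso_pcell (Mu A B)"
    and mu_mod: "\<lbrakk>\<guillemotleft>f : A \<rightarrow> A'\<guillemotright>; \<guillemotleft>g : B \<rightarrow> B'\<guillemotright>\<rbrakk>
        \<Longrightarrow> [\<one> A' \<otimes>\<^sub>1 lu B'] \<lhd> As\<^sub>n f (\<one> \<I>) g \<rhd> []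
              \<Zsemi> [] \<lhd> pinv (swap f) \<boxtimes> Lu\<^sub>n g \<rhd> [as A \<I> B]
              \<Zsemi> [f \<otimes>\<^sub>1 g] \<lhd> Mu A B \<rhd> []
            = [] \<lhd> Mu A' B' \<rhd> [(f \<otimes>\<^sub>1 \<one> \<I>) \<otimes>\<^sub>1 g]
              \<Zsemi> Ru\<^sub>n f \<boxtimes> pinv (swap g)"
    and la_iso: "\<lbrakk>A \<in> Obj \<M>; B \<in> Obj \<M>\<rbrakk> \<Longrightarrow> is_iso_pcell (La A B)"
    and la_mod: "\<lbrakk>\<guillemotleft>f : A \<rightarrow> A'\<guillemotright>; \<guillemotleft>g : B \<rightarrow> B'\<guillemotright>\<rbrakk>
        \<Longrightarrow> Lu\<^sub>n f \<boxtimes> pinv (swap g)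
              \<Zsemi> [f \<otimes>\<^sub>1 g] \<lhd> La A B \<rhd> []
            = [] \<lhd> La A' B' \<rhd> [(\<one> \<I> \<otimes>\<^sub>1 f) \<otimes>\<^sub>1 g]
              \<Zsemi> [lu (A' \<otimes>\<^sub>0 B')] \<lhd> As\<^sub>n (\<one> \<I>) f g \<rhd> []
              \<Zsemi> [] \<lhd> Lu\<^sub>n (f \<otimes>\<^sub>1 g) \<rhd> [as \<I> A B]"
    and rh_iso: "\<lbrakk>A \<in> Obj \<M>; B \<in> Obj \<M>\<rbrakk> \<Longrightarrow> is_iso_pcell (Rh A B)"
    and rh_mod: "\<lbrakk>\<guillemotleft>f : A \<rightarrow> A'\<guillemotright>; \<guillemotleft>g : B \<rightarrow> B'\<guillemotright>\<rbrakk>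
        \<Longrightarrow> [\<one> A' \<otimes>\<^sub>1 ru B'] \<lhd> As\<^sub>n f g (\<one> \<I>) \<rhd> []
              \<Zsemi> [] \<lhd> pinv (swap f) \<boxtimes> Ru\<^sub>n g \<rhd> [as A B \<I>]
              \<Zsemi> [f \<otimes>\<^sub>1 g] \<lhd> Rh A B \<rhd> []
            = [] \<lhd> Rh A' B' \<rhd> [(f \<otimes>\<^sub>1 g) \<otimes>\<^sub>1 \<one> \<I>]
              \<Zsemi> Ru\<^sub>n (f \<otimes>\<^sub>1 g)"
  \<comment> \<open>the nonabelian 4-cocycle condition, between cells with source
      \<open>(((A \<otimes> B) \<otimes> C) \<otimes> D) \<otimes> E\<close>\<close>
    and cocycle: "\<lbrakk>A \<in> Obj \<M>; B \<in> Obj \<M>; C \<in> Obj \<M>; D \<in> Obj \<M>; E \<in> Obj \<M>\<rbrakk>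
        \<Longrightarrow> [as A B (C \<otimes>\<^sub>0 D \<otimes>\<^sub>0 E)] \<lhd> Pi (A \<otimes>\<^sub>0 B) C D E \<rhd> []
              \<Zsemi> [] \<lhd> As\<^sub>r A B (as C D E) \<rhd> [as (A \<otimes>\<^sub>0 B) (C \<otimes>\<^sub>0 D) E, as (A \<otimes>\<^sub>0 B) C D \<otimes>\<^sub>1 \<one> E]
              \<Zsemi> [\<one> A \<otimes>\<^sub>1 (\<one> B \<otimes>\<^sub>1 as C D E)] \<lhd> Pi A B (C \<otimes>\<^sub>0 D) E \<rhd> [as (A \<otimes>\<^sub>0 B) C D \<otimes>\<^sub>1 \<one> E]
              \<Zsemi> [\<one> A \<otimes>\<^sub>1 (\<one> B \<otimes>\<^sub>1 as C D E), \<one> A \<otimes>\<^sub>1 as B (C \<otimes>\<^sub>0 D) E, as A (B \<otimes>\<^sub>0 C \<otimes>\<^sub>0 D) E]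
                \<lhd> rtensor (Pi A B C D) E \<rhd> []
              \<Zsemi> [\<one> A \<otimes>\<^sub>1 (\<one> B \<otimes>\<^sub>1 as C D E), \<one> A \<otimes>\<^sub>1 as B (C \<otimes>\<^sub>0 D) E]
                \<lhd> As\<^sub>n (\<one> A) (as B C D) (\<one> E) \<rhd>
                [as A (B \<otimes>\<^sub>0 C) D \<otimes>\<^sub>1 \<one> E, (as A B C \<otimes>\<^sub>1 \<one> D) \<otimes>\<^sub>1 \<one> E]
            = [] \<lhd> Pi A B C (D \<otimes>\<^sub>0 E) \<rhd> [as ((A \<otimes>\<^sub>0 B) \<otimes>\<^sub>0 C) D E]
              \<Zsemi> [\<one> A \<otimes>\<^sub>1 as B C (D \<otimes>\<^sub>0 E), as A (B \<otimes>\<^sub>0 C) (D \<otimes>\<^sub>0 E)]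
                \<lhd> pinv (As\<^sub>l (as A B C) D E) \<rhd> []
              \<Zsemi> [\<one> A \<otimes>\<^sub>1 as B C (D \<otimes>\<^sub>0 E)] \<lhd> Pi A (B \<otimes>\<^sub>0 C) D E \<rhd> [(as A B C \<otimes>\<^sub>1 \<one> D) \<otimes>\<^sub>1 \<one> E]
              \<Zsemi> [] \<lhd> ltensor A (Pi B C D E) \<rhd>
                [as A ((B \<otimes>\<^sub>0 C) \<otimes>\<^sub>0 D) E, as A (B \<otimes>\<^sub>0 C) D \<otimes>\<^sub>1 \<one> E, (as A B C \<otimes>\<^sub>1 \<one> D) \<otimes>\<^sub>1 \<one> E]"
  \<comment> \<open>the two normalization conditions, between cells with source
      \<open>((A \<otimes> I) \<otimes> B) \<otimes> C\<close> and \<open>((A \<otimes> B) \<otimes> I) \<otimes> C\<close>\<close>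
    and left_normalization: "\<lbrakk>A \<in> Obj \<M>; B \<in> Obj \<M>; C \<in> Obj \<M>\<rbrakk>
        \<Longrightarrow> [\<one> A \<otimes>\<^sub>1 lu (B \<otimes>\<^sub>0 C)] \<lhd> Pi A \<I> B C \<rhd> []
              \<Zsemi> [] \<lhd> pinv (ltensor A (La B C)) \<rhd> [as A (\<I> \<otimes>\<^sub>0 B) C, as A \<I> B \<otimes>\<^sub>1 \<one> C]
              \<Zsemi> [] \<lhd> pinv (As\<^sub>n (\<one> A) (lu B) (\<one> C)) \<rhd> [as A \<I> B \<otimes>\<^sub>1 \<one> C]
              \<Zsemi> [as A B C] \<lhd> rtensor (Mu A B) C \<rhd> []
            = [] \<lhd> Mu A (B \<otimes>\<^sub>0 C) \<rhd> [as (A \<otimes>\<^sub>0 \<I>) B C]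
              \<Zsemi> pinv (As\<^sub>l (ru A) B C)"
    and right_normalization: "\<lbrakk>A \<in> Obj \<M>; B \<in> Obj \<M>; C \<in> Obj \<M>\<rbrakk>
        \<Longrightarrow> [\<one> A \<otimes>\<^sub>1 (\<one> B \<otimes>\<^sub>1 lu C)] \<lhd> Pi A B \<I> C \<rhd> []
              \<Zsemi> [] \<lhd> ltensor A (Mu B C) \<rhd> [as A (B \<otimes>\<^sub>0 \<I>) C, as A B \<I> \<otimes>\<^sub>1 \<one> C]
              \<Zsemi> [] \<lhd> pinv (As\<^sub>n (\<one> A) (ru B) (\<one> C)) \<rhd> [as A B \<I> \<otimes>\<^sub>1 \<one> C]
              \<Zsemi> [as A B C] \<lhd> rtensor (Rh A B) C \<rhd> []
            = [] \<lhd> pinv (As\<^sub>r A B (lu C)) \<rhd> [as (A \<otimes>\<^sub>0 B) \<I> C]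
              \<Zsemi> [as A B C] \<lhd> Mu (A \<otimes>\<^sub>0 B) C \<rhd> []"


section \<open>Right skew monoidales, oplax actions, opmonoidal arrows, comodules\<close>

record ('o,'a,'c) skew_monoidale =
  carrier :: 'o
  mul :: 'a
  unit :: 'a
  skAssoc :: 'c
  skLun :: 'c
  skRun :: 'c

record ('o,'a,'c) action =
  aobj :: 'o
  act :: 'a
  act2 :: 'c
  act0 :: 'c

record ('a,'c) opmonoidal =
  oarr :: 'a
  op2 :: 'c
  op0 :: 'c

context monoidal_bicategory
begin

text \<open>
  The equations quoted in the comments are in element notation, as if \<open>\<M>\<close> were a Gray monoid; the
  formal equations spell out the coherence data of \<open>\<M>\<close>.  An iterated product such as \<open>w(x(yz))\<close> has as source the tensor
  product bracketed to the left, so \<open>x(yz)\<close> is the path \<open>[m, 1 \<otimes> m, as]\<close> and \<open>(xy)z\<close> the path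
  \<open>[m, m \<otimes> 1]\<close>; likewise \<open>\<lambda> : x \<rightarrow> ux\<close> becomes a cell \<open>lu \<Rightarrow> m \<odot> (u \<otimes> 1)\<close> and \<open>xu \<rightarrow> x\<close> becomes a
  cell \<open>m \<odot> (1 \<otimes> u) \<Rightarrow> ru\<close>.
\<close>

definition Act2 :: "('o,'a,'c) skew_monoidale \<Rightarrow> ('o,'a,'c) action \<Rightarrow> ('a,'c) pcell"
  where "Act2 M a =
    ([act a, \<one> (aobj a) \<otimes>\<^sub>1 mul M, as (aobj a) (carrier M) (carrier M)], act2 a,
     [act a, act a \<otimes>\<^sub>1 \<one> (carrier M)])"

definition Act0 :: "('o,'a,'c) skew_monoidale \<Rightarrow> ('o,'a,'c) action \<Rightarrow> ('a,'c) pcell"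
  where "Act0 M a = ([act a, \<one> (aobj a) \<otimes>\<^sub>1 unit M], act0 a, [ru (aobj a)])"

definition regular :: "('o,'a,'c) skew_monoidale \<Rightarrow> ('o,'a,'c) action"
  where "regular M = \<lparr> aobj = carrier M, act = mul M, act2 = skAssoc M, act0 = skRun M \<rparr>"

definition SkA :: "('o,'a,'c) skew_monoidale \<Rightarrow> ('a,'c) pcell"
  where "SkA M =
    ([mul M, \<one> (carrier M) \<otimes>\<^sub>1 mul M, as (carrier M) (carrier M) (carrier M)], skAssoc M,
     [mul M, mul M \<otimes>\<^sub>1 \<one> (carrier M)])"

definition SkL :: "('o,'a,'c) skew_monoidale \<Rightarrow> ('a,'c) pcell"
  where "SkL M = ([lu (carrier M)], skLun M, [mul M, unit M \<otimes>\<^sub>1 \<one> (carrier M)])"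

definition SkR :: "('o,'a,'c) skew_monoidale \<Rightarrow> ('a,'c) pcell"
  where "SkR M = ([mul M, \<one> (carrier M) \<otimes>\<^sub>1 unit M], skRun M, [ru (carrier M)])"

text \<open>
  The data and the three equations of an oplax right action, stated without requiring \<open>M\<close> to be a
  skew monoidale.  For \<open>regular M\<close>, that is, for \<open>a = m\<close>, \<open>a\<^sup>2 = \<alpha>\<close>, \<open>a\<^sup>0 = \<rho>\<close>, they are
  literally those equations of a right skew monoidale in which \<open>\<alpha>\<close> or \<open>\<rho>\<close> takes the place of \<open>a\<^sup>2\<close>
  or \<open>a\<^sup>0\<close>.
\<close>

definition action_axioms :: "('o,'a,'c) skew_monoidale \<Rightarrow> ('o,'a,'c) action \<Rightarrow> bool"
  where "action_axioms M a \<longleftrightarrow>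
    (let A = aobj a; X = carrier M; m = mul M; u = unit M in
      A \<in> Obj \<M> \<and> \<guillemotleft>act a : A \<otimes>\<^sub>0 X \<rightarrow> A\<guillemotright> \<and> is_pcell (Act2 M a) \<and> is_pcell (Act0 M a) \<and>
      \<comment> \<open>\<open>a\<^sup>2\<^bsub>x\<cdot>p,q,r\<^esub> a\<^sup>2\<^bsub>x,p,qr\<^esub> = (a\<^sup>2\<^bsub>x,p,q\<^esub>\<cdot>r) a\<^sup>2\<^bsub>x,pq,r\<^esub> (x\<cdot>\<alpha>)\<close>\<close>
      [act a, \<one> A \<otimes>\<^sub>1 m] \<lhd> pinv (As\<^sub>r A X m) \<rhd> [as (A \<otimes>\<^sub>0 X) X X]
        \<Zsemi> [] \<lhd> Act2 M a \<rhd> [\<one> (A \<otimes>\<^sub>0 X) \<otimes>\<^sub>1 m, as (A \<otimes>\<^sub>0 X) X X]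
        \<Zsemi> [act a] \<lhd> Inter (act a) m \<rhd> [as (A \<otimes>\<^sub>0 X) X X]
        \<Zsemi> [act a, \<one> A \<otimes>\<^sub>1 m] \<lhd> pinv (As\<^sub>l (act a) X X) \<rhd> []
        \<Zsemi> [] \<lhd> Act2 M a \<rhd> [(act a \<otimes>\<^sub>1 \<one> X) \<otimes>\<^sub>1 \<one> X]
      = [act a, \<one> A \<otimes>\<^sub>1 m, \<one> A \<otimes>\<^sub>1 (\<one> X \<otimes>\<^sub>1 m)] \<lhd> Pi A X X X \<rhd> []
        \<Zsemi> [act a] \<lhd> ltensor A (SkA M) \<rhd> [as A (X \<otimes>\<^sub>0 X) X, as A X X \<otimes>\<^sub>1 \<one> X]
        \<Zsemi> [act a, \<one> A \<otimes>\<^sub>1 m] \<lhd> pinv (As\<^sub>n (\<one> A) m (\<one> X)) \<rhd> [as A X X \<otimes>\<^sub>1 \<one> X]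
        \<Zsemi> [] \<lhd> Act2 M a \<rhd> [(\<one> A \<otimes>\<^sub>1 m) \<otimes>\<^sub>1 \<one> X, as A X X \<otimes>\<^sub>1 \<one> X]
        \<Zsemi> [act a] \<lhd> rtensor (Act2 M a) X \<rhd> [] \<and>
      \<comment> \<open>\<open>a\<^sup>0\<^bsub>x\<cdot>p\<^esub> a\<^sup>2\<^bsub>x,p,u\<^esub> = x\<cdot>\<rho>\<^bsub>p\<^esub>\<close>\<close>
      [act a, \<one> A \<otimes>\<^sub>1 m] \<lhd> pinv (As\<^sub>r A X u) \<rhd> []
        \<Zsemi> [] \<lhd> Act2 M a \<rhd> [\<one> (A \<otimes>\<^sub>0 X) \<otimes>\<^sub>1 u]
        \<Zsemi> [act a] \<lhd> Inter (act a) u \<rhd> []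
        \<Zsemi> [] \<lhd> Act0 M a \<rhd> [act a \<otimes>\<^sub>1 \<one> \<I>]
        \<Zsemi> Ru\<^sub>n (act a)
      = [act a] \<lhd> ltensor A (SkR M) \<rhd> [as A X \<I>]
        \<Zsemi> [act a] \<lhd> Rh A X \<rhd> [] \<and>
      \<comment> \<open>\<open>(a\<^sup>0\<^bsub>x\<^esub>\<cdot>p) a\<^sup>2\<^bsub>x,u,p\<^esub> (x\<cdot>\<lambda>\<^bsub>p\<^esub>) = 1\<close>\<close>
      [act a] \<lhd> ltensor A (SkL M) \<rhd> [as A \<I> X]
        \<Zsemi> [act a, \<one> A \<otimes>\<^sub>1 m] \<lhd> pinv (As\<^sub>n (\<one> A) u (\<one> X)) \<rhd> []
        \<Zsemi> [] \<lhd> Act2 M a \<rhd> [(\<one> A \<otimes>\<^sub>1 u) \<otimes>\<^sub>1 \<one> X]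
        \<Zsemi> [act a] \<lhd> rtensor (Act0 M a) X \<rhd> []
      = [act a] \<lhd> Mu A X \<rhd> [])"

text \<open>
  The canonical cell \<open>lu I \<Rightarrow> ru I\<close>, which is an identity in a Gray monoid.  It is determined by
  \<open>La I I\<close> and \<open>Mu I I\<close>, as \<open>lu I\<close> is an equivalence and \<open>- \<otimes> I\<close> is locally fully faithful.
\<close>

definition unit_comparison :: 'c
  where "unit_comparison = (THE \<kappa>. \<guillemotleft>\<kappa> : lu \<I> \<Rightarrow> ru \<I>\<guillemotright> \<and>
    [lu \<I>] \<lhd> single (\<kappa> \<otimes>\<^sub>2 \<ii> (\<one> \<I>)) \<rhd> []
    = [lu \<I>] \<lhd> La \<I> \<I> \<rhd> []
      \<Zsemi> [] \<lhd> pinv (Lu\<^sub>n (lu \<I>)) \<rhd> [as \<I> \<I> \<I>]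
      \<Zsemi> [lu \<I>] \<lhd> Mu \<I> \<I> \<rhd> [])"

definition right_skew_monoidale :: "('o,'a,'c) skew_monoidale \<Rightarrow> bool"
  where "right_skew_monoidale M \<longleftrightarrow>
    (let X = carrier M; m = mul M; u = unit M in
      \<guillemotleft>u : \<I> \<rightarrow> X\<guillemotright> \<and> is_pcell (SkL M) \<and>
      \<comment> \<open>the arrow \<open>m\<close>, the cells \<open>\<alpha>\<close>, \<open>\<rho>\<close>, and the equations
          \<open>\<alpha>\<^bsub>wx,y,z\<^esub> \<alpha>\<^bsub>w,x,yz\<^esub> = (\<alpha>\<^bsub>w,x,y\<^esub> z) \<alpha>\<^bsub>w,xy,z\<^esub> (w \<alpha>\<^bsub>x,y,z\<^esub>)\<close>,
          \<open>\<rho>\<^bsub>xy\<^esub> \<alpha>\<^bsub>x,y,u\<^esub> = x \<rho>\<^bsub>y\<^esub>\<close>, \<open>(\<rho>\<^bsub>x\<^esub> y) \<alpha>\<^bsub>x,u,y\<^esub> (x \<lambda>\<^bsub>y\<^esub>) = 1\<close>\<close>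
      action_axioms M (regular M) \<and>
      \<comment> \<open>\<open>\<alpha>\<^bsub>u,x,y\<^esub> \<lambda>\<^bsub>xy\<^esub> = \<lambda>\<^bsub>x\<^esub> y\<close>\<close>
      [m] \<lhd> La X X \<rhd> []
        \<Zsemi> [] \<lhd> pinv (Lu\<^sub>n m) \<rhd> [as \<I> X X]
        \<Zsemi> [] \<lhd> SkL M \<rhd> [\<one> \<I> \<otimes>\<^sub>1 m, as \<I> X X]
        \<Zsemi> [m] \<lhd> Inter u m \<rhd> [as \<I> X X]
        \<Zsemi> [m, \<one> X \<otimes>\<^sub>1 m] \<lhd> pinv (As\<^sub>l u X X) \<rhd> []
        \<Zsemi> [] \<lhd> SkA M \<rhd> [(u \<otimes>\<^sub>1 \<one> X) \<otimes>\<^sub>1 \<one> X]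
      = [m] \<lhd> rtensor (SkL M) X \<rhd> [] \<and>
      \<comment> \<open>\<open>\<rho>\<^bsub>u\<^esub> \<lambda>\<^bsub>u\<^esub> = 1\<close>\<close>
      pinv (Lu\<^sub>n u)
        \<Zsemi> [] \<lhd> SkL M \<rhd> [\<one> \<I> \<otimes>\<^sub>1 u]
        \<Zsemi> [m] \<lhd> Inter u u \<rhd> []
        \<Zsemi> [] \<lhd> SkR M \<rhd> [u \<otimes>\<^sub>1 \<one> \<I>]
        \<Zsemi> Ru\<^sub>n u
      = [u] \<lhd> single unit_comparison \<rhd> [])"

definition oplax_right_action :: "('o,'a,'c) skew_monoidale \<Rightarrow> ('o,'a,'c) action \<Rightarrow> bool"
  where "oplax_right_action M a \<longleftrightarrow> right_skew_monoidale M \<and> action_axioms M a"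

definition Op2 :: "('o,'a,'c) skew_monoidale \<Rightarrow> ('o,'a,'c) skew_monoidale \<Rightarrow> ('a,'c) opmonoidal
                    \<Rightarrow> ('a,'c) pcell"
  where "Op2 M N C = ([oarr C, mul M], op2 C, [mul N, oarr C \<otimes>\<^sub>1 oarr C])"

definition Op0 :: "('o,'a,'c) skew_monoidale \<Rightarrow> ('o,'a,'c) skew_monoidale \<Rightarrow> ('a,'c) opmonoidal
                    \<Rightarrow> ('a,'c) pcell"
  where "Op0 M N C = ([oarr C, unit M], op0 C, [unit N])"

text \<open>\<open>C\<^sup>0\<close> with an identity inserted in the target, so that it can be tensored with \<open>swap\<close>.\<close>

definition Op0' :: "('o,'a,'c) skew_monoidale \<Rightarrow> ('o,'a,'c) skew_monoidale \<Rightarrow> ('a,'c) opmonoidal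
                    \<Rightarrow> ('a,'c) pcell"
  where "Op0' M N C = ([oarr C, unit M], \<ominus> (\<rr> (unit N)) \<cdot> op0 C, [unit N, \<one> \<I>])"

definition Coact :: "('a,'c) opmonoidal \<Rightarrow> ('o,'a,'c) action \<Rightarrow> ('o,'a,'c) action
                      \<Rightarrow> 'a \<times> 'c \<Rightarrow> ('a,'c) pcell"
  where "Coact C a b Yy = ([fst Yy, act a], snd Yy, [act b, fst Yy \<otimes>\<^sub>1 oarr C])"

text \<open>
  The two comodule equations.  For \<open>a = m\<close>, \<open>b = n\<close>, \<open>Y = C\<close>, \<open>y = C\<^sup>2\<close> they are the first two
  equations of an opmonoidal arrow.
\<close>

definition comodule_axioms :: "('o,'a,'c) skew_monoidale \<Rightarrow> ('o,'a,'c) skew_monoidale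
    \<Rightarrow> ('a,'c) opmonoidal \<Rightarrow> ('o,'a,'c) action \<Rightarrow> ('o,'a,'c) action \<Rightarrow> 'a \<times> 'c \<Rightarrow> bool"
  where "comodule_axioms M N C a b Yy \<longleftrightarrow>
    (let A = aobj a; A' = aobj b; X = carrier M; X' = carrier N; Y = fst Yy in
      \<guillemotleft>Y : A \<rightarrow> A'\<guillemotright> \<and> is_pcell (Coact C a b Yy) \<and>
      \<comment> \<open>\<open>(y\<^bsub>x,p\<^esub>\<cdot>Cq) y\<^bsub>x\<cdot>p,q\<^esub> Ya\<^sup>2 = b\<^sup>2 (Yx\<cdot>C\<^sup>2) y\<^bsub>x,pq\<^esub>\<close>\<close>
      [Y] \<lhd> Act2 M a \<rhd> []
        \<Zsemi> [] \<lhd> Coact C a b Yy \<rhd> [act a \<otimes>\<^sub>1 \<one> X]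
        \<Zsemi> [act b] \<lhd> Coact C a b Yy \<boxtimes> swap (oarr C) \<rhd> []
      = [] \<lhd> Coact C a b Yy \<rhd> [\<one> A \<otimes>\<^sub>1 mul M, as A X X]
        \<Zsemi> [act b] \<lhd> swap Y \<boxtimes> Op2 M N C \<rhd> [as A X X]
        \<Zsemi> [act b, \<one> A' \<otimes>\<^sub>1 mul N] \<lhd> pinv (As\<^sub>n Y (oarr C) (oarr C)) \<rhd> []
        \<Zsemi> [] \<lhd> Act2 N b \<rhd> [(Y \<otimes>\<^sub>1 oarr C) \<otimes>\<^sub>1 oarr C] \<and>
      \<comment> \<open>\<open>Ya\<^sup>0 = b\<^sup>0 (Yx\<cdot>C\<^sup>0) y\<^bsub>x,u\<^esub>\<close>\<close>
      [Y] \<lhd> Act0 M a \<rhd> []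
      = [] \<lhd> Coact C a b Yy \<rhd> [\<one> A \<otimes>\<^sub>1 unit M]
        \<Zsemi> [act b] \<lhd> swap Y \<boxtimes> Op0' M N C \<rhd> []
        \<Zsemi> [] \<lhd> Act0 N b \<rhd> [Y \<otimes>\<^sub>1 \<one> \<I>]
        \<Zsemi> Ru\<^sub>n Y)"

definition opmonoidal_arrow :: "('o,'a,'c) skew_monoidale \<Rightarrow> ('o,'a,'c) skew_monoidale
    \<Rightarrow> ('a,'c) opmonoidal \<Rightarrow> bool"
  where "opmonoidal_arrow M N C \<longleftrightarrow>
    right_skew_monoidale M \<and> right_skew_monoidale N \<and> is_pcell (Op0 M N C) \<and>
    \<comment> \<open>the arrow \<open>C\<close>, the cell \<open>C\<^sup>2\<close>, and the equations
        \<open>\<alpha> (Cx C\<^sup>2\<^bsub>y,z\<^esub>) C\<^sup>2\<^bsub>x,yz\<^esub> = (C\<^sup>2\<^bsub>x,y\<^esub> Cz) C\<^sup>2\<^bsub>xy,z\<^esub> C\<alpha>\<close>,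
        \<open>\<rho>\<^bsub>Cx\<^esub> (Cx C\<^sup>0) C\<^sup>2\<^bsub>x,u\<^esub> = C\<rho>\<^bsub>x\<^esub>\<close>\<close>
    comodule_axioms M N C (regular M) (regular N) (oarr C, op2 C) \<and>
    \<comment> \<open>\<open>(C\<^sup>0 Cx) C\<^sup>2\<^bsub>u,x\<^esub> C\<lambda>\<^bsub>x\<^esub> = \<lambda>\<^bsub>Cx\<^esub>\<close>\<close>
    [oarr C] \<lhd> SkL M \<rhd> []
      \<Zsemi> [] \<lhd> Op2 M N C \<rhd> [unit M \<otimes>\<^sub>1 \<one> (carrier M)]
      \<Zsemi> [mul N] \<lhd> Op0' M N C \<boxtimes> swap (oarr C) \<rhd> []
    = pinv (Lu\<^sub>n (oarr C))
      \<Zsemi> [] \<lhd> SkL N \<rhd> [\<one> \<I> \<otimes>\<^sub>1 oarr C]"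

definition opmonoidal_cell :: "('o,'a,'c) skew_monoidale \<Rightarrow> ('o,'a,'c) skew_monoidale
    \<Rightarrow> ('a,'c) opmonoidal \<Rightarrow> ('a,'c) opmonoidal \<Rightarrow> 'c \<Rightarrow> bool"
  where "opmonoidal_cell M N C C' \<xi> \<longleftrightarrow> \<guillemotleft>\<xi> : oarr C \<Rightarrow> oarr C'\<guillemotright> \<and>
    op2 C' \<cdot> (\<xi> \<star> \<ii> (mul M)) = (\<ii> (mul N) \<star> (\<xi> \<otimes>\<^sub>2 \<xi>)) \<cdot> op2 C \<and>
    op0 C' \<cdot> (\<xi> \<star> \<ii> (unit M)) = op0 C"

text \<open>Composites and identities in the bicategory of right skew monoidales and opmonoidal arrows.\<close>

definition opmonoidal_comp :: "('o,'a,'c) skew_monoidale \<Rightarrow> ('o,'a,'c) skew_monoidale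
    \<Rightarrow> ('o,'a,'c) skew_monoidale \<Rightarrow> ('a,'c) opmonoidal \<Rightarrow> ('a,'c) opmonoidal \<Rightarrow> ('a,'c) opmonoidal"
  where "opmonoidal_comp M N P D C =
    \<lparr> oarr = oarr D \<odot> oarr C,
      op2 = mid ([] \<lhd> split (oarr D) (oarr C) \<rhd> [mul M]
                  \<Zsemi> [oarr D] \<lhd> Op2 M N C \<rhd> []
                  \<Zsemi> [] \<lhd> Op2 N P D \<rhd> [oarr C \<otimes>\<^sub>1 oarr C]
                  \<Zsemi> [mul P] \<lhd> Phi (oarr D) (oarr D) (oarr C) (oarr C) \<rhd> []),
      op0 = mid ([] \<lhd> split (oarr D) (oarr C) \<rhd> [unit M]
                  \<Zsemi> [oarr D] \<lhd> Op0 M N C \<rhd> []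
                  \<Zsemi> Op0 N P D) \<rparr>"

definition opmonoidal_id :: "('o,'a,'c) skew_monoidale \<Rightarrow> ('a,'c) opmonoidal"
  where "opmonoidal_id M =
    \<lparr> oarr = \<one> (carrier M),
      op2 = (\<ii> (mul M) \<star> TUnit \<M> (carrier M) (carrier M)) \<cdot> \<ominus> (\<rr> (mul M)) \<cdot> \<ll> (mul M),
      op0 = \<ll> (unit M) \<rparr>"

definition opmonoidal_monad :: "('o,'a,'c) skew_monoidale \<Rightarrow> ('a,'c) opmonoidal \<Rightarrow> 'c \<Rightarrow> 'c \<Rightarrow> bool"
  where "opmonoidal_monad M B \<mu> \<eta> \<longleftrightarrow>
    opmonoidal_arrow M M B \<and>
    opmonoidal_cell M M (opmonoidal_comp M M M B B) B \<mu> \<and>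
    opmonoidal_cell M M (opmonoidal_id M) B \<eta> \<and>
    \<mu> \<cdot> (\<mu> \<star> \<ii> (oarr B)) = \<mu> \<cdot> (\<ii> (oarr B) \<star> \<mu>) \<cdot> \<aa> (oarr B) (oarr B) (oarr B) \<and>
    \<mu> \<cdot> (\<eta> \<star> \<ii> (oarr B)) = \<ll> (oarr B) \<and>
    \<mu> \<cdot> (\<ii> (oarr B) \<star> \<eta>) = \<rr> (oarr B)"

definition right_comodule :: "('o,'a,'c) skew_monoidale \<Rightarrow> ('o,'a,'c) skew_monoidale
    \<Rightarrow> ('a,'c) opmonoidal \<Rightarrow> ('o,'a,'c) action \<Rightarrow> ('o,'a,'c) action \<Rightarrow> 'a \<times> 'c \<Rightarrow> bool"
  where "right_comodule M N C a b Yy \<longleftrightarrow>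
    opmonoidal_arrow M N C \<and> oplax_right_action M a \<and> oplax_right_action N b \<and>
    comodule_axioms M N C a b Yy"

definition comodule_morphism :: "('a,'c) opmonoidal \<Rightarrow> ('o,'a,'c) action \<Rightarrow> ('o,'a,'c) action
    \<Rightarrow> 'a \<times> 'c \<Rightarrow> 'a \<times> 'c \<Rightarrow> 'c \<Rightarrow> bool"
  where "comodule_morphism C a b Yy Yy' \<gamma> \<longleftrightarrow> \<guillemotleft>\<gamma> : fst Yy \<Rightarrow> fst Yy'\<guillemotright> \<and>
    snd Yy' \<cdot> (\<gamma> \<star> \<ii> (act a)) = (\<ii> (act b) \<star> (\<gamma> \<otimes>\<^sub>2 \<ii> (oarr C))) \<cdot> snd Yy"

text \<open>A morphism is stored as a cell together with its source and target comodules.\<close>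

definition rComod :: "('o,'a,'c) skew_monoidale \<Rightarrow> ('o,'a,'c) skew_monoidale
    \<Rightarrow> ('a,'c) opmonoidal \<Rightarrow> ('o,'a,'c) action \<Rightarrow> ('o,'a,'c) action
    \<Rightarrow> ('a \<times> 'c, ('a \<times> 'c) \<times> 'c \<times> ('a \<times> 'c)) category_data"
  where "rComod M N C a b =
    \<lparr> cObj = {Yy. right_comodule M N C a b Yy},
      cArr = {(Yy, \<gamma>, Yy'). right_comodule M N C a b Yy \<and> right_comodule M N C a b Yy' \<and>
                comodule_morphism C a b Yy Yy' \<gamma>},
      cDom = (\<lambda>(Yy, \<gamma>, Yy'). Yy),
      cCod = (\<lambda>(Yy, \<gamma>, Yy'). Yy'),
      cId = (\<lambda>Yy. (Yy, \<ii> (fst Yy), Yy)),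
      cComp = (\<lambda>(Yy', \<gamma>', Yy'') (Yy, \<gamma>, _). (Yy, \<gamma>' \<cdot> \<gamma>, Yy'')) \<rparr>"

definition comodule_tensor :: "('a,'c) opmonoidal \<Rightarrow> 'c \<Rightarrow> ('o,'a,'c) action
    \<Rightarrow> 'a \<times> 'c \<Rightarrow> 'a \<times> 'c \<Rightarrow> 'a \<times> 'c"
  where "comodule_tensor B \<mu> a Yy Zz =
    (let Y = fst Yy; Z = fst Zz; b = oarr B in
      (Z \<odot> Y,
       mid ([] \<lhd> split Z Y \<rhd> [act a]
            \<Zsemi> [Z] \<lhd> Coact B a a Yy \<rhd> []
            \<Zsemi> [] \<lhd> Coact B a a Zz \<rhd> [Y \<otimes>\<^sub>1 b]
            \<Zsemi> [act a] \<lhd> Phi Z b Y b \<rhd> []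
            \<Zsemi> [act a] \<lhd> single (\<ii> (Z \<odot> Y) \<otimes>\<^sub>2 \<mu>) \<rhd> [])))"

definition comodule_unit :: "('o,'a,'c) skew_monoidale \<Rightarrow> 'c \<Rightarrow> ('o,'a,'c) action \<Rightarrow> 'a \<times> 'c"
  where "comodule_unit M \<eta> a =
    (let A = aobj a in
      (\<one> A,
       (\<ii> (act a) \<star> ((\<ii> (\<one> A) \<otimes>\<^sub>2 \<eta>) \<cdot> TUnit \<M> A (carrier M)))
         \<cdot> \<ominus> (\<rr> (act a)) \<cdot> \<ll> (act a)))"

end

end

theory Submission
  imports Defs
begin

text \<open>
  Forget for a moment that \<open>\<M>\<close> is weak.  Write \<open>y : Y(x\<cdot>p) \<rightarrow> Yx\<cdot>Bp\<close> and \<open>z\<close> for two coactions; their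
  tensor product is \<open>(ZYx\<cdot>\<mu>\<^bsub>p\<^esub>) z\<^bsub>Yx,Bp\<^esub> (Z y\<^bsub>x,p\<^esub>)\<close>.  In the first comodule equation for it, the first
  \<open>\<mu>\<close> moves past the second \<open>z\<close> and \<open>y\<close>, and then \<open>z\<^bsub>Y(x\<cdot>p),Bq\<^esub>\<close> moves past \<open>Z(y\<^bsub>x,p\<^esub>\<cdot>Bq)\<close>.  Now the
  equation for \<open>Y\<close>, whiskered by \<open>Z\<close>, and the equation for \<open>Z\<close> apply one after the other.  They leave
  the two cells \<open>B(B\<^sup>2)\<close> and \<open>B\<^sup>2\<close>, whose composite is the structure cell of \<open>B\<circ>B\<close>, and that is compatible
  with \<open>\<mu>\<close> because \<open>\<mu>\<close> is an opmonoidal cell.  The second equation is the same with \<open>B\<^sup>0\<close>.  For the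
  unit object, \<open>\<eta>\<close> being an opmonoidal cell reduces both equations to naturality and the
  unit axioms of the constraints.

  A cell between underlying arrows determines a morphism of comodules, so the forgetful functor is
  faithful.  The constraints of \<open>\<M>(A,A)\<close> are morphisms of comodules: for the associator because \<open>\<mu>\<close>
  is associative, for the unitors because \<open>\<eta>\<close> is its unit.  Hence all axioms of a monoidal
  category are inherited from \<open>\<M>(A,A)\<close>, and the forgetful functor preserves the tensor product with
  identity cells as constraints.

  The work lies in making such calculations possible in a weak monoidal bicategory.  By the pentagon,
  rebracketing is strict on path cells: whiskering is functorial and compatible with concatenation of
  paths, and cells on disjoint parts of a path commute (\<open>dwhisker_dcomp\<close>, \<open>dwhisker_dwhisker\<close>,
  \<open>dexchange\<close>).  The tensor product of path cells preserves composition and whiskering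
  (\<open>dten_dcomp\<close>, \<open>dten_whisker\<close>), by the associativity of \<open>TComp\<close>.  Identity arrows can be moved
  along a path naturally (\<open>dswap_path_natural\<close>), by Kelly's coherence lemmas for the unitors.  A composite
  arrow is always split into a path, so that \<open>Phi\<close> becomes a tensor product of two such splittings.
  With these rules the argument above is carried out in \<open>dtens_eq1\<close>, \<open>dtens_eq2\<close>,
  \<open>dcounit_eq1\<close>, \<open>dcounit_eq2\<close> and the lemmas on \<open>dmor\<close>.
\<close>

section \<open>Typing and coherence in a bicategory\<close>

context bicategory
begin

definition invertible :: "'c \<Rightarrow> bool"
  where "invertible \<theta> \<longleftrightarrow> (\<exists>\<phi>. inverse_cells \<M> \<theta> \<phi>)"

lemma cellI: "\<theta> \<in> Cell \<M> \<Longrightarrow> is_cell \<M> \<theta> (Dom \<M> \<theta>) (Cod \<M> \<theta>)"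
  by (simp add: is_cell_def)

lemma obj_simps [simp]:
  "f \<in> Arr \<M> \<Longrightarrow> Src \<M> f \<in> Obj \<M>" "f \<in> Arr \<M> \<Longrightarrow> Trg \<M> f \<in> Obj \<M>"
  by (simp_all add: src_obj trg_obj)

lemma boundary_simps [simp]:
  "\<theta> \<in> Cell \<M> \<Longrightarrow> Dom \<M> \<theta> \<in> Arr \<M>" "\<theta> \<in> Cell \<M> \<Longrightarrow> Cod \<M> \<theta> \<in> Arr \<M>"
  "\<theta> \<in> Cell \<M> \<Longrightarrow> Src \<M> (Cod \<M> \<theta>) = Src \<M> (Dom \<M> \<theta>)"
  "\<theta> \<in> Cell \<M> \<Longrightarrow> Trg \<M> (Cod \<M> \<theta>) = Trg \<M> (Dom \<M> \<theta>)"
  by (simp_all add: dom_arr cod_arr src_dom_cod trg_dom_cod)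

lemma one_simps [simp]:
  assumes "A \<in> Obj \<M>"
  shows "\<one> A \<in> Arr \<M>" "Src \<M> (\<one> A) = A" "Trg \<M> (\<one> A) = A"
  using one_arrow[OF assms] by (simp_all add: is_arrow_def)

lemma comp_simps [simp]:
  assumes "f \<in> Arr \<M>" "g \<in> Arr \<M>" "Src \<M> g = Trg \<M> f"
  shows "g \<odot> f \<in> Arr \<M>" "Src \<M> (g \<odot> f) = Src \<M> f" "Trg \<M> (g \<odot> f) = Trg \<M> g"
  using comp_arrow[of f _ _ g] assms
  by (simp_all add: is_arrow_def)

lemma id_simps [simp]:
  assumes "f \<in> Arr \<M>"
  shows "\<ii> f \<in> Cell \<M>" "Dom \<M> (\<ii> f) = f" "Cod \<M> (\<ii> f) = f"
  using id_cell[OF assms] by (simp_all add: is_cell_def)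

lemma vcomp_simps [simp]:
  assumes "\<theta> \<in> Cell \<M>" "\<phi> \<in> Cell \<M>" "Dom \<M> \<phi> = Cod \<M> \<theta>"
  shows "\<phi> \<cdot> \<theta> \<in> Cell \<M>" "Dom \<M> (\<phi> \<cdot> \<theta>) = Dom \<M> \<theta>" "Cod \<M> (\<phi> \<cdot> \<theta>) = Cod \<M> \<phi>"
  using vcomp_cell[of \<theta> _ _ \<phi>] assms by (simp_all add: is_cell_def)

lemma vcomp_id [simp]:
  assumes "\<theta> \<in> Cell \<M>"
  shows "Cod \<M> \<theta> = f \<Longrightarrow> \<ii> f \<cdot> \<theta> = \<theta>" "Dom \<M> \<theta> = f \<Longrightarrow> \<theta> \<cdot> \<ii> f = \<theta>"
  using vcomp_id_left vcomp_id_right assms by (auto simp: is_cell_def)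

lemma vassoc:
  assumes "\<theta> \<in> Cell \<M>" "\<phi> \<in> Cell \<M>" "\<psi> \<in> Cell \<M>"
    "Dom \<M> \<phi> = Cod \<M> \<theta>" "Dom \<M> \<psi> = Cod \<M> \<phi>"
  shows "(\<psi> \<cdot> \<phi>) \<cdot> \<theta> = \<psi> \<cdot> (\<phi> \<cdot> \<theta>)"
  using vcomp_assoc assms by (simp add: is_cell_def)

lemma hcomp_simps [simp]:
  assumes "\<theta> \<in> Cell \<M>" "\<phi> \<in> Cell \<M>" "Src \<M> (Dom \<M> \<phi>) = Trg \<M> (Dom \<M> \<theta>)"
  shows "\<phi> \<star> \<theta> \<in> Cell \<M>" "Dom \<M> (\<phi> \<star> \<theta>) = Dom \<M> \<phi> \<odot> Dom \<M> \<theta>"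
    "Cod \<M> (\<phi> \<star> \<theta>) = Cod \<M> \<phi> \<odot> Cod \<M> \<theta>"
  using hcomp_cell[OF cellI cellI, of \<theta> \<phi>] assms by (simp_all add: is_cell_def)

lemma hcomp_id' [simp]:
  assumes "f \<in> Arr \<M>" "g \<in> Arr \<M>" "Src \<M> g = Trg \<M> f"
  shows "\<ii> g \<star> \<ii> f = \<ii> (g \<odot> f)"
  using hcomp_id[of f _ _ g] assms by (simp add: is_arrow_def)

lemma hcomp_vcomp:
  assumes "\<theta> \<in> Cell \<M>" "\<theta>' \<in> Cell \<M>" "\<phi> \<in> Cell \<M>" "\<phi>' \<in> Cell \<M>"
    "Dom \<M> \<theta>' = Cod \<M> \<theta>" "Dom \<M> \<phi>' = Cod \<M> \<phi>" "Src \<M> (Dom \<M> \<phi>) = Trg \<M> (Dom \<M> \<theta>)"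
  shows "(\<phi>' \<star> \<theta>') \<cdot> (\<phi> \<star> \<theta>) = (\<phi>' \<cdot> \<phi>) \<star> (\<theta>' \<cdot> \<theta>)"
  using assms interchange[of \<theta> _ _ \<theta>' _ \<phi> _ _ \<phi>'] by (simp add: is_cell_def)

lemma hcomp_vcomp':
  assumes "\<theta> \<in> Cell \<M>" "\<theta>' \<in> Cell \<M>" "\<phi> \<in> Cell \<M>" "\<phi>' \<in> Cell \<M>" "\<chi> \<in> Cell \<M>"
    "Dom \<M> \<theta>' = Cod \<M> \<theta>" "Dom \<M> \<phi>' = Cod \<M> \<phi>" "Src \<M> (Dom \<M> \<phi>) = Trg \<M> (Dom \<M> \<theta>)"
    "Cod \<M> \<chi> = Dom \<M> \<phi> \<odot> Dom \<M> \<theta>"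
  shows "(\<phi>' \<star> \<theta>') \<cdot> (\<phi> \<star> \<theta>) \<cdot> \<chi> = ((\<phi>' \<cdot> \<phi>) \<star> (\<theta>' \<cdot> \<theta>)) \<cdot> \<chi>"
proof -
  have "Src \<M> (Cod \<M> \<phi>) = Trg \<M> (Cod \<M> \<theta>)" using assms by simp
  then have "(\<phi>' \<star> \<theta>') \<cdot> (\<phi> \<star> \<theta>) \<cdot> \<chi> = ((\<phi>' \<star> \<theta>') \<cdot> (\<phi> \<star> \<theta>)) \<cdot> \<chi>"
    using assms by (simp add: vassoc del: boundary_simps(3,4))
  with assms show ?thesis by (simp add: hcomp_vcomp)
qed


lemma inverse_cells_unique:
  assumes "inverse_cells \<M> \<theta> \<phi>" "inverse_cells \<M> \<theta> \<psi>"
  shows "\<phi> = \<psi>"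
proof -
  have "\<phi> = \<phi> \<cdot> (\<theta> \<cdot> \<psi>)" using assms by (simp add: inverse_cells_def is_cell_def)
  also have "\<dots> = (\<phi> \<cdot> \<theta>) \<cdot> \<psi>"
    using assms by (intro vassoc[symmetric]) (simp_all add: inverse_cells_def is_cell_def)
  also have "\<dots> = \<psi>" using assms by (simp add: inverse_cells_def is_cell_def)
  finally show ?thesis .
qed

lemma cell_inv_eq: "inverse_cells \<M> \<theta> \<phi> \<Longrightarrow> \<ominus> \<theta> = \<phi>"
  unfolding cell_inv_def using inverse_cells_unique by blast

lemma inverse_cells_inv: "invertible \<theta> \<Longrightarrow> inverse_cells \<M> \<theta> (\<ominus> \<theta>)"
  unfolding invertible_def using cell_inv_eq by metis

lemma invertible_cell: "invertible \<theta> \<Longrightarrow> \<theta> \<in> Cell \<M>"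
  by (auto simp: invertible_def inverse_cells_def)

lemma inv_simps [simp]:
  assumes "invertible \<theta>"
  shows "\<ominus> \<theta> \<in> Cell \<M>" "Dom \<M> (\<ominus> \<theta>) = Cod \<M> \<theta>" "Cod \<M> (\<ominus> \<theta>) = Dom \<M> \<theta>"
    "\<ominus> \<theta> \<cdot> \<theta> = \<ii> (Dom \<M> \<theta>)" "\<theta> \<cdot> \<ominus> \<theta> = \<ii> (Cod \<M> \<theta>)"
  using inverse_cells_inv[OF assms] by (simp_all add: inverse_cells_def is_cell_def)

lemma inv_cancel [simp]:
  assumes "invertible \<theta>" "\<phi> \<in> Cell \<M>"
  shows "Cod \<M> \<phi> = Dom \<M> \<theta> \<Longrightarrow> \<ominus> \<theta> \<cdot> \<theta> \<cdot> \<phi> = \<phi>"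
    "Cod \<M> \<phi> = Cod \<M> \<theta> \<Longrightarrow> \<theta> \<cdot> \<ominus> \<theta> \<cdot> \<phi> = \<phi>"
  using assms invertible_cell[OF assms(1)] by (simp_all add: vassoc[symmetric])

lemma invertibleI:
  assumes "\<theta> \<in> Cell \<M>" "\<phi> \<in> Cell \<M>" "Dom \<M> \<phi> = Cod \<M> \<theta>" "Cod \<M> \<phi> = Dom \<M> \<theta>"
    "\<phi> \<cdot> \<theta> = \<ii> (Dom \<M> \<theta>)" "\<theta> \<cdot> \<phi> = \<ii> (Cod \<M> \<theta>)"
  shows "invertible \<theta>" "\<ominus> \<theta> = \<phi>"
proof -
  have "inverse_cells \<M> \<theta> \<phi>" using assms by (simp add: inverse_cells_def is_cell_def)
  then show "invertible \<theta>" "\<ominus> \<theta> = \<phi>" using cell_inv_eq by (auto simp: invertible_def)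
qed

lemma invertible_inv [simp]:
  assumes "invertible \<theta>" shows "invertible (\<ominus> \<theta>)" "\<ominus> (\<ominus> \<theta>) = \<theta>"
  using assms invertible_cell[OF assms(1)] by (auto intro: invertibleI[of "\<ominus> \<theta>" \<theta>])

lemma invertible_id [simp]:
  assumes "f \<in> Arr \<M>" shows "invertible (\<ii> f)" "\<ominus> (\<ii> f) = \<ii> f"
  using assms by (auto intro: invertibleI[of "\<ii> f" "\<ii> f"])

lemma invertible_vcomp [simp]:
  assumes "invertible \<theta>" "invertible \<phi>" "Dom \<M> \<phi> = Cod \<M> \<theta>"
  shows "invertible (\<phi> \<cdot> \<theta>)" "\<ominus> (\<phi> \<cdot> \<theta>) = \<ominus> \<theta> \<cdot> \<ominus> \<phi>"
  using assms invertible_cell[OF assms(1)] invertible_cell[OF assms(2)]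
  by (auto intro!: invertibleI[of "\<phi> \<cdot> \<theta>" "\<ominus> \<theta> \<cdot> \<ominus> \<phi>"] simp: vassoc)

lemma invertible_hcomp [simp]:
  assumes "invertible \<theta>" "invertible \<phi>" "Src \<M> (Dom \<M> \<phi>) = Trg \<M> (Dom \<M> \<theta>)"
  shows "invertible (\<phi> \<star> \<theta>)" "\<ominus> (\<phi> \<star> \<theta>) = \<ominus> \<phi> \<star> \<ominus> \<theta>"
  using assms invertible_cell[OF assms(1)] invertible_cell[OF assms(2)]
  by (auto intro!: invertibleI[of "\<phi> \<star> \<theta>" "\<ominus> \<phi> \<star> \<ominus> \<theta>"] simp: hcomp_vcomp)

lemma is_iso_cell_iff: "is_iso_cell \<M> \<theta> f g \<longleftrightarrow> invertible \<theta> \<and> Dom \<M> \<theta> = f \<and> Cod \<M> \<theta> = g"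
  by (auto simp: is_iso_cell_def invertible_def is_cell_def inverse_cells_def)

lemma assoc_simps [simp]:
  assumes "f \<in> Arr \<M>" "g \<in> Arr \<M>" "h \<in> Arr \<M>" "Src \<M> g = Trg \<M> f" "Src \<M> h = Trg \<M> g"
  shows "invertible (\<aa> h g f)" "Dom \<M> (\<aa> h g f) = (h \<odot> g) \<odot> f"
    "Cod \<M> (\<aa> h g f) = h \<odot> (g \<odot> f)"
  using assoc_iso[of f _ _ g _ h] assms by (simp_all add: is_iso_cell_iff is_arrow_def)

lemma unitor_simps [simp]:
  assumes "f \<in> Arr \<M>"
  shows "invertible (\<ll> f)" "Dom \<M> (\<ll> f) = \<one> (Trg \<M> f) \<odot> f" "Cod \<M> (\<ll> f) = f"
    "invertible (\<rr> f)" "Dom \<M> (\<rr> f) = f \<odot> \<one> (Src \<M> f)" "Cod \<M> (\<rr> f) = f"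
  using lun_iso run_iso assms by (simp_all add: is_iso_cell_iff is_arrow_def)

lemma assoc_cell [simp]:
  assumes "f \<in> Arr \<M>" "g \<in> Arr \<M>" "h \<in> Arr \<M>" "Src \<M> g = Trg \<M> f" "Src \<M> h = Trg \<M> g"
  shows "\<aa> h g f \<in> Cell \<M>"
  using assms by (simp add: invertible_cell)

lemma unitor_cell [simp]:
  assumes "f \<in> Arr \<M>" shows "\<ll> f \<in> Cell \<M>" "\<rr> f \<in> Cell \<M>"
  using assms by (simp_all add: invertible_cell)

lemma assoc_natural:
  assumes "\<theta> \<in> Cell \<M>" "\<phi> \<in> Cell \<M>" "\<psi> \<in> Cell \<M>"
    "Src \<M> (Dom \<M> \<phi>) = Trg \<M> (Dom \<M> \<theta>)" "Src \<M> (Dom \<M> \<psi>) = Trg \<M> (Dom \<M> \<phi>)"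
    "Dom \<M> \<theta> = f" "Dom \<M> \<phi> = g" "Dom \<M> \<psi> = h"
    "Cod \<M> \<theta> = f'" "Cod \<M> \<phi> = g'" "Cod \<M> \<psi> = h'"
  shows "\<aa> h' g' f' \<cdot> ((\<psi> \<star> \<phi>) \<star> \<theta>) = (\<psi> \<star> (\<phi> \<star> \<theta>)) \<cdot> \<aa> h g f"
  using assoc_nat[of \<theta> f f' \<phi> g g' \<psi> h h'] assms by (auto simp: is_cell_def)

lemma assoc_pentagon:
  assumes "f \<in> Arr \<M>" "g \<in> Arr \<M>" "h \<in> Arr \<M>" "k \<in> Arr \<M>"
    "Src \<M> g = Trg \<M> f" "Src \<M> h = Trg \<M> g" "Src \<M> k = Trg \<M> h"
  shows "\<aa> k h (g \<odot> f) \<cdot> \<aa> (k \<odot> h) g f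
         = (\<ii> k \<star> \<aa> h g f) \<cdot> \<aa> k (h \<odot> g) f \<cdot> (\<aa> k h g \<star> \<ii> f)"
  using pentagon[of f _ _ g _ h _ k] assms by (simp add: is_arrow_def)

lemma assoc_triangle:
  assumes "f \<in> Arr \<M>" "g \<in> Arr \<M>" "Src \<M> g = Trg \<M> f"
  shows "(\<ii> g \<star> \<ll> f) \<cdot> \<aa> g (\<one> (Trg \<M> f)) f = \<rr> g \<star> \<ii> f"
  using triangle[of f _ _ g] assms by (simp add: is_arrow_def)

lemma vcomp_cancel_left:
  assumes "invertible \<theta>" "\<phi> \<in> Cell \<M>" "\<psi> \<in> Cell \<M>" "Cod \<M> \<phi> = Dom \<M> \<theta>" "Cod \<M> \<psi> = Dom \<M> \<theta>"
    "\<theta> \<cdot> \<phi> = \<theta> \<cdot> \<psi>"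
  shows "\<phi> = \<psi>"
  using assms invertible_cell inv_cancel(1) by metis

lemma vcomp_cancel_right:
  assumes "invertible \<theta>" "\<phi> \<in> Cell \<M>" "\<psi> \<in> Cell \<M>" "Dom \<M> \<phi> = Cod \<M> \<theta>" "Dom \<M> \<psi> = Cod \<M> \<theta>"
    "\<phi> \<cdot> \<theta> = \<psi> \<cdot> \<theta>"
  shows "\<phi> = \<psi>"
proof -
  note [simp] = invertible_cell[OF assms(1)]
  have "\<phi> = (\<phi> \<cdot> \<theta>) \<cdot> \<ominus> \<theta>" using assms(1-5) by (simp add: vassoc)
  also have "\<dots> = \<psi>" unfolding assms(6) using assms(1-5) by (simp add: vassoc)
  finally show ?thesis .
qed

text \<open>Whiskering by an identity arrow is faithful, because the unitors are natural and invertible.\<close>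

lemma hcomp_one_cancel_left:
  assumes "\<phi> \<in> Cell \<M>" "\<psi> \<in> Cell \<M>" "Dom \<M> \<phi> = Dom \<M> \<psi>" "Cod \<M> \<phi> = Cod \<M> \<psi>"
    "Trg \<M> (Dom \<M> \<phi>) = A" "\<ii> (\<one> A) \<star> \<phi> = \<ii> (\<one> A) \<star> \<psi>"
  shows "\<phi> = \<psi>"
proof -
  have "\<phi> \<cdot> \<ll> (Dom \<M> \<phi>) = \<psi> \<cdot> \<ll> (Dom \<M> \<phi>)"
    using lun_nat[OF cellI, of \<phi>] lun_nat[OF cellI, of \<psi>] assms by metis
  then show ?thesis
    by (rule vcomp_cancel_right[rotated -1]) (use assms(1-4) in simp_all)
qed

lemma hcomp_one_cancel_right:
  assumes "\<phi> \<in> Cell \<M>" "\<psi> \<in> Cell \<M>" "Dom \<M> \<phi> = Dom \<M> \<psi>" "Cod \<M> \<phi> = Cod \<M> \<psi>"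
    "Src \<M> (Dom \<M> \<phi>) = A" "\<phi> \<star> \<ii> (\<one> A) = \<psi> \<star> \<ii> (\<one> A)"
  shows "\<phi> = \<psi>"
proof -
  have "\<phi> \<cdot> \<rr> (Dom \<M> \<phi>) = \<psi> \<cdot> \<rr> (Dom \<M> \<phi>)"
    using run_nat[OF cellI, of \<phi>] run_nat[OF cellI, of \<psi>] assms by metis
  then show ?thesis
    by (rule vcomp_cancel_right[rotated -1]) (use assms(1-4) in simp_all)
qed

text \<open>Kelly's consequences of the pentagon and the triangle.\<close>

lemma unitor_left_comp:
  assumes f: "f \<in> Arr \<M>" and g: "g \<in> Arr \<M>" and fg: "Src \<M> g = Trg \<M> f"
  shows "\<ll> (g \<odot> f) \<cdot> \<aa> (\<one> (Trg \<M> g)) g f = \<ll> g \<star> \<ii> f"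
proof -
  let ?B = "Trg \<M> g" and ?u = "\<one> (Trg \<M> g)"
  let ?a = "\<aa> ?u (?u \<odot> g) f \<cdot> (\<aa> ?u ?u g \<star> \<ii> f)"
  note [simp] = f g fg
  have a: "invertible ?a" by simp
  \<comment> \<open>Both sides whiskered by the identity arrow agree after composition with \<open>?a\<close>.\<close>
  have "(\<ii> ?u \<star> (\<ll> (g \<odot> f) \<cdot> \<aa> ?u g f)) \<cdot> ?a
        = (\<ii> ?u \<star> \<ll> (g \<odot> f)) \<cdot> (\<ii> ?u \<star> \<aa> ?u g f) \<cdot> ?a"
    by (simp add: hcomp_vcomp')
  also have "\<dots> = (\<ii> ?u \<star> \<ll> (g \<odot> f)) \<cdot> \<aa> ?u ?u (g \<odot> f) \<cdot> \<aa> (?u \<odot> ?u) g f"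
    by (simp add: assoc_pentagon)
  also have "\<dots> = ((\<ii> ?u \<star> \<ll> (g \<odot> f)) \<cdot> \<aa> ?u ?u (g \<odot> f)) \<cdot> \<aa> (?u \<odot> ?u) g f"
    by (simp add: vassoc)
  also have "\<dots> = (\<rr> ?u \<star> \<ii> (g \<odot> f)) \<cdot> \<aa> (?u \<odot> ?u) g f"
    using assoc_triangle[of "g \<odot> f" ?u] by simp
  also have "\<dots> = \<aa> ?u g f \<cdot> ((\<rr> ?u \<star> \<ii> g) \<star> \<ii> f)"
    using assoc_natural[of "\<ii> f" "\<ii> g" "\<rr> ?u", OF _ _ _ _ _ refl refl refl refl refl refl] by simp
  also have "\<dots> = \<aa> ?u g f \<cdot> (((\<ii> ?u \<star> \<ll> g) \<cdot> \<aa> ?u ?u g) \<star> \<ii> f)"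
    using assoc_triangle[of g ?u] by simp
  also have "\<dots> = \<aa> ?u g f \<cdot> ((\<ii> ?u \<star> \<ll> g) \<star> \<ii> f) \<cdot> (\<aa> ?u ?u g \<star> \<ii> f)"
    by (simp add: hcomp_vcomp)
  also have "\<dots> = (\<aa> ?u g f \<cdot> ((\<ii> ?u \<star> \<ll> g) \<star> \<ii> f)) \<cdot> (\<aa> ?u ?u g \<star> \<ii> f)"
    by (simp add: vassoc)
  also have "\<dots> = (\<ii> ?u \<star> (\<ll> g \<star> \<ii> f)) \<cdot> ?a"
    using assoc_natural[of "\<ii> f" "\<ll> g" "\<ii> ?u", OF _ _ _ _ _ refl refl refl refl refl refl]
    by (simp add: vassoc)
  finally have "\<ii> ?u \<star> (\<ll> (g \<odot> f) \<cdot> \<aa> ?u g f) = \<ii> ?u \<star> (\<ll> g \<star> \<ii> f)"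
    by (rule vcomp_cancel_right[OF a, rotated -1]) simp_all
  then show ?thesis by (rule hcomp_one_cancel_left[rotated -1]) simp_all
qed

lemma unitor_right_comp:
  assumes f: "f \<in> Arr \<M>" and g: "g \<in> Arr \<M>" and fg: "Src \<M> g = Trg \<M> f"
  shows "(\<ii> g \<star> \<rr> f) \<cdot> \<aa> g f (\<one> (Src \<M> f)) = \<rr> (g \<odot> f)"
proof -
  let ?u = "\<one> (Src \<M> f)"
  note [simp] = f g fg
  have "\<aa> g f ?u \<cdot> (((\<ii> g \<star> \<rr> f) \<cdot> \<aa> g f ?u) \<star> \<ii> ?u)
        = \<aa> g f ?u \<cdot> ((\<ii> g \<star> \<rr> f) \<star> \<ii> ?u) \<cdot> (\<aa> g f ?u \<star> \<ii> ?u)"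
    by (simp add: hcomp_vcomp)
  also have "\<dots> = (\<aa> g f ?u \<cdot> ((\<ii> g \<star> \<rr> f) \<star> \<ii> ?u)) \<cdot> (\<aa> g f ?u \<star> \<ii> ?u)"
    by (simp add: vassoc)
  also have "\<dots> = (\<ii> g \<star> (\<rr> f \<star> \<ii> ?u)) \<cdot> \<aa> g (f \<odot> ?u) ?u \<cdot> (\<aa> g f ?u \<star> \<ii> ?u)"
    using assoc_natural[of "\<ii> ?u" "\<rr> f" "\<ii> g", OF _ _ _ _ _ refl refl refl refl refl refl]
    by (simp add: vassoc)
  also have "\<dots> = (\<ii> g \<star> ((\<ii> f \<star> \<ll> ?u) \<cdot> \<aa> f ?u ?u)) \<cdot> \<aa> g (f \<odot> ?u) ?u \<cdot> (\<aa> g f ?u \<star> \<ii> ?u)"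
    using assoc_triangle[of ?u f] by simp
  also have "\<dots> = (\<ii> g \<star> (\<ii> f \<star> \<ll> ?u)) \<cdot> (\<ii> g \<star> \<aa> f ?u ?u) \<cdot> \<aa> g (f \<odot> ?u) ?u \<cdot> (\<aa> g f ?u \<star> \<ii> ?u)"
    by (simp add: hcomp_vcomp')
  also have "\<dots> = (\<ii> g \<star> (\<ii> f \<star> \<ll> ?u)) \<cdot> \<aa> g f (?u \<odot> ?u) \<cdot> \<aa> (g \<odot> f) ?u ?u"
    by (simp add: assoc_pentagon)
  also have "\<dots> = ((\<ii> g \<star> (\<ii> f \<star> \<ll> ?u)) \<cdot> \<aa> g f (?u \<odot> ?u)) \<cdot> \<aa> (g \<odot> f) ?u ?u"
    by (simp add: vassoc)
  also have "\<dots> = \<aa> g f ?u \<cdot> (\<ii> (g \<odot> f) \<star> \<ll> ?u) \<cdot> \<aa> (g \<odot> f) ?u ?u"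
    using assoc_natural[of "\<ll> ?u" "\<ii> f" "\<ii> g", OF _ _ _ _ _ refl refl refl refl refl refl]
    by (simp add: vassoc[symmetric])
  also have "\<dots> = \<aa> g f ?u \<cdot> (\<rr> (g \<odot> f) \<star> \<ii> ?u)"
    using assoc_triangle[of ?u "g \<odot> f"] by simp
  finally have "((\<ii> g \<star> \<rr> f) \<cdot> \<aa> g f ?u) \<star> \<ii> ?u = \<rr> (g \<odot> f) \<star> \<ii> ?u"
    apply (rule vcomp_cancel_left[of "\<aa> g f ?u", rotated -1])
    subgoal by simp
    subgoal by simp
    subgoal by simp
    subgoal by simp
    subgoal by simp
    done
  then show ?thesis by (rule hcomp_one_cancel_right[rotated -1]) simp_all
qed

lemma unitors_one: 
  assumes A: "A \<in> Obj \<M>" shows "\<ll> (\<one> A) = \<rr> (\<one> A)"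
proof -
  note [simp] = A
  let ?u = "\<one> A"
  have n: "\<ll> (?u \<odot> ?u) = \<ii> ?u \<star> \<ll> ?u"
  proof -
    have "\<ll> ?u \<cdot> (\<ii> ?u \<star> \<ll> ?u) = \<ll> ?u \<cdot> \<ll> (?u \<odot> ?u)" using lun_nat[OF cellI, of "\<ll> ?u"] by simp
    then show ?thesis using vcomp_cancel_left[of "\<ll> ?u"] by simp
  qed
  have "\<ll> ?u \<star> \<ii> ?u = \<rr> ?u \<star> \<ii> ?u"
    using unitor_left_comp[of ?u ?u] assoc_triangle[of ?u ?u] n by simp
  then show ?thesis by (rule hcomp_one_cancel_right[rotated -1]) simp_all
qed

end

section \<open>Pasting is strict\<close>

context bicategory
begin

fun ok_path :: "'a list \<Rightarrow> bool"
  where "ok_path [] = False"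
  | "ok_path [f] = (f \<in> Arr \<M>)"
  | "ok_path (f # g # p) = (f \<in> Arr \<M> \<and> Src \<M> f = Trg \<M> g \<and> ok_path (g # p))"

lemma ok_path_ne: "ok_path p \<Longrightarrow> p \<noteq> []" by auto

lemma ok_path_Cons: "p \<noteq> [] \<Longrightarrow> ok_path (f # p) \<longleftrightarrow> f \<in> Arr \<M> \<and> Src \<M> f = Trg \<M> (hd p) \<and> ok_path p"
  by (cases p) auto

lemma path_Cons: "p \<noteq> [] \<Longrightarrow> path (f # p) = f \<odot> path p"
  by (cases p) auto

lemma path_simps [simp]:
  assumes "ok_path p"
  shows "path p \<in> Arr \<M>" "Src \<M> (path p) = Src \<M> (last p)" "Trg \<M> (path p) = Trg \<M> (hd p)"
  using assms by (induction p rule: ok_path.induct) auto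

lemma ok_path_append:
  "p \<noteq> [] \<Longrightarrow> q \<noteq> [] \<Longrightarrow>
   ok_path (p @ q) \<longleftrightarrow> ok_path p \<and> ok_path q \<and> Src \<M> (last p) = Trg \<M> (hd q)"
  by (induction p rule: ok_path.induct) (auto simp: ok_path_Cons)

lemma join_Cons: "p \<noteq> [] \<Longrightarrow> join (f # p) r = (\<ii> f \<star> join p r) \<cdot> \<aa> f (path p) (path r)"
  by (cases p) auto

lemma join_simps:
  assumes "ok_path p" "ok_path r" "Src \<M> (last p) = Trg \<M> (hd r)"
  shows "invertible (join p r) \<and> Dom \<M> (join p r) = path p \<odot> path r \<and> Cod \<M> (join p r) = path (p @ r)"
  using assms
proof (induction p rule: ok_path.induct)
  case (2 f)
  then have "r \<noteq> []" by auto
  then show ?case using 2 by (simp add: path_Cons)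
next
  case (3 f g p)
  have ne: "(g # p) @ r \<noteq> []" by simp
  have j: "invertible (join (g # p) r)" "Dom \<M> (join (g # p) r) = path (g # p) \<odot> path r"
    "Cod \<M> (join (g # p) r) = path ((g # p) @ r)"
    using 3 by simp_all
  note [simp] = invertible_cell[OF j(1)]
  show ?case using 3(2-) j path_simps[of "g # p"] path_simps[of r] path_Cons[OF ne, of f]
    by (simp del: path.simps path_simps add: join_Cons path_Cons[of "g # p" f])
qed simp

lemma join_simps' [simp]:
  assumes "ok_path p" "ok_path r" "Src \<M> (last p) = Trg \<M> (hd r)"
  shows "invertible (join p r)" "join p r \<in> Cell \<M>"
    "Dom \<M> (join p r) = path p \<odot> path r" "Cod \<M> (join p r) = path (p @ r)"
  using join_simps[OF assms] invertible_cell by auto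

text \<open>
  Both sides rebracket three consecutive paths.  Each step of the induction on the first path
  uses the pentagon; everything that makes pasting strict rests on this equation.
\<close>

lemma join_assoc:
  assumes "ok_path p" "ok_path q" "ok_path r"
    "Src \<M> (last p) = Trg \<M> (hd q)" "Src \<M> (last q) = Trg \<M> (hd r)"
  shows "join (p @ q) r \<cdot> (join p q \<star> \<ii> (path r))
         = join p (q @ r) \<cdot> (\<ii> (path p) \<star> join q r) \<cdot> \<aa> (path p) (path q) (path r)"
  using assms
proof (induction p rule: ok_path.induct)
  case (2 f)
  then have "q \<noteq> []" by auto
  with 2 show ?case by (simp add: join_Cons path_Cons ok_path_append)
next
  case (3 f g p)
  let ?p = "g # p"
  have qr: "ok_path (q @ r)" "ok_path (?p @ q)" "ok_path (?p @ q @ r)" "q \<noteq> []" "r \<noteq> []"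
    using 3 ok_path_ne[of q] ok_path_ne[of r]
    by (auto simp: ok_path_append simp flip: append_Cons append_assoc)
  define P Q R where "P = path ?p" and "Q = path q" and "R = path r"
  define pq qr' where "pq = join ?p q" and "qr' = join q r"
  define p_qr pq_r where "p_qr = join ?p (q @ r)" and "pq_r = join (?p @ q) r"
  define PQ where "PQ = path (?p @ q)"
  define QR where "QR = path (q @ r)"
  define PQR where "PQR = path (?p @ q @ r)"
  have arr [simp]: "f \<in> Arr \<M>" "P \<in> Arr \<M>" "Q \<in> Arr \<M>" "R \<in> Arr \<M>"
      "Src \<M> f = Trg \<M> P" "Src \<M> P = Trg \<M> Q" "Src \<M> Q = Trg \<M> R"
      "PQ \<in> Arr \<M>" "Src \<M> PQ = Trg \<M> R" "Trg \<M> PQ = Trg \<M> P"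
      "QR \<in> Arr \<M>" "Src \<M> QR = Src \<M> R" "Trg \<M> QR = Trg \<M> Q"
    unfolding P_def Q_def R_def PQ_def QR_def using 3(2-) qr by (simp_all del: path.simps)
  have cells [simp]: "pq \<in> Cell \<M>" "Dom \<M> pq = P \<odot> Q" "Cod \<M> pq = PQ"
      "qr' \<in> Cell \<M>" "Dom \<M> qr' = Q \<odot> R" "Cod \<M> qr' = QR"
      "p_qr \<in> Cell \<M>" "Dom \<M> p_qr = P \<odot> QR" "Cod \<M> p_qr = PQR"
      "pq_r \<in> Cell \<M>" "Dom \<M> pq_r = PQ \<odot> R" "Cod \<M> pq_r = PQR"
    unfolding P_def Q_def R_def PQ_def QR_def PQR_def pq_def qr'_def p_qr_def pq_r_def
    using 3(2-) qr by (simp_all del: path.simps append_Cons join.simps)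
  have IH: "pq_r \<cdot> (pq \<star> \<ii> R) = p_qr \<cdot> (\<ii> P \<star> qr') \<cdot> \<aa> P Q R"
    unfolding P_def Q_def R_def pq_def qr'_def p_qr_def pq_r_def using 3 by simp
  have "join ((f # ?p) @ q) r \<cdot> (join (f # ?p) q \<star> \<ii> R)
    = ((\<ii> f \<star> pq_r) \<cdot> \<aa> f PQ R) \<cdot> (((\<ii> f \<star> pq) \<cdot> \<aa> f P Q) \<star> \<ii> R)"
    using join_Cons[of "?p @ q" f r] join_Cons[of ?p f q]
    by (simp add: P_def Q_def R_def pq_def pq_r_def PQ_def del: join.simps)
  also have "\<dots> = (\<ii> f \<star> pq_r) \<cdot> (\<aa> f PQ R \<cdot> ((\<ii> f \<star> pq) \<star> \<ii> R)) \<cdot> (\<aa> f P Q \<star> \<ii> R)"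
    using hcomp_vcomp[of "\<ii> R" "\<ii> R" "\<aa> f P Q" "\<ii> f \<star> pq"] by (simp add: vassoc)
  also have "\<aa> f PQ R \<cdot> ((\<ii> f \<star> pq) \<star> \<ii> R) = (\<ii> f \<star> (pq \<star> \<ii> R)) \<cdot> \<aa> f (P \<odot> Q) R"
    by (rule assoc_natural) simp_all
  also have "(\<ii> f \<star> pq_r) \<cdot> ((\<ii> f \<star> (pq \<star> \<ii> R)) \<cdot> \<aa> f (P \<odot> Q) R) \<cdot> (\<aa> f P Q \<star> \<ii> R)
    = (\<ii> f \<star> (pq_r \<cdot> (pq \<star> \<ii> R))) \<cdot> \<aa> f (P \<odot> Q) R \<cdot> (\<aa> f P Q \<star> \<ii> R)"
    by (simp add: vassoc hcomp_vcomp')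
  also have "\<dots> = (\<ii> f \<star> p_qr) \<cdot> (\<ii> f \<star> (\<ii> P \<star> qr')) \<cdot> (\<ii> f \<star> \<aa> P Q R) \<cdot> \<aa> f (P \<odot> Q) R \<cdot> (\<aa> f P Q \<star> \<ii> R)"
    unfolding IH by (simp add: hcomp_vcomp')
  also have "\<dots> = (\<ii> f \<star> p_qr) \<cdot> ((\<ii> f \<star> (\<ii> P \<star> qr')) \<cdot> \<aa> f P (Q \<odot> R)) \<cdot> \<aa> (f \<odot> P) Q R"
    by (simp add: assoc_pentagon[symmetric] vassoc)
  also have "(\<ii> f \<star> (\<ii> P \<star> qr')) \<cdot> \<aa> f P (Q \<odot> R) = \<aa> f P QR \<cdot> ((\<ii> f \<star> \<ii> P) \<star> qr')"
    by (rule assoc_natural[symmetric]) simp_all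
  also have "(\<ii> f \<star> p_qr) \<cdot> (\<aa> f P QR \<cdot> ((\<ii> f \<star> \<ii> P) \<star> qr')) \<cdot> \<aa> (f \<odot> P) Q R
    = ((\<ii> f \<star> p_qr) \<cdot> \<aa> f P QR) \<cdot> (\<ii> (f \<odot> P) \<star> qr') \<cdot> \<aa> (f \<odot> P) Q R"
    by (simp add: vassoc)
  also have "\<dots> = join (f # ?p) (q @ r) \<cdot> (\<ii> (f \<odot> P) \<star> qr') \<cdot> \<aa> (f \<odot> P) Q R"
    using join_Cons[of ?p f "q @ r"] by (simp add: P_def QR_def p_qr_def del: join.simps)
  finally show ?case by (simp add: P_def Q_def R_def qr'_def path_Cons del: join.simps)
qed simp


definition wt_cell :: "'a list \<Rightarrow> 'c \<Rightarrow> 'a list \<Rightarrow> bool"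
  where "wt_cell p \<theta> q \<longleftrightarrow> ok_path p \<and> ok_path q \<and> \<theta> \<in> Cell \<M> \<and> Dom \<M> \<theta> = path p \<and> Cod \<M> \<theta> = path q"

lemma wt_cell_simps:
  assumes "wt_cell p \<theta> q"
  shows "ok_path p" "ok_path q" "\<theta> \<in> Cell \<M>" "Dom \<M> \<theta> = path p" "Cod \<M> \<theta> = path q"
    "Src \<M> (last q) = Src \<M> (last p)" "Trg \<M> (hd q) = Trg \<M> (hd p)" "p \<noteq> []" "q \<noteq> []"
proof -
  show *: "ok_path p" "ok_path q" "\<theta> \<in> Cell \<M>" "Dom \<M> \<theta> = path p" "Cod \<M> \<theta> = path q"
    using assms by (simp_all add: wt_cell_def)
  then show "p \<noteq> []" "q \<noteq> []" by auto
  show "Src \<M> (last q) = Src \<M> (last p)" "Trg \<M> (hd q) = Trg \<M> (hd p)"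
    using * boundary_simps(3,4)[of \<theta>] by simp_all
qed

lemma wt_cell_id: "ok_path p \<Longrightarrow> wt_cell p (\<ii> (path p)) p"
  by (simp add: wt_cell_def)

lemma wt_cell_vcomp: "wt_cell p \<theta> q \<Longrightarrow> wt_cell q \<phi> r \<Longrightarrow> wt_cell p (\<phi> \<cdot> \<theta>) r"
  by (simp add: wt_cell_def)

lemma wt_cell_inv: "wt_cell p \<theta> q \<Longrightarrow> invertible \<theta> \<Longrightarrow> wt_cell q (\<ominus> \<theta>) p"
  by (simp add: wt_cell_def)

lemma whisker_right_eq:
  "whisker_right (p, \<theta>, q) r
   = (if r = [] then \<theta> else join q r \<cdot> (\<theta> \<star> \<ii> (path r)) \<cdot> \<ominus> (join p r))"
  by (cases r) auto

lemma ok_path_append_iff: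
  "ok_path (p @ q) \<longleftrightarrow> (if p = [] then ok_path q else if q = [] then ok_path p else
     ok_path p \<and> ok_path q \<and> Src \<M> (last p) = Trg \<M> (hd q))"
  by (simp add: ok_path_append)

lemma wt_cell_whisker_right:
  assumes P: "wt_cell p \<theta> q" and r: "ok_path (p @ r)"
  shows "wt_cell (p @ r) (whisker_right (p, \<theta>, q) r) (q @ r)"
proof (cases "r = []")
  case False
  note [simp] = wt_cell_simps[OF P] False
  have [simp]: "ok_path r" "Src \<M> (last p) = Trg \<M> (hd r)"
    using r by (simp_all add: ok_path_append)
  show ?thesis unfolding wt_cell_def by (simp add: whisker_right_eq ok_path_append)
qed (use P in \<open>simp add: whisker_right_eq\<close>)

lemma whisker_right_join:
  assumes P: "wt_cell p \<theta> q" and r: "ok_path r" "Src \<M> (last p) = Trg \<M> (hd r)"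
  shows "whisker_right (p, \<theta>, q) r \<cdot> join p r = join q r \<cdot> (\<theta> \<star> \<ii> (path r))"
proof -
  have [simp]: "r \<noteq> []" using r by auto
  note [simp] = wt_cell_simps[OF P] r
  show ?thesis by (simp add: whisker_right_eq vassoc)
qed

text \<open>
  Since \<open>join\<close> is invertible, a whiskered cell can be identified without computing with inverses.
\<close>

lemma whisker_right_unique:
  assumes P: "wt_cell p \<theta> q" and r: "ok_path r" "Src \<M> (last p) = Trg \<M> (hd r)"
    and \<chi>: "\<chi> \<in> Cell \<M>" "Dom \<M> \<chi> = path (p @ r)"
    and eq: "\<chi> \<cdot> join p r = join q r \<cdot> (\<theta> \<star> \<ii> (path r))"
  shows "whisker_right (p, \<theta>, q) r = \<chi>"
proof -
  note [simp] = wt_cell_simps(1,2)[OF P] r \<chi>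
  have pr: "ok_path (p @ r)" using P r ok_path_ne[OF r(1)] by (simp add: ok_path_append wt_cell_simps)
  show ?thesis
    by (rule vcomp_cancel_right[of "join p r"])
      (use wt_cell_whisker_right[OF P pr] whisker_right_join[OF P r] eq in \<open>simp_all add: wt_cell_def\<close>)
qed

lemma whisker_right_vcomp:
  assumes P: "wt_cell p \<theta> q" and Q: "wt_cell q \<phi> r" and s: "ok_path (p @ s)"
  shows "whisker_right (p, \<phi> \<cdot> \<theta>, r) s = whisker_right (q, \<phi>, r) s \<cdot> whisker_right (p, \<theta>, q) s"
proof (cases "s = []")
  case False
  note [simp] = wt_cell_simps[OF P] wt_cell_simps[OF Q] False
  have [simp]: "ok_path s" "Src \<M> (last p) = Trg \<M> (hd s)"
    using s by (simp_all add: ok_path_append)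
  have "(\<phi> \<cdot> \<theta>) \<star> \<ii> (path s) = (\<phi> \<star> \<ii> (path s)) \<cdot> (\<theta> \<star> \<ii> (path s))"
    using hcomp_vcomp[of "\<ii> (path s)" "\<ii> (path s)" \<theta> \<phi>] by simp
  then show ?thesis by (simp add: whisker_right_eq vassoc)
qed (simp add: whisker_right_eq)

lemma whisker_right_id: "ok_path (p @ s) \<Longrightarrow> p \<noteq> [] \<Longrightarrow>
  whisker_right (p, \<ii> (path p), p) s = \<ii> (path (p @ s))"
  by (auto simp: whisker_right_eq ok_path_append)

lemma whisker_right_inv:
  assumes P: "wt_cell p \<theta> q" "invertible \<theta>" and r: "ok_path (p @ r)"
  shows "invertible (whisker_right (p, \<theta>, q) r) \<and>
    whisker_right (q, \<ominus> \<theta>, p) r = \<ominus> (whisker_right (p, \<theta>, q) r)"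
proof (cases "r = []")
  case False
  note [simp] = wt_cell_simps[OF P(1)] P(2) False
  have [simp]: "ok_path r" "Src \<M> (last p) = Trg \<M> (hd r)"
    using r by (simp_all add: ok_path_append)
  show ?thesis by (simp add: whisker_right_eq vassoc)
qed (use P in \<open>simp add: whisker_right_eq\<close>)

text \<open>
  Compared after composition with the rebracketing of \<open>p\<close>, \<open>r\<close> and \<open>s\<close>, the two cells agree by
  \<open>join_assoc\<close> and the naturality of the associator.
\<close>

lemma whisker_right_append:
  assumes P: "wt_cell p \<theta> q" and rs: "ok_path (p @ r @ s)"
  shows "whisker_right (p @ r, whisker_right (p, \<theta>, q) r, q @ r) s = whisker_right (p, \<theta>, q) (r @ s)"
proof (cases "r = [] \<or> s = []")
  case False
  then have [simp]: "r \<noteq> []" "s \<noteq> []" by auto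
  note [simp] = wt_cell_simps[OF P]
  have [simp]: "ok_path r" "ok_path s" "Src \<M> (last p) = Trg \<M> (hd r)" "Src \<M> (last r) = Trg \<M> (hd s)"
    using rs by (auto simp: ok_path_append)
  have [simp]: "ok_path (p @ r)" "ok_path (q @ r)" "ok_path (r @ s)"
    by (simp_all add: ok_path_append)
  define w where "w = whisker_right (p, \<theta>, q) r"
  have w: "wt_cell (p @ r) w (q @ r)" unfolding w_def by (rule wt_cell_whisker_right[OF P]) simp
  have wj: "w \<cdot> join p r = join q r \<cdot> (\<theta> \<star> \<ii> (path r))"
    unfolding w_def by (rule whisker_right_join[OF P]) simp_all
  note [simp] = wt_cell_simps(3-)[OF w]
  define W where "W = whisker_right (p, \<theta>, q) (r @ s)"
  have W: "wt_cell (p @ r @ s) W (q @ r @ s)" unfolding W_def by (rule wt_cell_whisker_right[OF P rs])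
  have Wj: "W \<cdot> join p (r @ s) = join q (r @ s) \<cdot> (\<theta> \<star> \<ii> (path (r @ s)))"
    unfolding W_def by (rule whisker_right_join[OF P]) simp_all
  note [simp] = wt_cell_simps(3-)[OF W]
  have "W \<cdot> join (p @ r) s \<cdot> (join p r \<star> \<ii> (path s))
    = W \<cdot> join p (r @ s) \<cdot> (\<ii> (path p) \<star> join r s) \<cdot> \<aa> (path p) (path r) (path s)"
    by (simp add: join_assoc)
  also have "\<dots> = (W \<cdot> join p (r @ s)) \<cdot> (\<ii> (path p) \<star> join r s) \<cdot> \<aa> (path p) (path r) (path s)"
    by (simp add: vassoc)
  also have "\<dots> = join q (r @ s) \<cdot> (\<theta> \<star> join r s) \<cdot> \<aa> (path p) (path r) (path s)"
    unfolding Wj by (simp add: vassoc hcomp_vcomp')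
  also have "\<dots> = join q (r @ s) \<cdot> (\<ii> (path q) \<star> join r s) \<cdot> (\<theta> \<star> \<ii> (path r) \<star> \<ii> (path s)) \<cdot> \<aa> (path p) (path r) (path s)"
    by (simp add: hcomp_vcomp')
  also have "(\<theta> \<star> \<ii> (path r) \<star> \<ii> (path s)) \<cdot> \<aa> (path p) (path r) (path s)
    = \<aa> (path q) (path r) (path s) \<cdot> ((\<theta> \<star> \<ii> (path r)) \<star> \<ii> (path s))"
    by (rule assoc_natural[symmetric]) simp_all
  also have "join q (r @ s) \<cdot> (\<ii> (path q) \<star> join r s) \<cdot> \<aa> (path q) (path r) (path s) \<cdot> ((\<theta> \<star> \<ii> (path r)) \<star> \<ii> (path s))
    = (join q (r @ s) \<cdot> (\<ii> (path q) \<star> join r s) \<cdot> \<aa> (path q) (path r) (path s)) \<cdot> ((\<theta> \<star> \<ii> (path r)) \<star> \<ii> (path s))"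
    by (simp add: vassoc)
  also have "\<dots> = join (q @ r) s \<cdot> (join q r \<star> \<ii> (path s)) \<cdot> ((\<theta> \<star> \<ii> (path r)) \<star> \<ii> (path s))"
    by (simp add: join_assoc[symmetric] vassoc)
  also have "\<dots> = join (q @ r) s \<cdot> ((w \<cdot> join p r) \<star> \<ii> (path s))"
    unfolding wj by (simp add: hcomp_vcomp)
  also have "\<dots> = join (q @ r) s \<cdot> (w \<star> \<ii> (path s)) \<cdot> (join p r \<star> \<ii> (path s))"
    by (simp add: hcomp_vcomp)
  finally have "(W \<cdot> join (p @ r) s) \<cdot> (join p r \<star> \<ii> (path s))
    = (join (q @ r) s \<cdot> (w \<star> \<ii> (path s))) \<cdot> (join p r \<star> \<ii> (path s))"
    by (simp add: vassoc)
  then have "W \<cdot> join (p @ r) s = join (q @ r) s \<cdot> (w \<star> \<ii> (path s))"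
    by (rule vcomp_cancel_right[rotated -1]) (simp; fail)+
  then have "whisker_right (p @ r, w, q @ r) s = W"
    by (rule whisker_right_unique[OF w, rotated -1]) (simp; fail)+
  then show ?thesis unfolding W_def w_def .
qed (auto simp: whisker_right_eq)

abbreviation whisker_left :: "'a list \<Rightarrow> 'c \<Rightarrow> 'c"
  where "whisker_left l \<theta> \<equiv> foldr (\<lambda>f \<phi>. \<ii> f \<star> \<phi>) l \<theta>"

lemma wt_cell_whisker_left:
  assumes P: "wt_cell p \<theta> q" and "ok_path (l @ p)"
  shows "wt_cell (l @ p) (whisker_left l \<theta>) (l @ q)"
  using assms(2)
proof (induction l)
  case (Cons f l)
  have ne: "p \<noteq> []" "q \<noteq> []" using wt_cell_simps[OF P] by auto
  then have l: "ok_path (l @ p)" "f \<in> Arr \<M>" "Src \<M> f = Trg \<M> (hd (l @ p))"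
    using Cons(2) by (auto simp: ok_path_Cons)
  show ?case using Cons.IH[OF l(1)] l ne wt_cell_simps[OF Cons.IH[OF l(1)]]
    by (simp add: wt_cell_def ok_path_Cons path_Cons)
qed (use P in simp)

lemma wt_cell_Cons:
  assumes P: "wt_cell p \<theta> q" and "f \<in> Arr \<M>" "Src \<M> f = Trg \<M> (hd p)"
  shows "wt_cell (f # p) (\<ii> f \<star> \<theta>) (f # q)"
  using wt_cell_whisker_left[OF P, of "[f]"] assms wt_cell_simps[OF P] by (simp add: ok_path_Cons)

lemma whisker_left_vcomp:
  assumes P: "wt_cell p \<theta> q" and Q: "wt_cell q \<phi> r" and "ok_path (l @ p)"
  shows "whisker_left l (\<phi> \<cdot> \<theta>) = whisker_left l \<phi> \<cdot> whisker_left l \<theta>"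
  using assms(3)
proof (induction l)
  case (Cons f l)
  have ne: "p \<noteq> []" "q \<noteq> []" using wt_cell_simps[OF P] by auto
  then have l: "ok_path (l @ p)" "f \<in> Arr \<M>" "Src \<M> f = Trg \<M> (hd (l @ p))"
    using Cons(2) by (auto simp: ok_path_Cons)
  have l': "ok_path (l @ q)" using wt_cell_simps(2)[OF wt_cell_whisker_left[OF P l(1)]] .
  show ?case using Cons.IH[OF l(1)] l
      wt_cell_simps[OF wt_cell_whisker_left[OF P l(1)]] wt_cell_simps[OF wt_cell_whisker_left[OF Q l']]
    by (simp add: hcomp_vcomp)
qed simp

lemma whisker_left_id: "ok_path (l @ p) \<Longrightarrow> p \<noteq> [] \<Longrightarrow> whisker_left l (\<ii> (path p)) = \<ii> (path (l @ p))"
  by (induction l) (auto simp: ok_path_Cons path_Cons)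

lemma whisker_left_inv:
  assumes P: "wt_cell p \<theta> q" "invertible \<theta>" and "ok_path (l @ p)"
  shows "invertible (whisker_left l \<theta>) \<and> whisker_left l (\<ominus> \<theta>) = \<ominus> (whisker_left l \<theta>)"
  using assms(3)
proof (induction l)
  case (Cons f l)
  have "p \<noteq> []" using wt_cell_simps[OF P(1)] by auto
  then have l: "ok_path (l @ p)" "f \<in> Arr \<M>" "Src \<M> f = Trg \<M> (hd (l @ p))"
    using Cons(2) by (auto simp: ok_path_Cons)
  show ?case using Cons.IH[OF l(1)] l wt_cell_simps[OF wt_cell_whisker_left[OF P(1) l(1)]] by simp
qed (use P in simp)

text \<open>
  Whiskering on the left inserts no associators; up to \<open>join\<close> it is horizontal composition with an
  identity cell, as whiskering on the right is.
\<close>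

lemma whisker_left_join:
  assumes p: "ok_path p" and P: "wt_cell r \<phi> s" and "Src \<M> (last p) = Trg \<M> (hd r)"
  shows "whisker_left p \<phi> \<cdot> join p r = join p s \<cdot> (\<ii> (path p) \<star> \<phi>)"
  using assms(1,3)
proof (induction p rule: ok_path.induct)
  case (2 f)
  note [simp] = wt_cell_simps[OF P]
  show ?case using 2 by simp
next
  case (3 f g p)
  let ?p = "g # p"
  note [simp] = wt_cell_simps[OF P]
  have p [simp]: "ok_path ?p" "f \<in> Arr \<M>" "Src \<M> f = Trg \<M> (hd ?p)" "Src \<M> (last ?p) = Trg \<M> (hd r)"
    using 3(2-) by auto
  have pr: "ok_path (?p @ r)" using p by (subst ok_path_append) simp_all
  note [simp] = wt_cell_simps(3-)[OF wt_cell_whisker_left[OF P pr]]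
  have wl: "whisker_left (f # ?p) \<phi> = \<ii> f \<star> whisker_left ?p \<phi>"
    by (simp only: foldr_Cons o_apply)
  note [simp del] = path.simps join.simps foldr.simps foldr_Cons list.sel last.simps ok_path.simps append_Cons
  have IH: "whisker_left ?p \<phi> \<cdot> join ?p r = join ?p s \<cdot> (\<ii> (path ?p) \<star> \<phi>)"
    using 3(1) p by simp
  have "whisker_left (f # ?p) \<phi> \<cdot> join (f # ?p) r
    = (\<ii> f \<star> (whisker_left ?p \<phi> \<cdot> join ?p r)) \<cdot> \<aa> f (path ?p) (path r)"
    unfolding wl by (subst join_Cons) (simp_all add: hcomp_vcomp' pr)
  also have "\<dots> = (\<ii> f \<star> join ?p s) \<cdot> (\<ii> f \<star> \<ii> (path ?p) \<star> \<phi>) \<cdot> \<aa> f (path ?p) (path r)"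
    unfolding IH by (simp add: hcomp_vcomp')
  also have "(\<ii> f \<star> \<ii> (path ?p) \<star> \<phi>) \<cdot> \<aa> f (path ?p) (path r)
    = \<aa> f (path ?p) (path s) \<cdot> ((\<ii> f \<star> \<ii> (path ?p)) \<star> \<phi>)"
    by (rule assoc_natural[symmetric]) simp_all
  also have "(\<ii> f \<star> join ?p s) \<cdot> \<dots> = join (f # ?p) s \<cdot> (\<ii> (path (f # ?p)) \<star> \<phi>)"
    by (simp add: join_Cons[of ?p] path_Cons[of ?p] vassoc)
  finally show ?case .
qed simp

lemma whisker_right_Cons:
  assumes P: "wt_cell p \<theta> q" and f: "ok_path (f # p @ r)"
  shows "whisker_right (f # p, \<ii> f \<star> \<theta>, f # q) r = \<ii> f \<star> whisker_right (p, \<theta>, q) r"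
proof (cases "r = []")
  case False
  note [simp] = wt_cell_simps[OF P] False
  have [simp]: "ok_path r" "Src \<M> (last p) = Trg \<M> (hd r)" "f \<in> Arr \<M>" "Src \<M> f = Trg \<M> (hd p)"
    using f by (auto simp: ok_path_append ok_path_Cons)
  have pr: "ok_path (p @ r)" by (simp add: ok_path_append)
  note w = wt_cell_whisker_right[OF P pr]
  note [simp] = wt_cell_simps(3-)[OF w] pr
  have "(\<ii> f \<star> whisker_right (p, \<theta>, q) r) \<cdot> join (f # p) r
    = (\<ii> f \<star> (whisker_right (p, \<theta>, q) r \<cdot> join p r)) \<cdot> \<aa> f (path p) (path r)"
    by (simp add: join_Cons hcomp_vcomp')
  also have "\<dots> = (\<ii> f \<star> join q r) \<cdot> (\<ii> f \<star> \<theta> \<star> \<ii> (path r)) \<cdot> \<aa> f (path p) (path r)"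
    by (simp add: whisker_right_join[OF P] hcomp_vcomp')
  also have "(\<ii> f \<star> \<theta> \<star> \<ii> (path r)) \<cdot> \<aa> f (path p) (path r) = \<aa> f (path q) (path r) \<cdot> ((\<ii> f \<star> \<theta>) \<star> \<ii> (path r))"
    by (rule assoc_natural[symmetric]) simp_all
  also have "(\<ii> f \<star> join q r) \<cdot> \<dots> = join (f # q) r \<cdot> ((\<ii> f \<star> \<theta>) \<star> \<ii> (path r))"
    by (simp add: join_Cons vassoc)
  finally show ?thesis
    by (intro whisker_right_unique wt_cell_Cons P) (simp_all add: path_Cons)
qed (simp add: whisker_right_eq)

lemma whisker_right_left:
  assumes P: "wt_cell p \<theta> q" and "ok_path (l @ p @ r)"
  shows "whisker_right (l @ p, whisker_left l \<theta>, l @ q) r = whisker_left l (whisker_right (p, \<theta>, q) r)"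
  using assms(2)
proof (induction l)
  case (Cons f l)
  have ne: "p \<noteq> []" using wt_cell_simps[OF P] by auto
  then have l: "ok_path (l @ p @ r)" "ok_path (l @ p)"
    using Cons(2) ok_path_append[of "l @ p" r] by (cases "r = []"; auto simp: ok_path_Cons)+
  show ?case
    using whisker_right_Cons[OF wt_cell_whisker_left[OF P l(2)], of f r] Cons.IH[OF l(1)] Cons(2) by simp
qed simp

text \<open>
  After rebracketing, both composites are the horizontal composite of the two cells.
\<close>

lemma whisker_interchange:
  assumes P: "wt_cell p \<theta> q" and Q: "wt_cell r \<phi> s" and m: "Src \<M> (last p) = Trg \<M> (hd r)"
  shows "whisker_left q \<phi> \<cdot> whisker_right (p, \<theta>, q) r = whisker_right (p, \<theta>, q) s \<cdot> whisker_left p \<phi>"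
proof -
  note [simp] = wt_cell_simps[OF P] wt_cell_simps[OF Q] m
  have [simp]: "ok_path (p @ r)" "ok_path (p @ s)" "ok_path (q @ r)" by (simp_all add: ok_path_append)
  note [simp] = wt_cell_simps(3-5)[OF wt_cell_whisker_right[OF P, of r]]
    wt_cell_simps(3-5)[OF wt_cell_whisker_right[OF P, of s]] wt_cell_simps(3-5)[OF wt_cell_whisker_left[OF Q, of p]]
    wt_cell_simps(3-5)[OF wt_cell_whisker_left[OF Q, of q]]
  have "(whisker_left q \<phi> \<cdot> whisker_right (p, \<theta>, q) r) \<cdot> join p r
    = whisker_left q \<phi> \<cdot> (join q r \<cdot> (\<theta> \<star> \<ii> (path r)))"
    by (simp add: vassoc whisker_right_join[OF P])
  also have "\<dots> = (whisker_left q \<phi> \<cdot> join q r) \<cdot> (\<theta> \<star> \<ii> (path r))"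
    by (simp add: vassoc)
  also have "\<dots> = join q s \<cdot> (\<theta> \<star> \<phi>)"
    by (simp add: whisker_left_join[OF _ Q] vassoc hcomp_vcomp)
  also have "\<dots> = (join q s \<cdot> (\<theta> \<star> \<ii> (path s))) \<cdot> (\<ii> (path p) \<star> \<phi>)"
    by (simp add: vassoc hcomp_vcomp)
  also have "\<dots> = whisker_right (p, \<theta>, q) s \<cdot> (join p s \<cdot> (\<ii> (path p) \<star> \<phi>))"
    by (simp add: vassoc whisker_right_join[OF P, symmetric])
  also have "\<dots> = (whisker_right (p, \<theta>, q) s \<cdot> whisker_left p \<phi>) \<cdot> join p r"
    by (simp add: vassoc whisker_left_join[OF _ Q, symmetric])
  finally show ?thesis by (rule vcomp_cancel_right[rotated -1]) (simp; fail)+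
qed

end

section \<open>Diagrams\<close>

text \<open>
  A diagram is a path cell whose cell may be missing.  Composition, whiskering and tensor product
  below return a diagram without a cell unless all types match.  Therefore laws such as associativity
  hold without typing hypotheses, since both sides are undefined together, and can be used freely for
  rewriting.  Names that begin with \<open>d\<close> denote diagrams and operations on them.
\<close>

type_synonym ('a,'c) diagram = "'a list \<times> 'c option \<times> 'a list"

definition ddom :: "('a,'c) diagram \<Rightarrow> 'a list" where "ddom P = fst P"
definition dcod :: "('a,'c) diagram \<Rightarrow> 'a list" where "dcod P = snd (snd P)"
definition dcell :: "('a,'c) diagram \<Rightarrow> 'c" where "dcell P = the (fst (snd P))"

definition guard :: "'a list \<Rightarrow> bool \<Rightarrow> 'c \<Rightarrow> 'a list \<Rightarrow> ('a,'c) diagram"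
  where "guard p b \<theta> q = (p, if b then Some \<theta> else None, q)"

lemma guard_simps [simp]: "ddom (guard p b \<theta> q) = p" "dcod (guard p b \<theta> q) = q"
  by (simp_all add: guard_def ddom_def dcod_def)

lemma dcell_guard [simp]: "b \<Longrightarrow> dcell (guard p b \<theta> q) = \<theta>"
  by (simp add: guard_def dcell_def)

lemma guard_collapse': "fst (snd P) \<noteq> None \<Longrightarrow> guard (ddom P) True (dcell P) (dcod P) = P"
  by (cases P) (auto simp: guard_def ddom_def dcod_def dcell_def)

lemma guard_False [simp]: "guard p False \<theta> q = (p, None, q)"
  by (simp add: guard_def)

lemma raw_simps [simp]: "ddom (p, t, q) = p" "dcod (p, t, q) = q"
  by (simp_all add: ddom_def dcod_def)

context bicategory
begin

definition ok :: "('a,'c) diagram \<Rightarrow> bool"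
  where "ok P \<longleftrightarrow> fst (snd P) \<noteq> None \<and> wt_cell (ddom P) (dcell P) (dcod P)"

lemma ok_guard [simp]: "ok (guard p b \<theta> q) \<longleftrightarrow> b \<and> wt_cell p \<theta> q"
  by (cases b) (simp_all add: ok_def guard_def ddom_def dcod_def dcell_def)

lemma not_ok_None [simp]: "\<not> ok (p, None, q)"
  by (simp add: ok_def)

lemma ok_wt_cell: "ok P \<Longrightarrow> wt_cell (ddom P) (dcell P) (dcod P)"
  by (simp add: ok_def)

lemma ok_paths: "ok P \<Longrightarrow> ok_path (ddom P)" "ok P \<Longrightarrow> ok_path (dcod P)"
    "ok P \<Longrightarrow> ddom P \<noteq> []" "ok P \<Longrightarrow> dcod P \<noteq> []"
    "ok P \<Longrightarrow> Src \<M> (last (dcod P)) = Src \<M> (last (ddom P))"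
    "ok P \<Longrightarrow> Trg \<M> (hd (dcod P)) = Trg \<M> (hd (ddom P))"
  by (simp_all add: wt_cell_simps[OF ok_wt_cell])

lemma guard_collapse: "ok P \<Longrightarrow> guard (ddom P) True (dcell P) (dcod P) = P"
  by (rule guard_collapse') (simp add: ok_def)

lemma diagram_eqI:
  "ok P \<Longrightarrow> ok Q \<Longrightarrow> ddom P = ddom Q \<Longrightarrow> dcod P = dcod Q \<Longrightarrow> dcell P = dcell Q \<Longrightarrow> P = Q"
  by (metis guard_collapse)

definition dcomp :: "('a,'c) diagram \<Rightarrow> ('a,'c) diagram \<Rightarrow> ('a,'c) diagram"  (infixr ";;" 55)
  where "P ;; Q = guard (ddom P) (ok P \<and> ok Q \<and> dcod P = ddom Q) (dcell Q \<cdot> dcell P) (dcod Q)"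

definition dwhisker :: "'a list \<Rightarrow> ('a,'c) diagram \<Rightarrow> 'a list \<Rightarrow> ('a,'c) diagram"
    ("(_ <| _ |> _)" [61,61,61] 60)
  where "l <| P |> r = guard (l @ ddom P @ r) (ok P \<and> ok_path (l @ ddom P @ r))
    (whisker_left l (whisker_right (ddom P, dcell P, dcod P) r)) (l @ dcod P @ r)"

definition did :: "'a list \<Rightarrow> ('a,'c) diagram"
  where "did p = guard p (ok_path p) (\<ii> (path p)) p"

definition dinv :: "('a,'c) diagram \<Rightarrow> ('a,'c) diagram"
  where "dinv P = guard (dcod P) (ok P \<and> invertible (dcell P)) (\<ominus> (dcell P)) (ddom P)"

definition iso :: "('a,'c) diagram \<Rightarrow> bool"
  where "iso P \<longleftrightarrow> ok P \<and> invertible (dcell P)"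

lemma bounds [simp]:
  "ddom (P ;; Q) = ddom P" "dcod (P ;; Q) = dcod Q"
  "ddom (l <| P |> r) = l @ ddom P @ r" "dcod (l <| P |> r) = l @ dcod P @ r"
  "ddom (did p) = p" "dcod (did p) = p" "ddom (dinv P) = dcod P" "dcod (dinv P) = ddom P"
  by (simp_all add: dcomp_def dwhisker_def did_def dinv_def)

lemma ok_dcomp [simp]: "ok (P ;; Q) \<longleftrightarrow> ok P \<and> ok Q \<and> dcod P = ddom Q"
  using ok_wt_cell[of P] ok_wt_cell[of Q] wt_cell_vcomp[of "ddom P" "dcell P" "dcod P" "dcell Q" "dcod Q"]
  by (auto simp: dcomp_def)

lemma ok_dwhisker [simp]: "ok (l <| P |> r) \<longleftrightarrow> ok P \<and> ok_path (l @ ddom P @ r)"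
proof (cases "ok P \<and> ok_path (l @ ddom P @ r)")
  case True
  then have ne: "ddom P @ r \<noteq> []" "ok_path (ddom P @ r)" using ok_paths(3)[of P] 
    by (auto simp: ok_path_append_iff split: if_splits)
  show ?thesis using True wt_cell_whisker_left[OF wt_cell_whisker_right[OF ok_wt_cell ne(2)]]
    by (simp add: dwhisker_def)
qed (auto simp: dwhisker_def)

lemma ok_did [simp]: "ok (did p) \<longleftrightarrow> ok_path p"
  by (auto simp: did_def wt_cell_id)

lemma ok_dinv [simp]: "ok (dinv P) \<longleftrightarrow> iso P"
  by (auto simp: dinv_def iso_def intro: wt_cell_inv ok_wt_cell)

lemma iso_ok: "iso P \<Longrightarrow> ok P" by (simp add: iso_def)

lemma dcell_simps:
  "ok (P ;; Q) \<Longrightarrow> dcell (P ;; Q) = dcell Q \<cdot> dcell P"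
  "ok (l <| P |> r) \<Longrightarrow> dcell (l <| P |> r) = whisker_left l (whisker_right (ddom P, dcell P, dcod P) r)"
  "ok (did p) \<Longrightarrow> dcell (did p) = \<ii> (path p)"
  "iso P \<Longrightarrow> dcell (dinv P) = \<ominus> (dcell P)"
  unfolding ok_dcomp ok_dwhisker ok_did iso_def
  by (simp_all add: dcomp_def dwhisker_def did_def dinv_def)

text \<open>
  A strict diagram has either a cell of the right type or none; two strict diagrams are equal as soon
  as they agree wherever one of them is defined (\<open>strict_eqI\<close>).
\<close>

definition strict :: "('a,'c) diagram \<Rightarrow> bool"
  where "strict P \<longleftrightarrow> ok P \<or> fst (snd P) = None"

lemma strictI [simp]: "strict (P ;; Q)" "strict (l <| P |> r)" "strict (did p)" "strict (dinv P)"
proof -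
  have *: "strict (guard p b \<theta> q)" if "b = ok (guard p b \<theta> q)" for p b \<theta> q
  proof (cases b)
    case False then show ?thesis by (simp add: strict_def)
  qed (use that strict_def in blast)
  show "strict (P ;; Q)" unfolding dcomp_def
    by (rule *) (rule ok_dcomp[of P Q, unfolded dcomp_def, symmetric])
  show "strict (l <| P |> r)" unfolding dwhisker_def
    by (rule *) (rule ok_dwhisker[of l P r, unfolded dwhisker_def, symmetric])
  show "strict (did p)" unfolding did_def
    by (rule *) (rule ok_did[of p, unfolded did_def, symmetric])
  show "strict (dinv P)" unfolding dinv_def
    by (rule *) (rule ok_dinv[of P, unfolded dinv_def iso_def, symmetric])
qed

lemma strict_eqI:
  assumes "strict P" "strict Q" "ddom P = ddom Q" "dcod P = dcod Q" "ok P \<longleftrightarrow> ok Q" "ok P \<Longrightarrow> P = Q"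
  shows "P = Q"
proof (cases "ok P")
  case False
  then have "fst (snd P) = None" "fst (snd Q) = None" using assms(1,2,5) by (auto simp: strict_def)
  then show ?thesis using assms(3,4) by (cases P; cases Q) simp
qed (use assms(6) in blast)

lemma dcomp_assoc: "(P ;; Q) ;; R = P ;; (Q ;; R)"
proof (rule strict_eqI)
  assume "ok ((P ;; Q) ;; R)"
  then show "(P ;; Q) ;; R = P ;; (Q ;; R)"
    using wt_cell_simps[OF ok_wt_cell, of P] wt_cell_simps[OF ok_wt_cell, of Q] wt_cell_simps[OF ok_wt_cell, of R]
    by (intro diagram_eqI) (simp_all add: dcell_simps vassoc)
qed auto

text \<open>
  Turns an equation between two cells into a rewrite rule inside a longer composite bracketed to the
  right.
\<close>

lemma dcomp_step: "P ;; Q = R \<Longrightarrow> P ;; Q ;; S = R ;; S"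
  by (metis dcomp_assoc)

lemma ok_path_inner:
  assumes "ok P" "ok_path (l @ ddom P @ r)"
  shows "ok_path (l @ dcod P @ r)" "ok_path (ddom P @ r)" "ok_path (dcod P @ r)"
    "ok_path (l @ ddom P)" "ok_path (l @ dcod P)"
  using assms ok_paths[OF assms(1)] by (auto simp: ok_path_append_iff split: if_splits)

lemma dwhisker_dcomp: "l <| (P ;; Q) |> r = (l <| P |> r) ;; (l <| Q |> r)"
proof (cases "ok (l <| (P ;; Q) |> r)")
  case True
  then have *: "ok P" "ok Q" "dcod P = ddom Q" "ok_path (l @ ddom P @ r)" by simp_all
  note i = ok_path_inner[OF *(1,4)]
  have ok: "ok (l <| P |> r)" "ok (l <| Q |> r)" "ok (P ;; Q)" using * i by simp_all
  have "whisker_right (ddom P, dcell Q \<cdot> dcell P, dcod Q) r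
    = whisker_right (ddom Q, dcell Q, dcod Q) r \<cdot> whisker_right (ddom P, dcell P, dcod P) r"
    unfolding *(3) by (rule whisker_right_vcomp) (use * i ok_wt_cell[of P] ok_wt_cell[of Q] in simp_all)
  moreover have "whisker_left l (whisker_right (ddom Q, dcell Q, dcod Q) r \<cdot> whisker_right (ddom P, dcell P, dcod P) r)
    = whisker_left l (whisker_right (ddom Q, dcell Q, dcod Q) r) \<cdot> whisker_left l (whisker_right (ddom P, dcell P, dcod P) r)"
    by (rule whisker_left_vcomp[OF wt_cell_whisker_right[OF ok_wt_cell[OF *(1)] i(2)], of _ "dcod Q @ r"])
      (use * i wt_cell_whisker_right[OF ok_wt_cell[OF *(2)], of r] in simp_all)
  ultimately show ?thesis using True ok * i
    by (intro diagram_eqI) (simp_all add: dcell_simps)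
next
  case False
  show ?thesis by (rule strict_eqI) (use False in \<open>auto dest: ok_path_inner(1)\<close>)
qed

lemma dwhisker_dwhisker: "l <| (l' <| P |> r') |> r = (l @ l') <| P |> (r' @ r)"
proof (cases "ok P \<and> ok_path (l @ l' @ ddom P @ r' @ r)")
  case True
  then have *: "ok P" "ok_path (l @ l' @ ddom P @ r' @ r)" by simp_all
  note ne = ok_paths(3,4)[OF *(1)]
  have i: "ok_path (l' @ ddom P @ r')" "ok_path (l' @ (ddom P @ r') @ r)" "ok_path (ddom P @ r' @ r)"
     "ok_path (ddom P @ r')"
    using *(2) ne by (auto simp: ok_path_append_iff split: if_splits)
  have "whisker_right (l' @ ddom P @ r', whisker_left l' (whisker_right (ddom P, dcell P, dcod P) r'), l' @ dcod P @ r') r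
     = whisker_left l' (whisker_right (ddom P, dcell P, dcod P) (r' @ r))"
    using whisker_right_left[OF wt_cell_whisker_right[OF ok_wt_cell[OF *(1)] i(4)] i(2)]
      whisker_right_append[OF ok_wt_cell[OF *(1)] i(3)] by simp
  then show ?thesis using * i ok_dwhisker[of l' P r'] by (intro diagram_eqI) (simp_all add: dcell_simps)
next
  case False
  show ?thesis by (rule strict_eqI) (use False in auto)
qed

lemma dwhisker_did [simp]: "p \<noteq> [] \<Longrightarrow> l <| did p |> r = did (l @ p @ r)"
proof (cases "ok_path (l @ p @ r)")
  case True
  assume ne: "p \<noteq> []"
  then have "ok_path p" "ok_path (p @ r)" using True by (auto simp: ok_path_append_iff split: if_splits)
  then show ?thesis using True ne
    by (intro diagram_eqI) (simp_all add: dcell_simps whisker_right_id whisker_left_id[of l "p @ r"])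
qed (rule strict_eqI; simp)

lemma dwhisker_empty [simp]: "ok P \<Longrightarrow> [] <| P |> [] = P"
  by (intro diagram_eqI) (simp_all add: dcell_simps ok_paths)

lemma dcomp_did [simp]:
  "ok P \<Longrightarrow> ddom P = p \<Longrightarrow> did p ;; P = P" "ok P \<Longrightarrow> dcod P = p \<Longrightarrow> P ;; did p = P"
  using wt_cell_simps[OF ok_wt_cell, of P]
  by (auto intro!: diagram_eqI simp: dcell_simps)

lemmas dnormalize = dwhisker_dcomp dwhisker_dwhisker dcomp_assoc

text \<open>
  The interchange law of a 2-category, for cells separated by a path \<open>m\<close>.
\<close>

lemma dexchange:
  "(l <| P |> (m @ ddom Q @ r)) ;; ((l @ dcod P @ m) <| Q |> r)
   = ((l @ ddom P @ m) <| Q |> r) ;; (l <| P |> (m @ dcod Q @ r))"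
proof (cases "ok P \<and> ok Q \<and> ok_path (l @ ddom P @ m @ ddom Q @ r)")
  case True
  then have *: "ok P" "ok Q" "ok_path (l @ ddom P @ m @ ddom Q @ r)" by auto
  note n = ok_paths[OF *(1)] ok_paths[OF *(2)]
  let ?Q = "m <| Q |> []"
  have okm: "ok ?Q" "Src \<M> (last (ddom P)) = Trg \<M> (hd (ddom ?Q))"
    using * n by (auto simp: ok_path_append_iff split: if_splits)
  have okpm: "ok_path (ddom P @ ddom ?Q)" "ok_path (ddom P @ dcod ?Q)" "ok_path (dcod P @ ddom ?Q)"
    "ok_path (dcod P @ dcod ?Q)"
    using okm(1) okm(2) n ok_paths[OF okm(1)] by (simp_all add: ok_path_append del: bounds(3,4))
  have "([] <| P |> ddom ?Q) ;; (dcod P <| ?Q |> []) = (ddom P <| ?Q |> []) ;; ([] <| P |> dcod ?Q)"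
    using okpm okm * whisker_interchange[OF ok_wt_cell[OF *(1)] ok_wt_cell[OF okm(1)] okm(2)]
    by (intro diagram_eqI) (simp_all add: dcell_simps)
  from arg_cong[OF this, of "\<lambda>X. l <| X |> r"] show ?thesis
    by (simp add: dwhisker_dcomp dwhisker_dwhisker)
next
  case False
  show ?thesis by (rule strict_eqI) (use False in auto)
qed

lemma iso_dcomp: "iso P \<Longrightarrow> iso Q \<Longrightarrow> dcod P = ddom Q \<Longrightarrow> iso (P ;; Q)"
  using wt_cell_simps[OF ok_wt_cell, of P] wt_cell_simps[OF ok_wt_cell, of Q] 
  by (auto simp: iso_def dcell_simps)

lemma iso_dwhisker: "iso P \<Longrightarrow> ok_path (l @ ddom P @ r) \<Longrightarrow> iso (l <| P |> r)"
  using whisker_right_inv[of "ddom P" "dcell P" "dcod P" r]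
    wt_cell_whisker_right[of "ddom P" "dcell P" "dcod P" r]
    whisker_left_inv[of "ddom P @ r" _ "dcod P @ r" l] ok_path_inner[of P l r]
  by (simp add: iso_def dcell_simps ok_wt_cell)

lemma iso_dinv: "iso P \<Longrightarrow> iso (dinv P)" "iso P \<Longrightarrow> dinv (dinv P) = P"
proof -
  assume P: "iso P"
  then have [simp]: "invertible (dcell P)" by (simp add: iso_def)
  show i: "iso (dinv P)" using P by (simp add: iso_def[of "dinv P"] dcell_simps)
  show "dinv (dinv P) = P" using P i by (intro diagram_eqI) (simp_all add: dcell_simps iso_def)
qed

lemma dinv_cancel:
  assumes "iso P"
  shows "P ;; dinv P = did (ddom P)" "dinv P ;; P = did (dcod P)"
  using assms wt_cell_simps[OF ok_wt_cell[OF iso_ok[OF assms]]]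
  by (auto intro!: diagram_eqI simp: dcell_simps iso_def)

lemma dinv_whisker_cancel:
  assumes "iso P"
  shows "(l <| P |> r) ;; (l <| dinv P |> r) = did (l @ ddom P @ r)"
    "(l <| dinv P |> r) ;; (l <| P |> r) = did (l @ dcod P @ r)"
  using assms ok_paths[OF iso_ok[OF assms]]
  by (simp_all add: dwhisker_dcomp[symmetric] dinv_cancel)

lemma dcomp_cancel_left:
  assumes "iso P" "ok Q" "ok R" "ddom Q = dcod P" "ddom R = dcod P" "P ;; Q = P ;; R"
  shows "Q = R"
proof -
  have "dinv P ;; P ;; Q = dinv P ;; P ;; R" using assms(6) by simp
  then show ?thesis using assms(1-5) by (simp add: dinv_cancel flip: dcomp_assoc)
qed

lemma dinv_unique:
  assumes "iso P" "ok Q" "ddom Q = dcod P" "P ;; Q = did (ddom P)"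
  shows "dinv P = Q"
  by (rule dcomp_cancel_left[OF assms(1) _ assms(2) _ assms(3)])
    (simp_all add: assms(1) dinv_cancel(1)[OF assms(1)] assms(4))

lemma dinv_dcomp:
  assumes "iso P" "iso Q" "dcod P = ddom Q"
  shows "dinv (P ;; Q) = dinv Q ;; dinv P"
  using assms wt_cell_simps[OF ok_wt_cell[OF iso_ok[OF assms(1)]]] wt_cell_simps[OF ok_wt_cell[OF iso_ok[OF assms(2)]]]
  by (intro diagram_eqI) (simp_all add: dcell_simps iso_dcomp, simp_all add: iso_def dcell_simps)

lemma dinv_dwhisker:
  assumes "iso P" "ok_path (l @ ddom P @ r)"
  shows "dinv (l <| P |> r) = l <| dinv P |> r"
  using assms ok_path_inner[OF iso_ok[OF assms(1)] assms(2)]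
  by (intro dinv_unique iso_dwhisker) (simp_all add: dinv_whisker_cancel)

end

section \<open>Path cells as diagrams\<close>

context bicategory
begin

text \<open>
  The passage from path cells to diagrams.  It turns each operation on path cells into the
  corresponding total operation, provided that the types match.
\<close>

fun diag :: "('a,'c) pcell \<Rightarrow> ('a,'c) diagram"
  where "diag (p, \<theta>, q) = guard p (wt_cell p \<theta> q) \<theta> q"

lemma diag_pthen:
  "ok (diag P) \<Longrightarrow> ok (diag Q) \<Longrightarrow> dcod (diag P) = ddom (diag Q) \<Longrightarrow> diag (P \<Zsemi> Q) = diag P ;; diag Q"
  by (cases P; cases Q) (auto intro: diagram_eqI simp: dcell_simps wt_cell_vcomp)

lemma diag_whisker: "ok (diag P) \<Longrightarrow> ok_path (l @ ddom (diag P) @ r) \<Longrightarrow> diag (l \<lhd> P \<rhd> r) = l <| diag P |> r"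
  using ok_dwhisker[of l "diag P" r] ok_wt_cell[of "l <| diag P |> r"]
  by (cases P) (auto intro!: diagram_eqI simp: dcell_simps)

lemma diag_pinv: "iso (diag P) \<Longrightarrow> diag (pinv P) = dinv (diag P)"
  using ok_dinv[of "diag P"] ok_wt_cell[of "dinv (diag P)"]
  by (cases P) (auto intro!: diagram_eqI simp: dcell_simps iso_def)

lemma diag_inject: "ok (diag P) \<Longrightarrow> diag P = diag Q \<Longrightarrow> P = Q"
  by (cases P; cases Q) (auto simp: guard_def split: if_splits)

lemma diag_simps:
  "ddom (diag (p, \<theta>, q)) = p" "dcod (diag (p, \<theta>, q)) = q"
  "ok (diag (p, \<theta>, q)) \<longleftrightarrow> wt_cell p \<theta> q" "wt_cell p \<theta> q \<Longrightarrow> dcell (diag (p, \<theta>, q)) = \<theta>"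
  by simp_all

lemma iso_diag: "iso (diag (p, \<theta>, q)) \<longleftrightarrow> wt_cell p \<theta> q \<and> invertible \<theta>"
  by (auto simp: iso_def)

declare diag.simps [simp del]

text \<open>
  The cell of \<open>dsplit g f\<close> is an identity, but it replaces the path that consists of the single arrow
  \<open>g \<odot> f\<close> by the path \<open>g\<close>, \<open>f\<close>.  In terms of it, horizontal composition is whiskering
  (\<open>dsingle_hcomp\<close>) and the associator merely changes the way of splitting (\<open>dsingle_assoc\<close>).
\<close>

definition dsplit :: "'a \<Rightarrow> 'a \<Rightarrow> ('a,'c) diagram" where "dsplit g f = diag (split g f)"

abbreviation dsingle :: "'c \<Rightarrow> ('a,'c) diagram" where "dsingle \<theta> \<equiv> diag (single \<theta>)"

lemma dsplit_simps [simp]: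
  "ddom (dsplit g f) = [g \<odot> f]" "dcod (dsplit g f) = [g, f]"
  "f \<in> Arr \<M> \<Longrightarrow> g \<in> Arr \<M> \<Longrightarrow> Src \<M> g = Trg \<M> f \<Longrightarrow> iso (dsplit g f)"
  "f \<in> Arr \<M> \<Longrightarrow> g \<in> Arr \<M> \<Longrightarrow> Src \<M> g = Trg \<M> f \<Longrightarrow> ok (dsplit g f)"
  by (simp_all add: dsplit_def split_def diag_simps iso_diag wt_cell_def)

lemma dcell_dsplit: "f \<in> Arr \<M> \<Longrightarrow> g \<in> Arr \<M> \<Longrightarrow> Src \<M> g = Trg \<M> f \<Longrightarrow> dcell (dsplit g f) = \<ii> (g \<odot> f)"
  by (simp add: dsplit_def split_def diag_simps wt_cell_def)

lemma dsingle_simps [simp]: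
  "ddom (dsingle \<theta>) = [Dom \<M> \<theta>]" "dcod (dsingle \<theta>) = [Cod \<M> \<theta>]"
  "\<theta> \<in> Cell \<M> \<Longrightarrow> ok (dsingle \<theta>)" "\<theta> \<in> Cell \<M> \<Longrightarrow> dcell (dsingle \<theta>) = \<theta>"
  by (simp_all add: single_def diag_simps wt_cell_def)

lemma iso_dsingle [simp]: "invertible \<theta> \<Longrightarrow> iso (dsingle \<theta>)"
  by (simp add: iso_def invertible_cell)

lemma dsingle_id: "f \<in> Arr \<M> \<Longrightarrow> dsingle (\<ii> f) = did [f]"
  by (intro diagram_eqI) (simp_all add: dcell_simps)

lemma dsingle_inv: "invertible \<theta> \<Longrightarrow> dsingle (\<ominus> \<theta>) = dinv (dsingle \<theta>)"
  by (intro diagram_eqI) (simp_all add: dcell_simps invertible_cell)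

lemma dsingle_vcomp:
  "\<theta> \<in> Cell \<M> \<Longrightarrow> \<phi> \<in> Cell \<M> \<Longrightarrow> Dom \<M> \<phi> = Cod \<M> \<theta> \<Longrightarrow> dsingle (\<phi> \<cdot> \<theta>) = dsingle \<theta> ;; dsingle \<phi>"
  by (intro diagram_eqI) (simp_all add: dcell_simps)

lemma dsingle_hcomp':
  assumes "\<theta> \<in> Cell \<M>" "\<phi> \<in> Cell \<M>" "Src \<M> (Dom \<M> \<phi>) = Trg \<M> (Dom \<M> \<theta>)"
  shows "dsplit (Dom \<M> \<phi>) (Dom \<M> \<theta>) ;; ([] <| dsingle \<phi> |> [Dom \<M> \<theta>]) ;; ([Cod \<M> \<phi>] <| dsingle \<theta> |> [])
      = dsingle (\<phi> \<star> \<theta>) ;; dsplit (Cod \<M> \<phi>) (Cod \<M> \<theta>)"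
  by (intro diagram_eqI) (use assms in \<open>simp_all add: dcell_simps dcell_dsplit hcomp_vcomp\<close>)

lemma dsingle_hcomp:
  assumes "\<theta> \<in> Cell \<M>" "\<phi> \<in> Cell \<M>" "Dom \<M> \<theta> = f" "Cod \<M> \<theta> = f'" "Dom \<M> \<phi> = g" "Cod \<M> \<phi> = g'"
    "Src \<M> g = Trg \<M> f"
  shows "dsplit g f ;; ([] <| dsingle \<phi> |> [f]) ;; ([g'] <| dsingle \<theta> |> [])
      = dsingle (\<phi> \<star> \<theta>) ;; dsplit g' f'"
  using dsingle_hcomp'[of \<theta> \<phi>] assms by simp

lemma dsingle_assoc:
  assumes "f \<in> Arr \<M>" "g \<in> Arr \<M>" "h \<in> Arr \<M>" "Src \<M> g = Trg \<M> f" "Src \<M> h = Trg \<M> g"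
  shows "dsingle (\<aa> h g f) ;; dsplit h (g \<odot> f) ;; ([h] <| dsplit g f |> [])
     = dsplit (h \<odot> g) f ;; ([] <| dsplit h g |> [f])"
  using assms by (intro diagram_eqI) (simp_all add: dcell_simps dcell_dsplit)

end

section \<open>Unit cells\<close>

context bicategory
begin

definition dR :: "'a \<Rightarrow> ('a,'c) diagram" where "dR f = diag ([f, \<one> (Src \<M> f)], \<rr> f, [f])"
definition dL :: "'a \<Rightarrow> ('a,'c) diagram" where "dL f = diag ([\<one> (Trg \<M> f), f], \<ll> f, [f])"
definition dswap :: "'a \<Rightarrow> ('a,'c) diagram" where "dswap f = dR f ;; dinv (dL f)"

lemma unit_bounds [simp]:
  "ddom (dR f) = [f, \<one> (Src \<M> f)]" "dcod (dR f) = [f]"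
  "ddom (dL f) = [\<one> (Trg \<M> f), f]" "dcod (dL f) = [f]"
  "ddom (dswap f) = [f, \<one> (Src \<M> f)]" "dcod (dswap f) = [\<one> (Trg \<M> f), f]"
  by (simp_all add: dR_def dL_def dswap_def diag_simps)

lemma iso_unit [simp]: "f \<in> Arr \<M> \<Longrightarrow> iso (dR f)" "f \<in> Arr \<M> \<Longrightarrow> iso (dL f)" "f \<in> Arr \<M> \<Longrightarrow> iso (dswap f)"
  by (auto simp: dswap_def iso_diag wt_cell_def dR_def dL_def diag_simps intro!: iso_dcomp iso_dinv)

lemma ok_unit [simp]: "f \<in> Arr \<M> \<Longrightarrow> ok (dR f)" "f \<in> Arr \<M> \<Longrightarrow> ok (dL f)" "f \<in> Arr \<M> \<Longrightarrow> ok (dswap f)"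
  by (simp_all add: iso_ok)

lemma dcell_unit: "f \<in> Arr \<M> \<Longrightarrow> dcell (dR f) = \<rr> f" "f \<in> Arr \<M> \<Longrightarrow> dcell (dL f) = \<ll> f"
  by (simp_all add: dR_def dL_def diag_simps wt_cell_def)

lemma diag_swap: "f \<in> Arr \<M> \<Longrightarrow> diag (swap f) = dswap f"
  unfolding swap_def dswap_def
  by (intro diagram_eqI) (simp_all add: diag_simps dcell_simps dcell_unit wt_cell_def)

text \<open>
  The triangle axiom: an identity between two arrows can be absorbed on either side.
\<close>

lemma unit_triangle:
  assumes "f \<in> Arr \<M>" "g \<in> Arr \<M>" "Src \<M> f = Trg \<M> g"
  shows "[f] <| dL g |> [] = [] <| dR f |> [g]"
proof (rule diagram_eqI)
  show "dcell ([f] <| dL g |> []) = dcell ([] <| dR f |> [g])"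
    using assms assoc_triangle[of g f, symmetric] by (simp add: dcell_simps dcell_unit vassoc)
qed (use assms in simp_all)

text \<open>
  Unit cells for paths, whiskered from a single arrow, so that over a concatenation they restrict to
  one of the two parts.
\<close>

definition dR_path :: "'a list \<Rightarrow> ('a,'c) diagram" where "dR_path p = butlast p <| dR (last p) |> []"
definition dL_path :: "'a list \<Rightarrow> ('a,'c) diagram" where "dL_path p = [] <| dL (hd p) |> tl p"

lemma ok_path_last: "ok_path p \<Longrightarrow> last p \<in> Arr \<M>" "ok_path p \<Longrightarrow> hd p \<in> Arr \<M>"
  by (induction p rule: ok_path.induct) auto

lemma dR_path_simps [simp]:
  assumes "ok_path p"
  shows "ddom (dR_path p) = p @ [\<one> (Src \<M> (last p))]" "dcod (dR_path p) = p" "iso (dR_path p)" "ok (dR_path p)"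
proof -
  have ne: "p \<noteq> []" using assms by auto
  have p: "butlast p @ [last p] = p" using ne by simp
  have d: "butlast p @ ddom (dR (last p)) @ [] = p @ [\<one> (Src \<M> (last p))]"
    by (subst (3) p[symmetric]) simp
  show "ddom (dR_path p) = p @ [\<one> (Src \<M> (last p))]" "dcod (dR_path p) = p"
    using p d unfolding dR_path_def by (simp_all only: bounds unit_bounds append_Nil2)
  have "ok_path (p @ [\<one> (Src \<M> (last p))])" using assms ok_path_last[OF assms] by (simp add: ok_path_append ne)
  then show "iso (dR_path p)" unfolding dR_path_def using ok_path_last[OF assms]
    by (intro iso_dwhisker) (simp, simp only: d)
  then show "ok (dR_path p)" by (rule iso_ok)
qed

lemma dL_path_simps [simp]:
  assumes "ok_path p"
  shows "ddom (dL_path p) = \<one> (Trg \<M> (hd p)) # p" "dcod (dL_path p) = p" "iso (dL_path p)" "ok (dL_path p)"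
proof -
  have ne: "p \<noteq> []" using assms by auto
  then show "ddom (dL_path p) = \<one> (Trg \<M> (hd p)) # p" "dcod (dL_path p) = p" unfolding dL_path_def by simp_all
  have "ok_path (\<one> (Trg \<M> (hd p)) # p)" using assms ok_path_last[OF assms] by (simp add: ok_path_Cons ne)
  then show "iso (dL_path p)" unfolding dL_path_def using ne ok_path_last[OF assms]
    by (intro iso_dwhisker) simp_all
  then show "ok (dL_path p)" by (rule iso_ok)
qed

text \<open>
  By the coherence of the right unitor with composition, \<open>dR_path p\<close> is the right unitor of the composite
  of \<open>p\<close> up to rebracketing.  This is why it is natural (\<open>dR_path_natural\<close>).
\<close>

lemma dcell_dR_path:
  assumes "ok_path p"
  shows "dcell (dR_path p) \<cdot> join p [\<one> (Src \<M> (last p))] = \<rr> (path p)"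
  using assms
proof (induction p rule: ok_path.induct)
  case (2 f)
  then show ?case by (simp add: dR_path_def dcell_unit)
next
  case (3 f g p)
  let ?p = "g # p" and ?u = "[\<one> (Src \<M> (last (g # p)))]"
  have p [simp]: "ok_path ?p" "f \<in> Arr \<M>" "Src \<M> f = Trg \<M> (hd ?p)" using 3(2) by auto
  note l [simp] = ok_path_last[OF p(1)]
  have IH: "dcell (dR_path ?p) \<cdot> join ?p ?u = \<rr> (path ?p)" using 3 by simp
  have okp: "ok_path (?p @ ?u)" by (subst ok_path_append) (simp_all del: last.simps)
  have J: "join ?p ?u \<in> Cell \<M>" "Dom \<M> (join ?p ?u) = path ?p \<odot> path ?u"
    "Cod \<M> (join ?p ?u) = path (?p @ ?u)"
    by (intro join_simps'; simp del: last.simps)+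
  have eq: "dR_path (f # ?p) = [f] <| dR_path ?p |> []" by (simp add: dR_path_def dwhisker_dwhisker)
  have okf: "ok ([f] <| dR_path ?p |> [])" using okp by simp
  note [simp] = wt_cell_simps(3-5)[OF ok_wt_cell[OF dR_path_simps(4)[OF p(1)]]] okp J
  note [simp del] = path.simps join.simps list.sel last.simps ok_path.simps append_Cons
  have "dcell (dR_path (f # ?p)) \<cdot> join (f # ?p) ?u
    = (\<ii> f \<star> dcell (dR_path ?p)) \<cdot> (\<ii> f \<star> join ?p ?u) \<cdot> \<aa> f (path ?p) (path ?u)"
    unfolding eq using dcell_simps(2)[OF okf] by (simp add: join_Cons[of ?p])
  also have "\<dots> = (\<ii> f \<star> (dcell (dR_path ?p) \<cdot> join ?p ?u)) \<cdot> \<aa> f (path ?p) (path ?u)"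
    by (rule trans[OF hcomp_vcomp']) (simp_all add: path.simps ok_path.simps)
  also have "\<dots> = \<rr> (f \<odot> path ?p)"
    unfolding IH using unitor_right_comp[of "path ?p" f] by (simp add: path.simps)
  finally show ?case by (simp add: path_Cons[of ?p] last.simps)
qed simp

lemma dcell_dL_path:
  assumes "ok_path p" shows "dcell (dL_path p) = \<ll> (path p)"
proof (cases "tl p = []")
  case True
  with assms obtain f where "p = [f]" by (cases p) auto
  with assms show ?thesis by (simp add: dL_path_def dcell_unit)
next
  case False
  then obtain f q where p: "p = f # q" "q \<noteq> []" by (cases p) auto
  have q [simp]: "ok_path q" "f \<in> Arr \<M>" "Src \<M> f = Trg \<M> (hd q)" using assms p by (auto simp: ok_path_Cons)
  have "\<ll> (f \<odot> path q) \<cdot> \<aa> (\<one> (Trg \<M> f)) f (path q) = \<ll> f \<star> \<ii> (path q)"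
    using unitor_left_comp[of "path q" f] by simp
  then have "(\<ll> f \<star> \<ii> (path q)) \<cdot> \<ominus> (\<aa> (\<one> (Trg \<M> f)) f (path q)) = \<ll> (f \<odot> path q)"
    by (simp add: vassoc flip: \<open>_ = \<ll> f \<star> \<ii> (path q)\<close>)
  moreover have "dcell ([] <| dL f |> q) = (\<ll> f \<star> \<ii> (path q)) \<cdot> \<ominus> (\<aa> (\<one> (Trg \<M> f)) f (path q))"
    by (subst dcell_simps) (use p in \<open>simp_all add: ok_path_Cons dcell_unit whisker_right_eq path_Cons\<close>)
  ultimately show ?thesis using p by (simp add: dL_path_def path_Cons)
qed

lemma dR_path_natural:
  assumes P: "ok P"
  shows "([] <| P |> [\<one> (Src \<M> (last (ddom P)))]) ;; dR_path (dcod P) = dR_path (ddom P) ;; P"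
proof -
  let ?u = "[\<one> (Src \<M> (last (ddom P)))]"
  note n [simp] = ok_paths[OF P] wt_cell_simps(3-5)[OF ok_wt_cell[OF P]]
  note l [simp] = ok_path_last[OF n(1)] ok_path_last[OF n(2)]
  have [simp]: "ok_path (ddom P @ ?u)" "ok_path (dcod P @ ?u)" by (simp_all add: ok_path_append)
  have w: "wt_cell (ddom P @ ?u) (whisker_right (ddom P, dcell P, dcod P) ?u) (dcod P @ ?u)"
    by (rule wt_cell_whisker_right[OF ok_wt_cell[OF P]]) simp
  note [simp] = wt_cell_simps(3-5)[OF w] wt_cell_simps(3-5)[OF ok_wt_cell[OF dR_path_simps(4)[OF n(1)]]]
     wt_cell_simps(3-5)[OF ok_wt_cell[OF dR_path_simps(4)[OF n(2)]]]
  let ?w = "whisker_right (ddom P, dcell P, dcod P) ?u" and ?j = "join (ddom P) ?u"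
  have "(dcell (dR_path (dcod P)) \<cdot> ?w) \<cdot> ?j
    = dcell (dR_path (dcod P)) \<cdot> join (dcod P) ?u \<cdot> (dcell P \<star> \<ii> (path ?u))"
    using whisker_right_join[OF ok_wt_cell[OF P], of ?u] by (simp add: vassoc)
  also have "\<dots> = (dcell (dR_path (dcod P)) \<cdot> join (dcod P) ?u) \<cdot> (dcell P \<star> \<ii> (path ?u))"
    by (simp add: vassoc)
  also have "\<dots> = \<rr> (path (dcod P)) \<cdot> (dcell P \<star> \<ii> (path ?u))"
    using dcell_dR_path[OF n(2)] by simp
  also have "\<dots> = dcell P \<cdot> \<rr> (path (ddom P))"
    using run_nat[OF cellI, of "dcell P"] by simp
  also have "\<dots> = (dcell P \<cdot> dcell (dR_path (ddom P))) \<cdot> ?j"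
    using dcell_dR_path[OF n(1)] by (simp add: vassoc)
  finally have "dcell (dR_path (dcod P)) \<cdot> ?w = dcell P \<cdot> dcell (dR_path (ddom P))"
    by (rule vcomp_cancel_right[rotated -1]) (simp; fail)+
  then show ?thesis using P by (intro diagram_eqI) (simp_all add: dcell_simps)
qed

lemma dL_path_natural:
  assumes P: "ok P"
  shows "([\<one> (Trg \<M> (hd (ddom P)))] <| P |> []) ;; dL_path (dcod P) = dL_path (ddom P) ;; P"
proof -
  note n [simp] = ok_paths[OF P] wt_cell_simps(3-5)[OF ok_wt_cell[OF P]]
  note l [simp] = ok_path_last[OF n(1)] ok_path_last[OF n(2)]
  have "\<ll> (path (dcod P)) \<cdot> (\<ii> (\<one> (Trg \<M> (hd (ddom P)))) \<star> dcell P) = dcell P \<cdot> \<ll> (path (ddom P))"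
    using lun_nat[OF cellI, of "dcell P"] by simp
  then show ?thesis using P
    by (intro diagram_eqI) (simp_all add: dcell_simps dcell_dL_path ok_path_Cons)
qed

text \<open>
  The canonical cell that moves an identity arrow from the right end of a path to its left end,
  generalizing \<open>dswap\<close> from arrows to paths.  It is natural, and over a concatenation the identity arrow
  moves past one part after the other.
\<close>

definition dswap_path :: "'a list \<Rightarrow> ('a,'c) diagram" where "dswap_path p = dR_path p ;; dinv (dL_path p)"

lemma dswap_path_single: "f \<in> Arr \<M> \<Longrightarrow> dswap_path [f] = dswap f"
  by (simp add: dswap_path_def dswap_def dR_path_def dL_path_def)

lemma dswap_path_simps [simp]:
  assumes "ok_path p"
  shows "ddom (dswap_path p) = p @ [\<one> (Src \<M> (last p))]" "dcod (dswap_path p) = \<one> (Trg \<M> (hd p)) # p"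
    "iso (dswap_path p)" "ok (dswap_path p)"
proof -
  show "ddom (dswap_path p) = p @ [\<one> (Src \<M> (last p))]" "dcod (dswap_path p) = \<one> (Trg \<M> (hd p)) # p"
    using assms by (simp_all add: dswap_path_def)
  show "iso (dswap_path p)" unfolding dswap_path_def using assms by (intro iso_dcomp iso_dinv) simp_all
  then show "ok (dswap_path p)" by (rule iso_ok)
qed

lemma dswap_path_natural:
  assumes P: "ok P"
  shows "([] <| P |> [\<one> (Src \<M> (last (ddom P)))]) ;; dswap_path (dcod P)
       = dswap_path (ddom P) ;; ([\<one> (Trg \<M> (hd (ddom P)))] <| P |> [])"
proof -
  note n [simp] = ok_paths[OF P]
  let ?u = "\<one> (Trg \<M> (hd (ddom P)))"
  have okP: "ok ([?u] <| P |> [])" using P ok_path_last[OF n(1)] by (simp add: ok_path_Cons)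
  have "P ;; dinv (dL_path (dcod P)) = dinv (dL_path (ddom P)) ;; ([?u] <| P |> [])"
  proof (rule dcomp_cancel_left[of "dL_path (ddom P)"])
    have "dL_path (ddom P) ;; P ;; dinv (dL_path (dcod P))
      = ([?u] <| P |> []) ;; dL_path (dcod P) ;; dinv (dL_path (dcod P))"
      by (simp add: dL_path_natural[OF P, THEN dcomp_step] dcomp_assoc)
    also have "\<dots> = ([?u] <| P |> [])" using okP by (simp add: dinv_cancel)
    also have "\<dots> = did (ddom (dL_path (ddom P))) ;; ([?u] <| P |> [])" using okP by simp
    also have "\<dots> = dL_path (ddom P) ;; dinv (dL_path (ddom P)) ;; ([?u] <| P |> [])"
      by (simp add: dinv_cancel flip: dcomp_assoc)
    finally show "dL_path (ddom P) ;; P ;; dinv (dL_path (dcod P)) = dL_path (ddom P) ;; dinv (dL_path (ddom P)) ;; ([?u] <| P |> [])" .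
  qed (use okP P in simp_all)
  then show ?thesis
    by (simp add: dswap_path_def dcomp_assoc dR_path_natural[OF P, THEN dcomp_step])
qed

lemma dswap_path_append:
  assumes p: "ok_path p" and q: "ok_path q" and m: "Src \<M> (last p) = Trg \<M> (hd q)"
  shows "dswap_path (p @ q) = (p <| dswap_path q |> []) ;; ([] <| dswap_path p |> q)"
proof -
  have ne [simp]: "p \<noteq> []" "q \<noteq> []" using p q by auto
  note l [simp] = ok_path_last[OF p] ok_path_last[OF q] p q m
  have pq: "ok_path (p @ q)" by (simp add: ok_path_append)
  have R: "dR_path (p @ q) = p <| dR_path q |> []" by (simp add: dR_path_def dwhisker_dwhisker butlast_append)
  have L: "dL_path (p @ q) = [] <| dL_path p |> q" by (simp add: dL_path_def dwhisker_dwhisker)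
  \<comment> \<open>The identity arrow that the first factor inserts between \<open>p\<close> and \<open>q\<close> is removed by the second.\<close>
  have mid: "p <| dL_path q |> [] = [] <| dR_path p |> q"
  proof -
    have "[last p] <| dL (hd q) |> [] = [] <| dR (last p) |> [hd q]"
      by (rule unit_triangle) simp_all
    then have "butlast p <| ([last p] <| dL (hd q) |> []) |> tl q
      = butlast p <| ([] <| dR (last p) |> [hd q]) |> tl q" by simp
    then show ?thesis by (simp add: dL_path_def dR_path_def dwhisker_dwhisker)
  qed
  have ok1: "ok_path (p @ ddom (dL_path q) @ [])" using ok_path_append[of p "ddom (dL_path q)"] 
    by (simp add: ok_path_Cons)
  have ok2: "ok_path (ddom (dL_path p) @ q)" by (simp add: ok_path_Cons ok_path_append)
  have "(p <| dswap_path q |> []) ;; ([] <| dswap_path p |> q)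
     = (p <| dR_path q |> []) ;; dinv (p <| dL_path q |> []) ;; ([] <| dR_path p |> q) ;; dinv ([] <| dL_path p |> q)"
    using ok1 ok2 unfolding dswap_path_def by (simp add: dwhisker_dcomp dcomp_assoc dinv_dwhisker)
  also have "\<dots> = (p <| dR_path q |> []) ;; (dinv (p <| dL_path q |> []) ;; (p <| dL_path q |> [])) ;; dinv ([] <| dL_path p |> q)"
    unfolding mid by (simp add: dcomp_assoc)
  also have "\<dots> = (p <| dR_path q |> []) ;; dinv ([] <| dL_path p |> q)"
    using iso_dwhisker[OF dL_path_simps(3) ok1] iso_dwhisker[OF dL_path_simps(3), of p "[]" q] ok2
    by (simp add: dinv_cancel)
  finally show ?thesis unfolding dswap_path_def R L by simp
qed

lemma dswap_path_pair:
  assumes "f \<in> Arr \<M>" "g \<in> Arr \<M>" "Src \<M> f = Trg \<M> g"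
  shows "dswap_path [f, g] = ([f] <| dswap g |> []) ;; ([] <| dswap f |> [g])"
  using dswap_path_append[of "[f]" "[g]"] assms by (simp add: dswap_path_single)

lemma dswap_one: "A \<in> Obj \<M> \<Longrightarrow> dswap (\<one> A) = did [\<one> A, \<one> A]"
  by (intro diagram_eqI) (simp_all add: dcell_simps dswap_def dcell_unit unitors_one)

lemma dsingle_lun: "f \<in> Arr \<M> \<Longrightarrow> dsingle (\<ll> f) = dsplit (\<one> (Trg \<M> f)) f ;; dL f"
  and dsingle_run: "f \<in> Arr \<M> \<Longrightarrow> dsingle (\<rr> f) = dsplit f (\<one> (Src \<M> f)) ;; dR f"
  by (intro diagram_eqI; simp add: dcell_simps dcell_dsplit dcell_unit)+

lemma dswap_path_inv_natural:
  assumes P: "ok P"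
  shows "([\<one> (Trg \<M> (hd (ddom P)))] <| P |> []) ;; dinv (dswap_path (dcod P))
    = dinv (dswap_path (ddom P)) ;; ([] <| P |> [\<one> (Src \<M> (last (ddom P)))])"
proof (rule dcomp_cancel_left[of "dswap_path (ddom P)"])
  note n [simp] = ok_paths[OF P] ok_path_last[OF ok_paths(1)[OF P]] P
  let ?l = "[\<one> (Trg \<M> (hd (ddom P)))] <| P |> []" and ?r = "[] <| P |> [\<one> (Src \<M> (last (ddom P)))]"
  have ok: "ok ?l" "ok ?r" by (simp_all add: ok_path_Cons ok_path_append)
  show "ok (?l ;; dinv (dswap_path (dcod P)))" "ok (dinv (dswap_path (ddom P)) ;; ?r)" using ok by simp_all
  have "dswap_path (ddom P) ;; ?l ;; dinv (dswap_path (dcod P)) = ?r ;; dswap_path (dcod P) ;; dinv (dswap_path (dcod P))"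
    by (simp add: dswap_path_natural[OF P, THEN dcomp_step] dcomp_assoc)
  also have "\<dots> = dswap_path (ddom P) ;; dinv (dswap_path (ddom P)) ;; ?r"
    using ok by (simp add: dinv_cancel flip: dcomp_assoc)
  finally show "dswap_path (ddom P) ;; ?l ;; dinv (dswap_path (dcod P)) = dswap_path (ddom P) ;; dinv (dswap_path (ddom P)) ;; ?r" .
qed (use P in \<open>simp_all add: ok_paths\<close>)

lemma dinv_dswap_path_append:
  assumes p: "ok_path p" and q: "ok_path q" and m: "Src \<M> (last p) = Trg \<M> (hd q)"
  shows "dinv (dswap_path (p @ q)) = ([] <| dinv (dswap_path p) |> q) ;; (p <| dinv (dswap_path q) |> [])"
proof -
  have ne [simp]: "p \<noteq> []" "q \<noteq> []" using p q by auto
  note l [simp] = ok_path_last[OF p] ok_path_last[OF q] p q m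
  have ok1: "ok_path (p @ ddom (dswap_path q) @ [])" using ok_path_append[of p "ddom (dswap_path q)"]
    by (simp add: ok_path_append)
  have ok2: "ok_path ([] @ ddom (dswap_path p) @ q)" by (simp add: ok_path_Cons ok_path_append)
  show ?thesis unfolding dswap_path_append[OF assms]
    using iso_dwhisker[OF _ ok1] iso_dwhisker[OF _ ok2] ok1 ok2
    by (subst dinv_dcomp) (simp_all add: dinv_dwhisker)
qed

lemma dinv_did [simp]: "ok_path p \<Longrightarrow> dinv (did p) = did p"
proof (rule dinv_unique)
  assume p: "ok_path p"
  then show "iso (did p)" by (simp add: iso_def dcell_simps)
qed simp_all

text \<open>
  The mate of a commutative square whose vertical sides \<open>P\<close> and \<open>Q\<close> are invertible.
\<close>

lemma dcomp_inv_shift: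
  assumes "iso P" "iso Q" "ok R" "ok S" "P ;; R = S ;; Q" "dcod P = ddom R" "dcod S = ddom Q" "ddom P = ddom S" "dcod R = dcod Q"
  shows "R ;; dinv Q = dinv P ;; S"
proof (rule dcomp_cancel_left[OF assms(1)])
  have "P ;; R ;; dinv Q = (P ;; R) ;; dinv Q" by (simp only: dcomp_assoc)
  also have "\<dots> = S ;; Q ;; dinv Q" unfolding assms(5) by (simp only: dcomp_assoc)
  also have "\<dots> = S" unfolding dinv_cancel(1)[OF assms(2)] by (rule dcomp_did(2)[OF assms(4,7)])
  also have "\<dots> = did (ddom P) ;; S" by (rule dcomp_did(1)[symmetric, OF assms(4)]) (rule assms(8)[symmetric])
  also have "\<dots> = P ;; dinv P ;; S" unfolding dinv_cancel(1)[OF assms(1), symmetric] by (simp only: dcomp_assoc)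
  finally show "P ;; R ;; dinv Q = P ;; dinv P ;; S" .
qed (use assms in auto)

end

section \<open>Tensor products of diagrams\<close>

context tensor_bicategory
begin

lemma tensor_simps [simp]:
  assumes "f \<in> Arr \<M>" "f' \<in> Arr \<M>"
  shows "f \<otimes>\<^sub>1 f' \<in> Arr \<M>" "Src \<M> (f \<otimes>\<^sub>1 f') = Src \<M> f \<otimes>\<^sub>0 Src \<M> f'"
    "Trg \<M> (f \<otimes>\<^sub>1 f') = Trg \<M> f \<otimes>\<^sub>0 Trg \<M> f'"
  using tensor_arrow[of f _ _ f'] assms by (simp_all add: is_arrow_def)

lemma tensor_obj_simp [simp]: "A \<in> Obj \<M> \<Longrightarrow> B \<in> Obj \<M> \<Longrightarrow> A \<otimes>\<^sub>0 B \<in> Obj \<M>"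
  by (rule tensor_obj)

lemma tensor_cell_simps [simp]:
  assumes "\<theta> \<in> Cell \<M>" "\<theta>' \<in> Cell \<M>"
  shows "\<theta> \<otimes>\<^sub>2 \<theta>' \<in> Cell \<M>" "Dom \<M> (\<theta> \<otimes>\<^sub>2 \<theta>') = Dom \<M> \<theta> \<otimes>\<^sub>1 Dom \<M> \<theta>'"
    "Cod \<M> (\<theta> \<otimes>\<^sub>2 \<theta>') = Cod \<M> \<theta> \<otimes>\<^sub>1 Cod \<M> \<theta>'"
  using tensor_cell[of \<theta> _ _ \<theta>'] assms by (simp_all add: is_cell_def)

lemma tensor_id [simp]: "f \<in> Arr \<M> \<Longrightarrow> f' \<in> Arr \<M> \<Longrightarrow> \<ii> f \<otimes>\<^sub>2 \<ii> f' = \<ii> (f \<otimes>\<^sub>1 f')"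
  by (rule tensor_id_cell)

lemma tensor_vcomp':
  assumes "\<theta> \<in> Cell \<M>" "\<phi> \<in> Cell \<M>" "\<theta>' \<in> Cell \<M>" "\<phi>' \<in> Cell \<M>"
    "Dom \<M> \<phi> = Cod \<M> \<theta>" "Dom \<M> \<phi>' = Cod \<M> \<theta>'"
  shows "(\<phi> \<otimes>\<^sub>2 \<phi>') \<cdot> (\<theta> \<otimes>\<^sub>2 \<theta>') = (\<phi> \<cdot> \<theta>) \<otimes>\<^sub>2 (\<phi>' \<cdot> \<theta>')"
  using tensor_vcomp[of \<theta> _ _ \<phi> _ \<theta>' _ _ \<phi>'] assms by (simp add: is_cell_def)

lemma tensor_vcomp'':
  assumes "\<theta> \<in> Cell \<M>" "\<phi> \<in> Cell \<M>" "\<theta>' \<in> Cell \<M>" "\<phi>' \<in> Cell \<M>" "\<chi> \<in> Cell \<M>"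
    "Dom \<M> \<phi> = Cod \<M> \<theta>" "Dom \<M> \<phi>' = Cod \<M> \<theta>'" "Cod \<M> \<chi> = Dom \<M> \<theta> \<otimes>\<^sub>1 Dom \<M> \<theta>'"
  shows "(\<phi> \<otimes>\<^sub>2 \<phi>') \<cdot> (\<theta> \<otimes>\<^sub>2 \<theta>') \<cdot> \<chi> = ((\<phi> \<cdot> \<theta>) \<otimes>\<^sub>2 (\<phi>' \<cdot> \<theta>')) \<cdot> \<chi>"
  using assms by (simp add: tensor_vcomp' flip: vassoc)

lemma tensor_invertible [simp]:
  assumes "invertible \<theta>" "invertible \<theta>'"
  shows "invertible (\<theta> \<otimes>\<^sub>2 \<theta>')" "\<ominus> (\<theta> \<otimes>\<^sub>2 \<theta>') = \<ominus> \<theta> \<otimes>\<^sub>2 \<ominus> \<theta>'"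
  using assms invertible_cell[OF assms(1)] invertible_cell[OF assms(2)]
  by (auto intro!: invertibleI[of "\<theta> \<otimes>\<^sub>2 \<theta>'" "\<ominus> \<theta> \<otimes>\<^sub>2 \<ominus> \<theta>'"] simp: tensor_vcomp')

lemma tcomp_simps [simp]:
  assumes "f \<in> Arr \<M>" "g \<in> Arr \<M>" "f' \<in> Arr \<M>" "g' \<in> Arr \<M>" "Src \<M> g = Trg \<M> f" "Src \<M> g' = Trg \<M> f'"
  shows "invertible (TComp \<M> g g' f f')" "TComp \<M> g g' f f' \<in> Cell \<M>"
    "Dom \<M> (TComp \<M> g g' f f') = (g \<otimes>\<^sub>1 g') \<odot> (f \<otimes>\<^sub>1 f')"
    "Cod \<M> (TComp \<M> g g' f f') = (g \<odot> f) \<otimes>\<^sub>1 (g' \<odot> f')"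
  using tcomp_iso[of f _ _ g _ f' _ _ g'] assms invertible_cell
  by (auto simp add: is_iso_cell_iff is_arrow_def)

lemma tunit_simps [simp]:
  assumes "A \<in> Obj \<M>" "B \<in> Obj \<M>"
  shows "invertible (TUnit \<M> A B)" "TUnit \<M> A B \<in> Cell \<M>" "Dom \<M> (TUnit \<M> A B) = \<one> (A \<otimes>\<^sub>0 B)"
    "Cod \<M> (TUnit \<M> A B) = \<one> A \<otimes>\<^sub>1 \<one> B"
  using tunit_iso[OF assms] invertible_cell by (auto simp add: is_iso_cell_iff)

lemma tcomp_natural:
  assumes "\<theta> \<in> Cell \<M>" "\<phi> \<in> Cell \<M>" "\<theta>' \<in> Cell \<M>" "\<phi>' \<in> Cell \<M>"
    "Src \<M> (Dom \<M> \<phi>) = Trg \<M> (Dom \<M> \<theta>)" "Src \<M> (Dom \<M> \<phi>') = Trg \<M> (Dom \<M> \<theta>')"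
    "Dom \<M> \<theta> = f" "Dom \<M> \<phi> = g" "Dom \<M> \<theta>' = f'" "Dom \<M> \<phi>' = g'"
    "Cod \<M> \<theta> = k" "Cod \<M> \<phi> = h" "Cod \<M> \<theta>' = k'" "Cod \<M> \<phi>' = h'"
  shows "TComp \<M> h h' k k' \<cdot> ((\<phi> \<otimes>\<^sub>2 \<phi>') \<star> (\<theta> \<otimes>\<^sub>2 \<theta>')) = ((\<phi> \<star> \<theta>) \<otimes>\<^sub>2 (\<phi>' \<star> \<theta>')) \<cdot> TComp \<M> g g' f f'"
  using tcomp_nat[of \<theta> f k \<phi> g h \<theta>' f' k' \<phi>' g' h'] assms by (auto simp: is_cell_def)

lemma tcomp_assoc':
  assumes "f \<in> Arr \<M>" "g \<in> Arr \<M>" "h \<in> Arr \<M>" "f' \<in> Arr \<M>" "g' \<in> Arr \<M>" "h' \<in> Arr \<M>"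
    "Src \<M> g = Trg \<M> f" "Src \<M> g' = Trg \<M> f'" "Src \<M> h = Trg \<M> g" "Src \<M> h' = Trg \<M> g'"
  shows "TComp \<M> h h' (g \<odot> f) (g' \<odot> f') \<cdot> (\<ii> (h \<otimes>\<^sub>1 h') \<star> TComp \<M> g g' f f') \<cdot> \<aa> (h \<otimes>\<^sub>1 h') (g \<otimes>\<^sub>1 g') (f \<otimes>\<^sub>1 f')
    = (\<aa> h g f \<otimes>\<^sub>2 \<aa> h' g' f') \<cdot> TComp \<M> (h \<odot> g) (h' \<odot> g') f f' \<cdot> (TComp \<M> h h' g g' \<star> \<ii> (f \<otimes>\<^sub>1 f'))"
  using tcomp_assoc[of f _ _ g _ h _ f' _ _ g' _ h'] assms by (simp add: is_arrow_def)

lemma map2_ends [simp]: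
  "length p = length p' \<Longrightarrow> p \<noteq> [] \<Longrightarrow> hd (map2 F p p') = F (hd p) (hd p')"
  "length p = length p' \<Longrightarrow> p \<noteq> [] \<Longrightarrow> last (map2 F p p') = F (last p) (last p')"
  "length p = length p' \<Longrightarrow> (map2 F p p' = []) = (p = [])"
  by (induction p p' rule: list_induct2) auto

lemma ok_path_map2 [simp]:
  assumes "length p = length p'" "ok_path p" "ok_path p'"
  shows "ok_path (map2 (\<otimes>\<^sub>1) p p')"
  using assms
proof (induction p p' rule: list_induct2)
  case (Cons f p f' p')
  then have "p = [] \<longleftrightarrow> p' = []" by auto
  then show ?case using Cons by (cases "p = []") (auto simp: ok_path_Cons ok_path_last)
qed simp

lemma tjoin_Cons:
  "p \<noteq> [] \<Longrightarrow> p' \<noteq> [] \<Longrightarrow> tjoin (f # p) (f' # p')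
   = TComp \<M> f f' (path p) (path p') \<cdot> (\<ii> (f \<otimes>\<^sub>1 f') \<star> tjoin p p')"
  by (cases p; cases p') auto

lemma tjoin_typing:
  assumes "length p = length p'" "ok_path p" "ok_path p'"
  shows "invertible (tjoin p p') \<and> Dom \<M> (tjoin p p') = path (map2 (\<otimes>\<^sub>1) p p') \<and>
    Cod \<M> (tjoin p p') = path p \<otimes>\<^sub>1 path p'"
  using assms
proof (induction p p' rule: list_induct2)
  case (Cons f p f' p')
  show ?case
  proof (cases "p = []")
    case False
    then have "p' \<noteq> []" using Cons(1) by auto
    then have *: "ok_path p" "ok_path p'" "f \<in> Arr \<M>" "f' \<in> Arr \<M>" "Src \<M> f = Trg \<M> (hd p)" "Src \<M> f' = Trg \<M> (hd p')"
      using Cons False by (auto simp: ok_path_Cons)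
    note IH = Cons.IH[OF *(1,2)]
    show ?thesis using IH * False \<open>p' \<noteq> []\<close> Cons(1) invertible_cell[of "tjoin p p'"]
      by (simp add: tjoin_Cons path_Cons ok_path_last)
  qed (use Cons in auto)
qed simp

lemma tjoin_simps [simp]:
  assumes "length p = length p'" "ok_path p" "ok_path p'"
  shows "invertible (tjoin p p')" "tjoin p p' \<in> Cell \<M>" "Dom \<M> (tjoin p p') = path (map2 (\<otimes>\<^sub>1) p p')"
    "Cod \<M> (tjoin p p') = path p \<otimes>\<^sub>1 path p'"
  using tjoin_typing[OF assms] invertible_cell by auto

text \<open>
  The associativity axiom of the pseudofunctor \<open>\<otimes>\<close>, extended from three arrows to paths.  It relates
  the comparison of tensor products with path composition to the rebracketing by \<open>join\<close>.
\<close>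

lemma tjoin_append:
  assumes "length p = length p'" "ok_path p" "ok_path p'"
    and r: "length r = length r'" "ok_path r" "ok_path r'"
    and "Src \<M> (last p) = Trg \<M> (hd r)" "Src \<M> (last p') = Trg \<M> (hd r')"
  shows "tjoin (p @ r) (p' @ r') \<cdot> join (map2 (\<otimes>\<^sub>1) p p') (map2 (\<otimes>\<^sub>1) r r')
    = (join p r \<otimes>\<^sub>2 join p' r') \<cdot> TComp \<M> (path p) (path p') (path r) (path r') \<cdot> (tjoin p p' \<star> tjoin r r')"
  using assms(1,2,3,7,8)
proof (induction p p' rule: list_induct2)
  case (Cons f p f' p')
  have rn [simp]: "r \<noteq> []" "r' \<noteq> []" using r by auto
  show ?case
  proof (cases "p = []")
    case True
    then have "p' = []" using Cons(1) by auto
    show ?thesis using Cons(3-) True \<open>p' = []\<close> r by (simp add: tjoin_Cons path_Cons ok_path_last)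
  next
    case False
    then have pn [simp]: "p \<noteq> []" "p' \<noteq> []" using Cons(1) by auto
    have o [simp]: "ok_path p" "ok_path p'" "f \<in> Arr \<M>" "f' \<in> Arr \<M>" "Src \<M> f = Trg \<M> (hd p)" "Src \<M> f' = Trg \<M> (hd p')"
      "Src \<M> (last p) = Trg \<M> (hd r)" "Src \<M> (last p') = Trg \<M> (hd r')"
      using Cons(3-) False pn by (auto simp: ok_path_Cons)
    note [simp] = Cons(1) r
    define P P' R R' where "P = path p" and "P' = path p'" and "R = path r" and "R' = path r'"
    define PP RR where "PP = path (map2 (\<otimes>\<^sub>1) p p')" and "RR = path (map2 (\<otimes>\<^sub>1) r r')"
    define PR PR' PPRR where "PR = path (p @ r)" and "PR' = path (p' @ r')"
      and "PPRR = path (map2 (\<otimes>\<^sub>1) p p' @ map2 (\<otimes>\<^sub>1) r r')"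
    define j j' J where "j = join p r" and "j' = join p' r'" and "J = join (map2 (\<otimes>\<^sub>1) p p') (map2 (\<otimes>\<^sub>1) r r')"
    define tp tr tpr where "tp = tjoin p p'" and "tr = tjoin r r'" and "tpr = tjoin (p @ r) (p' @ r')"
    have l [simp]: "last p \<in> Arr \<M>" "last p' \<in> Arr \<M>" "last r \<in> Arr \<M>" "last r' \<in> Arr \<M>"
       "hd p \<in> Arr \<M>" "hd p' \<in> Arr \<M>" "hd r \<in> Arr \<M>" "hd r' \<in> Arr \<M>"
      by (simp_all add: ok_path_last)
    have opr [simp]: "ok_path (p @ r)" "ok_path (p' @ r')" by (simp_all add: ok_path_append)
    have a [simp]: "P \<in> Arr \<M>" "P' \<in> Arr \<M>" "R \<in> Arr \<M>" "R' \<in> Arr \<M>" "PP \<in> Arr \<M>" "RR \<in> Arr \<M>"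
      "PR \<in> Arr \<M>" "PR' \<in> Arr \<M>" "Trg \<M> (hd p) = Trg \<M> P" "Trg \<M> (hd p') = Trg \<M> P'"
      "Src \<M> P = Trg \<M> R" "Src \<M> P' = Trg \<M> R'" "Trg \<M> PR = Trg \<M> P" "Trg \<M> PR' = Trg \<M> P'"
      "Trg \<M> PP = Trg \<M> P \<otimes>\<^sub>0 Trg \<M> P'" "Src \<M> PP = Trg \<M> R \<otimes>\<^sub>0 Trg \<M> R'"
      "Trg \<M> RR = Trg \<M> R \<otimes>\<^sub>0 Trg \<M> R'"
      "PPRR \<in> Arr \<M>" "Trg \<M> PPRR = Trg \<M> P \<otimes>\<^sub>0 Trg \<M> P'"
      unfolding P_def P'_def R_def R'_def PP_def RR_def PR_def PR'_def PPRR_def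
      by (simp_all add: ok_path_append)
    have c [simp]: "j \<in> Cell \<M>" "Dom \<M> j = P \<odot> R" "Cod \<M> j = PR"
      "j' \<in> Cell \<M>" "Dom \<M> j' = P' \<odot> R'" "Cod \<M> j' = PR'"
      "J \<in> Cell \<M>" "Dom \<M> J = PP \<odot> RR" "Cod \<M> J = PPRR"
      "tp \<in> Cell \<M>" "Dom \<M> tp = PP" "Cod \<M> tp = P \<otimes>\<^sub>1 P'"
      "tr \<in> Cell \<M>" "Dom \<M> tr = RR" "Cod \<M> tr = R \<otimes>\<^sub>1 R'"
      "tpr \<in> Cell \<M>" "Dom \<M> tpr = PPRR" "Cod \<M> tpr = PR \<otimes>\<^sub>1 PR'"
      unfolding P_def P'_def R_def R'_def PP_def RR_def PR_def PR'_def PPRR_def j_def j'_def J_def tp_def tr_def tpr_def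
      by simp_all
    have IH: "tpr \<cdot> J = (j \<otimes>\<^sub>2 j') \<cdot> TComp \<M> P P' R R' \<cdot> (tp \<star> tr)"
      unfolding P_def P'_def R_def R'_def j_def j'_def J_def tp_def tr_def tpr_def
      using Cons.IH by simp
    have J1: "join (f # p) r = (\<ii> f \<star> j) \<cdot> \<aa> f P R"
      unfolding P_def R_def j_def by (rule join_Cons) (rule pn)
    have J2: "join (f' # p') r' = (\<ii> f' \<star> j') \<cdot> \<aa> f' P' R'"
      unfolding P'_def R'_def j'_def by (rule join_Cons) (rule pn)
    let ?T = "\<ii> (f \<otimes>\<^sub>1 f')"
    have "tjoin ((f # p) @ r) ((f' # p') @ r') \<cdot> join (map2 (\<otimes>\<^sub>1) (f # p) (f' # p')) (map2 (\<otimes>\<^sub>1) r r')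
      = (TComp \<M> f f' PR PR' \<cdot> (?T \<star> tpr)) \<cdot> ((?T \<star> J) \<cdot> \<aa> (f \<otimes>\<^sub>1 f') PP RR)"
      using tjoin_Cons[of "p @ r" "p' @ r'" f f'] join_Cons[of "map2 (\<otimes>\<^sub>1) p p'" "f \<otimes>\<^sub>1 f'"]
      by (simp add: PR_def PR'_def tpr_def J_def PP_def RR_def)
    also have "\<dots> = TComp \<M> f f' PR PR' \<cdot> (?T \<star> (tpr \<cdot> J)) \<cdot> \<aa> (f \<otimes>\<^sub>1 f') PP RR"
      by (simp add: vassoc hcomp_vcomp')
    also have "\<dots> = (TComp \<M> f f' PR PR' \<cdot> (?T \<star> (j \<otimes>\<^sub>2 j'))) \<cdot> (?T \<star> TComp \<M> P P' R R')
        \<cdot> ((?T \<star> (tp \<star> tr)) \<cdot> \<aa> (f \<otimes>\<^sub>1 f') PP RR)"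
      unfolding IH by (simp add: vassoc hcomp_vcomp')
    also have "(?T \<star> (tp \<star> tr)) \<cdot> \<aa> (f \<otimes>\<^sub>1 f') PP RR
        = \<aa> (f \<otimes>\<^sub>1 f') (P \<otimes>\<^sub>1 P') (R \<otimes>\<^sub>1 R') \<cdot> ((?T \<star> tp) \<star> tr)"
      by (rule assoc_natural[symmetric]) simp_all
    also have "TComp \<M> f f' PR PR' \<cdot> (?T \<star> (j \<otimes>\<^sub>2 j'))
        = ((\<ii> f \<star> j) \<otimes>\<^sub>2 (\<ii> f' \<star> j')) \<cdot> TComp \<M> f f' (P \<odot> R) (P' \<odot> R')"
      using tcomp_natural[OF _ _ _ _ _ _ refl refl refl refl refl refl refl refl,
        where \<theta>=j and \<phi>="\<ii> f" and \<theta>'=j' and \<phi>'="\<ii> f'"] by simp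
    also have "\<dots> \<cdot> (?T \<star> TComp \<M> P P' R R') \<cdot> \<aa> (f \<otimes>\<^sub>1 f') (P \<otimes>\<^sub>1 P') (R \<otimes>\<^sub>1 R') \<cdot> ((?T \<star> tp) \<star> tr)
      = ((\<ii> f \<star> j) \<otimes>\<^sub>2 (\<ii> f' \<star> j')) \<cdot> (TComp \<M> f f' (P \<odot> R) (P' \<odot> R') \<cdot> (?T \<star> TComp \<M> P P' R R')
        \<cdot> \<aa> (f \<otimes>\<^sub>1 f') (P \<otimes>\<^sub>1 P') (R \<otimes>\<^sub>1 R')) \<cdot> ((?T \<star> tp) \<star> tr)"
      by (simp add: vassoc)
    also have "\<dots> = (((\<ii> f \<star> j) \<otimes>\<^sub>2 (\<ii> f' \<star> j')) \<cdot> (\<aa> f P R \<otimes>\<^sub>2 \<aa> f' P' R'))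
        \<cdot> TComp \<M> (f \<odot> P) (f' \<odot> P') R R' \<cdot> ((TComp \<M> f f' P P' \<star> \<ii> (R \<otimes>\<^sub>1 R')) \<cdot> ((?T \<star> tp) \<star> tr))"
      by (subst tcomp_assoc') (simp_all add: vassoc)
    also have "((\<ii> f \<star> j) \<otimes>\<^sub>2 (\<ii> f' \<star> j')) \<cdot> (\<aa> f P R \<otimes>\<^sub>2 \<aa> f' P' R') = join (f # p) r \<otimes>\<^sub>2 join (f' # p') r'"
      by (simp add: tensor_vcomp' J1 J2)
    also have "(TComp \<M> f f' P P' \<star> \<ii> (R \<otimes>\<^sub>1 R')) \<cdot> ((?T \<star> tp) \<star> tr) = (TComp \<M> f f' P P' \<cdot> (?T \<star> tp)) \<star> tr"
      by (simp add: hcomp_vcomp)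
    also have "TComp \<M> f f' P P' \<cdot> (?T \<star> tp) = tjoin (f # p) (f' # p')"
      unfolding P_def P'_def tp_def by (rule tjoin_Cons[symmetric]) (rule pn)+
    finally show ?thesis unfolding P_def P'_def R_def R'_def tr_def
      by (simp only: path_Cons[OF pn(1)] path_Cons[OF pn(2)])
  qed
qed simp

text \<open>
  The length conditions are those under which \<open>tjoin\<close> is meaningful at both ends.
\<close>

definition dten :: "('a,'c) diagram \<Rightarrow> ('a,'c) diagram \<Rightarrow> ('a,'c) diagram"  (infixr "\<otimes>" 75)
  where "P \<otimes> Q = guard (map2 (\<otimes>\<^sub>1) (ddom P) (ddom Q))
    (ok P \<and> ok Q \<and> length (ddom P) = length (ddom Q) \<and> length (dcod P) = length (dcod Q))
    (\<ominus> (tjoin (dcod P) (dcod Q)) \<cdot> (dcell P \<otimes>\<^sub>2 dcell Q) \<cdot> tjoin (ddom P) (ddom Q))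
    (map2 (\<otimes>\<^sub>1) (dcod P) (dcod Q))"

lemma dten_bounds [simp]: "ddom (P \<otimes> Q) = map2 (\<otimes>\<^sub>1) (ddom P) (ddom Q)"
    "dcod (P \<otimes> Q) = map2 (\<otimes>\<^sub>1) (dcod P) (dcod Q)"
  by (simp_all add: dten_def)

lemma ok_dten [simp]: "ok (P \<otimes> Q) \<longleftrightarrow> ok P \<and> ok Q \<and> length (ddom P) = length (ddom Q) \<and>
    length (dcod P) = length (dcod Q)"
  using wt_cell_simps(1-5)[OF ok_wt_cell, of P] wt_cell_simps(1-5)[OF ok_wt_cell, of Q]
  by (auto simp: dten_def wt_cell_def)

lemma dcell_dten: "ok (P \<otimes> Q) \<Longrightarrow>
    dcell (P \<otimes> Q) = \<ominus> (tjoin (dcod P) (dcod Q)) \<cdot> (dcell P \<otimes>\<^sub>2 dcell Q) \<cdot> tjoin (ddom P) (ddom Q)"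
  unfolding ok_dten by (simp add: dten_def)

lemma dten_dcomp:
  assumes "ok P" "ok P'" "ok Q" "ok Q'" "dcod P = ddom P'" "dcod Q = ddom Q'"
    "length (ddom P) = length (ddom Q)" "length (dcod P) = length (dcod Q)" "length (dcod P') = length (dcod Q')"
  shows "(P ;; P') \<otimes> (Q ;; Q') = P \<otimes> Q ;; P' \<otimes> Q'"
proof -
  note [simp] = wt_cell_simps(1-5)[OF ok_wt_cell[OF assms(1)]] wt_cell_simps(1-5)[OF ok_wt_cell[OF assms(2)]]
    wt_cell_simps(1-5)[OF ok_wt_cell[OF assms(3)]] wt_cell_simps(1-5)[OF ok_wt_cell[OF assms(4)]]
  have [simp]: "length (ddom P') = length (ddom Q')" using assms by simp
  show ?thesis using assms by (intro diagram_eqI) (simp_all add: dcell_simps dcell_dten vassoc tensor_vcomp'')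
qed

lemma dten_did: "ok_path p \<Longrightarrow> ok_path q \<Longrightarrow> length p = length q \<Longrightarrow> did p \<otimes> did q = did (map2 (\<otimes>\<^sub>1) p q)"
  by (intro diagram_eqI) (simp_all add: dcell_simps dcell_dten)

lemma dten_Cons:
  assumes P: "ok P" and Q: "ok Q" and l: "length (ddom P) = length (ddom Q)" "length (dcod P) = length (dcod Q)"
    and f: "f \<in> Arr \<M>" "f' \<in> Arr \<M>" "Src \<M> f = Trg \<M> (hd (ddom P))" "Src \<M> f' = Trg \<M> (hd (ddom Q))"
  shows "([f] <| P |> []) \<otimes> ([f'] <| Q |> []) = [f \<otimes>\<^sub>1 f'] <| (P \<otimes> Q) |> []"
proof -
  note [simp] = ok_paths[OF P] ok_paths[OF Q] wt_cell_simps(3-5)[OF ok_wt_cell[OF P]] wt_cell_simps(3-5)[OF ok_wt_cell[OF Q]]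
    l f P Q
  have [simp]: "length (dcod P) = length (dcod Q)" by (fact l(2))
  note [simp] = ok_path_last[OF ok_paths(1)[OF P]] ok_path_last[OF ok_paths(1)[OF Q]]
     ok_path_last[OF ok_paths(2)[OF P]] ok_path_last[OF ok_paths(2)[OF Q]]
  let ?t = "tjoin (ddom P) (ddom Q)" and ?s = "tjoin (dcod P) (dcod Q)" and ?T = "\<ii> (f \<otimes>\<^sub>1 f')"
  let ?C = "TComp \<M> f f' (path (ddom P)) (path (ddom Q))" and ?D = "TComp \<M> f f' (path (dcod P)) (path (dcod Q))"
  have ok1: "ok (([f] <| P |> []) \<otimes> ([f'] <| Q |> []))" by (simp add: ok_path_Cons)
  have ok2: "ok ([f \<otimes>\<^sub>1 f'] <| (P \<otimes> Q) |> [])" by (simp add: ok_path_Cons)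
  have c1: "dcell ([f] <| P |> []) = \<ii> f \<star> dcell P" "dcell ([f'] <| Q |> []) = \<ii> f' \<star> dcell Q"
    by (subst dcell_simps; simp add: ok_path_Cons)+
  have "dcell (([f] <| P |> []) \<otimes> ([f'] <| Q |> []))
    = \<ominus> (?D \<cdot> (?T \<star> ?s)) \<cdot> ((\<ii> f \<star> dcell P) \<otimes>\<^sub>2 (\<ii> f' \<star> dcell Q)) \<cdot> ?C \<cdot> (?T \<star> ?t)"
    unfolding dcell_dten[OF ok1] c1 by (simp add: tjoin_Cons)
  also have "\<dots> = \<ominus> (?D \<cdot> (?T \<star> ?s)) \<cdot> (((\<ii> f \<star> dcell P) \<otimes>\<^sub>2 (\<ii> f' \<star> dcell Q)) \<cdot> ?C) \<cdot> (?T \<star> ?t)"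
    by (simp add: vassoc)
  also have "((\<ii> f \<star> dcell P) \<otimes>\<^sub>2 (\<ii> f' \<star> dcell Q)) \<cdot> ?C = ?D \<cdot> (?T \<star> (dcell P \<otimes>\<^sub>2 dcell Q))"
    using tcomp_natural[OF _ _ _ _ _ _ refl refl refl refl refl refl refl refl,
      where \<theta>="dcell P" and \<phi>="\<ii> f" and \<theta>'="dcell Q" and \<phi>'="\<ii> f'"] by simp
  also have "\<ominus> (?D \<cdot> (?T \<star> ?s)) \<cdot> (?D \<cdot> (?T \<star> (dcell P \<otimes>\<^sub>2 dcell Q))) \<cdot> (?T \<star> ?t)
     = (?T \<star> \<ominus> ?s) \<cdot> (?T \<star> (dcell P \<otimes>\<^sub>2 dcell Q)) \<cdot> (?T \<star> ?t)"
    by (simp add: vassoc)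
  also have "\<dots> = ?T \<star> (\<ominus> ?s \<cdot> (dcell P \<otimes>\<^sub>2 dcell Q) \<cdot> ?t)"
    by (simp add: hcomp_vcomp)
  also have "\<dots> = dcell ([f \<otimes>\<^sub>1 f'] <| (P \<otimes> Q) |> [])"
    using dcell_simps(2)[OF ok2] by (simp add: dcell_dten)
  finally show ?thesis using ok1 ok2 by (intro diagram_eqI) simp_all
qed

lemma dten_whisker_left:
  assumes "length l = length l'" and P: "ok P" and Q: "ok Q"
    and len: "length (ddom P) = length (ddom Q)" "length (dcod P) = length (dcod Q)"
    and "ok_path (l @ ddom P)" "ok_path (l' @ ddom Q)"
  shows "(l <| P |> []) \<otimes> (l' <| Q |> []) = map2 (\<otimes>\<^sub>1) l l' <| (P \<otimes> Q) |> []"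
  using assms(1,6,7)
proof (induction l l' rule: list_induct2)
  case (Cons f l f' l')
  have ne: "ddom P \<noteq> []" "ddom Q \<noteq> []" using ok_paths P Q by auto
  then have *: "ok_path (l @ ddom P)" "ok_path (l' @ ddom Q)" "f \<in> Arr \<M>" "f' \<in> Arr \<M>"
    "Src \<M> f = Trg \<M> (hd (l @ ddom P))" "Src \<M> f' = Trg \<M> (hd (l' @ ddom Q))"
    using Cons by (auto simp: ok_path_Cons)
  have "([f] <| (l <| P |> []) |> []) \<otimes> ([f'] <| (l' <| Q |> []) |> [])
    = [f \<otimes>\<^sub>1 f'] <| ((l <| P |> []) \<otimes> (l' <| Q |> [])) |> []"
    by (rule dten_Cons) (use * P Q len Cons(1) in simp_all)
  then show ?case unfolding Cons.IH[OF *(1,2)] by (simp add: dwhisker_dwhisker)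
qed (use assms(2-5) in simp)

text \<open>
  Both sides are compared after composition with \<open>join\<close>, where \<open>tjoin_append\<close> and the naturality of
  \<open>TComp\<close> apply.
\<close>

lemma dten_whisker_right:
  assumes P: "ok P" and Q: "ok Q"
    and len: "length (ddom P) = length (ddom Q)" "length (dcod P) = length (dcod Q)" "length r = length r'"
    and ok: "ok_path (ddom P @ r)" "ok_path (ddom Q @ r')"
  shows "([] <| P |> r) \<otimes> ([] <| Q |> r') = [] <| (P \<otimes> Q) |> map2 (\<otimes>\<^sub>1) r r'"
proof (cases "r = []")
  case True
  then show ?thesis using len P Q by simp
next
  case False
  then have [simp]: "r \<noteq> []" "r' \<noteq> []" using len by auto
  note [simp] = ok_paths[OF P] ok_paths[OF Q] wt_cell_simps(3-5)[OF ok_wt_cell[OF P]] wt_cell_simps(3-5)[OF ok_wt_cell[OF Q]]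
    len P Q
  have okr [simp]: "ok_path r" "ok_path r'" "Src \<M> (last (ddom P)) = Trg \<M> (hd r)" "Src \<M> (last (ddom Q)) = Trg \<M> (hd r')"
    using ok by (auto simp: ok_path_append)
  note [simp] = ok_path_last[OF ok_paths(1)[OF P]] ok_path_last[OF ok_paths(1)[OF Q]]
     ok_path_last[OF ok_paths(2)[OF P]] ok_path_last[OF ok_paths(2)[OF Q]] ok_path_last[OF okr(1)] ok_path_last[OF okr(2)]
  note [simp] = ok
  have [simp]: "ok_path (dcod P @ r)" "ok_path (dcod Q @ r')" by (simp_all add: ok_path_append)
  let ?p = "ddom P" and ?q = "dcod P" and ?p' = "ddom Q" and ?q' = "dcod Q"
  let ?pp = "map2 (\<otimes>\<^sub>1) ?p ?p'" and ?qq = "map2 (\<otimes>\<^sub>1) ?q ?q'" and ?rr = "map2 (\<otimes>\<^sub>1) r r'"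
  define w w' where "w = whisker_right (?p, dcell P, ?q) r" and "w' = whisker_right (?p', dcell Q, ?q') r'"
  have w: "wt_cell (?p @ r) w (?q @ r)" "wt_cell (?p' @ r') w' (?q' @ r')"
    unfolding w_def w'_def by (intro wt_cell_whisker_right ok_wt_cell P Q ok)+
  note [simp] = wt_cell_simps(3-5)[OF w(1)] wt_cell_simps(3-5)[OF w(2)]
  have wj: "w \<cdot> join ?p r = join ?q r \<cdot> (dcell P \<star> \<ii> (path r))" "w' \<cdot> join ?p' r' = join ?q' r' \<cdot> (dcell Q \<star> \<ii> (path r'))"
    unfolding w_def w'_def by (intro whisker_right_join ok_wt_cell P Q okr)+
  have ok1: "ok (([] <| P |> r) \<otimes> ([] <| Q |> r'))" by simp
  have okPQ: "ok (P \<otimes> Q)" by simp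
  note [simp] = wt_cell_simps(3-5)[OF ok_wt_cell[OF okPQ]]
  have okpp [simp]: "ok_path (?pp @ ?rr)" "ok_path (?qq @ ?rr)" by (simp_all add: ok_path_append)
  have ok2: "ok ([] <| (P \<otimes> Q) |> map2 (\<otimes>\<^sub>1) r r')" by simp
  define X where "X = dcell (([] <| P |> r) \<otimes> ([] <| Q |> r'))"
  have X: "X = \<ominus> (tjoin (?q @ r) (?q' @ r')) \<cdot> (w \<otimes>\<^sub>2 w') \<cdot> tjoin (?p @ r) (?p' @ r')"
    unfolding X_def dcell_dten[OF ok1] w_def w'_def by (simp add: dcell_simps)
  have Xpc: "wt_cell (?pp @ ?rr) X (?qq @ ?rr)" using ok_wt_cell[OF ok1] by (simp add: X_def)
  note [simp] = wt_cell_simps(3-5)[OF Xpc]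
  let ?C = "TComp \<M> (path ?p) (path ?p') (path r) (path r')" and ?D = "TComp \<M> (path ?q) (path ?q') (path r) (path r')"
  let ?jj = "join ?p r \<otimes>\<^sub>2 join ?p' r'" and ?ll = "join ?q r \<otimes>\<^sub>2 join ?q' r'"
  have "tjoin (?q @ r) (?q' @ r') \<cdot> (X \<cdot> join ?pp ?rr)
     = (w \<otimes>\<^sub>2 w') \<cdot> (tjoin (?p @ r) (?p' @ r') \<cdot> join ?pp ?rr)"
    unfolding X by (simp add: vassoc)
  also have "\<dots> = (w \<otimes>\<^sub>2 w') \<cdot> ?jj \<cdot> ?C \<cdot> (tjoin ?p ?p' \<star> tjoin r r')"
    by (simp add: tjoin_append)
  also have "\<dots> = ((w \<cdot> join ?p r) \<otimes>\<^sub>2 (w' \<cdot> join ?p' r')) \<cdot> ?C \<cdot> (tjoin ?p ?p' \<star> tjoin r r')"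
    by (simp add: tensor_vcomp'')
  also have "\<dots> = ?ll \<cdot> (((dcell P \<star> \<ii> (path r)) \<otimes>\<^sub>2 (dcell Q \<star> \<ii> (path r'))) \<cdot> ?C) \<cdot> (tjoin ?p ?p' \<star> tjoin r r')"
    unfolding wj by (simp add: tensor_vcomp'' vassoc)
  also have "((dcell P \<star> \<ii> (path r)) \<otimes>\<^sub>2 (dcell Q \<star> \<ii> (path r'))) \<cdot> ?C = ?D \<cdot> ((dcell P \<otimes>\<^sub>2 dcell Q) \<star> \<ii> (path r \<otimes>\<^sub>1 path r'))"
    using tcomp_natural[OF _ _ _ _ _ _ refl refl refl refl refl refl refl refl,
      where \<theta>="\<ii> (path r)" and \<phi>="dcell P" and \<theta>'="\<ii> (path r')" and \<phi>'="dcell Q"] by simp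
  also have "?ll \<cdot> (?D \<cdot> ((dcell P \<otimes>\<^sub>2 dcell Q) \<star> \<ii> (path r \<otimes>\<^sub>1 path r'))) \<cdot> (tjoin ?p ?p' \<star> tjoin r r')
     = ?ll \<cdot> ?D \<cdot> (((dcell P \<otimes>\<^sub>2 dcell Q) \<cdot> tjoin ?p ?p') \<star> tjoin r r')"
    by (simp add: vassoc hcomp_vcomp)
  also have "(dcell P \<otimes>\<^sub>2 dcell Q) \<cdot> tjoin ?p ?p' = tjoin ?q ?q' \<cdot> dcell (P \<otimes> Q)"
    unfolding dcell_dten[OF okPQ] by (simp add: vassoc)
  also have "?ll \<cdot> ?D \<cdot> ((tjoin ?q ?q' \<cdot> dcell (P \<otimes> Q)) \<star> tjoin r r')
    = (?ll \<cdot> ?D \<cdot> (tjoin ?q ?q' \<star> tjoin r r')) \<cdot> (dcell (P \<otimes> Q) \<star> \<ii> (path ?rr))"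
    by (simp add: vassoc hcomp_vcomp)
  also have "\<dots> = (tjoin (?q @ r) (?q' @ r') \<cdot> join ?qq ?rr) \<cdot> (dcell (P \<otimes> Q) \<star> \<ii> (path ?rr))"
    by (simp add: tjoin_append)
  also have "\<dots> = tjoin (?q @ r) (?q' @ r') \<cdot> (join ?qq ?rr \<cdot> (dcell (P \<otimes> Q) \<star> \<ii> (path ?rr)))"
    by (simp add: vassoc)
  finally have "X \<cdot> join ?pp ?rr = join ?qq ?rr \<cdot> (dcell (P \<otimes> Q) \<star> \<ii> (path ?rr))"
    by (rule vcomp_cancel_left[rotated -1]) (simp; fail)+
  then have "whisker_right (?pp, dcell (P \<otimes> Q), ?qq) ?rr = X"
    using ok_wt_cell[OF okPQ] by (intro whisker_right_unique) simp_all
  then have "dcell ([] <| (P \<otimes> Q) |> ?rr) = X"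
    using dcell_simps(2)[OF ok2] by simp
  then show ?thesis using ok1 ok2 by (intro diagram_eqI) (simp_all add: X_def)
qed

lemma dten_whisker:
  assumes P: "ok P" and Q: "ok Q"
    and len: "length (ddom P) = length (ddom Q)" "length (dcod P) = length (dcod Q)"
      "length l = length l'" "length r = length r'"
    and ok: "ok_path (l @ ddom P @ r)" "ok_path (l' @ ddom Q @ r')"
  shows "(l <| P |> r) \<otimes> (l' <| Q |> r') = map2 (\<otimes>\<^sub>1) l l' <| (P \<otimes> Q) |> map2 (\<otimes>\<^sub>1) r r'"
proof -
  note i = ok_path_inner[OF P ok(1)] ok_path_inner[OF Q ok(2)]
  have "(l <| ([] <| P |> r) |> []) \<otimes> (l' <| ([] <| Q |> r') |> [])
    = map2 (\<otimes>\<^sub>1) l l' <| (([] <| P |> r) \<otimes> ([] <| Q |> r')) |> []"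
    by (rule dten_whisker_left) (use P Q len ok i in simp_all)
  also have "([] <| P |> r) \<otimes> ([] <| Q |> r') = [] <| (P \<otimes> Q) |> map2 (\<otimes>\<^sub>1) r r'"
    by (rule dten_whisker_right) (use P Q len ok i in simp_all)
  finally show ?thesis by (simp add: dwhisker_dwhisker)
qed

lemma dten_dinv:
  assumes P: "iso P" and Q: "iso Q" and len: "length (ddom P) = length (ddom Q)" "length (dcod P) = length (dcod Q)"
  shows "iso (P \<otimes> Q)" "dinv (P \<otimes> Q) = dinv P \<otimes> dinv Q"
proof -
  note [simp] = wt_cell_simps(1-5)[OF ok_wt_cell[OF iso_ok[OF P]]] wt_cell_simps(1-5)[OF ok_wt_cell[OF iso_ok[OF Q]]]
    iso_ok[OF P] iso_ok[OF Q] len P Q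
  have [simp]: "invertible (dcell P)" "invertible (dcell Q)" using P Q by (auto simp: iso_def)
  show i: "iso (P \<otimes> Q)" by (simp add: iso_def dcell_dten)
  have "(P \<otimes> Q) ;; (dinv P \<otimes> dinv Q) = did (ddom (P \<otimes> Q))"
    by (subst dten_dcomp[symmetric]) (simp_all add: dinv_cancel dten_did)
  then show "dinv (P \<otimes> Q) = dinv P \<otimes> dinv Q"
    by (intro dinv_unique i) simp_all
qed

lemma dsingle_tensor: "\<theta> \<in> Cell \<M> \<Longrightarrow> \<phi> \<in> Cell \<M> \<Longrightarrow> dsingle (\<theta> \<otimes>\<^sub>2 \<phi>) = dsingle \<theta> \<otimes> dsingle \<phi>"
  by (intro diagram_eqI) (simp_all add: dcell_dten)

text \<open>
  Because the comparison \<open>tjoin\<close> of two paths of length two is \<open>TComp\<close> itself, the constraint \<open>Phi\<close> is a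
  tensor product of splittings, and its naturality is an instance of \<open>dten_dcomp\<close>.
\<close>

lemma diag_Phi:
  assumes "f \<in> Arr \<M>" "g \<in> Arr \<M>" "f' \<in> Arr \<M>" "g' \<in> Arr \<M>" "Src \<M> g = Trg \<M> f" "Src \<M> g' = Trg \<M> f'"
  shows "diag (Phi g g' f f') = dinv (dsplit g f) \<otimes> dinv (dsplit g' f')"
  unfolding Phi_def using assms
  by (intro diagram_eqI) (simp_all add: diag_simps wt_cell_def dcell_dten dcell_simps dcell_dsplit)

lemma diag_ptensor: "ok (diag P) \<Longrightarrow> ok (diag Q) \<Longrightarrow> length (ddom (diag P)) = length (ddom (diag Q)) \<Longrightarrow>
    length (dcod (diag P)) = length (dcod (diag Q)) \<Longrightarrow> diag (P \<boxtimes> Q) = diag P \<otimes> diag Q"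
  using ok_wt_cell[of "diag P \<otimes> diag Q"]
  by (cases P; cases Q) (auto intro!: diagram_eqI simp: diag_simps dcell_dten)

abbreviation dunit :: "'o \<Rightarrow> 'o \<Rightarrow> ('a,'c) diagram" where "dunit A B \<equiv> dsingle (TUnit \<M> A B)"

text \<open>
  The unit constraint of \<open>\<otimes>\<close> is not itself a tensor product of diagrams, since its source is a single
  identity arrow.  By the unit axioms of the pseudofunctor it can be absorbed into unit cells; this
  lemma, its mirror image \<open>dL_tensor\<close> and the consequence \<open>dswap_tensor\<close> are the rules for it.
\<close>

lemma dR_tensor:
  assumes "f \<in> Arr \<M>" "f' \<in> Arr \<M>"
  shows "([f \<otimes>\<^sub>1 f'] <| dunit (Src \<M> f) (Src \<M> f') |> []) ;; dR f \<otimes> dR f' = dR (f \<otimes>\<^sub>1 f')"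
  using assms tcomp_run[of f _ _ f'] 
  by (intro diagram_eqI) (simp_all add: dcell_simps dcell_dten dcell_unit is_arrow_def vassoc)

lemma dL_tensor:
  assumes "f \<in> Arr \<M>" "f' \<in> Arr \<M>"
  shows "([] <| dunit (Trg \<M> f) (Trg \<M> f') |> [f \<otimes>\<^sub>1 f']) ;; dL f \<otimes> dL f' = dL (f \<otimes>\<^sub>1 f')"
  using assms tcomp_lun[of f _ _ f']
  by (intro diagram_eqI) (simp_all add: dcell_simps dcell_dten dcell_unit is_arrow_def vassoc)

lemma dswap_tensor:
  assumes "f \<in> Arr \<M>" "f' \<in> Arr \<M>"
  shows "dswap (f \<otimes>\<^sub>1 f') ;; ([] <| dunit (Trg \<M> f) (Trg \<M> f') |> [f \<otimes>\<^sub>1 f'])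
    = ([f \<otimes>\<^sub>1 f'] <| dunit (Src \<M> f) (Src \<M> f') |> []) ;; dswap f \<otimes> dswap f'"
proof -
  let ?J = "[] <| dunit (Trg \<M> f) (Trg \<M> f') |> [f \<otimes>\<^sub>1 f']"
  note [simp] = assms
  have LL: "iso (dL f \<otimes> dL f')" "dinv (dL f \<otimes> dL f') = dinv (dL f) \<otimes> dinv (dL f')"
    by (rule dten_dinv; simp)+
  have J: "ok ?J" by simp
  have "dinv (dL (f \<otimes>\<^sub>1 f')) ;; ?J = dinv (dL f) \<otimes> dinv (dL f')"
  proof (rule dcomp_cancel_left[of "dL (f \<otimes>\<^sub>1 f')"])
    have "dL (f \<otimes>\<^sub>1 f') ;; dinv (dL (f \<otimes>\<^sub>1 f')) ;; ?J = ?J"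
      using J by (simp add: dinv_cancel flip: dcomp_assoc)
    also have "\<dots> = ?J ;; dL f \<otimes> dL f' ;; dinv (dL f) \<otimes> dinv (dL f')"
      using J LL(1) by (simp add: dinv_cancel(1) flip: LL(2))
    also have "\<dots> = dL (f \<otimes>\<^sub>1 f') ;; dinv (dL f) \<otimes> dinv (dL f')"
      by (rule dcomp_step) (use dL_tensor in simp)
    finally show "dL (f \<otimes>\<^sub>1 f') ;; dinv (dL (f \<otimes>\<^sub>1 f')) ;; ?J = dL (f \<otimes>\<^sub>1 f') ;; dinv (dL f) \<otimes> dinv (dL f')" .
  qed simp_all
  then have "dswap (f \<otimes>\<^sub>1 f') ;; ?J = dR (f \<otimes>\<^sub>1 f') ;; dinv (dL f) \<otimes> dinv (dL f')"
    by (simp add: dswap_def dcomp_assoc)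
  also have "\<dots> = ([f \<otimes>\<^sub>1 f'] <| dunit (Src \<M> f) (Src \<M> f') |> []) ;; dR f \<otimes> dR f' ;; dinv (dL f) \<otimes> dinv (dL f')"
    by (rule dcomp_step[OF dR_tensor, symmetric, unfolded dcomp_assoc]) simp_all
  also have "dR f \<otimes> dR f' ;; dinv (dL f) \<otimes> dinv (dL f') = dswap f \<otimes> dswap f'"
    unfolding dswap_def by (rule dten_dcomp[symmetric]) simp_all
  finally show ?thesis .
qed

lemma dswap_tensor_inv:
  assumes "f \<in> Arr \<M>" "f' \<in> Arr \<M>"
  shows "([] <| dunit (Trg \<M> f) (Trg \<M> f') |> [f \<otimes>\<^sub>1 f']) ;; dinv (dswap f) \<otimes> dinv (dswap f')
    = dinv (dswap (f \<otimes>\<^sub>1 f')) ;; ([f \<otimes>\<^sub>1 f'] <| dunit (Src \<M> f) (Src \<M> f') |> [])"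
proof -
  have i: "iso (dswap f \<otimes> dswap f')" "dinv (dswap f \<otimes> dswap f') = dinv (dswap f) \<otimes> dinv (dswap f')"
    by (rule dten_dinv; use assms in simp)+
  show ?thesis unfolding i(2)[symmetric]
    by (rule dcomp_inv_shift) (use i assms dswap_tensor[OF assms] in simp_all)
qed

text \<open>
  Carries the typing of the diagram along, so that the diagram of a compound path cell is found by
  resolution with \<open>rep_intros\<close> in a single pass.
\<close>

definition rep :: "('a,'c) pcell \<Rightarrow> ('a,'c) diagram \<Rightarrow> bool"
  where "rep P D \<longleftrightarrow> diag P = D \<and> ok D"

lemma rep_pthen: "rep P D \<Longrightarrow> rep Q E \<Longrightarrow> dcod D = ddom E \<Longrightarrow> rep (P \<Zsemi> Q) (D ;; E)"
  by (simp add: rep_def diag_pthen)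

lemma rep_whisker: "rep P D \<Longrightarrow> ok_path (l @ ddom D @ r) \<Longrightarrow> rep (l \<lhd> P \<rhd> r) (l <| D |> r)"
  by (auto simp add: rep_def diag_whisker)

lemma rep_pinv: "rep P D \<Longrightarrow> iso D \<Longrightarrow> rep (pinv P) (dinv D)"
  by (auto simp add: rep_def diag_pinv)

lemma rep_ptensor: "rep P D \<Longrightarrow> rep Q E \<Longrightarrow> length (ddom D) = length (ddom E) \<Longrightarrow>
    length (dcod D) = length (dcod E) \<Longrightarrow> rep (P \<boxtimes> Q) (D \<otimes> E)"
  by (auto simp add: rep_def diag_ptensor)

lemma rep_swap: "f \<in> Arr \<M> \<Longrightarrow> rep (swap f) (dswap f)"
  by (simp add: rep_def diag_swap)

lemma rep_split: "f \<in> Arr \<M> \<Longrightarrow> g \<in> Arr \<M> \<Longrightarrow> Src \<M> g = Trg \<M> f \<Longrightarrow> rep (split g f) (dsplit g f)"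
  using dsplit_simps(4)[of f g] by (simp add: rep_def dsplit_def)

lemma rep_single: "\<theta> \<in> Cell \<M> \<Longrightarrow> rep (single \<theta>) (dsingle \<theta>)"
  by (simp add: rep_def)

lemma rep_Phi:
  assumes "f \<in> Arr \<M>" "g \<in> Arr \<M>" "f' \<in> Arr \<M>" "g' \<in> Arr \<M>" "Src \<M> g = Trg \<M> f" "Src \<M> g' = Trg \<M> f'"
  shows "rep (Phi g g' f f') (dinv (dsplit g f) \<otimes> dinv (dsplit g' f'))"
  using assms by (simp add: rep_def diag_Phi)

lemmas rep_intros = rep_pthen rep_whisker rep_pinv rep_ptensor rep_swap rep_split rep_single rep_Phi

lemma rep_eq: "rep P D \<Longrightarrow> rep Q E \<Longrightarrow> P = Q \<longleftrightarrow> D = E"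
  using diag_inject[of P Q] by (auto simp: rep_def)

lemma rep_eqI: "rep P D \<Longrightarrow> rep Q E \<Longrightarrow> D = D' \<Longrightarrow> E = E' \<Longrightarrow> P = Q \<longleftrightarrow> D' = E'"
  using rep_eq by auto

lemma rep_transfer: "P = Q \<Longrightarrow> rep P D \<Longrightarrow> rep Q E \<Longrightarrow> D = D' \<Longrightarrow> E = E' \<Longrightarrow> D' = E'"
  using rep_eq by auto

lemma rep_mid: "rep P D \<Longrightarrow> dcell D = mid P"
  by (cases P) (auto simp: rep_def diag_simps)

lemma rep_cong: "rep P D \<Longrightarrow> D = D' \<Longrightarrow> rep P D'"
  by simp

text \<open>
  \<open>TComp\<close> rewritten by splittings, in the form in which it occurs as one factor of a tensor product.
\<close>

lemma dsplit_tensor: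
  assumes "f \<in> Arr \<M>" "g \<in> Arr \<M>" "f' \<in> Arr \<M>" "g' \<in> Arr \<M>" "Src \<M> g = Trg \<M> f" "Src \<M> g' = Trg \<M> f'"
  shows "dinv (dsplit (g \<otimes>\<^sub>1 g') (f \<otimes>\<^sub>1 f')) ;; dsingle (TComp \<M> g g' f f')
    = dinv (dsplit g f) \<otimes> dinv (dsplit g' f')"
  using assms
  by (intro diagram_eqI) (simp_all add: dcell_dten dcell_simps dcell_dsplit)

end

section \<open>The constraints of a monoidal bicategory\<close>

context monoidal_bicategory
begin

lemma equivalence_arrow: "is_equivalence \<M> f A B \<Longrightarrow> f \<in> Arr \<M> \<and> Src \<M> f = A \<and> Trg \<M> f = B"
  by (simp add: is_equivalence_def is_arrow_def)

lemma constraint_simps [simp]: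
  assumes "A \<in> Obj \<M>"
  shows "ru A \<in> Arr \<M>" "Src \<M> (ru A) = A \<otimes>\<^sub>0 \<I>" "Trg \<M> (ru A) = A"
    "lu A \<in> Arr \<M>" "Src \<M> (lu A) = \<I> \<otimes>\<^sub>0 A" "Trg \<M> (lu A) = A"
    "B \<in> Obj \<M> \<Longrightarrow> C \<in> Obj \<M> \<Longrightarrow> as A B C \<in> Arr \<M>"
    "B \<in> Obj \<M> \<Longrightarrow> C \<in> Obj \<M> \<Longrightarrow> Src \<M> (as A B C) = (A \<otimes>\<^sub>0 B) \<otimes>\<^sub>0 C"
    "B \<in> Obj \<M> \<Longrightarrow> C \<in> Obj \<M> \<Longrightarrow> Trg \<M> (as A B C) = A \<otimes>\<^sub>0 (B \<otimes>\<^sub>0 C)"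
  using equivalence_arrow[OF ru_equiv[OF assms]] equivalence_arrow[OF lu_equiv[OF assms]]
    equivalence_arrow[OF as_equiv[OF assms]] by auto

lemma unit_obj' [simp]: "\<I> \<in> Obj \<M>"
  by (rule unit_obj)

definition dAs :: "'a \<Rightarrow> 'a \<Rightarrow> 'a \<Rightarrow> ('a,'c) diagram" where "dAs f g h = diag (As\<^sub>n f g h)"
definition dRu :: "'a \<Rightarrow> ('a,'c) diagram" where "dRu f = diag (Ru\<^sub>n f)"

lemma dAs_bounds [simp]:
  "ddom (dAs f g h) = [as (Trg \<M> f) (Trg \<M> g) (Trg \<M> h), (f \<otimes>\<^sub>1 g) \<otimes>\<^sub>1 h]"
  "dcod (dAs f g h) = [f \<otimes>\<^sub>1 (g \<otimes>\<^sub>1 h), as (Src \<M> f) (Src \<M> g) (Src \<M> h)]"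
  by (simp_all add: dAs_def As\<^sub>n_def diag_simps)

lemma iso_dAs [simp]: "f \<in> Arr \<M> \<Longrightarrow> g \<in> Arr \<M> \<Longrightarrow> h \<in> Arr \<M> \<Longrightarrow> iso (dAs f g h)"
  using asn_iso[of f g h] invertible_cell
  by (auto simp: dAs_def As\<^sub>n_def iso_diag is_iso_pcell_def is_iso_cell_iff wt_cell_def)

lemma ok_dAs [simp]: "f \<in> Arr \<M> \<Longrightarrow> g \<in> Arr \<M> \<Longrightarrow> h \<in> Arr \<M> \<Longrightarrow> ok (dAs f g h)"
  by (simp add: iso_ok)

lemma dRu_bounds [simp]:
  "ddom (dRu f) = [ru (Trg \<M> f), f \<otimes>\<^sub>1 \<one> \<I>]" "dcod (dRu f) = [f, ru (Src \<M> f)]"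
  by (simp_all add: dRu_def Ru\<^sub>n_def diag_simps)

lemma iso_dRu [simp]: "f \<in> Arr \<M> \<Longrightarrow> iso (dRu f)"
  using run_iso'[of f] invertible_cell
  by (auto simp: dRu_def Ru\<^sub>n_def iso_diag is_iso_pcell_def is_iso_cell_iff wt_cell_def)

lemma ok_dRu [simp]: "f \<in> Arr \<M> \<Longrightarrow> ok (dRu f)"
  by (simp add: iso_ok)

lemma rep_As: "f \<in> Arr \<M> \<Longrightarrow> g \<in> Arr \<M> \<Longrightarrow> h \<in> Arr \<M> \<Longrightarrow> rep (As\<^sub>n f g h) (dAs f g h)"
  using ok_dAs[of f g h] by (simp add: rep_def dAs_def)

lemma rep_Ru: "f \<in> Arr \<M> \<Longrightarrow> rep (Ru\<^sub>n f) (dRu f)"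
  using ok_dRu[of f] by (simp add: rep_def dRu_def)

lemma dAs_natural:
  assumes "\<theta> \<in> Cell \<M>" "\<phi> \<in> Cell \<M>" "\<psi> \<in> Cell \<M>"
    "Dom \<M> \<theta> = f" "Cod \<M> \<theta> = f'" "Dom \<M> \<phi> = g" "Cod \<M> \<phi> = g'" "Dom \<M> \<psi> = h" "Cod \<M> \<psi> = h'"
  shows "([as (Trg \<M> f) (Trg \<M> g) (Trg \<M> h)] <| ((dsingle \<theta> \<otimes> dsingle \<phi>) \<otimes> dsingle \<psi>) |> []) ;; dAs f' g' h'
    = dAs f g h ;; ([] <| (dsingle \<theta> \<otimes> (dsingle \<phi> \<otimes> dsingle \<psi>)) |> [as (Src \<M> f) (Src \<M> g) (Src \<M> h)])"
proof -
  have f: "f \<in> Arr \<M>" "f' \<in> Arr \<M>" "g \<in> Arr \<M>" "g' \<in> Arr \<M>" "h \<in> Arr \<M>" "h' \<in> Arr \<M>"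
    "Src \<M> f' = Src \<M> f" "Src \<M> g' = Src \<M> g" "Src \<M> h' = Src \<M> h"
    "Trg \<M> f' = Trg \<M> f" "Trg \<M> g' = Trg \<M> g" "Trg \<M> h' = Trg \<M> h"
    using assms boundary_simps by auto
  note [simp] = f assms
  show ?thesis
    by (rule rep_transfer[OF asn_nat[of \<theta> f f' \<phi> g g' \<psi> h h']])
      (rule rep_intros rep_As | (simp add: dsingle_tensor is_cell_def; fail))+
qed

text \<open>
  Pseudonaturality of the associator for composite arrows, once every constraint of \<open>\<otimes>\<close> is expressed
  by splittings.
\<close>

lemma dAs_comp:
  assumes "f \<in> Arr \<M>" "f' \<in> Arr \<M>" "g \<in> Arr \<M>" "g' \<in> Arr \<M>" "h \<in> Arr \<M>" "h' \<in> Arr \<M>"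
    "Src \<M> f' = Trg \<M> f" "Src \<M> g' = Trg \<M> g" "Src \<M> h' = Trg \<M> h"
  shows "([as (Trg \<M> f') (Trg \<M> g') (Trg \<M> h')] <|
      ((dinv (dsplit f' f) \<otimes> dinv (dsplit g' g)) \<otimes> dinv (dsplit h' h)) |> []) ;; dAs (f' \<odot> f) (g' \<odot> g) (h' \<odot> h)
    = ([] <| dAs f' g' h' |> [(f \<otimes>\<^sub>1 g) \<otimes>\<^sub>1 h]) ;; ([f' \<otimes>\<^sub>1 (g' \<otimes>\<^sub>1 h')] <| dAs f g h |> [])
      ;; ([] <| (dinv (dsplit f' f) \<otimes> (dinv (dsplit g' g) \<otimes> dinv (dsplit h' h))) |> [as (Src \<M> f) (Src \<M> g) (Src \<M> h)])"
proof -
  note [simp] = assms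
  let ?a = "as (Trg \<M> f') (Trg \<M> g') (Trg \<M> h')" and ?b = "as (Src \<M> f) (Src \<M> g) (Src \<M> h)"
  let ?F = "dinv (dsplit f' f)" and ?G = "dinv (dsplit g' g)" and ?H = "dinv (dsplit h' h)"
  have "dinv (dsplit (f' \<otimes>\<^sub>1 g') (f \<otimes>\<^sub>1 g)) \<otimes> ?H ;; dsingle (TComp \<M> f' g' f g \<otimes>\<^sub>2 \<ii> (h' \<odot> h))
    = (dinv (dsplit (f' \<otimes>\<^sub>1 g') (f \<otimes>\<^sub>1 g)) ;; dsingle (TComp \<M> f' g' f g)) \<otimes> (?H ;; did [h' \<odot> h])"
    by (subst dten_dcomp) (simp_all add: dsingle_tensor dsingle_id)
  then have 1: "dinv (dsplit (f' \<otimes>\<^sub>1 g') (f \<otimes>\<^sub>1 g)) \<otimes> ?H ;; dsingle (TComp \<M> f' g' f g \<otimes>\<^sub>2 \<ii> (h' \<odot> h)) = (?F \<otimes> ?G) \<otimes> ?H"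
    by (simp add: dsplit_tensor)
  have "?F \<otimes> dinv (dsplit (g' \<otimes>\<^sub>1 h') (g \<otimes>\<^sub>1 h)) ;; dsingle (\<ii> (f' \<odot> f) \<otimes>\<^sub>2 TComp \<M> g' h' g h)
    = (?F ;; did [f' \<odot> f]) \<otimes> (dinv (dsplit (g' \<otimes>\<^sub>1 h') (g \<otimes>\<^sub>1 h)) ;; dsingle (TComp \<M> g' h' g h))"
    by (subst dten_dcomp) (simp_all add: dsingle_tensor dsingle_id)
  then have 2: "?F \<otimes> dinv (dsplit (g' \<otimes>\<^sub>1 h') (g \<otimes>\<^sub>1 h)) ;; dsingle (\<ii> (f' \<odot> f) \<otimes>\<^sub>2 TComp \<M> g' h' g h) = ?F \<otimes> (?G \<otimes> ?H)"
    by (simp add: dsplit_tensor)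
  show ?thesis unfolding 1[symmetric] 2[symmetric]
    by (rule rep_transfer[OF asn_comp[of f _ _ f' _ g _ _ g' _ h _ _ h']])
      (rule rep_intros rep_As | (simp add: dwhisker_dcomp dcomp_assoc is_arrow_def; fail))+
qed

lemma dAs_unit:
  assumes "A \<in> Obj \<M>" "B \<in> Obj \<M>" "C \<in> Obj \<M>"
  shows "([as A B C] <| dunit (A \<otimes>\<^sub>0 B) C |> []) ;; ([as A B C] <| (dunit A B \<otimes> did [\<one> C]) |> [])
      ;; dAs (\<one> A) (\<one> B) (\<one> C)
    = dswap (as A B C) ;; ([] <| dunit A (B \<otimes>\<^sub>0 C) |> [as A B C])
      ;; ([] <| (did [\<one> A] \<otimes> dunit B C) |> [as A B C])"
proof -
  note [simp] = assms
  show ?thesis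
    by (rule rep_transfer[OF asn_unit[OF assms]])
      (rule rep_intros rep_As | (simp add: dsingle_tensor dsingle_id dcomp_assoc; fail))+
qed

text \<open>
  On the factor \<open>\<I>\<close> the splitting of \<open>1 \<odot> 1\<close> and the left unitor combine to \<open>dL 1\<close>.
\<close>

lemma dRu_comp:
  assumes "f \<in> Arr \<M>" "g \<in> Arr \<M>" "Src \<M> g = Trg \<M> f"
  shows "([ru (Trg \<M> g)] <| (dinv (dsplit g f) \<otimes> dL (\<one> \<I>)) |> []) ;; dRu (g \<odot> f)
    = ([] <| dRu g |> [f \<otimes>\<^sub>1 \<one> \<I>]) ;; ([g] <| dRu f |> []) ;; ([] <| dinv (dsplit g f) |> [ru (Src \<M> f)])"
proof -
  note [simp] = assms
  let ?S = "dinv (dsplit g f)" and ?U = "dinv (dsplit (\<one> \<I>) (\<one> \<I>))"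
  have "?U ;; dsingle (\<ll> (\<one> \<I>)) = dL (\<one> \<I>)"
    using dsingle_lun[of "\<one> \<I>"] by (simp add: dinv_cancel flip: dcomp_assoc)
  then have 1: "(?S \<otimes> ?U) ;; dsingle (\<ii> (g \<odot> f) \<otimes>\<^sub>2 \<ll> (\<one> \<I>)) = ?S \<otimes> dL (\<one> \<I>)"
    by (simp add: dsingle_tensor dsingle_id flip: dten_dcomp)
  show ?thesis unfolding 1[symmetric]
    by (rule rep_transfer[OF run_comp[of f _ _ g]])
      (rule rep_intros rep_Ru | (simp add: dwhisker_dcomp dcomp_assoc is_arrow_def; fail))+
qed

lemma dRu_unit:
  assumes "A \<in> Obj \<M>"
  shows "([ru A] <| dunit A \<I> |> []) ;; dRu (\<one> A) = dswap (ru A)"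
proof -
  note [simp] = assms
  show ?thesis
    by (rule rep_transfer[OF run_unit[OF assms]]) (rule rep_intros rep_Ru | (simp; fail))+
qed

end

section \<open>Comodules and the laws of an opmonoidal monad\<close>

locale comodule_setting = monoidal_bicategory \<M>
  for \<M> :: "('o,'a,'c,'z) monoidal_bicategory_data_scheme" (structure) +
  fixes M :: "('o,'a,'c) skew_monoidale"
    and a :: "('o,'a,'c) action"
    and B :: "('a,'c) opmonoidal"
    and \<mu> \<eta> :: 'c
  assumes skew: "right_skew_monoidale M"
    and action: "oplax_right_action M a"
    and monad: "opmonoidal_monad M B \<mu> \<eta>"
begin

abbreviation A :: 'o where "A \<equiv> aobj a"
abbreviation X :: 'o where "X \<equiv> carrier M"
abbreviation ac :: 'a where "ac \<equiv> act a"
abbreviation m :: 'a where "m \<equiv> mul M"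
abbreviation u :: 'a where "u \<equiv> unit M"
abbreviation b :: 'a where "b \<equiv> oarr B"

lemma arrows [simp]:
  "A \<in> Obj \<M>" "X \<in> Obj \<M>"
  "ac \<in> Arr \<M>" "Src \<M> ac = A \<otimes>\<^sub>0 X" "Trg \<M> ac = A"
  "m \<in> Arr \<M>" "Src \<M> m = X \<otimes>\<^sub>0 X" "Trg \<M> m = X"
  "u \<in> Arr \<M>" "Src \<M> u = \<I>" "Trg \<M> u = X"
  "b \<in> Arr \<M>" "Src \<M> b = X" "Trg \<M> b = X"
proof -
  have "action_axioms M a" using action by (simp add: oplax_right_action_def)
  then show "A \<in> Obj \<M>" and ac: "ac \<in> Arr \<M>" "Src \<M> ac = A \<otimes>\<^sub>0 X" "Trg \<M> ac = A"
    by (auto simp: action_axioms_def Let_def is_arrow_def)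
  have "action_axioms M (regular M)" and u: "is_arrow \<M> u \<I> X"
    using skew by (simp_all add: right_skew_monoidale_def Let_def)
  then show "X \<in> Obj \<M>" "m \<in> Arr \<M>" "Src \<M> m = X \<otimes>\<^sub>0 X" "Trg \<M> m = X"
    by (auto simp: action_axioms_def Let_def is_arrow_def regular_def)
  show "u \<in> Arr \<M>" "Src \<M> u = \<I>" "Trg \<M> u = X" using u by (simp_all add: is_arrow_def)
  have "opmonoidal_arrow M M B" using monad by (simp add: opmonoidal_monad_def)
  then have "comodule_axioms M M B (regular M) (regular M) (b, op2 B)"
    by (simp add: opmonoidal_arrow_def)
  then have "is_arrow \<M> b X X" by (auto simp: comodule_axioms_def Let_def regular_def)
  then show "b \<in> Arr \<M>" "Src \<M> b = X" "Trg \<M> b = X" by (simp_all add: is_arrow_def)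
qed

text \<open>
  The multiplication becomes a diagram on the path \<open>[b, b]\<close>, so that the arrow \<open>b \<odot> b\<close> never occurs
  in calculations; \<open>dop0\<close> contains \<open>B\<^sup>0\<close> followed by an inserted identity arrow, so that it can be
  tensored with \<open>dswap\<close>.
\<close>

definition dact2 :: "('a,'c) diagram" where "dact2 = diag (Act2 M a)"
definition dact0 :: "('a,'c) diagram" where "dact0 = diag (Act0 M a)"
definition dop2 :: "('a,'c) diagram" where "dop2 = diag (Op2 M M B)"
definition dop0 :: "('a,'c) diagram" where "dop0 = diag (Op0' M M B)"
definition dmu :: "('a,'c) diagram" where "dmu = dinv (dsplit b b) ;; dsingle \<mu>"
definition deta :: "('a,'c) diagram" where "deta = dsingle \<eta>"
definition dco :: "'a \<times> 'c \<Rightarrow> ('a,'c) diagram" where "dco Yy = diag (Coact B a a Yy)"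

lemma bound_simps [simp]:
  "ddom dact2 = [ac, \<one> A \<otimes>\<^sub>1 m, as A X X]" "dcod dact2 = [ac, ac \<otimes>\<^sub>1 \<one> X]"
  "ddom dact0 = [ac, \<one> A \<otimes>\<^sub>1 u]" "dcod dact0 = [ru A]"
  "ddom dop2 = [b, m]" "dcod dop2 = [m, b \<otimes>\<^sub>1 b]"
  "ddom dop0 = [b, u]" "dcod dop0 = [u, \<one> \<I>]"
  "ddom (dco Yy) = [fst Yy, ac]" "dcod (dco Yy) = [ac, fst Yy \<otimes>\<^sub>1 b]"
  by (simp_all add: dact2_def dact0_def dop2_def dop0_def dco_def Act2_def Act0_def Op2_def Op0'_def Coact_def diag_simps)

lemma cell_types [simp]: "op2 B \<in> Cell \<M>" "Dom \<M> (op2 B) = b \<odot> m" "Cod \<M> (op2 B) = m \<odot> (b \<otimes>\<^sub>1 b)"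
    "op0 B \<in> Cell \<M>" "Dom \<M> (op0 B) = b \<odot> u" "Cod \<M> (op0 B) = u"
    "\<mu> \<in> Cell \<M>" "Dom \<M> \<mu> = b \<odot> b" "Cod \<M> \<mu> = b"
    "\<eta> \<in> Cell \<M>" "Dom \<M> \<eta> = \<one> X" "Cod \<M> \<eta> = b"
proof -
  have o: "opmonoidal_arrow M M B" using monad by (simp add: opmonoidal_monad_def)
  then have "comodule_axioms M M B (regular M) (regular M) (b, op2 B)" "is_pcell (Op0 M M B)"
    by (simp_all add: opmonoidal_arrow_def)
  then have "is_cell \<M> (op2 B) (b \<odot> m) (m \<odot> (b \<otimes>\<^sub>1 b))" "is_cell \<M> (op0 B) (b \<odot> u) u"
    by (auto simp: comodule_axioms_def Let_def regular_def is_pcell_def Coact_def Op0_def)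
  then show "op2 B \<in> Cell \<M>" "Dom \<M> (op2 B) = b \<odot> m" "Cod \<M> (op2 B) = m \<odot> (b \<otimes>\<^sub>1 b)"
    "op0 B \<in> Cell \<M>" "Dom \<M> (op0 B) = b \<odot> u" "Cod \<M> (op0 B) = u"
    by (simp_all add: is_cell_def)
  show "\<mu> \<in> Cell \<M>" "Dom \<M> \<mu> = b \<odot> b" "Cod \<M> \<mu> = b"
    "\<eta> \<in> Cell \<M>" "Dom \<M> \<eta> = \<one> X" "Cod \<M> \<eta> = b"
    using monad by (auto simp: opmonoidal_monad_def opmonoidal_cell_def opmonoidal_comp_def opmonoidal_id_def is_cell_def)
qed

lemma ok_simps [simp]: "ok dact2" "ok dact0" "ok dop2" "ok dop0" "ok dmu" "ok deta"
  "ddom dmu = [b, b]" "dcod dmu = [b]" "ddom deta = [\<one> X]" "dcod deta = [b]"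
proof -
  have "action_axioms M a" using action by (simp add: oplax_right_action_def)
  then have "is_pcell (Act2 M a)" "is_pcell (Act0 M a)" by (auto simp: action_axioms_def Let_def)
  then show "ok dact2" "ok dact0"
    by (simp_all add: dact2_def dact0_def Act2_def Act0_def is_pcell_def is_cell_def diag_simps wt_cell_def)
  show "ok dop2" "ok dop0"
    by (simp_all add: dop2_def dop0_def Op2_def Op0'_def diag_simps wt_cell_def)
qed (simp_all add: dmu_def deta_def)

lemma rep_data:
  "rep (Act2 M a) dact2" "rep (Act0 M a) dact0" "rep (Op2 M M B) dop2" "rep (Op0' M M B) dop0"
  using ok_simps by (simp_all add: rep_def dact2_def dact0_def dop2_def dop0_def)

lemma rep_Coact: "ok (dco Yy) \<Longrightarrow> rep (Coact B a a Yy) (dco Yy)"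
  by (simp add: rep_def dco_def)

text \<open>
  The notion of comodule for a coaction that is given as a diagram \<open>D\<close>.  Coactions of tensor products
  arise in this form, and \<open>comodule_iff\<close> translates back.
\<close>

definition dcomodule :: "'a \<Rightarrow> ('a,'c) diagram \<Rightarrow> bool"
  where "dcomodule Y D \<longleftrightarrow> is_arrow \<M> Y A A \<and> ok D \<and> ddom D = [Y, ac] \<and> dcod D = [ac, Y \<otimes>\<^sub>1 b] \<and>
    ([Y] <| dact2 |> []) ;; ([] <| D |> [ac \<otimes>\<^sub>1 \<one> X]) ;; ([ac] <| (D \<otimes> dswap b) |> [])
    = ([] <| D |> [\<one> A \<otimes>\<^sub>1 m, as A X X]) ;; ([ac] <| (dswap Y \<otimes> dop2) |> [as A X X])
      ;; ([ac, \<one> A \<otimes>\<^sub>1 m] <| dinv (dAs Y b b) |> []) ;; ([] <| dact2 |> [(Y \<otimes>\<^sub>1 b) \<otimes>\<^sub>1 b]) \<and>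
    [Y] <| dact0 |> []
    = ([] <| D |> [\<one> A \<otimes>\<^sub>1 u]) ;; ([ac] <| (dswap Y \<otimes> dop0) |> [])
      ;; ([] <| dact0 |> [Y \<otimes>\<^sub>1 \<one> \<I>]) ;; dRu Y"

lemma dcomodule_typing:
  assumes "dcomodule Y D"
  shows "Y \<in> Arr \<M>" "Src \<M> Y = A" "Trg \<M> Y = A" "ok D" "ddom D = [Y, ac]" "dcod D = [ac, Y \<otimes>\<^sub>1 b]"
  using assms by (auto simp: dcomodule_def is_arrow_def)

lemma dcomodule_eq1:
  assumes "dcomodule Y D"
  shows "([Y] <| dact2 |> []) ;; ([] <| D |> [ac \<otimes>\<^sub>1 \<one> X]) ;; ([ac] <| (D \<otimes> dswap b) |> [])
    = ([] <| D |> [\<one> A \<otimes>\<^sub>1 m, as A X X]) ;; ([ac] <| (dswap Y \<otimes> dop2) |> [as A X X])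
      ;; ([ac, \<one> A \<otimes>\<^sub>1 m] <| dinv (dAs Y b b) |> []) ;; ([] <| dact2 |> [(Y \<otimes>\<^sub>1 b) \<otimes>\<^sub>1 b])"
  using assms by (simp add: dcomodule_def)

lemma dcomodule_eq2:
  assumes "dcomodule Y D"
  shows "[Y] <| dact0 |> []
    = ([] <| D |> [\<one> A \<otimes>\<^sub>1 u]) ;; ([ac] <| (dswap Y \<otimes> dop0) |> [])
      ;; ([] <| dact0 |> [Y \<otimes>\<^sub>1 \<one> \<I>]) ;; dRu Y"
  using assms by (simp add: dcomodule_def)

lemma comodule_iff: "comodule_axioms M M B a a Yy \<longleftrightarrow> dcomodule (fst Yy) (dco Yy)"
proof (cases "is_arrow \<M> (fst Yy) A A \<and> is_pcell (Coact B a a Yy)")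
  case True
  define Y where "Y = fst Yy"
  have Y [simp]: "Y \<in> Arr \<M>" "Src \<M> Y = A" "Trg \<M> Y = A" using True by (simp_all add: is_arrow_def Y_def)
  have ok [simp]: "ok (dco Yy)" using True Y
    by (simp add: dco_def Coact_def is_pcell_def is_cell_def diag_simps wt_cell_def flip: Y_def)
  have b' [simp]: "ddom (dco Yy) = [Y, ac]" "dcod (dco Yy) = [ac, Y \<otimes>\<^sub>1 b]" by (simp_all add: Y_def)
  note rep = rep_intros rep_As rep_Ru rep_data rep_Coact[OF ok]
  have "([Y] \<lhd> Act2 M a \<rhd> []
        \<Zsemi> [] \<lhd> Coact B a a Yy \<rhd> [ac \<otimes>\<^sub>1 \<one> X]
        \<Zsemi> [ac] \<lhd> Coact B a a Yy \<boxtimes> swap b \<rhd> []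
      = [] \<lhd> Coact B a a Yy \<rhd> [\<one> A \<otimes>\<^sub>1 m, as A X X]
        \<Zsemi> [ac] \<lhd> swap Y \<boxtimes> Op2 M M B \<rhd> [as A X X]
        \<Zsemi> [ac, \<one> A \<otimes>\<^sub>1 m] \<lhd> pinv (As\<^sub>n Y b b) \<rhd> []
        \<Zsemi> [] \<lhd> Act2 M a \<rhd> [(Y \<otimes>\<^sub>1 b) \<otimes>\<^sub>1 b]) \<longleftrightarrow>
    ([Y] <| dact2 |> []) ;; ([] <| dco Yy |> [ac \<otimes>\<^sub>1 \<one> X]) ;; ([ac] <| (dco Yy \<otimes> dswap b) |> [])
    = ([] <| dco Yy |> [\<one> A \<otimes>\<^sub>1 m, as A X X]) ;; ([ac] <| (dswap Y \<otimes> dop2) |> [as A X X])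
      ;; ([ac, \<one> A \<otimes>\<^sub>1 m] <| dinv (dAs Y b b) |> []) ;; ([] <| dact2 |> [(Y \<otimes>\<^sub>1 b) \<otimes>\<^sub>1 b])"
    by (rule rep_eqI) (rule rep | (simp add: dcomp_assoc del: bound_simps(9,10); fail))+
  moreover have "([Y] \<lhd> Act0 M a \<rhd> []
      = [] \<lhd> Coact B a a Yy \<rhd> [\<one> A \<otimes>\<^sub>1 u]
        \<Zsemi> [ac] \<lhd> swap Y \<boxtimes> Op0' M M B \<rhd> []
        \<Zsemi> [] \<lhd> Act0 M a \<rhd> [Y \<otimes>\<^sub>1 \<one> \<I>]
        \<Zsemi> Ru\<^sub>n Y) \<longleftrightarrow>
    [Y] <| dact0 |> []
    = ([] <| dco Yy |> [\<one> A \<otimes>\<^sub>1 u]) ;; ([ac] <| (dswap Y \<otimes> dop0) |> [])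
      ;; ([] <| dact0 |> [Y \<otimes>\<^sub>1 \<one> \<I>]) ;; dRu Y"
    by (rule rep_eqI) (rule rep | (simp add: dcomp_assoc del: bound_simps(9,10); fail))+
  ultimately show ?thesis using True
    unfolding comodule_axioms_def dcomodule_def Let_def by (simp add: is_arrow_def flip: Y_def)
next
  case False
  have "\<not> comodule_axioms M M B a a Yy" using False by (auto simp: comodule_axioms_def Let_def)
  moreover have "\<not> dcomodule (fst Yy) (dco Yy)"
    using False by (auto simp: dcomodule_def dco_def Coact_def diag_simps wt_cell_def is_pcell_def is_cell_def)
  ultimately show ?thesis by simp
qed


lemma dcell_dmu: "dcell dmu = \<mu>"
  by (simp add: dmu_def dcell_simps dcell_dsplit)

lemma dmu_assoc: "([] <| dmu |> [b]) ;; dmu = ([b] <| dmu |> []) ;; dmu"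
proof -
  have "\<mu> \<cdot> (\<mu> \<star> \<ii> b) = \<mu> \<cdot> (\<ii> b \<star> \<mu>) \<cdot> \<aa> b b b"
    using monad by (simp add: opmonoidal_monad_def)
  then have "(\<mu> \<cdot> (\<mu> \<star> \<ii> b)) \<cdot> \<ominus> (\<aa> b b b) = \<mu> \<cdot> (\<ii> b \<star> \<mu>)" by (simp add: vassoc)
  then show ?thesis by (intro diagram_eqI) (simp_all add: dcell_simps dcell_dmu vassoc)
qed

lemma dmu_unit: "([] <| deta |> [b]) ;; dmu = dL b" "([b] <| deta |> []) ;; dmu = dR b"
proof -
  have "\<mu> \<cdot> (\<eta> \<star> \<ii> b) = \<ll> b" "\<mu> \<cdot> (\<ii> b \<star> \<eta>) = \<rr> b"
    using monad by (simp_all add: opmonoidal_monad_def)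
  then show "([] <| deta |> [b]) ;; dmu = dL b" "([b] <| deta |> []) ;; dmu = dR b"
    by (auto intro!: diagram_eqI simp: dcell_simps dcell_dmu dcell_unit deta_def)
qed

text \<open>
  \<open>\<mu>\<close> is an opmonoidal cell from \<open>B\<circ>B\<close>, whose structure cell \<open>(B\<circ>B)\<^sup>2\<close> consists of two copies of
  \<open>B\<^sup>2\<close>.
\<close>

lemma dop2_mu:
  "([] <| dmu |> [m]) ;; dop2
   = ([b] <| dop2 |> []) ;; ([] <| dop2 |> [b \<otimes>\<^sub>1 b]) ;; ([m] <| (dmu \<otimes> dmu) |> [])"
proof -
  let ?S = "dinv (dsplit b b)"
  let ?P = "[] \<lhd> split b b \<rhd> [m] \<Zsemi> [b] \<lhd> Op2 M M B \<rhd> [] \<Zsemi> [] \<lhd> Op2 M M B \<rhd> [b \<otimes>\<^sub>1 b] \<Zsemi> [m] \<lhd> Phi b b b b \<rhd> []"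
  let ?D = "([b] <| dop2 |> []) ;; ([] <| dop2 |> [b \<otimes>\<^sub>1 b]) ;; ([m] <| (?S \<otimes> ?S) |> [])"
  have rep: "rep ?P (([] <| dsplit b b |> [m]) ;; ?D)"
    by (rule rep_cong) (rule rep_intros rep_data | (simp add: dcomp_assoc; fail))+
  have c2: "dcell dop2 = op2 B" by (simp add: dop2_def Op2_def diag_simps wt_cell_def)
  have "op2 B \<cdot> (\<mu> \<star> \<ii> m) = (\<ii> m \<star> (\<mu> \<otimes>\<^sub>2 \<mu>)) \<cdot> mid ?P"
    using monad by (simp add: opmonoidal_monad_def opmonoidal_cell_def opmonoidal_comp_def)
  then have eq: "([] <| dsingle \<mu> |> [m]) ;; dop2
      = (([] <| dsplit b b |> [m]) ;; ?D) ;; ([m] <| (dsingle \<mu> \<otimes> dsingle \<mu>) |> [])"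
    unfolding rep_mid[OF rep, symmetric]
    by (intro diagram_eqI) (simp_all add: dcell_simps c2 flip: dsingle_tensor)
  have "([] <| ?S |> [m]) ;; (([] <| dsplit b b |> [m]) ;; ?D) ;; ([m] <| (dsingle \<mu> \<otimes> dsingle \<mu>) |> [])
     = (([] <| ?S |> [m]) ;; ([] <| dsplit b b |> [m])) ;; ?D ;; ([m] <| (dsingle \<mu> \<otimes> dsingle \<mu>) |> [])"
    by (simp add: dcomp_assoc)
  also have "\<dots> = ?D ;; ([m] <| (dsingle \<mu> \<otimes> dsingle \<mu>) |> [])"
    by (simp add: dinv_whisker_cancel)
  also have "\<dots> = ([b] <| dop2 |> []) ;; ([] <| dop2 |> [b \<otimes>\<^sub>1 b])
      ;; ([m] <| (?S \<otimes> ?S ;; dsingle \<mu> \<otimes> dsingle \<mu>) |> [])"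
    by (simp add: dwhisker_dcomp dcomp_assoc)
  also have "?S \<otimes> ?S ;; dsingle \<mu> \<otimes> dsingle \<mu> = dmu \<otimes> dmu"
    unfolding dmu_def by (rule dten_dcomp[symmetric]) simp_all
  finally show ?thesis by (simp add: dmu_def dwhisker_dcomp dcomp_assoc eq)
qed

text \<open>
  The structure cell \<open>(B\<circ>B)\<^sup>0\<close> consists of two copies of \<open>B\<^sup>0\<close>.  Each copy in \<open>dop0\<close> inserts an
  identity arrow of \<open>\<I>\<close>; the last factor on the right merges the two.
\<close>

lemma dop0_mu:
  "([] <| dmu |> [u]) ;; dop0
   = ([b] <| dop0 |> []) ;; ([] <| dop0 |> [\<one> \<I>]) ;; ([u] <| dL (\<one> \<I>) |> [])"
proof -
  let ?S = "dinv (dsplit b b)"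
  define E where "E = diag (Op0 M M B)"
  have E [simp]: "ok E" "ddom E = [b, u]" "dcod E = [u]" "dcell E = op0 B"
    by (simp_all add: E_def Op0_def diag_simps wt_cell_def)
  have rE: "rep (Op0 M M B) E" using E(1) by (simp add: rep_def E_def)
  let ?P = "[] \<lhd> split b b \<rhd> [u] \<Zsemi> [b] \<lhd> Op0 M M B \<rhd> [] \<Zsemi> Op0 M M B"
  have rep: "rep ?P (([] <| dsplit b b |> [u]) ;; ([b] <| E |> []) ;; E)"
    by (rule rep_cong) (rule rep_intros rE | (simp add: dcomp_assoc; fail))+
  have "op0 B \<cdot> (\<mu> \<star> \<ii> u) = mid ?P"
    using monad by (simp add: opmonoidal_monad_def opmonoidal_cell_def opmonoidal_comp_def)
  then have eq: "([] <| dsingle \<mu> |> [u]) ;; E = ([] <| dsplit b b |> [u]) ;; ([b] <| E |> []) ;; E"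
    unfolding rep_mid[OF rep, symmetric]
    by (intro diagram_eqI) (simp_all add: dcell_simps)
  have mu: "([] <| dmu |> [u]) ;; E = ([b] <| E |> []) ;; E"
    by (simp add: dmu_def dwhisker_dcomp dcomp_assoc eq)
      (simp add: dinv_whisker_cancel flip: dcomp_assoc)
  have O: "dop0 = E ;; dinv (dR u)"
    by (intro diagram_eqI) (simp_all add: dcell_simps dcell_unit dop0_def Op0'_def diag_simps wt_cell_def)
  have tri: "[u] <| dL (\<one> \<I>) |> [] = [] <| dR u |> [\<one> \<I>]"
    by (rule unit_triangle) simp_all
  \<comment> \<open>Naturality of the right unitor with respect to the second copy of \<open>B\<^sup>0\<close>.\<close>
  have slide: "([b] <| dinv (dR u) |> []) ;; ([] <| E |> [\<one> \<I>]) = E ;; dinv (dR u)"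
  proof (rule dcomp_cancel_left[of "[b] <| dR u |> []"])
    have "([b] <| dR u |> []) ;; ([b] <| dinv (dR u) |> []) ;; ([] <| E |> [\<one> \<I>]) = [] <| E |> [\<one> \<I>]"
      by (simp add: dinv_whisker_cancel flip: dcomp_assoc)
    also have "\<dots> = (([] <| E |> [\<one> \<I>]) ;; dR u) ;; dinv (dR u)"
      by (simp add: dcomp_assoc dinv_cancel)
    also have "([] <| E |> [\<one> \<I>]) ;; dR u = ([b] <| dR u |> []) ;; E"
      using dR_path_natural[of E] by (simp add: dR_path_def)
    finally show "([b] <| dR u |> []) ;; ([b] <| dinv (dR u) |> []) ;; ([] <| E |> [\<one> \<I>])
      = ([b] <| dR u |> []) ;; E ;; dinv (dR u)" by (simp add: dcomp_assoc)
  qed (auto intro: iso_dwhisker)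
  have "([b] <| dop0 |> []) ;; ([] <| dop0 |> [\<one> \<I>]) ;; ([u] <| dL (\<one> \<I>) |> [])
     = ([b] <| E |> []) ;; (([b] <| dinv (dR u) |> []) ;; ([] <| E |> [\<one> \<I>]))
       ;; (([] <| dinv (dR u) |> [\<one> \<I>]) ;; ([] <| dR u |> [\<one> \<I>]))"
    unfolding O tri by (simp add: dwhisker_dcomp dcomp_assoc)
  also have "\<dots> = ([b] <| E |> []) ;; E ;; dinv (dR u)"
    unfolding slide by (simp add: dinv_whisker_cancel dcomp_assoc)
  also have "\<dots> = ([] <| dmu |> [u]) ;; E ;; dinv (dR u)"
    using mu by (simp flip: dcomp_assoc)
  finally show ?thesis by (simp add: O)
qed

lemma dop2_eta:
  "([] <| deta |> [m]) ;; dop2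
   = dinv (dswap m) ;; ([m] <| dunit X X |> []) ;; ([m] <| (deta \<otimes> deta) |> [])"
proof -
  have "op2 B \<cdot> (\<eta> \<star> \<ii> m) = (\<ii> m \<star> (\<eta> \<otimes>\<^sub>2 \<eta>)) \<cdot> (\<ii> m \<star> TUnit \<M> X X) \<cdot> \<ominus> (\<rr> m) \<cdot> \<ll> m"
    using monad by (simp add: opmonoidal_monad_def opmonoidal_cell_def opmonoidal_id_def)
  moreover have "dcell dop2 = op2 B" by (simp add: dop2_def Op2_def diag_simps wt_cell_def)
  moreover have "dcell (dinv (dswap m)) = \<ominus> (\<rr> m) \<cdot> \<ll> m"
    by (simp add: dcell_simps dswap_def dcell_unit iso_dcomp iso_dinv)
  ultimately show ?thesis unfolding deta_def
    by (intro diagram_eqI) (simp_all add: dcell_simps vassoc flip: dsingle_tensor)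
qed

lemma dop0_eta: "([] <| deta |> [u]) ;; dop0 = dinv (dswap u)"
proof -
  have "op0 B \<cdot> (\<eta> \<star> \<ii> u) = \<ll> u"
    using monad by (simp add: opmonoidal_monad_def opmonoidal_cell_def opmonoidal_id_def)
  moreover have "dcell dop0 = \<ominus> (\<rr> u) \<cdot> op0 B" by (simp add: dop0_def Op0'_def diag_simps wt_cell_def)
  moreover have "dcell (dinv (dswap u)) = \<ominus> (\<rr> u) \<cdot> \<ll> u"
    by (simp add: dcell_simps dswap_def dcell_unit iso_dcomp iso_dinv)
  ultimately show ?thesis unfolding deta_def
    by (intro diagram_eqI) (simp_all add: dcell_simps vassoc)
qed

end

section \<open>The tensor product of two comodules\<close>

context comodule_setting
begin

text \<open>
  The coaction of \<open>comodule_tensor\<close>, see \<open>dco_tensor\<close>; its last factor merges \<open>Z\<close> with \<open>Y\<close>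
  and multiplies \<open>B\<close> with \<open>B\<close>.
\<close>

definition dtens :: "'a \<Rightarrow> ('a,'c) diagram \<Rightarrow> 'a \<Rightarrow> ('a,'c) diagram \<Rightarrow> ('a,'c) diagram"
  where "dtens Y y Z z = ([] <| dsplit Z Y |> [ac]) ;; ([Z] <| y |> []) ;; ([] <| z |> [Y \<otimes>\<^sub>1 b])
    ;; ([ac] <| (dinv (dsplit Z Y) \<otimes> dmu) |> [])"

lemma rep_mid_cell: "rep P D \<Longrightarrow> diag (ddom D, mid P, dcod D) = D"
  by (cases P) (auto simp: rep_def diag_simps)

lemma dco_tensor:
  assumes "dcomodule (fst Yy) (dco Yy)" "dcomodule (fst Zz) (dco Zz)"
  shows "dco (comodule_tensor B \<mu> a Yy Zz) = dtens (fst Yy) (dco Yy) (fst Zz) (dco Zz)"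
proof -
  define Y Z where "Y = fst Yy" and "Z = fst Zz"
  note Y = dcomodule_typing[OF assms(1)] and Z = dcomodule_typing[OF assms(2)]
  note [simp] = Y[folded Y_def] Z[folded Z_def]
  note rep = rep_intros rep_Coact[OF Y(4)] rep_Coact[OF Z(4)]
  let ?P = "[] \<lhd> split Z Y \<rhd> [ac] \<Zsemi> [Z] \<lhd> Coact B a a Yy \<rhd> [] \<Zsemi> [] \<lhd> Coact B a a Zz \<rhd> [Y \<otimes>\<^sub>1 b]
    \<Zsemi> [ac] \<lhd> Phi Z b Y b \<rhd> [] \<Zsemi> [ac] \<lhd> single (\<ii> (Z \<odot> Y) \<otimes>\<^sub>2 \<mu>) \<rhd> []"
  let ?s = "dinv (dsplit Z Y)"
  have "?s \<otimes> dinv (dsplit b b) ;; dsingle (\<ii> (Z \<odot> Y) \<otimes>\<^sub>2 \<mu>)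
      = (?s ;; did [Z \<odot> Y]) \<otimes> (dinv (dsplit b b) ;; dsingle \<mu>)"
    by (subst dten_dcomp) (simp_all add: dsingle_tensor dsingle_id)
  then have 1: "?s \<otimes> dinv (dsplit b b) ;; dsingle (\<ii> (Z \<odot> Y) \<otimes>\<^sub>2 \<mu>) = ?s \<otimes> dmu"
    by (simp add: dmu_def)
  have D: "dtens Y (dco Yy) Z (dco Zz)
    = ([] <| dsplit Z Y |> [ac]) ;; ([Z] <| dco Yy |> []) ;; ([] <| dco Zz |> [Y \<otimes>\<^sub>1 b])
    ;; ([ac] <| (?s \<otimes> dinv (dsplit b b) ;; dsingle (\<ii> (Z \<odot> Y) \<otimes>\<^sub>2 \<mu>)) |> [])"
    unfolding 1 by (simp add: dtens_def)
  have "rep ?P (dtens Y (dco Yy) Z (dco Zz))"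
    unfolding D
    by (rule rep_cong) (rule rep | (simp add: dwhisker_dcomp dcomp_assoc del: bound_simps(9,10); fail))+
  note r = rep_mid_cell[OF this]
  have e: "comodule_tensor B \<mu> a Yy Zz = (Z \<odot> Y, mid ?P)"
    by (simp only: comodule_tensor_def Let_def Y_def Z_def)
  have d: "dco (f, \<theta>) = diag ([f, ac], \<theta>, [ac, f \<otimes>\<^sub>1 b])" for f \<theta>
    by (simp add: dco_def Coact_def)
  have t: "ddom (dtens Y (dco Yy) Z (dco Zz)) = [Z \<odot> Y, ac]" "dcod (dtens Y (dco Yy) Z (dco Zz)) = [ac, (Z \<odot> Y) \<otimes>\<^sub>1 b]"
    by (simp_all add: dtens_def)
  show ?thesis unfolding e d r[unfolded t] by (simp only: Y_def Z_def)
qed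

context
  fixes Y Z :: 'a and y z :: "('a,'c) diagram"
  assumes Y: "dcomodule Y y" and Z: "dcomodule Z z"
begin

private lemmas [simp] = dcomodule_typing[OF Y] dcomodule_typing[OF Z]

private definition "\<sigma> = dinv (dsplit Z Y)"

private lemma \<sigma> [simp]: "ddom \<sigma> = [Z, Y]" "dcod \<sigma> = [Z \<odot> Y]" "iso \<sigma>" "ok \<sigma>"
  by (auto simp: \<sigma>_def intro: iso_dinv)

text \<open>
  The tensor coaction on the path \<open>[Z, Y, ac]\<close>, that is, with \<open>Z \<odot> Y\<close> split.  Since \<open>\<sigma>\<close> is invertible,
  equations for \<open>dtens Y y Z z\<close> may be checked for \<open>W\<close>.
\<close>

private definition "W = ([Z] <| y |> []) ;; ([] <| z |> [Y \<otimes>\<^sub>1 b]) ;; ([ac] <| (\<sigma> \<otimes> dmu) |> [])"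

private lemma dtens_W: "dtens Y y Z z = ([] <| dinv \<sigma> |> [ac]) ;; W"
  unfolding dtens_def W_def by (simp add: \<sigma>_def iso_dinv)

private lemma ok_W [simp]: "ok W" "ddom W = [Z, Y, ac]" "dcod W = [ac, (Z \<odot> Y) \<otimes>\<^sub>1 b]"
  by (simp_all add: W_def)

lemma dtens_simps [simp]: "ok (dtens Y y Z z)" "ddom (dtens Y y Z z) = [Z \<odot> Y, ac]"
    "dcod (dtens Y y Z z) = [ac, (Z \<odot> Y) \<otimes>\<^sub>1 b]"
  by (simp_all add: dtens_W iso_dinv)

private lemma W_eq: "([] <| \<sigma> |> [ac]) ;; dtens Y y Z z = W"
  by (simp add: dtens_W dinv_whisker_cancel flip: dcomp_assoc)

private lemma swap_mu: "([] <| dmu |> [\<one> X]) ;; dswap b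
    = ([b] <| dswap b |> []) ;; ([] <| dswap b |> [b]) ;; ([\<one> X] <| dmu |> [])"
  using dswap_path_natural[of dmu] by (simp add: dswap_path_single dswap_path_pair dcomp_assoc)

private lemma swap_\<sigma>: "([] <| \<sigma> |> [\<one> A]) ;; dswap (Z \<odot> Y)
    = ([Z] <| dswap Y |> []) ;; ([] <| dswap Z |> [Y]) ;; ([\<one> A] <| \<sigma> |> [])"
  using dswap_path_natural[of \<sigma>] by (simp add: dswap_path_single dswap_path_pair dcomp_assoc)

text \<open>
  In element notation, the second use of the coaction, \<open>w\<cdot>Bq\<close>, is taken apart into \<open>y\<cdot>Bq\<close> and
  \<open>z\<cdot>Bq\<close>, while the earlier \<open>\<mu>\<close> on the last factor moves to the end.
\<close>

private lemma coaction_swap: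
  "([] <| (\<sigma> \<otimes> dmu) |> [ac \<otimes>\<^sub>1 \<one> X]) ;; (dtens Y y Z z \<otimes> dswap b)
   = ([Z \<otimes>\<^sub>1 b] <| (y \<otimes> dswap b) |> []) ;; ([] <| (z \<otimes> dswap b) |> [(Y \<otimes>\<^sub>1 b) \<otimes>\<^sub>1 b])
     ;; ([ac \<otimes>\<^sub>1 \<one> X] <| ((\<sigma> \<otimes> dmu) \<otimes> dmu) |> [])"
proof -
  have "([] <| (\<sigma> \<otimes> dmu) |> [ac \<otimes>\<^sub>1 \<one> X]) = ([] <| \<sigma> |> [ac]) \<otimes> ([] <| dmu |> [\<one> X])"
    by (simp add: dten_whisker)
  then have "([] <| (\<sigma> \<otimes> dmu) |> [ac \<otimes>\<^sub>1 \<one> X]) ;; (dtens Y y Z z \<otimes> dswap b)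
    = (([] <| \<sigma> |> [ac]) ;; dtens Y y Z z) \<otimes> (([] <| dmu |> [\<one> X]) ;; dswap b)"
    by (simp add: dten_dcomp)
  also have "\<dots> = W \<otimes> (([b] <| dswap b |> []) ;; ([] <| dswap b |> [b]) ;; ([\<one> X] <| dmu |> []))"
    by (simp only: W_eq swap_mu)
  also have "\<dots> = ([Z \<otimes>\<^sub>1 b] <| (y \<otimes> dswap b) |> []) ;; ([] <| (z \<otimes> dswap b) |> [(Y \<otimes>\<^sub>1 b) \<otimes>\<^sub>1 b])
     ;; ([ac \<otimes>\<^sub>1 \<one> X] <| ((\<sigma> \<otimes> dmu) \<otimes> dmu) |> [])"
    unfolding W_def by (simp add: dten_dcomp dten_whisker)
  finally show ?thesis .
qed

text \<open>
  Here \<open>\<mu>\<close> moves past \<open>B\<^sup>2\<close> and doubles.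
\<close>

private lemma opmonoidal_swap:
  "([] <| (\<sigma> \<otimes> dmu) |> [\<one> A \<otimes>\<^sub>1 m]) ;; (dswap (Z \<odot> Y) \<otimes> dop2)
   = ([Z \<otimes>\<^sub>1 b] <| (dswap Y \<otimes> dop2) |> []) ;; ([] <| (dswap Z \<otimes> dop2) |> [Y \<otimes>\<^sub>1 (b \<otimes>\<^sub>1 b)])
     ;; ([\<one> A \<otimes>\<^sub>1 m] <| (\<sigma> \<otimes> (dmu \<otimes> dmu)) |> [])"
proof -
  have "([] <| (\<sigma> \<otimes> dmu) |> [\<one> A \<otimes>\<^sub>1 m]) = ([] <| \<sigma> |> [\<one> A]) \<otimes> ([] <| dmu |> [m])"
    by (simp add: dten_whisker)
  then have "([] <| (\<sigma> \<otimes> dmu) |> [\<one> A \<otimes>\<^sub>1 m]) ;; (dswap (Z \<odot> Y) \<otimes> dop2)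
    = (([] <| \<sigma> |> [\<one> A]) ;; dswap (Z \<odot> Y)) \<otimes> (([] <| dmu |> [m]) ;; dop2)"
    by (simp add: dten_dcomp)
  also have "\<dots> = ([Z \<otimes>\<^sub>1 b] <| (dswap Y \<otimes> dop2) |> []) ;; ([] <| (dswap Z \<otimes> dop2) |> [Y \<otimes>\<^sub>1 (b \<otimes>\<^sub>1 b)])
     ;; ([\<one> A \<otimes>\<^sub>1 m] <| (\<sigma> \<otimes> (dmu \<otimes> dmu)) |> [])"
    unfolding swap_\<sigma> dop2_mu by (simp add: dten_dcomp dten_whisker)
  finally show ?thesis .
qed

private lemma opmonoidal_unit_swap:
  "([] <| (\<sigma> \<otimes> dmu) |> [\<one> A \<otimes>\<^sub>1 u]) ;; (dswap (Z \<odot> Y) \<otimes> dop0)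
   = ([Z \<otimes>\<^sub>1 b] <| (dswap Y \<otimes> dop0) |> []) ;; ([] <| (dswap Z \<otimes> dop0) |> [Y \<otimes>\<^sub>1 \<one> \<I>])
     ;; ([\<one> A \<otimes>\<^sub>1 u] <| (\<sigma> \<otimes> dL (\<one> \<I>)) |> [])"
proof -
  have "([] <| (\<sigma> \<otimes> dmu) |> [\<one> A \<otimes>\<^sub>1 u]) = ([] <| \<sigma> |> [\<one> A]) \<otimes> ([] <| dmu |> [u])"
    by (simp add: dten_whisker)
  then have "([] <| (\<sigma> \<otimes> dmu) |> [\<one> A \<otimes>\<^sub>1 u]) ;; (dswap (Z \<odot> Y) \<otimes> dop0)
    = (([] <| \<sigma> |> [\<one> A]) ;; dswap (Z \<odot> Y)) \<otimes> (([] <| dmu |> [u]) ;; dop0)"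
    by (simp add: dten_dcomp)
  also have "\<dots> = ([Z \<otimes>\<^sub>1 b] <| (dswap Y \<otimes> dop0) |> []) ;; ([] <| (dswap Z \<otimes> dop0) |> [Y \<otimes>\<^sub>1 \<one> \<I>])
     ;; ([\<one> A \<otimes>\<^sub>1 u] <| (\<sigma> \<otimes> dL (\<one> \<I>)) |> [])"
    unfolding swap_\<sigma> dop0_mu by (simp add: dten_dcomp dten_whisker)
  finally show ?thesis .
qed

text \<open>
  The associator cell at \<open>Z \<odot> Y\<close> is composed of those at \<open>Z\<close> and \<open>Y\<close>: pseudonaturality for the
  splittings, and naturality for \<open>\<mu>\<close>.  The inverses come from \<open>main\<close>, in which all associator cells
  are on the other side.
\<close>

private lemma associator_split:
  "([] <| (\<sigma> \<otimes> (dmu \<otimes> dmu)) |> [as A X X]) ;; dinv (dAs (Z \<odot> Y) b b)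
   = ([Z \<otimes>\<^sub>1 (b \<otimes>\<^sub>1 b)] <| dinv (dAs Y b b) |> []) ;; ([] <| dinv (dAs Z b b) |> [(Y \<otimes>\<^sub>1 b) \<otimes>\<^sub>1 b])
     ;; ([as A X X] <| ((\<sigma> \<otimes> dmu) \<otimes> dmu) |> [])"
proof -
  let ?s = "dinv (dsplit b b)"
  let ?l = "[as A X X] <| ((\<sigma> \<otimes> dmu) \<otimes> dmu) |> []"
  let ?r = "[] <| (\<sigma> \<otimes> (dmu \<otimes> dmu)) |> [as A X X]"
  let ?I = "did [Z \<odot> Y]"
  have L: "(\<sigma> \<otimes> dmu) \<otimes> dmu = (\<sigma> \<otimes> ?s) \<otimes> ?s ;; (?I \<otimes> dsingle \<mu>) \<otimes> dsingle \<mu>"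
  proof -
    have "(\<sigma> \<otimes> ?s) \<otimes> ?s ;; (?I \<otimes> dsingle \<mu>) \<otimes> dsingle \<mu> = ((\<sigma> \<otimes> ?s) ;; (?I \<otimes> dsingle \<mu>)) \<otimes> dmu"
      unfolding dmu_def by (rule dten_dcomp[symmetric]) simp_all
    also have "(\<sigma> \<otimes> ?s) ;; (?I \<otimes> dsingle \<mu>) = (\<sigma> ;; ?I) \<otimes> dmu"
      unfolding dmu_def by (rule dten_dcomp[symmetric]) simp_all
    finally show ?thesis by simp
  qed
  have R: "\<sigma> \<otimes> (dmu \<otimes> dmu) = \<sigma> \<otimes> (?s \<otimes> ?s) ;; ?I \<otimes> (dsingle \<mu> \<otimes> dsingle \<mu>)"
  proof -
    have "\<sigma> \<otimes> (?s \<otimes> ?s) ;; ?I \<otimes> (dsingle \<mu> \<otimes> dsingle \<mu>) = (\<sigma> ;; ?I) \<otimes> ((?s \<otimes> ?s) ;; (dsingle \<mu> \<otimes> dsingle \<mu>))"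
      by (rule dten_dcomp[symmetric]) simp_all
    also have "(?s \<otimes> ?s) ;; (dsingle \<mu> \<otimes> dsingle \<mu>) = dmu \<otimes> dmu"
      unfolding dmu_def by (rule dten_dcomp[symmetric]) simp_all
    finally show ?thesis by simp
  qed
  have nat: "([as A X X] <| ((?I \<otimes> dsingle \<mu>) \<otimes> dsingle \<mu>) |> []) ;; dAs (Z \<odot> Y) b b
    = dAs (Z \<odot> Y) (b \<odot> b) (b \<odot> b) ;; ([] <| (?I \<otimes> (dsingle \<mu> \<otimes> dsingle \<mu>)) |> [as A X X])"
    using dAs_natural[of "\<ii> (Z \<odot> Y)" \<mu> \<mu>, OF _ _ _ refl refl refl refl refl refl] by (simp add: dsingle_id)
  have comp: "([as A X X] <| ((\<sigma> \<otimes> ?s) \<otimes> ?s) |> []) ;; dAs (Z \<odot> Y) (b \<odot> b) (b \<odot> b)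
    = ([] <| dAs Z b b |> [(Y \<otimes>\<^sub>1 b) \<otimes>\<^sub>1 b]) ;; ([Z \<otimes>\<^sub>1 (b \<otimes>\<^sub>1 b)] <| dAs Y b b |> [])
      ;; ([] <| (\<sigma> \<otimes> (?s \<otimes> ?s)) |> [as A X X])"
    using dAs_comp[of Y Z b b b b] by (simp add: \<sigma>_def)
  have main: "?l ;; dAs (Z \<odot> Y) b b
    = ([] <| dAs Z b b |> [(Y \<otimes>\<^sub>1 b) \<otimes>\<^sub>1 b]) ;; ([Z \<otimes>\<^sub>1 (b \<otimes>\<^sub>1 b)] <| dAs Y b b |> []) ;; ?r"
    unfolding L R by (simp add: dwhisker_dcomp dcomp_assoc nat comp[THEN dcomp_step])
  let ?AZ = "[] <| dAs Z b b |> [(Y \<otimes>\<^sub>1 b) \<otimes>\<^sub>1 b]" and ?AY = "[Z \<otimes>\<^sub>1 (b \<otimes>\<^sub>1 b)] <| dAs Y b b |> []"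
  have i: "iso ?AZ" "iso ?AY" by (auto intro!: iso_dwhisker)
  have d: "dinv ?AZ = [] <| dinv (dAs Z b b) |> [(Y \<otimes>\<^sub>1 b) \<otimes>\<^sub>1 b]" "dinv ?AY = [Z \<otimes>\<^sub>1 (b \<otimes>\<^sub>1 b)] <| dinv (dAs Y b b) |> []"
    by (auto intro!: dinv_dwhisker)
  have "dinv ?AY ;; dinv ?AZ ;; ?l = dinv ?AY ;; dinv ?AZ ;; ?l ;; dAs (Z \<odot> Y) b b ;; dinv (dAs (Z \<odot> Y) b b)"
    by (simp add: dinv_cancel)
  also have "\<dots> = dinv ?AY ;; (dinv ?AZ ;; ?AZ) ;; ?AY ;; ?r ;; dinv (dAs (Z \<odot> Y) b b)"
    by (simp add: dcomp_assoc main[THEN dcomp_step])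
  also have "\<dots> = (dinv ?AY ;; ?AY) ;; ?r ;; dinv (dAs (Z \<odot> Y) b b)"
    using i(1) by (simp add: dinv_cancel(2)[OF i(1)] dcomp_assoc)
  also have "\<dots> = ?r ;; dinv (dAs (Z \<odot> Y) b b)"
    by (simp add: dinv_cancel(2)[OF i(2)])
  finally show ?thesis unfolding d by simp
qed


text \<open>
  Both sides are brought to the form that starts with \<open>y\<close> and \<open>B\<^sup>2\<close>, continues with \<open>z\<close> and \<open>B\<^sup>2\<close>, and
  ends with \<open>a\<^sup>2\<close> and two copies of \<open>\<mu>\<close>.  The left side reaches it by the comodule equations of \<open>Y\<close> and
  \<open>Z\<close>, the right side by the compatibility of \<open>\<mu>\<close> with \<open>B\<^sup>2\<close>; the remaining steps exchange cells on
  disjoint parts of the path.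
\<close>

lemma dtens_eq1:
  "([Z \<odot> Y] <| dact2 |> []) ;; ([] <| dtens Y y Z z |> [ac \<otimes>\<^sub>1 \<one> X]) ;; ([ac] <| (dtens Y y Z z \<otimes> dswap b) |> [])
    = ([] <| dtens Y y Z z |> [\<one> A \<otimes>\<^sub>1 m, as A X X]) ;; ([ac] <| (dswap (Z \<odot> Y) \<otimes> dop2) |> [as A X X])
      ;; ([ac, \<one> A \<otimes>\<^sub>1 m] <| dinv (dAs (Z \<odot> Y) b b) |> []) ;; ([] <| dact2 |> [((Z \<odot> Y) \<otimes>\<^sub>1 b) \<otimes>\<^sub>1 b])"
  (is "?L = ?R")
proof (rule dcomp_cancel_left)
  let ?as = "as A X X" and ?w = "dtens Y y Z z" and ?E = "\<sigma> \<otimes> dmu" and ?i = "dinv (dAs Y b b)" and ?j = "dinv (dAs Z b b)"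
  let ?Y = "(Y \<otimes>\<^sub>1 b) \<otimes>\<^sub>1 b" and ?Z = "(Z \<otimes>\<^sub>1 b) \<otimes>\<^sub>1 b"
  let ?k = "dinv (dAs (Z \<odot> Y) b b)"
    and ?V = "((Z \<odot> Y) \<otimes>\<^sub>1 b) \<otimes>\<^sub>1 b"
    and ?m = "\<one> A \<otimes>\<^sub>1 m"
    and ?x = "ac \<otimes>\<^sub>1 \<one> X"
    and ?Yb = "Y \<otimes>\<^sub>1 (b \<otimes>\<^sub>1 b)"
    and ?Zb = "Z \<otimes>\<^sub>1 (b \<otimes>\<^sub>1 b)"
    and ?p = "dswap Y \<otimes> dop2"
    and ?q = "dswap Z \<otimes> dop2"
  \<comment> \<open>Splitting the source commutes with whiskering; the goal is checked after composition with \<open>\<sigma>\<close>.\<close>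
  have W: "([] <| \<sigma> |> ac # r) ;; ([] <| ?w |> r)
    = ([Z] <| y |> r) ;; ([] <| z |> (Y \<otimes>\<^sub>1 b) # r) ;; ([ac] <| ?E |> r)" for r
    using arg_cong[OF W_eq, of "\<lambda>D. [] <| D |> r"] by (simp add: W_def dwhisker_dcomp dwhisker_dwhisker)
  have "([] <| \<sigma> |> [ac, ?m, ?as]) ;; ?L
    = ([Z, Y] <| dact2 |> []) ;; (([] <| \<sigma> |> [ac, ?x]) ;; ([] <| ?w |> [?x])) ;; ([ac] <| (?w \<otimes> dswap b) |> [])"
  proof -
    have "([] <| \<sigma> |> [ac, ?m, ?as]) ;; ([Z \<odot> Y] <| dact2 |> [])
      = ([Z, Y] <| dact2 |> []) ;; ([] <| \<sigma> |> [ac, ?x])"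
      using dexchange[of "[]" \<sigma> "[]" dact2 "[]"] by simp
    from dcomp_step[OF this] show ?thesis by (simp add: dcomp_assoc)
  qed
  also have "\<dots> = ([Z, Y] <| dact2 |> []) ;; ([Z] <| y |> [?x]) ;; ([] <| z |> [Y \<otimes>\<^sub>1 b, ?x])
      ;; ([ac] <| ?E |> [?x]) ;; ([ac] <| (?w \<otimes> dswap b) |> [])"
    unfolding W by (simp add: dcomp_assoc)
  also have "([ac] <| ?E |> [?x]) ;; ([ac] <| (?w \<otimes> dswap b) |> [])
      = ([ac, Z \<otimes>\<^sub>1 b] <| (y \<otimes> dswap b) |> []) ;; ([ac] <| (z \<otimes> dswap b) |> [?Y])
     ;; ([ac, ?x] <| (?E \<otimes> dmu) |> [])"
    using arg_cong[OF coaction_swap, of "\<lambda>D. [ac] <| D |> []"] by (simp add: dwhisker_dcomp dwhisker_dwhisker)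
  also have "([Z, Y] <| dact2 |> []) ;; ([Z] <| y |> [?x]) ;; ([] <| z |> [Y \<otimes>\<^sub>1 b, ?x]) ;; \<dots>
    = (([Z, Y] <| dact2 |> []) ;; ([Z] <| y |> [?x]) ;; ([Z, ac] <| (y \<otimes> dswap b) |> []))
      ;; ([] <| z |> [?x, ?Y]) ;; ([ac] <| (z \<otimes> dswap b) |> [?Y]) ;; ([ac, ?x] <| (?E \<otimes> dmu) |> [])"
  proof -
    have "([] <| z |> [Y \<otimes>\<^sub>1 b, ?x]) ;; ([ac, Z \<otimes>\<^sub>1 b] <| (y \<otimes> dswap b) |> [])
      = ([Z, ac] <| (y \<otimes> dswap b) |> []) ;; ([] <| z |> [?x, ?Y])"
      using dexchange[of "[]" z "[]" "y \<otimes> dswap b" "[]"] by simp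
    from dcomp_step[OF this] show ?thesis by (simp add: dcomp_assoc)
  qed
  also have "([Z, Y] <| dact2 |> []) ;; ([Z] <| y |> [?x]) ;; ([Z, ac] <| (y \<otimes> dswap b) |> [])
    = ([Z] <| y |> [?m, ?as]) ;; ([Z, ac] <| ?p |> [?as])
      ;; ([Z, ac, ?m] <| ?i |> []) ;; ([Z] <| dact2 |> [?Y])"
    using arg_cong[OF dcomodule_eq1[OF Y], of "\<lambda>D. [Z] <| D |> []"] by (simp add: dwhisker_dcomp dwhisker_dwhisker)
  also have "\<dots> ;; ([] <| z |> [?x, ?Y]) ;; ([ac] <| (z \<otimes> dswap b) |> [?Y]) ;; ([ac, ?x] <| (?E \<otimes> dmu) |> [])
    = ([Z] <| y |> [?m, ?as]) ;; ([Z, ac] <| ?p |> [?as])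
      ;; ([Z, ac, ?m] <| ?i |> [])
      ;; (([Z] <| dact2 |> [?Y]) ;; ([] <| z |> [?x, ?Y]) ;; ([ac] <| (z \<otimes> dswap b) |> [?Y]))
      ;; ([ac, ?x] <| (?E \<otimes> dmu) |> [])"
    by (simp add: dcomp_assoc)
  also have "([Z] <| dact2 |> [?Y]) ;; ([] <| z |> [?x, ?Y]) ;; ([ac] <| (z \<otimes> dswap b) |> [?Y])
    = ([] <| z |> [?m, ?as, ?Y]) ;; ([ac] <| ?q |> [?as, ?Y])
      ;; ([ac, ?m] <| ?j |> [?Y]) ;; ([] <| dact2 |> [?Z, ?Y])"
    using arg_cong[OF dcomodule_eq1[OF Z], of "\<lambda>D. [] <| D |> [?Y]"] by (simp add: dwhisker_dcomp dwhisker_dwhisker)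
  finally have L: "([] <| \<sigma> |> [ac, ?m, ?as]) ;; ?L
    = ([Z] <| y |> [?m, ?as]) ;; ([Z, ac] <| ?p |> [?as])
      ;; ([Z, ac, ?m] <| ?i |> []) ;; ([] <| z |> [?m, ?as, ?Y]) ;; ([ac] <| ?q |> [?as, ?Y])
      ;; ([ac, ?m] <| ?j |> [?Y]) ;; ([] <| dact2 |> [?Z, ?Y]) ;; ([ac, ?x] <| (?E \<otimes> dmu) |> [])"
    by (simp add: dcomp_assoc)
  have "([] <| \<sigma> |> [ac, ?m, ?as]) ;; ?R
    = ([Z] <| y |> [?m, ?as]) ;; ([] <| z |> [Y \<otimes>\<^sub>1 b, ?m, ?as])
      ;; (([ac] <| ?E |> [?m, ?as]) ;; ([ac] <| (dswap (Z \<odot> Y) \<otimes> dop2) |> [?as]))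
      ;; ([ac, ?m] <| ?k |> []) ;; ([] <| dact2 |> [?V])"
    by (simp add: dcomp_assoc W[THEN dcomp_step])
  also have "([ac] <| ?E |> [?m, ?as]) ;; ([ac] <| (dswap (Z \<odot> Y) \<otimes> dop2) |> [?as])
    = ([ac, Z \<otimes>\<^sub>1 b] <| ?p |> [?as]) ;; ([ac] <| ?q |> [?Yb, ?as])
     ;; ([ac, ?m] <| (\<sigma> \<otimes> (dmu \<otimes> dmu)) |> [?as])"
    using arg_cong[OF opmonoidal_swap, of "\<lambda>D. [ac] <| D |> [?as]"] by (simp add: dwhisker_dcomp dwhisker_dwhisker)
  also have "([Z] <| y |> [?m, ?as]) ;; ([] <| z |> [Y \<otimes>\<^sub>1 b, ?m, ?as]) ;; (\<dots>)
      ;; ([ac, ?m] <| ?k |> []) ;; ([] <| dact2 |> [?V])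
    = ([Z] <| y |> [?m, ?as]) ;; ([] <| z |> [Y \<otimes>\<^sub>1 b, ?m, ?as])
      ;; ([ac, Z \<otimes>\<^sub>1 b] <| ?p |> [?as]) ;; ([ac] <| ?q |> [?Yb, ?as])
      ;; (([ac, ?m] <| (\<sigma> \<otimes> (dmu \<otimes> dmu)) |> [?as])
      ;; ([ac, ?m] <| ?k |> [])) ;; ([] <| dact2 |> [?V])"
    by (simp add: dcomp_assoc)
  also have "([ac, ?m] <| (\<sigma> \<otimes> (dmu \<otimes> dmu)) |> [?as]) ;; ([ac, ?m] <| ?k |> [])
    = ([ac, ?m, ?Zb] <| ?i |> []) ;; ([ac, ?m] <| ?j |> [?Y])
     ;; ([ac, ?m, ?as] <| (?E \<otimes> dmu) |> [])"
    using arg_cong[OF associator_split, of "\<lambda>D. [ac, ?m] <| D |> []"] by (simp add: dwhisker_dcomp dwhisker_dwhisker)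
  also have "([Z] <| y |> [?m, ?as]) ;; ([] <| z |> [Y \<otimes>\<^sub>1 b, ?m, ?as])
      ;; ([ac, Z \<otimes>\<^sub>1 b] <| ?p |> [?as]) ;; ([ac] <| ?q |> [?Yb, ?as])
      ;; (\<dots>) ;; ([] <| dact2 |> [?V])
    = ([Z] <| y |> [?m, ?as]) ;; (([] <| z |> [Y \<otimes>\<^sub>1 b, ?m, ?as])
      ;; ([ac, Z \<otimes>\<^sub>1 b] <| ?p |> [?as])) ;; (([ac] <| ?q |> [?Yb, ?as])
      ;; ([ac, ?m, ?Zb] <| ?i |> [])) ;; ([ac, ?m] <| ?j |> [?Y])
     ;; (([ac, ?m, ?as] <| (?E \<otimes> dmu) |> []) ;; ([] <| dact2 |> [?V]))"
    by (simp add: dcomp_assoc)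
  also have "([ac, ?m, ?as] <| (?E \<otimes> dmu) |> []) ;; ([] <| dact2 |> [?V])
    = ([] <| dact2 |> [?Z, ?Y]) ;; ([ac, ?x] <| (?E \<otimes> dmu) |> [])"
    using dexchange[of "[]" dact2 "[]" "?E \<otimes> dmu" "[]"] by simp
  also have "([] <| z |> [Y \<otimes>\<^sub>1 b, ?m, ?as]) ;; ([ac, Z \<otimes>\<^sub>1 b] <| ?p |> [?as])
    = ([Z, ac] <| ?p |> [?as]) ;; ([] <| z |> [?m, ?Yb, ?as])"
    using dexchange[of "[]" z "[]" "dswap Y \<otimes> dop2" "[?as]"] by simp
  also have "([ac] <| ?q |> [?Yb, ?as]) ;; ([ac, ?m, ?Zb] <| ?i |> [])
    = ([ac, Z \<otimes>\<^sub>1 b, ?m] <| ?i |> []) ;; ([ac] <| ?q |> [?as, ?Y])"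
    using dexchange[of "[ac]" "dswap Z \<otimes> dop2" "[]" ?i "[]"] by simp
  also have "([Z] <| y |> [?m, ?as])
      ;; (([Z, ac] <| ?p |> [?as]) ;; ([] <| z |> [?m, ?Yb, ?as])) ;; (\<dots>)
      ;; ([ac, ?m] <| ?j |> [?Y]) ;; ([] <| dact2 |> [?Z, ?Y]) ;; ([ac, ?x] <| (?E \<otimes> dmu) |> [])
    = ([Z] <| y |> [?m, ?as])
      ;; ([Z, ac] <| ?p |> [?as]) ;; (([] <| z |> [?m, ?Yb, ?as])
      ;; ([ac, Z \<otimes>\<^sub>1 b, ?m] <| ?i |> [])) ;; ([ac] <| ?q |> [?as, ?Y])
      ;; ([ac, ?m] <| ?j |> [?Y]) ;; ([] <| dact2 |> [?Z, ?Y]) ;; ([ac, ?x] <| (?E \<otimes> dmu) |> [])"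
    by (simp add: dcomp_assoc)
  also have "([] <| z |> [?m, ?Yb, ?as]) ;; ([ac, Z \<otimes>\<^sub>1 b, ?m] <| ?i |> [])
    = ([Z, ac, ?m] <| ?i |> []) ;; ([] <| z |> [?m, ?as, ?Y])"
    using dexchange[of "[]" z "[?m]" ?i "[]"] by simp
  finally show "([] <| \<sigma> |> [ac, ?m, ?as]) ;; ?L = ([] <| \<sigma> |> [ac, ?m, ?as]) ;; ?R"
    unfolding L by (simp add: dcomp_assoc)
qed (auto intro!: iso_dwhisker)

text \<open>
  The right side is taken apart into the unit equations of \<open>Z\<close> and \<open>Y\<close>; the cell \<open>Ru\<^sub>n\<close> at the
  composite decomposes by \<open>dRu_comp\<close>, which also consumes the merged identity arrows of \<open>\<I>\<close>.
\<close>

lemma dtens_eq2: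
  "[Z \<odot> Y] <| dact0 |> []
    = ([] <| dtens Y y Z z |> [\<one> A \<otimes>\<^sub>1 u]) ;; ([ac] <| (dswap (Z \<odot> Y) \<otimes> dop0) |> [])
      ;; ([] <| dact0 |> [(Z \<odot> Y) \<otimes>\<^sub>1 \<one> \<I>]) ;; dRu (Z \<odot> Y)"
  (is "?L = ?R")
proof (rule dcomp_cancel_left)
  let ?w = "dtens Y y Z z" and ?E = "\<sigma> \<otimes> dmu" and ?Y = "Y \<otimes>\<^sub>1 \<one> \<I>" and ?Z = "Z \<otimes>\<^sub>1 \<one> \<I>" and ?F = "\<sigma> \<otimes> dL (\<one> \<I>)"
  let ?m = "\<one> A \<otimes>\<^sub>1 u"
    and ?V = "(Z \<odot> Y) \<otimes>\<^sub>1 \<one> \<I>"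
    and ?p = "dswap Y \<otimes> dop0"
    and ?q = "dswap Z \<otimes> dop0"
  have W: "([] <| \<sigma> |> [ac, ?m]) ;; ([] <| ?w |> [?m])
    = ([Z] <| y |> [?m]) ;; ([] <| z |> [Y \<otimes>\<^sub>1 b, ?m]) ;; ([ac] <| ?E |> [?m])"
    using arg_cong[OF W_eq, of "\<lambda>D. [] <| D |> [?m]"] by (simp add: W_def dwhisker_dcomp dwhisker_dwhisker)
  have "([] <| \<sigma> |> [ac, ?m]) ;; ?R
    = ([Z] <| y |> [?m]) ;; ([] <| z |> [Y \<otimes>\<^sub>1 b, ?m])
      ;; (([ac] <| ?E |> [?m]) ;; ([ac] <| (dswap (Z \<odot> Y) \<otimes> dop0) |> []))
      ;; ([] <| dact0 |> [?V]) ;; dRu (Z \<odot> Y)"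
    by (simp add: dcomp_assoc W[THEN dcomp_step])
  also have "([ac] <| ?E |> [?m]) ;; ([ac] <| (dswap (Z \<odot> Y) \<otimes> dop0) |> [])
    = ([ac, Z \<otimes>\<^sub>1 b] <| ?p |> []) ;; ([ac] <| ?q |> [?Y])
     ;; ([ac, ?m] <| ?F |> [])"
    using arg_cong[OF opmonoidal_unit_swap, of "\<lambda>D. [ac] <| D |> []"] by (simp add: dwhisker_dcomp dwhisker_dwhisker)
  also have "([Z] <| y |> [?m]) ;; ([] <| z |> [Y \<otimes>\<^sub>1 b, ?m]) ;; (\<dots>)
      ;; ([] <| dact0 |> [?V]) ;; dRu (Z \<odot> Y)
    = ([Z] <| y |> [?m]) ;; (([] <| z |> [Y \<otimes>\<^sub>1 b, ?m]) ;; ([ac, Z \<otimes>\<^sub>1 b] <| ?p |> []))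
      ;; ([ac] <| ?q |> [?Y])
      ;; (([ac, ?m] <| ?F |> []) ;; ([] <| dact0 |> [?V])) ;; dRu (Z \<odot> Y)"
    by (simp add: dcomp_assoc)
  also have "([] <| z |> [Y \<otimes>\<^sub>1 b, ?m]) ;; ([ac, Z \<otimes>\<^sub>1 b] <| ?p |> [])
    = ([Z, ac] <| ?p |> []) ;; ([] <| z |> [?m, ?Y])"
    using dexchange[of "[]" z "[]" "dswap Y \<otimes> dop0" "[]"] by simp
  also have "([ac, ?m] <| ?F |> []) ;; ([] <| dact0 |> [?V])
    = ([] <| dact0 |> [?Z, ?Y]) ;; ([ru A] <| ?F |> [])"
    using dexchange[of "[]" dact0 "[]" ?F "[]"] by simp
  also have "([Z] <| y |> [?m]) ;; (([Z, ac] <| ?p |> []) ;; ([] <| z |> [?m, ?Y]))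
      ;; ([ac] <| ?q |> [?Y]) ;; (\<dots>) ;; dRu (Z \<odot> Y)
    = ([Z] <| y |> [?m]) ;; ([Z, ac] <| ?p |> [])
      ;; ([] <| z |> [?m, ?Y]) ;; ([ac] <| ?q |> [?Y]) ;; ([] <| dact0 |> [?Z, ?Y])
      ;; (([ru A] <| ?F |> []) ;; dRu (Z \<odot> Y))"
    by (simp add: dcomp_assoc)
  also have "([ru A] <| ?F |> []) ;; dRu (Z \<odot> Y)
    = ([] <| dRu Z |> [?Y]) ;; ([Z] <| dRu Y |> []) ;; ([] <| \<sigma> |> [ru A])"
    using dRu_comp[of Y Z] by (simp add: \<sigma>_def)
  also have "([Z] <| y |> [?m]) ;; ([Z, ac] <| ?p |> [])
      ;; ([] <| z |> [?m, ?Y]) ;; ([ac] <| ?q |> [?Y]) ;; ([] <| dact0 |> [?Z, ?Y]) ;; (\<dots>)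
    = ([Z] <| y |> [?m]) ;; ([Z, ac] <| ?p |> [])
      ;; (([] <| z |> [?m, ?Y]) ;; ([ac] <| ?q |> [?Y]) ;; ([] <| dact0 |> [?Z, ?Y]) ;; ([] <| dRu Z |> [?Y]))
      ;; ([Z] <| dRu Y |> []) ;; ([] <| \<sigma> |> [ru A])"
    by (simp add: dcomp_assoc)
  also have "([] <| z |> [?m, ?Y]) ;; ([ac] <| ?q |> [?Y]) ;; ([] <| dact0 |> [?Z, ?Y]) ;; ([] <| dRu Z |> [?Y])
    = [Z] <| dact0 |> [?Y]"
    using arg_cong[OF dcomodule_eq2[OF Z], of "\<lambda>D. [] <| D |> [?Y]"] by (simp add: dwhisker_dcomp dwhisker_dwhisker)
  also have "([Z] <| y |> [?m]) ;; ([Z, ac] <| ?p |> []) ;; (\<dots>)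
      ;; ([Z] <| dRu Y |> []) ;; ([] <| \<sigma> |> [ru A])
    = (([Z] <| y |> [?m]) ;; ([Z, ac] <| ?p |> []) ;; ([Z] <| dact0 |> [?Y])
      ;; ([Z] <| dRu Y |> [])) ;; ([] <| \<sigma> |> [ru A])"
    by (simp add: dcomp_assoc)
  also have "([Z] <| y |> [?m]) ;; ([Z, ac] <| ?p |> []) ;; ([Z] <| dact0 |> [?Y]) ;; ([Z] <| dRu Y |> [])
    = [Z, Y] <| dact0 |> []"
    using arg_cong[OF dcomodule_eq2[OF Y], of "\<lambda>D. [Z] <| D |> []"] by (simp add: dwhisker_dcomp dwhisker_dwhisker)
  also have "([Z, Y] <| dact0 |> []) ;; ([] <| \<sigma> |> [ru A]) = ([] <| \<sigma> |> [ac, ?m]) ;; ?L"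
    using dexchange[of "[]" \<sigma> "[]" dact0 "[]"] by simp
  finally show "([] <| \<sigma> |> [ac, ?m]) ;; ?L = ([] <| \<sigma> |> [ac, ?m]) ;; ?R" by simp
qed (auto intro!: iso_dwhisker)

lemma dcomodule_tensor: "dcomodule (Z \<odot> Y) (dtens Y y Z z)"
  unfolding dcomodule_def using dtens_eq1 dtens_eq2 by (simp add: is_arrow_def)

end

end

section \<open>The unit comodule\<close>

context comodule_setting
begin

definition dcounit :: "('a,'c) diagram"
  where "dcounit = dinv (dswap ac) ;; ([ac] <| dunit A X |> []) ;; ([ac] <| (did [\<one> A] \<otimes> deta) |> [])"

lemma dcounit_simps [simp]: "ok dcounit" "ddom dcounit = [\<one> A, ac]" "dcod dcounit = [ac, \<one> A \<otimes>\<^sub>1 b]"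
  by (simp_all add: dcounit_def)

lemma dco_unit: "dco (comodule_unit M \<eta> a) = dcounit"
proof -
  have e: "comodule_unit M \<eta> a = (\<one> A, (\<ii> ac \<star> ((\<ii> (\<one> A) \<otimes>\<^sub>2 \<eta>) \<cdot> TUnit \<M> A X)) \<cdot> \<ominus> (\<rr> ac) \<cdot> \<ll> ac)"
    by (simp add: comodule_unit_def Let_def)
  have d: "dco (f, \<theta>) = diag ([f, ac], \<theta>, [ac, f \<otimes>\<^sub>1 b])" for f \<theta>
    by (simp add: dco_def Coact_def)
  have I: "did [\<one> A] \<otimes> deta = dsingle (\<ii> (\<one> A) \<otimes>\<^sub>2 \<eta>)"
    by (simp add: dsingle_tensor dsingle_id deta_def)
  have s: "dcell (dinv (dswap ac)) = \<ominus> (\<rr> ac) \<cdot> \<ll> ac"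
    by (simp add: dcell_simps dswap_def dcell_unit iso_dcomp iso_dinv)
  have h: "\<ii> ac \<star> ((\<ii> (\<one> A) \<otimes>\<^sub>2 \<eta>) \<cdot> TUnit \<M> A X) = (\<ii> ac \<star> (\<ii> (\<one> A) \<otimes>\<^sub>2 \<eta>)) \<cdot> (\<ii> ac \<star> TUnit \<M> A X)"
    by (simp add: hcomp_vcomp)
  show ?thesis unfolding e d h dcounit_def I
    by (rule diagram_eqI) (simp_all add: diag_simps wt_cell_def dcell_simps s vassoc)
qed

lemma deta_swap: "([] <| deta |> [\<one> X]) ;; dswap b = [\<one> X] <| deta |> []"
  using dswap_path_natural[of deta] by (simp add: dswap_path_single dswap_one)

text \<open>
  On both sides the cells \<open>\<eta>\<close> are moved to the end.  What remains is made of unit constraints: on the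
  left an identity arrow moves along the path \<open>[ac, ac \<otimes>\<^sub>1 1]\<close>, by naturality also along the source of
  \<open>a\<^sup>2\<close>, and is then expanded to \<open>(1 \<otimes> 1) \<otimes> 1\<close>; the unit axiom of the associator turns this into the
  expansion to \<open>1 \<otimes> (1 \<otimes> 1)\<close> on the right, where \<open>B\<^sup>2\<close> has cancelled against \<open>\<eta>\<close>.
\<close>

lemma dcounit_eq1:
  "([\<one> A] <| dact2 |> []) ;; ([] <| dcounit |> [ac \<otimes>\<^sub>1 \<one> X]) ;; ([ac] <| (dcounit \<otimes> dswap b) |> [])
    = ([] <| dcounit |> [\<one> A \<otimes>\<^sub>1 m, as A X X]) ;; ([ac] <| (dswap (\<one> A) \<otimes> dop2) |> [as A X X])
      ;; ([ac, \<one> A \<otimes>\<^sub>1 m] <| dinv (dAs (\<one> A) b b) |> []) ;; ([] <| dact2 |> [(\<one> A \<otimes>\<^sub>1 b) \<otimes>\<^sub>1 b])"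
  (is "?L = ?R")
proof -
  let ?as = "as A X X" and ?I = "did [\<one> A]" and ?J = "did [\<one> X]"
  let ?e = "dinv (dswap ac) ;; ([ac] <| dunit A X |> [])"
  let ?H = "(?I \<otimes> deta) \<otimes> deta" and ?H' = "?I \<otimes> (deta \<otimes> deta)"
  let ?K = "dunit (A \<otimes>\<^sub>0 X) X ;; dunit A X \<otimes> ?J" and ?K' = "dunit A (X \<otimes>\<^sub>0 X) ;; ?I \<otimes> dunit X X"
  let ?s = "dinv (dswap_path [ac, \<one> A \<otimes>\<^sub>1 m])"
  let ?m = "\<one> A \<otimes>\<^sub>1 m"
    and ?x = "ac \<otimes>\<^sub>1 \<one> X"
    and ?V = "(\<one> A \<otimes>\<^sub>1 b) \<otimes>\<^sub>1 b"
    and ?i = "dinv (dAs (\<one> A) b b)"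
    and ?i1 = "dinv (dAs (\<one> A) (\<one> X) (\<one> X))"
  have swap1: "dinv (dswap (\<one> A)) = did [\<one> A, \<one> A]" "dinv (dswap (\<one> X)) = did [\<one> X, \<one> X]"
    by (simp_all add: dswap_one)
  have "([] <| (?I \<otimes> deta) |> [?x]) = did [\<one> A, ac] \<otimes> ([] <| deta |> [\<one> X])"
    using dten_whisker[of ?I deta "[]" "[]" "[ac]" "[\<one> X]"] by simp
  then have "([] <| (?I \<otimes> deta) |> [?x]) ;; (dcounit \<otimes> dswap b) = dcounit \<otimes> ([\<one> X] <| deta |> [])"
    by (simp add: deta_swap flip: dten_dcomp)
  also have "\<dots> = (?e ;; ([ac] <| (?I \<otimes> deta) |> [])) \<otimes> (did [\<one> X, \<one> X] ;; ([\<one> X] <| deta |> []))"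
    by (simp add: dcounit_def dcomp_assoc)
  also have "\<dots> = ?e \<otimes> did [\<one> X, \<one> X] ;; ([?x] <| ?H |> [])"
    by (subst dten_dcomp) (simp_all add: dten_whisker)
  also have "?e \<otimes> did [\<one> X, \<one> X] = ?e \<otimes> (dinv (dswap (\<one> X)) ;; ([\<one> X] <| ?J |> []))"
    by (simp add: dswap_one)
  also have "\<dots> = dinv (dswap ac) \<otimes> dinv (dswap (\<one> X)) ;; ([?x] <| (dunit A X \<otimes> ?J) |> [])"
    by (subst dten_dcomp) (simp_all add: dten_whisker del: dwhisker_did)
  finally have 1: "([] <| (?I \<otimes> deta) |> [?x]) ;; (dcounit \<otimes> dswap b)
    = dinv (dswap ac) \<otimes> dinv (dswap (\<one> X)) ;; ([?x] <| (dunit A X \<otimes> ?J) |> []) ;; ([?x] <| ?H |> [])"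
    by (simp add: dcomp_assoc)
  have "([] <| dunit A X |> [?x]) ;; ([] <| (?I \<otimes> deta) |> [?x]) ;; (dcounit \<otimes> dswap b)
    = dinv (dswap (?x)) ;; ([?x] <| ?K |> []) ;; ([?x] <| ?H |> [])"
    unfolding 1 using dcomp_step[OF dswap_tensor_inv[of ac "\<one> X"]] by (simp add: dwhisker_dcomp dcomp_assoc)
  from arg_cong[OF this, of "\<lambda>D. [ac] <| D |> []"]
  have "?L = ([\<one> A] <| dact2 |> []) ;; (([] <| dinv (dswap ac) |> [?x]) ;; ([ac] <| dinv (dswap (?x)) |> []))
      ;; ([ac, ?x] <| (?K ;; ?H) |> [])"
    by (simp add: dcounit_def dnormalize)
  also have "([] <| dinv (dswap ac) |> [?x]) ;; ([ac] <| dinv (dswap (?x)) |> []) = dinv (dswap_path [ac, ?x])"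
    using dinv_dswap_path_append[of "[ac]" "[?x]"] by (simp add: dswap_path_single)
  also have "([\<one> A] <| dact2 |> []) ;; dinv (dswap_path [ac, ?x]) ;; ([ac, ?x] <| (?K ;; ?H) |> [])
    = dinv (dswap_path [ac, ?m, ?as]) ;; ([] <| dact2 |> [\<one> ((A \<otimes>\<^sub>0 X) \<otimes>\<^sub>0 X)]) ;; ([ac, ?x] <| (?K ;; ?H) |> [])"
    using dcomp_step[OF dswap_path_inv_natural[of dact2]] by (simp add: dcomp_assoc)
  also have "([] <| dact2 |> [\<one> ((A \<otimes>\<^sub>0 X) \<otimes>\<^sub>0 X)]) ;; ([ac, ?x] <| (?K ;; ?H) |> [])
    = ([ac, ?m, ?as] <| (?K ;; ?H) |> []) ;; ([] <| dact2 |> [?V])"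
    using dexchange[of "[]" dact2 "[]" "?K ;; ?H" "[]"] by simp
  also have "dinv (dswap_path [ac, ?m, ?as]) = ([] <| ?s |> [?as]) ;; ([ac, ?m] <| dinv (dswap ?as) |> [])"
    using dinv_dswap_path_append[of "[ac, ?m]" "[?as]"] by (simp add: dswap_path_single)
  also have "\<dots> ;; ([ac, ?m, ?as] <| (?K ;; ?H) |> []) ;; ([] <| dact2 |> [?V])
    = ([] <| ?s |> [?as]) ;; ([ac, ?m] <| ((dinv (dswap ?as) ;; ([?as] <| ?K |> [])) ;; ([?as] <| ?H |> [])) |> [])
      ;; ([] <| dact2 |> [?V])"
    by (simp add: dnormalize)
  also have "dinv (dswap ?as) ;; ([?as] <| ?K |> []) = ([] <| ?K' |> [?as]) ;; ?i1"
  proof (rule dcomp_inv_shift[symmetric])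
    show "dswap ?as ;; ([] <| ?K' |> [?as]) = ([?as] <| ?K |> []) ;; dAs (\<one> A) (\<one> X) (\<one> X)"
      using dAs_unit[of A X X] by (simp add: dwhisker_dcomp dcomp_assoc)
  qed simp_all
  also have "(([] <| ?K' |> [?as]) ;; ?i1) ;; ([?as] <| ?H |> [])
    = ([] <| ?K' |> [?as]) ;; ?i1 ;; ([?as] <| ?H |> [])" by (simp only: dcomp_assoc)
  also have "?i1 ;; ([?as] <| ?H |> []) = ([] <| ?H' |> [?as]) ;; ?i"
  proof (rule dcomp_inv_shift[symmetric])
    show "dAs (\<one> A) (\<one> X) (\<one> X) ;; ([] <| ?H' |> [?as]) = ([?as] <| ?H |> []) ;; dAs (\<one> A) b b"
      using dAs_natural[of "\<ii> (\<one> A)" \<eta> \<eta>, OF _ _ _ refl refl refl refl refl refl] by (simp add: dsingle_id deta_def)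
  qed simp_all
  finally have L: "?L = ([] <| (?s ;; ([ac, ?m] <| (?K' ;; ?H') |> [])) |> [?as])
     ;; ([ac, ?m] <| ?i |> []) ;; ([] <| dact2 |> [?V])"
    by (simp add: dnormalize)
  have "([] <| (?I \<otimes> deta) |> [?m]) = did [\<one> A, \<one> A] \<otimes> ([] <| deta |> [m])"
    using dten_whisker[of ?I deta "[]" "[]" "[\<one> A]" "[m]"] by simp
  then have "([] <| (?I \<otimes> deta) |> [?m]) ;; (dswap (\<one> A) \<otimes> dop2)
    = did [\<one> A, \<one> A] \<otimes> (([] <| deta |> [m]) ;; dop2)"
    by (simp add: dswap_one flip: dten_dcomp)
  also have "\<dots> = (dinv (dswap (\<one> A)) ;; ([\<one> A] <| ?I |> []) ;; ([\<one> A] <| ?I |> []))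
      \<otimes> (dinv (dswap m) ;; ([m] <| dunit X X |> []) ;; ([m] <| (deta \<otimes> deta) |> []))"
    unfolding dop2_eta by (simp add: dswap_one)
  also have "\<dots> = dinv (dswap (\<one> A)) \<otimes> dinv (dswap m) ;; ([?m] <| (?I \<otimes> dunit X X) |> []) ;; ([?m] <| ?H' |> [])"
    by (simp add: dten_dcomp dten_whisker del: dwhisker_did)
  finally have 2: "([] <| dunit A X |> [?m]) ;; ([] <| (?I \<otimes> deta) |> [?m]) ;; (dswap (\<one> A) \<otimes> dop2)
    = dinv (dswap (?m)) ;; ([?m] <| (?K' ;; ?H') |> [])"
    using dcomp_step[OF dswap_tensor_inv[of "\<one> A" m]] by (simp add: dwhisker_dcomp dcomp_assoc)
  from arg_cong[OF this, of "\<lambda>D. [ac] <| D |> []"]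
  have "([] <| dcounit |> [?m]) ;; ([ac] <| (dswap (\<one> A) \<otimes> dop2) |> [])
    = ([] <| dinv (dswap ac) |> [?m]) ;; ([ac] <| dinv (dswap (?m)) |> []) ;; ([ac, ?m] <| (?K' ;; ?H') |> [])"
    by (simp add: dcounit_def dnormalize)
  also have "\<dots> = ?s ;; ([ac, ?m] <| (?K' ;; ?H') |> [])"
    using dinv_dswap_path_append[of "[ac]" "[?m]"] by (simp add: dswap_path_single dcomp_assoc)
  finally have R: "([] <| dcounit |> [?m]) ;; ([ac] <| (dswap (\<one> A) \<otimes> dop2) |> [])
    = ?s ;; ([ac, ?m] <| (?K' ;; ?H') |> [])" .
  show ?thesis unfolding L R[symmetric] by (simp add: dnormalize)
qed

text \<open>
  Since \<open>\<eta>\<close> cancels \<open>B\<^sup>0\<close>, the right side moves an identity arrow to the right along the source of \<open>a\<^sup>0\<close>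
  and back along its target, which by naturality has no effect.
\<close>

lemma dcounit_eq2:
  "[\<one> A] <| dact0 |> []
    = ([] <| dcounit |> [\<one> A \<otimes>\<^sub>1 u]) ;; ([ac] <| (dswap (\<one> A) \<otimes> dop0) |> [])
      ;; ([] <| dact0 |> [\<one> A \<otimes>\<^sub>1 \<one> \<I>]) ;; dRu (\<one> A)"
proof -
  let ?I = "did [\<one> A]" and ?s = "dinv (dswap_path [ac, \<one> A \<otimes>\<^sub>1 u])" and ?t = "\<one> A \<otimes>\<^sub>1 u"
  have "([] <| (?I \<otimes> deta) |> [?t]) = did [\<one> A, \<one> A] \<otimes> ([] <| deta |> [u])"
    using dten_whisker[of ?I deta "[]" "[]" "[\<one> A]" "[u]"] by simp
  then have "([] <| (?I \<otimes> deta) |> [?t]) ;; (dswap (\<one> A) \<otimes> dop0) = did [\<one> A, \<one> A] \<otimes> (([] <| deta |> [u]) ;; dop0)"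
    by (simp add: dswap_one flip: dten_dcomp)
  also have "\<dots> = dinv (dswap (\<one> A)) \<otimes> dinv (dswap u)"
    unfolding dop0_eta by (simp add: dswap_one)
  finally have "([] <| dunit A X |> [?t]) ;; ([] <| (?I \<otimes> deta) |> [?t]) ;; (dswap (\<one> A) \<otimes> dop0)
    = dinv (dswap ?t) ;; ([?t] <| dunit A \<I> |> [])"
    using dswap_tensor_inv[of "\<one> A" u] by simp
  from arg_cong[OF this, of "\<lambda>D. [ac] <| D |> []"]
  have "([] <| dcounit |> [?t]) ;; ([ac] <| (dswap (\<one> A) \<otimes> dop0) |> [])
    = ([] <| dinv (dswap ac) |> [?t]) ;; ([ac] <| dinv (dswap ?t) |> []) ;; ([ac, ?t] <| dunit A \<I> |> [])"
    by (simp add: dcounit_def dnormalize)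
  also have "\<dots> = ?s ;; ([ac, ?t] <| dunit A \<I> |> [])"
    using dinv_dswap_path_append[of "[ac]" "[?t]"] by (simp add: dswap_path_single dcomp_assoc)
  finally have R: "([] <| dcounit |> [?t]) ;; ([ac] <| (dswap (\<one> A) \<otimes> dop0) |> []) = ?s ;; ([ac, ?t] <| dunit A \<I> |> [])" .
  have "([] <| dcounit |> [?t]) ;; ([ac] <| (dswap (\<one> A) \<otimes> dop0) |> []) ;; ([] <| dact0 |> [\<one> A \<otimes>\<^sub>1 \<one> \<I>]) ;; dRu (\<one> A)
    = ?s ;; (([ac, ?t] <| dunit A \<I> |> []) ;; ([] <| dact0 |> [\<one> A \<otimes>\<^sub>1 \<one> \<I>])) ;; dRu (\<one> A)"
    using dcomp_step[OF R] by (simp add: dcomp_assoc)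
  also have "([ac, ?t] <| dunit A \<I> |> []) ;; ([] <| dact0 |> [\<one> A \<otimes>\<^sub>1 \<one> \<I>])
    = ([] <| dact0 |> [\<one> (A \<otimes>\<^sub>0 \<I>)]) ;; ([ru A] <| dunit A \<I> |> [])"
    using dexchange[of "[]" dact0 "[]" "dunit A \<I>" "[]"] by simp
  also have "?s ;; (\<dots>) ;; dRu (\<one> A)
    = (?s ;; ([] <| dact0 |> [\<one> (A \<otimes>\<^sub>0 \<I>)])) ;; dswap (ru A)"
    by (simp add: dcomp_assoc dRu_unit)
  also have "?s ;; ([] <| dact0 |> [\<one> (A \<otimes>\<^sub>0 \<I>)]) = ([\<one> A] <| dact0 |> []) ;; dinv (dswap (ru A))"
    using dswap_path_inv_natural[of dact0] by (simp add: dswap_path_single)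
  also have "(\<dots>) ;; dswap (ru A) = [\<one> A] <| dact0 |> []"
    by (simp add: dcomp_assoc dinv_cancel)
  finally show ?thesis by simp
qed

lemma dcomodule_unit: "dcomodule (\<one> A) dcounit"
  unfolding dcomodule_def using dcounit_eq1 dcounit_eq2 by (simp add: is_arrow_def)

end

section \<open>Comodule morphisms\<close>

context comodule_setting
begin

text \<open>
  The condition on a morphism of comodules, for its cell as a diagram \<open>g\<close>.
\<close>

definition dmor :: "('a,'c) diagram \<Rightarrow> ('a,'c) diagram \<Rightarrow> ('a,'c) diagram \<Rightarrow> bool"
  where "dmor D g D' \<longleftrightarrow> ([] <| g |> [ac]) ;; D' = D ;; ([ac] <| (g \<otimes> did [b]) |> [])"

lemma dcell_dco: "dcomodule (fst Yy) (dco Yy) \<Longrightarrow> dcell (dco Yy) = snd Yy"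
  using dcomodule_typing(4)[of "fst Yy" "dco Yy"] by (simp add: dco_def Coact_def diag_simps)

lemma morphism_iff:
  assumes Y: "dcomodule (fst Yy) (dco Yy)" and Y': "dcomodule (fst Yy') (dco Yy')"
  shows "comodule_morphism B a a Yy Yy' \<gamma> \<longleftrightarrow>
    \<gamma> \<in> Cell \<M> \<and> Dom \<M> \<gamma> = fst Yy \<and> Cod \<M> \<gamma> = fst Yy' \<and> dmor (dco Yy) (dsingle \<gamma>) (dco Yy')"
proof (cases "\<gamma> \<in> Cell \<M> \<and> Dom \<M> \<gamma> = fst Yy \<and> Cod \<M> \<gamma> = fst Yy'")
  case True
  note [simp] = dcomodule_typing[OF Y] dcomodule_typing[OF Y']
  have g [simp]: "\<gamma> \<in> Cell \<M>" "Dom \<M> \<gamma> = fst Yy" "Cod \<M> \<gamma> = fst Yy'" using True by auto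
  have t: "dsingle \<gamma> \<otimes> did [b] = dsingle (\<gamma> \<otimes>\<^sub>2 \<ii> b)" by (simp add: dsingle_tensor dsingle_id)
  let ?l = "([] <| dsingle \<gamma> |> [ac]) ;; dco Yy'" and ?r = "dco Yy ;; ([ac] <| dsingle (\<gamma> \<otimes>\<^sub>2 \<ii> b) |> [])"
  have ok: "ok ?l" "ok ?r" "ddom ?l = ddom ?r" "dcod ?l = dcod ?r" by simp_all
  have "dcell ?l = snd Yy' \<cdot> (\<gamma> \<star> \<ii> ac)" "dcell ?r = (\<ii> ac \<star> (\<gamma> \<otimes>\<^sub>2 \<ii> b)) \<cdot> snd Yy"
    by (simp_all add: dcell_simps dcell_dco[OF Y] dcell_dco[OF Y'])
  then have "(snd Yy' \<cdot> (\<gamma> \<star> \<ii> ac) = (\<ii> ac \<star> (\<gamma> \<otimes>\<^sub>2 \<ii> b)) \<cdot> snd Yy) \<longleftrightarrow> ?l = ?r"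
    using diagram_eqI[OF ok] by auto
  then show ?thesis using True by (simp add: comodule_morphism_def dmor_def is_cell_def t)
qed (auto simp: comodule_morphism_def is_cell_def)

lemma dmor_id: "dcomodule Y D \<Longrightarrow> dmor D (did [Y]) D"
  using dcomodule_typing[of Y D] by (simp add: dmor_def dten_did)

lemma dmor_comp:
  assumes "dmor D g D'" "dmor D' h D''" "ok g" "ok h" "dcod g = ddom h"
    "length (ddom g) = 1" "length (dcod g) = 1" "length (dcod h) = 1"
  shows "dmor D (g ;; h) D''"
proof -
  have "(g ;; h) \<otimes> did [b] = (g ;; h) \<otimes> (did [b] ;; did [b])" by simp
  also have "\<dots> = g \<otimes> did [b] ;; h \<otimes> did [b]" by (rule dten_dcomp) (use assms in simp_all)
  finally have t: "(g ;; h) \<otimes> did [b] = g \<otimes> did [b] ;; h \<otimes> did [b]" .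
  have "([] <| (g ;; h) |> [ac]) ;; D'' = ([] <| g |> [ac]) ;; ([] <| h |> [ac]) ;; D''"
    by (simp only: dwhisker_dcomp dcomp_assoc)
  also have "([] <| h |> [ac]) ;; D'' = D' ;; ([ac] <| (h \<otimes> did [b]) |> [])"
    using assms(2) by (simp only: dmor_def)
  also have "([] <| g |> [ac]) ;; D' ;; ([ac] <| (h \<otimes> did [b]) |> [])
    = (([] <| g |> [ac]) ;; D') ;; ([ac] <| (h \<otimes> did [b]) |> [])" by (simp only: dcomp_assoc)
  also have "([] <| g |> [ac]) ;; D' = D ;; ([ac] <| (g \<otimes> did [b]) |> [])"
    using assms(1) by (simp only: dmor_def)
  finally show ?thesis unfolding dmor_def t by (simp only: dwhisker_dcomp dcomp_assoc)
qed

lemma dmor_inv: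
  assumes Y: "dcomodule Y D" and Y': "dcomodule Y' D'" and g: "iso g" "ddom g = [Y]" "dcod g = [Y']" and m: "dmor D g D'"
  shows "dmor D' (dinv g) D"
proof -
  note [simp] = dcomodule_typing[OF Y] dcomodule_typing[OF Y'] g iso_ok[OF g(1)]
  have ib: "iso (did [b])" by (simp add: iso_def dcell_simps)
  have t: "iso (g \<otimes> did [b])" "dinv (g \<otimes> did [b]) = dinv g \<otimes> did [b]"
    using dten_dinv[OF g(1) ib] by simp_all
  let ?P = "[] <| g |> [ac]" and ?Q = "[ac] <| (g \<otimes> did [b]) |> []"
  have i: "iso ?P" "iso ?Q" using t(1) by (auto intro!: iso_dwhisker)
  have "D' ;; dinv ?Q = dinv ?P ;; D"
    by (rule dcomp_inv_shift) (use i m in \<open>simp_all add: dmor_def\<close>)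
  moreover have "dinv ?P = [] <| dinv g |> [ac]" "dinv ?Q = [ac] <| (dinv g \<otimes> did [b]) |> []"
    using t by (auto intro!: dinv_dwhisker simp flip: t(2))
  ultimately show ?thesis by (simp add: dmor_def)
qed

lemma dmor_tensor:
  assumes Y: "dcomodule Y y" and Y': "dcomodule Y' y'" and Z: "dcomodule Z z" and Z': "dcomodule Z' z'"
    and \<gamma>: "\<gamma> \<in> Cell \<M>" "Dom \<M> \<gamma> = Y" "Cod \<M> \<gamma> = Y'" "dmor y (dsingle \<gamma>) y'"
    and \<delta>: "\<delta> \<in> Cell \<M>" "Dom \<M> \<delta> = Z" "Cod \<M> \<delta> = Z'" "dmor z (dsingle \<delta>) z'"
  shows "dmor (dtens Y y Z z) (dsingle (\<delta> \<star> \<gamma>)) (dtens Y' y' Z' z')"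
proof -
  note [simp] = dcomodule_typing[OF Y] dcomodule_typing[OF Y'] dcomodule_typing[OF Z] dcomodule_typing[OF Z'] \<gamma>(1-3) \<delta>(1-3)
  let ?g = "dsingle \<gamma>" and ?d = "dsingle \<delta>" and ?h = "dsingle (\<delta> \<star> \<gamma>)"
  let ?S = "dsplit Z Y" and ?S' = "dsplit Z' Y'" and ?I = "did [b]"
  have h: "?h ;; ?S' = ?S ;; ([] <| ?d |> [Y]) ;; ([Z'] <| ?g |> [])"
    using dsingle_hcomp[of \<gamma> \<delta> Y Y' Z Z'] by simp
  have "dinv ?S ;; ?h = dinv ?S ;; (?h ;; ?S') ;; dinv ?S'" by (simp add: dcomp_assoc dinv_cancel)
  also have "\<dots> = ([] <| ?d |> [Y]) ;; ([Z'] <| ?g |> []) ;; dinv ?S'"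
    unfolding h by (simp add: dcomp_assoc) (simp add: dinv_cancel flip: dcomp_assoc)
  finally have h': "dinv ?S ;; ?h = ([] <| ?d |> [Y]) ;; ([Z'] <| ?g |> []) ;; dinv ?S'" .
  have g: "([Z'] <| ?g |> [ac]) ;; ([Z'] <| y' |> []) = ([Z'] <| y |> []) ;; ([Z', ac] <| (?g \<otimes> ?I) |> [])"
    using arg_cong[OF \<gamma>(4)[unfolded dmor_def], of "\<lambda>D. [Z'] <| D |> []"] by (simp add: dwhisker_dcomp dwhisker_dwhisker)
  have d: "([] <| ?d |> [ac, Y \<otimes>\<^sub>1 b]) ;; ([] <| z' |> [Y \<otimes>\<^sub>1 b]) = ([] <| z |> [Y \<otimes>\<^sub>1 b]) ;; ([ac] <| (?d \<otimes> ?I) |> [Y \<otimes>\<^sub>1 b])"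
    using arg_cong[OF \<delta>(4)[unfolded dmor_def], of "\<lambda>D. [] <| D |> [Y \<otimes>\<^sub>1 b]"] by (simp add: dwhisker_dcomp dwhisker_dwhisker)
  have x1: "([] <| ?d |> [Y, ac]) ;; ([Z'] <| y |> []) = ([Z] <| y |> []) ;; ([] <| ?d |> [ac, Y \<otimes>\<^sub>1 b])"
    using dexchange[of "[]" ?d "[]" y "[]"] by simp
  have x2: "([Z', ac] <| (?g \<otimes> ?I) |> []) ;; ([] <| z' |> [Y' \<otimes>\<^sub>1 b]) = ([] <| z' |> [Y \<otimes>\<^sub>1 b]) ;; ([ac, Z' \<otimes>\<^sub>1 b] <| (?g \<otimes> ?I) |> [])"
    using dexchange[of "[]" z' "[]" "?g \<otimes> ?I" "[]"] by simp
  have "([] <| (?d \<otimes> ?I) |> [Y \<otimes>\<^sub>1 b]) = ([] <| ?d |> [Y]) \<otimes> did [b, b]"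
    using dten_whisker[of ?d ?I "[]" "[]" "[Y]" "[b]"] by simp
  moreover have "([Z' \<otimes>\<^sub>1 b] <| (?g \<otimes> ?I) |> []) = ([Z'] <| ?g |> []) \<otimes> did [b, b]"
    using dten_whisker[of ?g ?I "[Z']" "[b]" "[]" "[]"] by simp
  ultimately have "([] <| (?d \<otimes> ?I) |> [Y \<otimes>\<^sub>1 b]) ;; ([Z' \<otimes>\<^sub>1 b] <| (?g \<otimes> ?I) |> []) ;; (dinv ?S' \<otimes> dmu)
    = (([] <| ?d |> [Y]) ;; ([Z'] <| ?g |> []) ;; dinv ?S') \<otimes> dmu"
    by (simp flip: dten_dcomp)
  also have "\<dots> = dinv ?S \<otimes> dmu ;; ?h \<otimes> ?I"
    unfolding h'[symmetric] by (simp flip: dten_dcomp)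
  finally have t: "([] <| (?d \<otimes> ?I) |> [Y \<otimes>\<^sub>1 b]) ;; ([Z' \<otimes>\<^sub>1 b] <| (?g \<otimes> ?I) |> []) ;; (dinv ?S' \<otimes> dmu)
    = dinv ?S \<otimes> dmu ;; ?h \<otimes> ?I" .
  have "([] <| ?h |> [ac]) ;; dtens Y' y' Z' z'
    = ([] <| (?h ;; ?S') |> [ac]) ;; ([Z'] <| y' |> []) ;; ([] <| z' |> [Y' \<otimes>\<^sub>1 b]) ;; ([ac] <| (dinv ?S' \<otimes> dmu) |> [])"
    by (simp add: dtens_def dwhisker_dcomp dcomp_assoc)
  also have "\<dots> = ([] <| ?S |> [ac]) ;; ([] <| ?d |> [Y, ac]) ;; (([Z'] <| ?g |> [ac]) ;; ([Z'] <| y' |> []))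
      ;; ([] <| z' |> [Y' \<otimes>\<^sub>1 b]) ;; ([ac] <| (dinv ?S' \<otimes> dmu) |> [])"
    unfolding h by (simp add: dnormalize)
  also have "\<dots> = ([] <| ?S |> [ac]) ;; (([] <| ?d |> [Y, ac]) ;; ([Z'] <| y |> []))
      ;; (([Z', ac] <| (?g \<otimes> ?I) |> []) ;; ([] <| z' |> [Y' \<otimes>\<^sub>1 b])) ;; ([ac] <| (dinv ?S' \<otimes> dmu) |> [])"
    unfolding g by (simp add: dcomp_assoc)
  also have "\<dots> = ([] <| ?S |> [ac]) ;; ([Z] <| y |> []) ;; (([] <| ?d |> [ac, Y \<otimes>\<^sub>1 b]) ;; ([] <| z' |> [Y \<otimes>\<^sub>1 b]))
      ;; ([ac, Z' \<otimes>\<^sub>1 b] <| (?g \<otimes> ?I) |> []) ;; ([ac] <| (dinv ?S' \<otimes> dmu) |> [])"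
    unfolding x1 x2 by (simp add: dcomp_assoc)
  also have "\<dots> = ([] <| ?S |> [ac]) ;; ([Z] <| y |> []) ;; ([] <| z |> [Y \<otimes>\<^sub>1 b])
      ;; ([ac] <| (([] <| (?d \<otimes> ?I) |> [Y \<otimes>\<^sub>1 b]) ;; ([Z' \<otimes>\<^sub>1 b] <| (?g \<otimes> ?I) |> []) ;; (dinv ?S' \<otimes> dmu)) |> [])"
    unfolding d by (simp add: dnormalize)
  also have "\<dots> = dtens Y y Z z ;; ([ac] <| (?h \<otimes> ?I) |> [])"
    unfolding t by (simp add: dtens_def dwhisker_dcomp dcomp_assoc)
  finally show ?thesis unfolding dmor_def .
qed

text \<open>
  With \<open>W\<close>, \<open>Y\<close>, \<open>Z\<close> in one path, both coactions apply \<open>w\<close>, \<open>y\<close>, \<open>z\<close> in turn and then merge.  They differ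
  only in the bracketing of the arrows, which the associator cell corrects, and of the
  multiplications, which agree because \<open>\<mu>\<close> is associative.
\<close>

lemma dmor_assoc:
  assumes W: "dcomodule W w" and Y: "dcomodule Y y" and Z: "dcomodule Z z"
  shows "dmor (dtens W w (Z \<odot> Y) (dtens Y y Z z)) (dsingle (\<aa> Z Y W)) (dtens (Y \<odot> W) (dtens W w Y y) Z z)"
proof -
  note [simp] = dcomodule_typing[OF W] dcomodule_typing[OF Y] dcomodule_typing[OF Z]
  let ?g = "dsingle (\<aa> Z Y W)" and ?I = "did [b]"
  let ?s = "dsplit (Z \<odot> Y) W" and ?t = "dsplit Z Y" and ?p = "dsplit Z (Y \<odot> W)" and ?q = "dsplit Y W"
  let ?W = "W \<otimes>\<^sub>1 b" and ?Y = "Y \<otimes>\<^sub>1 b" and ?Z = "Z \<otimes>\<^sub>1 b"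
  have g: "?g ;; ?p ;; ([Z] <| ?q |> []) = ?s ;; ([] <| ?t |> [W])"
    using dsingle_assoc[of W Y Z] by simp
  have ig: "iso ?g" by simp
  have iT: "iso ([] <| ?t |> [W])" "iso ([Z] <| ?q |> [])" by (auto intro!: iso_dwhisker)
  have "dinv (?s ;; ([] <| ?t |> [W])) = dinv ([] <| ?t |> [W]) ;; dinv ?s"
    using iT by (subst dinv_dcomp) simp_all
  moreover have "dinv (?g ;; ?p ;; ([Z] <| ?q |> [])) = (dinv ([Z] <| ?q |> []) ;; dinv ?p) ;; dinv ?g"
    using iT ig by (subst dinv_dcomp; simp add: iso_dcomp dinv_dcomp)
  ultimately have "dinv ([] <| ?t |> [W]) ;; dinv ?s ;; ?g = (dinv ([Z] <| ?q |> []) ;; dinv ?p) ;; dinv ?g ;; ?g"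
    unfolding g by (metis dcomp_assoc)
  then have g': "([] <| dinv ?t |> [W]) ;; dinv ?s ;; ?g = ([Z] <| dinv ?q |> []) ;; dinv ?p"
    using ig by (simp add: dinv_cancel dinv_dwhisker dcomp_assoc)
  let ?L = "([] <| dinv ?t |> [W]) ;; dinv ?s" and ?R = "([Z] <| dinv ?q |> []) ;; dinv ?p"
  let ?ml = "([] <| dmu |> [b]) ;; dmu" and ?mr = "([b] <| dmu |> []) ;; dmu"
  have l: "([] <| (dinv ?t \<otimes> dmu) |> [?W]) ;; (dinv ?s \<otimes> dmu) = ?L \<otimes> ?ml"
    using dten_whisker[of "dinv ?t" dmu "[]" "[]" "[W]" "[b]"] by (simp add: dten_dcomp)
  have r: "([?Z] <| (dinv ?q \<otimes> dmu) |> []) ;; (dinv ?p \<otimes> dmu) = ?R \<otimes> ?mr"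
    using dten_whisker[of "dinv ?q" dmu "[Z]" "[b]" "[]" "[]"] by (simp add: dten_dcomp)
  have lg: "?L \<otimes> ?ml ;; ?g \<otimes> ?I = ?R \<otimes> ?mr"
  proof -
    have "?L \<otimes> ?ml ;; ?g \<otimes> ?I = (?L ;; ?g) \<otimes> (?ml ;; ?I)"
      by (rule dten_dcomp[symmetric]) simp_all
    also have "?L ;; ?g = ?R" using g' by (simp add: dcomp_assoc)
    also have "?ml ;; ?I = ?mr" using dmu_assoc by simp
    finally show ?thesis .
  qed
  let ?mid = "([Z, Y] <| w |> []) ;; ([Z] <| y |> [?W]) ;; ([] <| z |> [?Y, ?W])"
  have x1: "([Z \<odot> Y] <| w |> []) ;; ([] <| ?t |> [ac, ?W]) = ([] <| ?t |> [W, ac]) ;; ([Z, Y] <| w |> [])"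
    using dexchange[of "[]" ?t "[]" w "[]"] by simp
  have x2: "([Z, ac] <| (dinv ?q \<otimes> dmu) |> []) ;; ([] <| z |> [(Y \<odot> W) \<otimes>\<^sub>1 b]) = ([] <| z |> [?Y, ?W]) ;; ([ac, ?Z] <| (dinv ?q \<otimes> dmu) |> [])"
    using dexchange[of "[]" z "[]" "dinv ?q \<otimes> dmu" "[]"] by simp
  have "dtens W w (Z \<odot> Y) (dtens Y y Z z)
    = ([] <| ?s |> [ac]) ;; (([Z \<odot> Y] <| w |> []) ;; ([] <| ?t |> [ac, ?W])) ;; ([Z] <| y |> [?W]) ;; ([] <| z |> [?Y, ?W])
      ;; ([ac] <| (([] <| (dinv ?t \<otimes> dmu) |> [?W]) ;; (dinv ?s \<otimes> dmu)) |> [])"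
    by (simp add: dtens_def dnormalize)
  also have "\<dots> = ([] <| (?s ;; ([] <| ?t |> [W])) |> [ac]) ;; ?mid ;; ([ac] <| (?L \<otimes> ?ml) |> [])"
    unfolding x1 l by (simp add: dnormalize)
  finally have D1: "dtens W w (Z \<odot> Y) (dtens Y y Z z)
    = ([] <| (?s ;; ([] <| ?t |> [W])) |> [ac]) ;; ?mid ;; ([ac] <| (?L \<otimes> ?ml) |> [])" .
  have "dtens (Y \<odot> W) (dtens W w Y y) Z z
    = ([] <| (?p ;; ([Z] <| ?q |> [])) |> [ac]) ;; ([Z, Y] <| w |> []) ;; ([Z] <| y |> [?W])
      ;; (([Z, ac] <| (dinv ?q \<otimes> dmu) |> []) ;; ([] <| z |> [(Y \<odot> W) \<otimes>\<^sub>1 b])) ;; ([ac] <| (dinv ?p \<otimes> dmu) |> [])"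
    by (simp add: dtens_def dnormalize)
  also have "\<dots> = ([] <| (?p ;; ([Z] <| ?q |> [])) |> [ac]) ;; ?mid ;; ([ac] <| (([?Z] <| (dinv ?q \<otimes> dmu) |> []) ;; (dinv ?p \<otimes> dmu)) |> [])"
    unfolding x2 by (simp add: dnormalize)
  finally have D2: "dtens (Y \<odot> W) (dtens W w Y y) Z z
    = ([] <| (?p ;; ([Z] <| ?q |> [])) |> [ac]) ;; ?mid ;; ([ac] <| (?R \<otimes> ?mr) |> [])"
    unfolding r .
  have "([] <| ?g |> [ac]) ;; dtens (Y \<odot> W) (dtens W w Y y) Z z
    = ([] <| (?g ;; ?p ;; ([Z] <| ?q |> [])) |> [ac]) ;; ?mid ;; ([ac] <| (?R \<otimes> ?mr) |> [])"
    unfolding D2 by (simp only: dwhisker_dcomp dcomp_assoc)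
  also have "\<dots> = ([] <| (?s ;; ([] <| ?t |> [W])) |> [ac]) ;; ?mid ;; ([ac] <| (?L \<otimes> ?ml ;; ?g \<otimes> ?I) |> [])"
    unfolding g lg ..
  also have "\<dots> = dtens W w (Z \<odot> Y) (dtens Y y Z z) ;; ([ac] <| (?g \<otimes> ?I) |> [])"
    unfolding D1 by (simp only: dwhisker_dcomp dcomp_assoc)
  finally show ?thesis unfolding dmor_def .
qed

lemma dswap_ac: "dinv (dswap ac) ;; dR ac = dL ac"
proof -
  have "dinv (dswap ac) = dL ac ;; dinv (dR ac)"
    unfolding dswap_def by (subst dinv_dcomp) (simp_all add: iso_dinv)
  then show ?thesis by (simp add: dcomp_assoc dinv_cancel)
qed

text \<open>
  By the unit law \<open>\<mu>(B\<eta>) = 1\<close>, the coaction of the unit object leaves behind only an identity arrow,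
  applied before \<open>Y\<close>; naturality of the right unitor with respect to \<open>y\<close> removes it.
\<close>

lemma dmor_run:
  assumes Y: "dcomodule Y y"
  shows "dmor (dtens (\<one> A) dcounit Y y) (dsingle (\<rr> Y)) y"
proof -
  note [simp] = dcomodule_typing[OF Y]
  let ?S = "dsplit Y (\<one> A)" and ?I = "did [b]" and ?Y = "Y \<otimes>\<^sub>1 b" and ?J = "dunit A X" and ?H = "did [\<one> A] \<otimes> deta"
  have r: "dsingle (\<rr> Y) = ?S ;; dR Y" using dsingle_run[of Y] by simp
  have "dinv ?S \<otimes> dmu ;; dsingle (\<rr> Y) \<otimes> ?I = (dinv ?S ;; dsingle (\<rr> Y)) \<otimes> (dmu ;; ?I)"
    by (rule dten_dcomp[symmetric]) simp_all
  also have "dinv ?S ;; dsingle (\<rr> Y) = dR Y" unfolding r by (simp add: dinv_cancel flip: dcomp_assoc)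
  finally have 1: "dinv ?S \<otimes> dmu ;; dsingle (\<rr> Y) \<otimes> ?I = dR Y \<otimes> dmu" by simp
  have "[?Y] <| ?H |> [] = did [Y, \<one> A] \<otimes> ([b] <| deta |> [])"
    using dten_whisker[of "did [\<one> A]" deta "[Y]" "[b]" "[]" "[]"] by simp
  then have "([?Y] <| ?H |> []) ;; dR Y \<otimes> dmu = dR Y \<otimes> dR b"
    by (simp add: dmu_unit flip: dten_dcomp)
  then have 2: "([?Y] <| ?J |> []) ;; ([?Y] <| ?H |> []) ;; dR Y \<otimes> dmu = dR ?Y"
    using dR_tensor[of Y b] by simp
  have x: "([Y, ac] <| (?J ;; ?H) |> []) ;; ([] <| y |> [\<one> A \<otimes>\<^sub>1 b])
    = ([] <| y |> [\<one> (A \<otimes>\<^sub>0 X)]) ;; ([ac, ?Y] <| (?J ;; ?H) |> [])"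
    using dexchange[of "[]" y "[]" "?J ;; ?H" "[]"] by simp
  have "dtens (\<one> A) dcounit Y y ;; ([ac] <| (dsingle (\<rr> Y) \<otimes> ?I) |> [])
    = ([] <| ?S |> [ac]) ;; ([Y] <| dinv (dswap ac) |> []) ;; (([Y, ac] <| (?J ;; ?H) |> []) ;; ([] <| y |> [\<one> A \<otimes>\<^sub>1 b]))
      ;; ([ac] <| (dinv ?S \<otimes> dmu ;; dsingle (\<rr> Y) \<otimes> ?I) |> [])"
    by (simp add: dtens_def dcounit_def dnormalize)
  also have "\<dots> = ([] <| ?S |> [ac]) ;; ([Y] <| dinv (dswap ac) |> []) ;; ([] <| y |> [\<one> (A \<otimes>\<^sub>0 X)])
      ;; ([ac] <| (([?Y] <| ?J |> []) ;; ([?Y] <| ?H |> []) ;; dR Y \<otimes> dmu) |> [])"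
    unfolding x 1 by (simp add: dnormalize)
  also have "\<dots> = ([] <| ?S |> [ac]) ;; ([Y] <| dinv (dswap ac) |> []) ;; (([] <| y |> [\<one> (A \<otimes>\<^sub>0 X)]) ;; ([ac] <| dR ?Y |> []))"
    unfolding 2 ..
  also have "([] <| y |> [\<one> (A \<otimes>\<^sub>0 X)]) ;; ([ac] <| dR ?Y |> []) = ([Y] <| dR ac |> []) ;; y"
    using dR_path_natural[of y] by (simp add: dR_path_def)
  also have "([] <| ?S |> [ac]) ;; ([Y] <| dinv (dswap ac) |> []) ;; ([Y] <| dR ac |> []) ;; y
    = ([] <| ?S |> [ac]) ;; ([Y] <| (dinv (dswap ac) ;; dR ac) |> []) ;; y"
    by (simp add: dwhisker_dcomp dcomp_assoc)
  also have "\<dots> = ([] <| ?S |> [ac]) ;; ([] <| dR Y |> [ac]) ;; y"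
    unfolding dswap_ac using unit_triangle[of Y ac] by simp
  also have "\<dots> = ([] <| dsingle (\<rr> Y) |> [ac]) ;; y"
    unfolding r by (simp add: dwhisker_dcomp dcomp_assoc)
  finally show ?thesis by (simp only: dmor_def)
qed

text \<open>
  As for \<open>dmor_run\<close>, but with the law \<open>\<mu>(\<eta>B) = 1\<close> and an identity arrow applied after \<open>Y\<close>.
\<close>

lemma dmor_lun:
  assumes Y: "dcomodule Y y"
  shows "dmor (dtens Y y (\<one> A) dcounit) (dsingle (\<ll> Y)) y"
proof -
  note [simp] = dcomodule_typing[OF Y]
  let ?S = "dsplit (\<one> A) Y" and ?I = "did [b]" and ?Y = "Y \<otimes>\<^sub>1 b" and ?J = "dunit A X" and ?H = "did [\<one> A] \<otimes> deta"
  have r: "dsingle (\<ll> Y) = ?S ;; dL Y" using dsingle_lun[of Y] by simp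
  have "dinv ?S \<otimes> dmu ;; dsingle (\<ll> Y) \<otimes> ?I = (dinv ?S ;; dsingle (\<ll> Y)) \<otimes> (dmu ;; ?I)"
    by (rule dten_dcomp[symmetric]) simp_all
  also have "dinv ?S ;; dsingle (\<ll> Y) = dL Y" unfolding r by (simp add: dinv_cancel flip: dcomp_assoc)
  finally have 1: "dinv ?S \<otimes> dmu ;; dsingle (\<ll> Y) \<otimes> ?I = dL Y \<otimes> dmu" by simp
  have "[] <| ?H |> [?Y] = did [\<one> A, Y] \<otimes> ([] <| deta |> [b])"
    using dten_whisker[of "did [\<one> A]" deta "[]" "[]" "[Y]" "[b]"] by simp
  then have "([] <| ?H |> [?Y]) ;; dL Y \<otimes> dmu = dL Y \<otimes> dL b"
    by (simp add: dmu_unit flip: dten_dcomp)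
  then have 2: "([] <| ?J |> [?Y]) ;; ([] <| ?H |> [?Y]) ;; dL Y \<otimes> dmu = dL ?Y"
    using dL_tensor[of Y b] by simp
  have "dtens Y y (\<one> A) dcounit ;; ([ac] <| (dsingle (\<ll> Y) \<otimes> ?I) |> [])
    = ([] <| ?S |> [ac]) ;; ([\<one> A] <| y |> []) ;; ([] <| dinv (dswap ac) |> [?Y])
      ;; ([ac] <| (([] <| ?J |> [?Y]) ;; ([] <| ?H |> [?Y]) ;; (dinv ?S \<otimes> dmu ;; dsingle (\<ll> Y) \<otimes> ?I)) |> [])"
    by (simp add: dtens_def dcounit_def dnormalize)
  also have "\<dots> = ([] <| ?S |> [ac]) ;; ([\<one> A] <| y |> []) ;; ([] <| dinv (dswap ac) |> [?Y]) ;; ([] <| dR ac |> [?Y])"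
    unfolding 1 2 using unit_triangle[of ac ?Y] by simp
  also have "\<dots> = ([] <| ?S |> [ac]) ;; ([\<one> A] <| y |> []) ;; ([] <| dL ac |> [?Y])"
    unfolding dswap_ac[symmetric] by (simp only: dwhisker_dcomp)
  also have "([\<one> A] <| y |> []) ;; ([] <| dL ac |> [?Y]) = ([] <| dL Y |> [ac]) ;; y"
    using dL_path_natural[of y] by (simp add: dL_path_def)
  also have "([] <| ?S |> [ac]) ;; ([] <| dL Y |> [ac]) ;; y = ([] <| dsingle (\<ll> Y) |> [ac]) ;; y"
    unfolding r by (simp add: dwhisker_dcomp dcomp_assoc)
  finally show ?thesis by (simp only: dmor_def)
qed

end

section \<open>Endoarrows under composition\<close>

context bicategory
begin

lemma inv_assoc_natural:
  assumes "\<theta> \<in> Cell \<M>" "\<phi> \<in> Cell \<M>" "\<psi> \<in> Cell \<M>"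
    "Src \<M> g = Trg \<M> f" "Src \<M> h = Trg \<M> g"
    "Dom \<M> \<theta> = f" "Dom \<M> \<phi> = g" "Dom \<M> \<psi> = h" "Cod \<M> \<theta> = f'" "Cod \<M> \<phi> = g'" "Cod \<M> \<psi> = h'"
  shows "\<ominus> (\<aa> h' g' f') \<cdot> (\<psi> \<star> (\<phi> \<star> \<theta>)) = ((\<psi> \<star> \<phi>) \<star> \<theta>) \<cdot> \<ominus> (\<aa> h g f)"
proof -
  have f: "f \<in> Arr \<M>" "g \<in> Arr \<M>" "h \<in> Arr \<M>" "f' \<in> Arr \<M>" "g' \<in> Arr \<M>" "h' \<in> Arr \<M>"
    "Src \<M> g' = Trg \<M> f'" "Src \<M> h' = Trg \<M> g'"
    using assms boundary_simps[OF assms(1)] boundary_simps[OF assms(2)] boundary_simps[OF assms(3)] by auto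
  note [simp] = f assms
  have n: "\<aa> h' g' f' \<cdot> ((\<psi> \<star> \<phi>) \<star> \<theta>) = (\<psi> \<star> (\<phi> \<star> \<theta>)) \<cdot> \<aa> h g f"
    by (rule assoc_natural) simp_all
  have "\<ominus> (\<aa> h' g' f') \<cdot> (\<psi> \<star> (\<phi> \<star> \<theta>)) = \<ominus> (\<aa> h' g' f') \<cdot> ((\<psi> \<star> (\<phi> \<star> \<theta>)) \<cdot> \<aa> h g f) \<cdot> \<ominus> (\<aa> h g f)"
    by (simp add: vassoc)
  also have "\<dots> = ((\<psi> \<star> \<phi>) \<star> \<theta>) \<cdot> \<ominus> (\<aa> h g f)"
    unfolding n[symmetric] by (simp add: vassoc)
  finally show ?thesis .
qed

lemma inv_assoc_pentagon:
  assumes [simp]: "f \<in> Arr \<M>" "g \<in> Arr \<M>" "h \<in> Arr \<M>" "k \<in> Arr \<M>"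
    "Src \<M> g = Trg \<M> f" "Src \<M> h = Trg \<M> g" "Src \<M> k = Trg \<M> h"
  shows "\<ominus> (\<aa> (k \<odot> h) g f) \<cdot> \<ominus> (\<aa> k h (g \<odot> f))
         = (\<ominus> (\<aa> k h g) \<star> \<ii> f) \<cdot> \<ominus> (\<aa> k (h \<odot> g) f) \<cdot> (\<ii> k \<star> \<ominus> (\<aa> h g f))"
proof -
  have "\<ominus> (\<aa> k h (g \<odot> f) \<cdot> \<aa> (k \<odot> h) g f)
    = \<ominus> ((\<ii> k \<star> \<aa> h g f) \<cdot> \<aa> k (h \<odot> g) f \<cdot> (\<aa> k h g \<star> \<ii> f))"
    by (simp only: assoc_pentagon[OF assms])
  then show ?thesis by (simp add: vassoc)
qed

lemma inv_assoc_triangle: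
  assumes [simp]: "f \<in> Arr \<M>" "g \<in> Arr \<M>" "Src \<M> g = Trg \<M> f"
  shows "(\<rr> g \<star> \<ii> f) \<cdot> \<ominus> (\<aa> g (\<one> (Trg \<M> f)) f) = \<ii> g \<star> \<ll> f"
  using assoc_triangle[OF assms, symmetric] by (simp add: vassoc)

lemma hom_cHom:
  "cHom (hom_category \<M> A B) \<theta> f g \<longleftrightarrow>
    \<theta> \<in> Cell \<M> \<and> Dom \<M> \<theta> = f \<and> Cod \<M> \<theta> = g \<and> f \<in> Arr \<M> \<and> Src \<M> f = A \<and> Trg \<M> f = B"
  by (auto simp: cHom_def hom_category_def is_arrow_def)

lemma hom_cIso:
  assumes "invertible \<theta>" "Dom \<M> \<theta> = f" "Cod \<M> \<theta> = g" "f \<in> Arr \<M>" "Src \<M> f = A" "Trg \<M> f = B"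
  shows "cIso (hom_category \<M> A B) \<theta> f g"
proof -
  have c: "\<theta> \<in> Cell \<M>" using assms(1) by (rule invertible_cell)
  have g: "g \<in> Arr \<M>" "Src \<M> g = A" "Trg \<M> g = B" using boundary_simps[OF c] assms by auto
  show ?thesis unfolding cIso_def hom_cHom
    by (intro conjI exI[of _ "\<ominus> \<theta>"]) (use assms c g in \<open>simp_all add: hom_category_def\<close>)
qed

lemma hom_simps [simp]:
  "cObj (hom_category \<M> A B) = {f. is_arrow \<M> f A B}" "cId (hom_category \<M> A B) = IdCell \<M>"
  "cComp (hom_category \<M> A B) = VComp \<M>"
  by (simp_all add: hom_category_def)

lemma hom_category_category: "category (hom_category \<M> A B)"
proof
  fix \<theta> assume "\<theta> \<in> cArr (hom_category \<M> A B)"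
  then show "cDom (hom_category \<M> A B) \<theta> \<in> cObj (hom_category \<M> A B)"
    "cCod (hom_category \<M> A B) \<theta> \<in> cObj (hom_category \<M> A B)"
    by (auto simp: hom_category_def is_arrow_def)
qed (auto simp: hom_cHom is_arrow_def vassoc)

lemma composition_simps [simp]:
  "mTenO (composition_monoidal \<M> A) f g = g \<odot> f" "mTenA (composition_monoidal \<M> A) \<theta> \<phi> = \<phi> \<star> \<theta>"
  "mUnit (composition_monoidal \<M> A) = \<one> A" "mAssoc (composition_monoidal \<M> A) f g h = \<ominus> (\<aa> h g f)"
  "mLun (composition_monoidal \<M> A) = \<rr>" "mRun (composition_monoidal \<M> A) = \<ll>"
  by (simp_all add: composition_monoidal_def)

lemma composition_monoidal_category:
  assumes A: "A \<in> Obj \<M>"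
  shows "monoidal_category (hom_category \<M> A A) (composition_monoidal \<M> A)"
proof (intro monoidal_category.intro hom_category_category monoidal_category_axioms.intro, goal_cases)
  case (6 X Y Z)
  then show ?case by (intro hom_cIso) (simp_all add: is_arrow_def)
next
  case (7 f X X' g Y Y' h Z Z')
  then show ?case using inv_assoc_natural[of f g h] by (simp add: hom_cHom)
next
  case (8 X)
  then show ?case by (intro hom_cIso) (auto simp add: is_arrow_def A)
next
  case (9 f X X')
  then show ?case using run_nat[of f X X'] by (simp add: hom_cHom is_cell_def)
next
  case (10 X)
  then show ?case by (intro hom_cIso) (auto simp add: is_arrow_def A)
next
  case (11 f X X')
  then show ?case using lun_nat[of f X X'] by (simp add: hom_cHom is_cell_def)
next
  case (12 W X Y Z)
  then show ?case by (simp add: is_arrow_def inv_assoc_pentagon)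
next
  case (13 X Y)
  then show ?case using inv_assoc_triangle[of X Y] by (auto simp add: is_arrow_def)
qed (auto simp: is_arrow_def hom_cHom A hcomp_vcomp)

end

section \<open>The monoidal category of comodules\<close>

context comodule_setting
begin

abbreviation comodules :: "('a \<times> 'c, ('a \<times> 'c) \<times> 'c \<times> ('a \<times> 'c)) category_data"
  where "comodules \<equiv> rComod M M B a a"

abbreviation tensor_comodule :: "'a \<times> 'c \<Rightarrow> 'a \<times> 'c \<Rightarrow> 'a \<times> 'c"
  where "tensor_comodule \<equiv> comodule_tensor B \<mu> a"

abbreviation unit_comodule :: "'a \<times> 'c"
  where "unit_comodule \<equiv> comodule_unit M \<eta> a"

definition comod :: "'a \<times> 'c \<Rightarrow> bool" where "comod Y \<longleftrightarrow> dcomodule (fst Y) (dco Y)"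

definition morph :: "'a \<times> 'c \<Rightarrow> 'c \<Rightarrow> 'a \<times> 'c \<Rightarrow> bool"
  where "morph Y \<gamma> Z \<longleftrightarrow> comod Y \<and> comod Z \<and> \<gamma> \<in> Cell \<M> \<and> Dom \<M> \<gamma> = fst Y \<and> Cod \<M> \<gamma> = fst Z
    \<and> dmor (dco Y) (dsingle \<gamma>) (dco Z)"

lemma comod_iff: "right_comodule M M B a a Y \<longleftrightarrow> comod Y"
  using monad action by (simp add: right_comodule_def comodule_iff comod_def opmonoidal_monad_def)

lemma comod_arrow [simp]: "comod Y \<Longrightarrow> fst Y \<in> Arr \<M>" "comod Y \<Longrightarrow> Src \<M> (fst Y) = A" "comod Y \<Longrightarrow> Trg \<M> (fst Y) = A"
  using dcomodule_typing by (auto simp: comod_def)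

lemma fst_tensor [simp]: "fst (tensor_comodule Y Z) = fst Z \<odot> fst Y" "fst unit_comodule = \<one> A"
  by (simp_all add: comodule_tensor_def comodule_unit_def Let_def)

lemma comod_tensor [simp]: "comod Y \<Longrightarrow> comod Z \<Longrightarrow> comod (tensor_comodule Y Z)"
  unfolding comod_def by (simp add: dco_tensor dcomodule_tensor)

lemma comod_unit [simp]: "comod unit_comodule"
  unfolding comod_def by (simp add: dco_unit dcomodule_unit)

lemma morph_cell:
  assumes "morph Y \<gamma> Z"
  shows "comod Y" "comod Z" "\<gamma> \<in> Cell \<M>" "Dom \<M> \<gamma> = fst Y" "Cod \<M> \<gamma> = fst Z"
  using assms by (auto simp: morph_def)

lemma morph_id: "comod Y \<Longrightarrow> morph Y (\<ii> (fst Y)) Y"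
  using dmor_id[of "fst Y" "dco Y"] by (simp add: morph_def dsingle_id) (simp add: comod_def)

lemma morph_comp:
  assumes "morph W \<gamma> Y" "morph Y \<delta> Z" shows "morph W (\<delta> \<cdot> \<gamma>) Z"
proof -
  note [simp] = morph_cell[OF assms(1)] morph_cell[OF assms(2)]
  have "dmor (dco W) (dsingle \<gamma> ;; dsingle \<delta>) (dco Z)"
    by (rule dmor_comp[of _ _ "dco Y"]) (use assms in \<open>simp_all add: morph_def\<close>)
  then show ?thesis by (simp add: morph_def dsingle_vcomp)
qed

lemma morph_tensor:
  assumes "morph Y \<gamma> Y'" "morph Z \<delta> Z'" shows "morph (tensor_comodule Y Z) (\<delta> \<star> \<gamma>) (tensor_comodule Y' Z')"
proof -
  note [simp] = morph_cell[OF assms(1)] morph_cell[OF assms(2)]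
  have o: "dcomodule (fst Y) (dco Y)" "dcomodule (fst Y') (dco Y')" "dcomodule (fst Z) (dco Z)" "dcomodule (fst Z') (dco Z')"
    using morph_cell(1,2)[OF assms(1)] morph_cell(1,2)[OF assms(2)] by (simp_all add: comod_def)
  have "dmor (dtens (fst Y) (dco Y) (fst Z) (dco Z)) (dsingle (\<delta> \<star> \<gamma>)) (dtens (fst Y') (dco Y') (fst Z') (dco Z'))"
    by (rule dmor_tensor[OF o]) (use assms in \<open>simp_all add: morph_def\<close>)
  then show ?thesis by (simp add: morph_def dco_tensor o)
qed

lemma morph_inv:
  assumes "morph Y \<gamma> Z" "invertible \<gamma>" shows "morph Z (\<ominus> \<gamma>) Y"
proof -
  note [simp] = morph_cell[OF assms(1)] assms(2)
  have "dmor (dco Z) (dinv (dsingle \<gamma>)) (dco Y)"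
    by (rule dmor_inv) (use assms in \<open>simp_all add: morph_def comod_def\<close>)
  then show ?thesis by (simp add: morph_def dsingle_inv)
qed

lemma morph_assoc:
  assumes [simp]: "comod W" "comod Y" "comod Z"
  shows "morph (tensor_comodule (tensor_comodule W Y) Z) (\<ominus> (\<aa> (fst Z) (fst Y) (fst W))) (tensor_comodule W (tensor_comodule Y Z))"
proof (rule morph_inv)
  have o: "dcomodule (fst W) (dco W)" "dcomodule (fst Y) (dco Y)" "dcomodule (fst Z) (dco Z)"
    using assms by (simp_all add: comod_def)
  note o' = comod_tensor[OF assms(1,2), unfolded comod_def] comod_tensor[OF assms(2,3), unfolded comod_def]
  show "morph (tensor_comodule W (tensor_comodule Y Z)) (\<aa> (fst Z) (fst Y) (fst W)) (tensor_comodule (tensor_comodule W Y) Z)"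
    unfolding morph_def using dmor_assoc[OF o]
    by (simp add: dco_tensor[OF o(1) o'(2)] dco_tensor[OF o'(1) o(3)] dco_tensor[OF o(1,2)] dco_tensor[OF o(2,3)])
qed simp

lemma morph_run:
  assumes [simp]: "comod Y" shows "morph (tensor_comodule unit_comodule Y) (\<rr> (fst Y)) Y"
proof -
  have o: "dcomodule (fst Y) (dco Y)" using assms by (simp add: comod_def)
  show ?thesis unfolding morph_def using dmor_run[OF o] dco_tensor[OF comod_unit[unfolded comod_def] o]
    by (simp add: dco_unit)
qed

lemma morph_lun:
  assumes [simp]: "comod Y" shows "morph (tensor_comodule Y unit_comodule) (\<ll> (fst Y)) Y"
proof -
  have o: "dcomodule (fst Y) (dco Y)" using assms by (simp add: comod_def)
  show ?thesis unfolding morph_def using dmor_lun[OF o] dco_tensor[OF o comod_unit[unfolded comod_def]]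
    by (simp add: dco_unit)
qed

lemma comodules_simps [simp]:
  "cObj comodules = {Y. comod Y}" "cId comodules Y = (Y, \<ii> (fst Y), Y)"
  "cComp comodules (Y', \<gamma>', Y'') (Y, \<gamma>, Z) = (Y, \<gamma>' \<cdot> \<gamma>, Y'')"
  by (simp_all add: rComod_def comod_iff)

lemma comodules_arr: "(Y, \<gamma>, Z) \<in> cArr comodules \<longleftrightarrow> morph Y \<gamma> Z"
  by (auto simp: rComod_def comod_iff morph_def morphism_iff comod_def)

lemma comodules_hom: "cHom comodules f Y Z \<longleftrightarrow> (\<exists>\<gamma>. f = (Y, \<gamma>, Z) \<and> morph Y \<gamma> Z)"
proof -
  obtain Y' \<gamma> Z' where "f = (Y', \<gamma>, Z')" by (cases f)
  then show ?thesis using comodules_arr[of Y' \<gamma> Z'] by (auto simp: cHom_def) (auto simp: rComod_def)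
qed

text \<open>
  The inverse cell satisfies the condition on a morphism automatically.
\<close>

lemma comodules_iso: "morph Y \<gamma> Z \<Longrightarrow> invertible \<gamma> \<Longrightarrow> cIso comodules (Y, \<gamma>, Z) Y Z"
  unfolding cIso_def using morph_cell[of Y \<gamma> Z]
  by (auto simp: comodules_hom intro!: exI[of _ "(Z, \<ominus> \<gamma>, Y)"] morph_inv)

lemma comodules_category: "category comodules"
proof
  fix f assume f: "f \<in> cArr comodules"
  obtain Y \<gamma> Z where fe: "f = (Y, \<gamma>, Z)" by (cases f)
  with f have "morph Y \<gamma> Z" by (simp add: comodules_arr)
  then show "cDom comodules f \<in> cObj comodules" "cCod comodules f \<in> cObj comodules"
    using morph_cell[of Y \<gamma> Z] fe by (auto simp: rComod_def comod_iff)
qed (auto simp: comodules_hom morph_id morph_comp morph_cell vassoc)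

text \<open>
  The tensor product of \<open>Y\<close> and \<open>Z\<close> has underlying arrow \<open>Z \<odot> Y\<close>, in the order of
  \<open>composition_monoidal\<close>.  So the associator is an inverse, and the left unitor is \<open>\<rr>\<close>.
\<close>

definition comodule_monoidal :: "('a \<times> 'c, ('a \<times> 'c) \<times> 'c \<times> ('a \<times> 'c)) monoidal_structure"
  where "comodule_monoidal =
    \<lparr> mTenO = tensor_comodule,
      mTenA = (\<lambda>(Y, \<gamma>, Y') (Z, \<delta>, Z'). (tensor_comodule Y Z, \<delta> \<star> \<gamma>, tensor_comodule Y' Z')),
      mUnit = unit_comodule,
      mAssoc = (\<lambda>X Y Z. (tensor_comodule (tensor_comodule X Y) Z, \<ominus> (\<aa> (fst Z) (fst Y) (fst X)),
                  tensor_comodule X (tensor_comodule Y Z))),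
      mLun = (\<lambda>Y. (tensor_comodule unit_comodule Y, \<rr> (fst Y), Y)),
      mRun = (\<lambda>Y. (tensor_comodule Y unit_comodule, \<ll> (fst Y), Y)) \<rparr>"

lemma comodule_monoidal_simps [simp]:
  "mTenO comodule_monoidal = tensor_comodule"
  "mTenA comodule_monoidal (Y, \<gamma>, Y') (Z, \<delta>, Z') = (tensor_comodule Y Z, \<delta> \<star> \<gamma>, tensor_comodule Y' Z')"
  "mUnit comodule_monoidal = unit_comodule"
  "mAssoc comodule_monoidal W Y Z = (tensor_comodule (tensor_comodule W Y) Z, \<ominus> (\<aa> (fst Z) (fst Y) (fst W)),
                  tensor_comodule W (tensor_comodule Y Z))"
  "mLun comodule_monoidal Y = (tensor_comodule unit_comodule Y, \<rr> (fst Y), Y)"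
  "mRun comodule_monoidal Y = (tensor_comodule Y unit_comodule, \<ll> (fst Y), Y)"
  by (simp_all add: comodule_monoidal_def)

lemma comodule_monoidal_category: "monoidal_category comodules comodule_monoidal"
proof (intro monoidal_category.intro comodules_category monoidal_category_axioms.intro, goal_cases)
  case (3 f X X' g Y Y')
  then show ?case by (auto simp: comodules_hom morph_tensor)
next
  case (5 f X X' f' X'' g Y Y' g' Y'')
  then obtain p p' q q' where e: "f = (X, p, X')" "f' = (X', p', X'')" "g = (Y, q, Y')" "g' = (Y', q', Y'')"
    and m: "morph X p X'" "morph X' p' X''" "morph Y q Y'" "morph Y' q' Y''" by (auto simp: comodules_hom)
  show ?case using morph_cell[OF m(1)] morph_cell[OF m(2)] morph_cell[OF m(3)] morph_cell[OF m(4)]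
    by (simp add: e hcomp_vcomp)
next
  case (6 X Y Z)
  then show ?case by (auto intro!: comodules_iso morph_assoc)
next
  case (7 f X X' g Y Y' h Z Z')
  then obtain p q r where e: "f = (X, p, X')" "g = (Y, q, Y')" "h = (Z, r, Z')"
    and m: "morph X p X'" "morph Y q Y'" "morph Z r Z'" by (auto simp: comodules_hom)
  show ?case
    using morph_cell[OF m(1)] morph_cell[OF m(2)] morph_cell[OF m(3)]
      inv_assoc_natural[of p q r "fst Y" "fst X" "fst Z" "fst X'" "fst Y'" "fst Z'"] by (simp add: e)
next
  case (8 X)
  then show ?case by (auto intro!: comodules_iso morph_run)
next
  case (9 f X X')
  then obtain p where e: "f = (X, p, X')" and m: "morph X p X'" by (auto simp: comodules_hom)
  show ?case using morph_cell[OF m] run_nat[of p "fst X" "fst X'"] by (simp add: e is_cell_def)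
next
  case (10 X)
  then show ?case by (auto intro!: comodules_iso morph_lun)
next
  case (11 f X X')
  then obtain p where e: "f = (X, p, X')" and m: "morph X p X'" by (auto simp: comodules_hom)
  show ?case using morph_cell[OF m] lun_nat[of p "fst X" "fst X'"] by (simp add: e is_cell_def)
next
  case (12 W X Y Z)
  then show ?case by (simp add: inv_assoc_pentagon)
next
  case (13 X Y)
  then show ?case using inv_assoc_triangle[of "fst X" "fst Y"] by simp
qed simp_all

text \<open>
  Underlying arrows of tensor products are composites on the nose, so identity cells serve as
  constraints.
\<close>

lemma forgetful_strong_monoidal:
  "strong_monoidal_functor comodules comodule_monoidal (hom_category \<M> A A) (composition_monoidal \<M> A)
    (\<lambda>(Y, y). Y) (\<lambda>(Y, \<gamma>, Z). \<gamma>) (\<lambda>Y Z. \<ii> (fst Z \<odot> fst Y)) (\<ii> (\<one> A))"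
proof -
  have fst: "(\<lambda>(Y, y). Y) = (fst :: 'a \<times> 'c \<Rightarrow> 'a)" by auto
  have ifun: "category_functor comodules (hom_category \<M> A A) fst (\<lambda>(Y, \<gamma>, Z). \<gamma>)"
  proof (intro category_functor.intro category_functor_axioms.intro comodules_category hom_category_category, goal_cases)
    case (1 f Y Z)
    then obtain \<gamma> where f: "f = (Y, \<gamma>, Z)" and g: "morph Y \<gamma> Z" by (auto simp: comodules_hom)
    show ?case using morph_cell[OF g] by (simp add: f hom_cHom)
  qed (auto simp: comodules_hom is_arrow_def comod_arrow(1)[of "(_, _)", simplified]
        comod_arrow(2)[of "(_, _)", simplified] comod_arrow(3)[of "(_, _)", simplified])
  show ?thesis unfolding fst
  proof (intro strong_monoidal_functor.intro strong_monoidal_functor_axioms.intro comodule_monoidal_category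
      composition_monoidal_category ifun, goal_cases)
    case (2 X Y)
    then show ?case by (intro hom_cIso) simp_all
  next
    case 3
    show ?case by (intro hom_cIso) simp_all
  next
    case (4 f X X' g Y Y')
    then obtain p q where e: "f = (X, p, X')" "g = (Y, q, Y')" and m: "morph X p X'" "morph Y q Y'"
      by (auto simp: comodules_hom)
    show ?case using morph_cell[OF m(1)] morph_cell[OF m(2)] by (simp add: e)
  qed simp_all
qed

end

theorem theorem7p18:
  fixes \<M> :: "('o,'a,'c) monoidal_bicategory_data"
    and A :: 'o
    and M :: "('o,'a,'c) skew_monoidale"
    and a :: "('o,'a,'c) action"
    and B :: "('a,'c) opmonoidal"
    and \<mu> \<eta> :: 'c
  assumes "monoidal_bicategory \<M>"
    and "monoidal_bicategory.right_skew_monoidale \<M> M"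
    and "monoidal_bicategory.oplax_right_action \<M> M a" and "aobj a = A"
    and "monoidal_bicategory.opmonoidal_monad \<M> M B \<mu> \<eta>"
  shows "\<exists>T \<phi> \<phi>0.
      monoidal_category (monoidal_bicategory.rComod \<M> M M B a a) T \<and>
      (\<forall>Yy \<in> cObj (monoidal_bicategory.rComod \<M> M M B a a).
       \<forall>Zz \<in> cObj (monoidal_bicategory.rComod \<M> M M B a a).
         mTenO T Yy Zz = monoidal_bicategory.comodule_tensor \<M> B \<mu> a Yy Zz) \<and>
      mUnit T = monoidal_bicategory.comodule_unit \<M> M \<eta> a \<and>
      strong_monoidal_functor
        (monoidal_bicategory.rComod \<M> M M B a a) T
        (hom_category \<M> A A) (composition_monoidal \<M> A)
        (\<lambda>(Y, y). Y) (\<lambda>(Yy, \<gamma>, Zz). \<gamma>) \<phi> \<phi>0"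
proof -
  interpret comodule_setting \<M> M a B \<mu> \<eta>
    using assms by (simp add: comodule_setting_def comodule_setting_axioms_def)
  show ?thesis
    unfolding assms(4)[symmetric]
    by (intro exI conjI) (rule comodule_monoidal_category, simp, simp, rule forgetful_strong_monoidal)
qed

end
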